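(* Consider the standardized Gaussian two-way wire-tap channel (GTW-WT) described in the context with gains $\alpha_1,\alpha_2,h_1,h_2>0$ and power limits $\bar P_1,\bar P_2>0$. For $\mathbf P=(P_1,P_2)$ define $$\mathcal G^{\mathrm{TW}}(\mathbf P)=\Big\{\mathbf R:\ R^s_k+R^o_k\le\tfrac12\log(1+P_k),\ k=1,2;\ \ \sum_{k\in S}R^s_k\le\Big[\sum_{k\in S}\tfrac12\log(1+P_k)-\tilde C^W_S(\mathbf P)\Big]^+\ \forall\, \emptyset\ne S\subseteq\{1,2\}\Big\}.$$ Then every rate vector in the closure of the convex hull of $\bigcup_{\mathbf P\in\mathcal P}\mathcal G^{\mathrm{TW}}(\mathbf P)$ is achievable for the GTW-WT, where $\mathcal P=\{(P_1,P_2):0\le P_k\le\bar P_k\}$.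
   Context: Standardized GTW-WT: two terminals $k\in\mathcal K=\{1,2\}$; over $n$ channel uses terminal $k$ sends $\mathbf X_k$ with $\frac1n\sum_i X_{ki}^2\le\bar P_k$. Terminal 1 receives $\mathbf Y_1=\sqrt{\alpha_1}\mathbf X_1+\mathbf X_2+\mathbf N_1$, terminal 2 receives $\mathbf Y_2=\mathbf X_1+\sqrt{\alpha_2}\mathbf X_2+\mathbf N_2$, and the eavesdropper receives $\mathbf Z=\sqrt{h_1}\mathbf X_1+\sqrt{h_2}\mathbf X_2+\mathbf N_W$, with $\mathbf N_1,\mathbf N_2,\mathbf N_W$ having i.i.d. $\mathcal N(0,1)$ components, independent of everything else. Terminal $k$ has a secret message $W^s_k$ uniform on $\{1,\dots,M^s_k\}$ and an open message $W^o_k$ uniform on $\{1,\dots,M^o_k\}$, all independent; it encodes them (possibly with private randomization) into $\mathbf X_k$, and decodes the other terminal's messages from $\mathbf Y_k$ together with its own messages and transmitted codeword. The eavesdropper knows codebooks and channel; no shared secret. A nonnegative rate vector $\mathbf R=((R^s_k,R^o_k))_{k=1,2}$ is achievable if for every $\epsilon>0$ there is, for some $n$, a code with $\frac1n\log M^s_k\ge R^s_k-\epsilon$, $\frac1n\log M^o_k\ge R^o_k-\epsilon$, average probability that some terminal decodes incorrectly at most $\epsilon$, and $H(W^s_1,W^s_2\mid\mathbf Z)/H(W^s_1,W^s_2)\ge1-\epsilon$. Notation: $[x]^+=\max\{x,0\}$, logs base 2, $\tilde C^W_S(\mathbf P)=\frac12\log\big(1+\frac{\sum_{k\in S}h_kP_k}{1+\sum_{k\in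 S^c}h_kP_k}\big)$ for $S\subseteq\{1,2\}$. *)

theory Defs
  imports "HOL-Probability.Probability"
begin

type_synonym rate = "(real \<times> real) \<times> (real \<times> real)"
  (* ((R^s_1, R^o_1), (R^s_2, R^o_2)) *)

definition Rsec :: "rate \<Rightarrow> nat \<Rightarrow> real" where
  "Rsec R k = (if k = 1 then fst (fst R) else fst (snd R))"

definition Ropen :: "rate \<Rightarrow> nat \<Rightarrow> real" where
  "Ropen R k = (if k = 1 then snd (fst R) else snd (snd R))"

definition sel :: "real \<times> real \<Rightarrow> nat \<Rightarrow> real" where
  "sel p k = (if k = 1 then fst p else snd p)"

definition CW :: "real \<times> real \<Rightarrow> real \<times> real \<Rightarrow> nat set \<Rightarrow> real" where
  "CW h P S = 1/2 * log 2 (1 + (\<Sum>k\<in>S. sel h k * sel P k) /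
                               (1 + (\<Sum>k\<in>{1,2} - S. sel h k * sel P k)))"

definition G_TW :: "real \<times> real \<Rightarrow> real \<times> real \<Rightarrow> rate set" where
  "G_TW h P = {R.
     (\<forall>k\<in>{1,2::nat}. 0 \<le> Rsec R k \<and> 0 \<le> Ropen R k \<and>
        Rsec R k + Ropen R k \<le> 1/2 * log 2 (1 + sel P k)) \<and>
     (\<forall>S. S \<subseteq> {1,2} \<and> S \<noteq> {} \<longrightarrow>
        (\<Sum>k\<in>S. Rsec R k) \<le>
          max 0 ((\<Sum>k\<in>S. 1/2 * log 2 (1 + sel P k)) - CW h P S))}"

definition power_set :: "real \<times> real \<Rightarrow> (real \<times> real) set" where
  "power_set Pbar = {P. 0 \<le> fst P \<and> fst P \<le> fst Pbar \<and> 0 \<le> snd P \<and> snd P \<le> snd Pbar}"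

definition Rn :: "nat \<Rightarrow> (nat \<Rightarrow> real) measure" where
  "Rn n = PiM {..<n} (\<lambda>_. lborel)"

definition noise :: "nat \<Rightarrow> (nat \<Rightarrow> real) measure" where
  "noise n = PiM {..<n} (\<lambda>_. density lborel std_normal_density)"

type_synonym msgs = "(nat \<times> nat) \<times> (nat \<times> nat)"
  (* ((W^s_1, W^o_1), (W^s_2, W^o_2)), messages indexed from 0 *)
type_synonym outcome = "msgs \<times> ((nat \<Rightarrow> real) \<times> (nat \<Rightarrow> real)) \<times>
                        ((nat \<Rightarrow> real) \<times> (nat \<Rightarrow> real) \<times> (nat \<Rightarrow> real))"
  (* (messages, (X1, X2), (N1, N2, NW)) *)

text \<open>Stochastic encoder of terminal k: (secret msg, open msg) \<mapsto> distribution of X_k.\<close>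
type_synonym encoder = "nat \<Rightarrow> nat \<Rightarrow> (nat \<Rightarrow> real) measure"
text \<open>Decoder: own secret msg, own open msg, own codeword, received sequence \<mapsto> estimate.\<close>
type_synonym decoder = "nat \<Rightarrow> nat \<Rightarrow> (nat \<Rightarrow> real) \<Rightarrow> (nat \<Rightarrow> real) \<Rightarrow> nat \<times> nat"

definition msg_set :: "nat \<Rightarrow> nat \<Rightarrow> nat \<Rightarrow> nat \<Rightarrow> msgs set" where
  "msg_set Ms1 Mo1 Ms2 Mo2 = ({..<Ms1} \<times> {..<Mo1}) \<times> ({..<Ms2} \<times> {..<Mo2})"

definition outcome_space :: "nat \<Rightarrow> outcome measure" where
  "outcome_space n = count_space UNIV \<Otimes>\<^sub>M ((Rn n \<Otimes>\<^sub>M Rn n) \<Otimes>\<^sub>M (Rn n \<Otimes>\<^sub>M Rn n \<Otimes>\<^sub>M Rn n))"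

definition gtw_joint :: "nat \<Rightarrow> nat \<Rightarrow> nat \<Rightarrow> nat \<Rightarrow> nat \<Rightarrow> encoder \<Rightarrow> encoder \<Rightarrow> outcome measure" where
  "gtw_joint n Ms1 Mo1 Ms2 Mo2 enc1 enc2 =
     measure_pmf (pmf_of_set (msg_set Ms1 Mo1 Ms2 Mo2)) \<bind>
     (\<lambda>w. distr ((enc1 (fst (fst w)) (snd (fst w)) \<Otimes>\<^sub>M enc2 (fst (snd w)) (snd (snd w)))
                 \<Otimes>\<^sub>M (noise n \<Otimes>\<^sub>M noise n \<Otimes>\<^sub>M noise n))
               (outcome_space n) (\<lambda>v. (w, v)))"

definition Y1_of :: "nat \<Rightarrow> real \<Rightarrow> outcome \<Rightarrow> nat \<Rightarrow> real" where
  "Y1_of n a1 \<omega> = (case \<omega> of (w, (x1, x2), (n1, n2, nw)) \<Rightarrow>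
      restrict (\<lambda>i. sqrt a1 * x1 i + x2 i + n1 i) {..<n})"

definition Y2_of :: "nat \<Rightarrow> real \<Rightarrow> outcome \<Rightarrow> nat \<Rightarrow> real" where
  "Y2_of n a2 \<omega> = (case \<omega> of (w, (x1, x2), (n1, n2, nw)) \<Rightarrow>
      restrict (\<lambda>i. x1 i + sqrt a2 * x2 i + n2 i) {..<n})"

definition Z_of :: "nat \<Rightarrow> real \<Rightarrow> real \<Rightarrow> outcome \<Rightarrow> nat \<Rightarrow> real" where
  "Z_of n h1 h2 \<omega> = (case \<omega> of (w, (x1, x2), (n1, n2, nw)) \<Rightarrow>
      restrict (\<lambda>i. sqrt h1 * x1 i + sqrt h2 * x2 i + nw i) {..<n})"

definition Wsec_of :: "outcome \<Rightarrow> nat \<times> nat" where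
  "Wsec_of \<omega> = (fst (fst (fst \<omega>)), fst (snd (fst \<omega>)))"

definition decoding_error :: "nat \<Rightarrow> real \<Rightarrow> real \<Rightarrow> decoder \<Rightarrow> decoder \<Rightarrow> outcome \<Rightarrow> bool" where
  "decoding_error n a1 a2 dec1 dec2 \<omega> = (case \<omega> of (((s1, o1), (s2, o2)), (x1, x2), _) \<Rightarrow>
      dec1 s1 o1 x1 (Y1_of n a1 \<omega>) \<noteq> (s2, o2) \<or> dec2 s2 o2 x2 (Y2_of n a2 \<omega>) \<noteq> (s1, o1))"

definition valid_encoder :: "nat \<Rightarrow> real \<Rightarrow> encoder \<Rightarrow> bool" where
  "valid_encoder n Pbar enc = (\<forall>s o'. prob_space (enc s o') \<and> sets (enc s o') = sets (Rn n) \<and>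
      (AE x in enc s o'. (1 / real n) * (\<Sum>i<n. (x i)\<^sup>2) \<le> Pbar))"

definition valid_decoder :: "nat \<Rightarrow> decoder \<Rightarrow> bool" where
  "valid_decoder n dec = (\<forall>s o'. (\<lambda>(x, y). dec s o' x y) \<in> (Rn n \<Otimes>\<^sub>M Rn n) \<rightarrow>\<^sub>M count_space UNIV)"

definition gtw_achievable :: "real \<Rightarrow> real \<Rightarrow> real \<Rightarrow> real \<Rightarrow> real \<Rightarrow> real \<Rightarrow> rate \<Rightarrow> bool" where
  "gtw_achievable a1 a2 h1 h2 Pb1 Pb2 R \<longleftrightarrow>
     (\<forall>\<epsilon>>0. \<exists>n Ms1 Mo1 Ms2 Mo2 enc1 enc2 dec1 dec2.
        0 < n \<and> 0 < Ms1 \<and> 0 < Mo1 \<and> 0 < Ms2 \<and> 0 < Mo2 \<and>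
        valid_encoder n Pb1 enc1 \<and> valid_encoder n Pb2 enc2 \<and>
        valid_decoder n dec1 \<and> valid_decoder n dec2 \<and>
        log 2 (real Ms1) / real n \<ge> Rsec R 1 - \<epsilon> \<and>
        log 2 (real Mo1) / real n \<ge> Ropen R 1 - \<epsilon> \<and>
        log 2 (real Ms2) / real n \<ge> Rsec R 2 - \<epsilon> \<and>
        log 2 (real Mo2) / real n \<ge> Ropen R 2 - \<epsilon> \<and>
        (let M = gtw_joint n Ms1 Mo1 Ms2 Mo2 enc1 enc2 in
           measure M {\<omega> \<in> space M. decoding_error n a1 a2 dec1 dec2 \<omega>} \<le> \<epsilon> \<and>
           prob_space.conditional_entropy M 2 (count_space UNIV) (Rn n) Wsec_of (Z_of n h1 h2)
             \<ge> (1 - \<epsilon>) * prob_space.entropy M 2 (count_space UNIV) Wsec_of))"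

end

theory Submission
  imports Defs
begin

text \<open>Both codebooks are random: Gaussian of power slightly below the limit, conditioned on the power
  constraint, with every codeword indexed by a secret and an open message. The open messages have rate just
  below what is left by the secrets, so they carry all the randomness the eavesdropper has to be confused
  with, and the encoders are deterministic. A terminal subtracts its own codeword and decodes by comparing
  likelihood ratios with a threshold. Secrecy is soft covering for a multiple-access channel: given the
  secrets, the output density \<open>p\<close> at the eavesdropper is an average over the open messages, and
  \<open>ln T \<le> ln c + T / c - 1\<close> with \<open>T = p / q\<close> and \<open>c\<close> the conditional mean of \<open>T\<close> given one pair of
  codewords bounds the expected divergence by a constant, through the explicit Gaussian moments of
  the information density, as soon as the open rates exceed the three mutual informations. Constant leakage is
  negligible against a secret whose size grows exponentially.

  If a bracket for a single terminal vanishes, that terminal has no secret; revealing its codeword to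
  the eavesdropper costs only a bounded amount, and the other terminal faces a point-to-point wiretap channel.
  The remaining boundary points follow by perturbing powers and rates, and the closed convex hull by
  concatenating codes.\<close>

subsection \<open>Gaussian densities and exponential moments\<close>

text \<open>Up to the final entropy computation only nonnegative functions are integrated, so no
  integrability has to be shown; this is why the leakage carries the absolute value of the
  logarithm. The price is an extra term \<open>1 / T\<close>, whose mean is the mass of the
  reference density.

  The power constraint destroys the Gaussian law of the codewords, on which the explicit moments
  rest. Conditioning on an event of probability at least 1/2 at most doubles nonnegative
  expectations, and such factors are harmless: they multiply small error terms or enter a constant
  leakage.

  In the covering argument a single parameter \<open>s\<close> is both the order of the moments and
  the rate margin of the open messages: a moment of order \<open>s\<close> costs \<open>s^2\<close>
  per channel use, which is what the margin \<open>s\<close> gains after multiplication by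
  \<open>s\<close>.

  Covering needs an open rate above the mutual information of its terminal with the eavesdropper and
  below the capacity of that terminal. If a single bracket vanishes, no such rate exists, which
  forces the separate treatment of a terminal without secret.\<close>

definition nd :: "real \<Rightarrow> real \<Rightarrow> real" where
  "nd v x = normal_density 0 (sqrt v) x"

definition gd :: "nat set \<Rightarrow> real \<Rightarrow> (nat \<Rightarrow> real) \<Rightarrow> real" where
  "gd I v x = (\<Prod>i\<in>I. nd v (x i))"

definition LI :: "nat set \<Rightarrow> (nat \<Rightarrow> real) measure" where
  "LI I = PiM I (\<lambda>_. lborel)"

interpretation lborel_prod: product_sigma_finite "\<lambda>_::nat. lborel :: real measure"
  by standard

lemma sigma_finite_LI: "finite I \<Longrightarrow> sigma_finite_measure (LI I)"
  unfolding LI_def by (rule lborel_prod.sigma_finite)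

lemma nd_eq: "v > 0 \<Longrightarrow> nd v x = exp (- x\<^sup>2 / (2 * v)) / sqrt (2 * pi * v)"
  by (simp add: nd_def normal_density_def)

lemma nd_pos: "v > 0 \<Longrightarrow> 0 < nd v x"
  by (simp add: nd_def normal_density_pos)

lemma nd_nonneg [simp]: "0 \<le> nd v x"
  by (simp add: nd_def)

lemma nd_measurable [measurable]: "nd v \<in> borel_measurable borel"
  unfolding nd_def[abs_def] by simp

lemma gd_pos: "v > 0 \<Longrightarrow> 0 < gd I v x"
  by (simp add: gd_def prod_pos nd_pos)

lemma gd_nonneg [simp]: "0 \<le> gd I v x"
  by (simp add: gd_def prod_nonneg)

lemma gd_measurable:
  assumes "\<And>i. i \<in> I \<Longrightarrow> (\<lambda>x. f x i) \<in> borel_measurable M"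
  shows "(\<lambda>x. gd I v (f x)) \<in> borel_measurable M"
  unfolding gd_def using assms by measurable

lemma gd_cong: "(\<And>i. i \<in> I \<Longrightarrow> x i = y i) \<Longrightarrow> gd I v x = gd I v y"
  by (simp add: gd_def)

lemma component_LI [measurable]: "i \<in> I \<Longrightarrow> (\<lambda>x. x i) \<in> borel_measurable (LI I)"
  using measurable_component_singleton[of i I "\<lambda>_. lborel"] by (simp add: LI_def)

lemma space_LI: "space (LI I) = extensional I"
  by (auto simp: LI_def space_PiM PiE_def)

lemma nn_integral_nd: "v > 0 \<Longrightarrow> (\<integral>\<^sup>+x. ennreal (nd v (x - a)) \<partial>lborel) = 1"
proof -
  assume v: "v > 0"
  have eq: "nd v (x - a) = normal_density a (sqrt v) x" for x
    by (simp add: nd_def normal_density_def)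
  interpret prob_space "density lborel (normal_density a (sqrt v))"
    by (rule prob_space_normal_density) (use v in simp)
  show ?thesis
    using emeasure_space_1 by (simp add: eq emeasure_density)
qed

text \<open>This is the substitution \<open>y = sqrt h * x\<close>, under which variance
  \<open>h * P\<close> becomes \<open>P\<close>; \<open>conv_nd\<close> uses it to bring a scaled
  input into the form of a convolution of densities.\<close>

lemma nd_scale:
  assumes "P > 0" "h > 0"
  shows "sqrt h * nd (h * P) (sqrt h * x) = nd P x"
proof -
  have "sqrt (2 * pi * (h * P)) = sqrt h * sqrt (2 * pi * P)"
    by (simp add: real_sqrt_mult)
  then show ?thesis
    using assms by (simp add: nd_eq power_mult_distrib field_simps)
qed

text \<open>A channel use with gain \<open>h\<close> adds \<open>h * P\<close> to the variance. The
  gain 0 has to be included, because terminals without secret are later treated by a channel whose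
  gain is set to 0; there the substitution degenerates and the claim is just that
  \<open>nd P\<close> has mass 1.\<close>

lemma conv_nd:
  assumes "P > 0" "v > 0" "h \<ge> 0"
  shows "(\<integral>\<^sup>+x. ennreal (nd P x * nd v (z - sqrt h * x)) \<partial>lborel) = ennreal (nd (v + h * P) z)"
proof (cases "h = 0")
  case True
  then show ?thesis
    using nn_integral_nd[OF assms(1), of 0]
    by (simp add: ennreal_mult nn_integral_multc)
next
  case False
  then have h: "h > 0" using assms by simp
  have "ennreal (nd (v + h * P) z) = (\<integral>\<^sup>+y. ennreal (nd v (z - y) * nd (h * P) y) \<partial>lborel)"
    using conv_normal_density_zero_mean[of "sqrt v" "sqrt (h * P)"] assms h
    by (simp add: nd_def fun_eq_iff)
  also have "\<dots> = ennreal \<bar>sqrt h\<bar> * (\<integral>\<^sup>+x. ennreal (nd v (z - (0 + sqrt h * x)) * nd (h * P) (0 + sqrt h * x)) \<partial>lborel)"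
    by (rule nn_integral_real_affine) (use h in auto)
  also have "\<dots> = (\<integral>\<^sup>+x. ennreal (nd P x * nd v (z - sqrt h * x)) \<partial>lborel)"
  proof -
    have "ennreal (sqrt h) * ennreal (nd v (z - sqrt h * x) * nd (h * P) (sqrt h * x))
        = ennreal (nd P x * nd v (z - sqrt h * x))" for x
      unfolding nd_scale[OF assms(1) h, of x, symmetric]
      using h by (subst ennreal_mult[symmetric]) (auto simp: mult_ac)
    then show ?thesis
      using h by (subst nn_integral_cmult[symmetric]) auto
  qed
  finally show ?thesis by simp
qed

text \<open>Gaussians are closed under multiplication by \<open>exp (t * z^2)\<close>, up to a
  constant: the factor changes the variance to \<open>v / (1 - 2 * t * v)\<close>. Quadratic
  exponential moments thus reduce to the mass of a density.\<close>

lemma nd_exp_square: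
  assumes "v > 0" "2 * t * v < 1"
  shows "nd v z * exp (t * z\<^sup>2) = (1 - 2 * t * v) powr (- 1 / 2) * nd (v / (1 - 2 * t * v)) z"
proof -
  let ?d = "1 - 2 * t * v"
  have d: "?d > 0" using assms by simp
  have "exp (- z\<^sup>2 / (2 * v)) * exp (t * z\<^sup>2) = exp (- z\<^sup>2 / (2 * (v / ?d)))"
    unfolding exp_add[symmetric] using assms d by (simp add: field_simps)
  moreover have "1 / sqrt (2 * pi * v) = ?d powr (- 1 / 2) / sqrt (2 * pi * (v / ?d))"
  proof -
    have p: "?d powr (- 1 / 2) = 1 / sqrt ?d"
      using d by (simp add: powr_minus powr_half_sqrt inverse_eq_divide)
    have "sqrt (2 * pi * (v / ?d)) = sqrt (2 * pi * v) / sqrt ?d"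
      by (simp add: real_sqrt_divide[symmetric])
    then show ?thesis unfolding p using d assms by simp
  qed
  ultimately have "(1 / sqrt (2 * pi * v)) * (exp (- z\<^sup>2 / (2 * v)) * exp (t * z\<^sup>2))
      = ?d powr (- 1 / 2) / sqrt (2 * pi * (v / ?d)) * exp (- z\<^sup>2 / (2 * (v / ?d)))"
    by (simp only:)
  then show ?thesis
    using assms d by (simp only: nd_eq divide_pos_pos) (simp add: ac_simps)
qed

lemma nn_integral_nd_exp_square:
  assumes "v > 0" "2 * t * v < 1"
  shows "(\<integral>\<^sup>+z. ennreal (nd v z * exp (t * z\<^sup>2)) \<partial>lborel) = ennreal ((1 - 2 * t * v) powr (- 1 / 2))"
  using nn_integral_nd[of "v / (1 - 2 * t * v)" 0] assms
  by (simp add: nd_exp_square ennreal_mult nn_integral_cmult)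

lemma nn_integral_LI_prod:
  assumes "finite I" "\<And>i. i \<in> I \<Longrightarrow> f i \<in> borel_measurable borel" "\<And>i x. 0 \<le> f i x"
  shows "(\<integral>\<^sup>+x. ennreal (\<Prod>i\<in>I. f i (x i)) \<partial>LI I) = (\<Prod>i\<in>I. \<integral>\<^sup>+x. ennreal (f i x) \<partial>lborel)"
  using lborel_prod.product_nn_integral_prod[of I "\<lambda>i x. ennreal (f i x)"] assms
  by (simp add: prod_ennreal LI_def)

lemma nn_integral_gd:
  assumes "finite I" "v > 0"
  shows "(\<integral>\<^sup>+x. ennreal (gd I v (\<lambda>i. x i - a i)) \<partial>LI I) = 1"
  unfolding gd_def
  using nn_integral_LI_prod[of I "\<lambda>i x. nd v (x - a i)"] nn_integral_nd[OF assms(2)] assms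
  by simp

lemma nn_integral_gd0:
  assumes "finite I" "v > 0"
  shows "(\<integral>\<^sup>+x. ennreal (gd I v x) \<partial>LI I) = 1"
  using nn_integral_gd[OF assms, of "\<lambda>_. 0"] by simp

lemma conv_gd:
  assumes "finite I" "P > 0" "v > 0" "h \<ge> 0"
  shows "(\<integral>\<^sup>+x. ennreal (gd I P x * gd I v (\<lambda>i. z i - sqrt h * x i)) \<partial>LI I) = ennreal (gd I (v + h * P) z)"
proof -
  have "(\<integral>\<^sup>+x. ennreal (\<Prod>i\<in>I. nd P (x i) * nd v (z i - sqrt h * x i)) \<partial>LI I)
      = (\<Prod>i\<in>I. \<integral>\<^sup>+x. ennreal (nd P x * nd v (z i - sqrt h * x)) \<partial>lborel)"
    by (rule nn_integral_LI_prod[of I "\<lambda>i x. nd P x * nd v (z i - sqrt h * x)"]) (use assms in auto)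
  then show ?thesis
    using assms by (simp add: gd_def prod.distrib conv_nd prod_ennreal)
qed

lemma nn_integral_gd_exp_square:
  assumes "finite I" "v > 0" "2 * t * v < 1"
  shows "(\<integral>\<^sup>+z. ennreal (gd I v z * exp (t * (\<Sum>i\<in>I. (z i)\<^sup>2))) \<partial>LI I)
      = ennreal (((1 - 2 * t * v) powr (- 1 / 2)) ^ card I)"
proof -
  have "(\<integral>\<^sup>+x. ennreal (\<Prod>i\<in>I. nd v (x i) * exp (t * (x i)\<^sup>2)) \<partial>LI I)
      = (\<Prod>i\<in>I. \<integral>\<^sup>+x. ennreal (nd v x * exp (t * x\<^sup>2)) \<partial>lborel)"
    by (rule nn_integral_LI_prod[of I "\<lambda>i x. nd v x * exp (t * x\<^sup>2)"]) (use assms in auto)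
  then show ?thesis
    using assms by (simp add: gd_def prod.distrib exp_sum sum_distrib_left nn_integral_nd_exp_square ennreal_power)
qed

text \<open>The power \<open>1 + s\<close> of a Gaussian of variance \<open>v\<close> is a Gaussian
  of variance \<open>v / (1 + s)\<close> up to a constant, and \<open>nd k z powr (- s)\<close> is
  the exponential of a square. Logarithms turn the comparison of constants into linear arithmetic.
  Two separate arguments are kept because \<open>y\<close> will be the output \<open>z\<close> minus
  the transmitted codewords.\<close>

lemma nd_tilt:
  assumes "v > 0" "k > 0" "- 1 < s"
  shows "nd v y * (nd v y / nd k z) powr s
       = ((k / v) powr (s / 2) * (1 + s) powr (- 1 / 2)) * (nd (v / (1 + s)) y * exp (s / (2 * k) * z\<^sup>2))"
proof -
  have l: "ln (nd w x) = - x\<^sup>2 / (2 * w) - (ln (2 * pi) + ln w) / 2" if "w > 0" for w x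
    using that by (simp add: nd_eq ln_div ln_sqrt ln_mult)
  have "ln (nd v y * (nd v y / nd k z) powr s) =
        ln (((k / v) powr (s / 2) * (1 + s) powr (- 1 / 2)) * (nd (v / (1 + s)) y * exp (s / (2 * k) * z\<^sup>2)))"
    using assms nd_pos[of v y] nd_pos[of k z] nd_pos[of "v / (1 + s)" y]
    by (simp add: ln_mult ln_div ln_powr l) (simp add: field_simps)
  then show ?thesis
    using assms nd_pos[of v y] nd_pos[of k z] nd_pos[of "v / (1 + s)" y]
    by (subst (asm) ln_inj_iff) auto
qed

lemma gd_tilt:
  assumes "finite I" "v > 0" "k > 0" "- 1 < s"
  shows "gd I v y * (gd I v y / gd I k z) powr s
       = ((k / v) powr (s / 2) * (1 + s) powr (- 1 / 2)) ^ card I *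
         (gd I (v / (1 + s)) y * exp (s / (2 * k) * (\<Sum>i\<in>I. (z i)\<^sup>2)))"
proof -
  have "gd I v y * (gd I v y / gd I k z) powr s = (\<Prod>i\<in>I. nd v (y i) * (nd v (y i) / nd k (z i)) powr s)"
    by (simp add: gd_def prod.distrib prod_dividef[symmetric] prod_powr_distrib)
  also have "\<dots> = (\<Prod>i\<in>I. ((k / v) powr (s / 2) * (1 + s) powr (- 1 / 2)) * (nd (v / (1 + s)) (y i) * exp (s / (2 * k) * (z i)\<^sup>2)))"
    using assms by (simp add: nd_tilt)
  finally show ?thesis
    using assms by (simp add: gd_def prod.distrib exp_sum sum_distrib_left)
qed

text \<open>The factors combine through \<open>(1 + s) * (1 - (s / k) * (v / (1 + s) + u)) = 1 - s^2
  * u / k\<close>: the terms of first order in \<open>s\<close> cancel. What remains is the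
  exponential of \<open>s\<close> times the mutual information, up to a correction of second
  order.\<close>

lemma tilt_const:
  fixes v u k s :: real
  assumes "v > 0" "u \<ge> 0" "k = v + u" "\<bar>s\<bar> < 1"
  shows "(k / v) powr (s / 2) * (1 + s) powr (- 1 / 2) * (1 - 2 * (s / (2 * k)) * (v / (1 + s) + u)) powr (- 1 / 2)
     = exp (s * (ln (k / v) / 2)) * (1 - s\<^sup>2 * u / k) powr (- 1 / 2)"
    and "2 * (s / (2 * k)) * (v / (1 + s) + u) < 1"
proof -
  have k: "k > 0" using assms by linarith
  have s: "1 + s > 0" using assms by simp
  have eq: "(1 + s) * (1 - 2 * (s / (2 * k)) * (v / (1 + s) + u)) = 1 - s\<^sup>2 * u / k"
  proof -
    have *: "(1 + s) * (v / (1 + s) + u) = k + s * u"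
      using s by (simp add: assms(3) distrib_left) (simp add: algebra_simps)
    have "(1 + s) * (1 - 2 * (s / (2 * k)) * w) = (1 + s) - (s / k) * ((1 + s) * w)" for w
      by (simp add: algebra_simps add_divide_distrib)
    then have "(1 + s) * (1 - 2 * (s / (2 * k)) * (v / (1 + s) + u)) = (1 + s) - (s / k) * (k + s * u)"
      using * by metis
    also have "\<dots> = 1 - s\<^sup>2 * u / k"
      using k by (simp add: field_simps power2_eq_square)
    finally show ?thesis .
  qed
  have "s\<^sup>2 * u / k < 1"
  proof -
    have "s\<^sup>2 < 1" using assms(4) by (simp add: abs_square_less_1)
    then have "s\<^sup>2 * u \<le> 1 * u" using assms(2) by (intro mult_right_mono) auto
    then show ?thesis using k assms by simp
  qed
  then have pos: "1 - 2 * (s / (2 * k)) * (v / (1 + s) + u) > 0"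
    using eq s by (metis diff_gt_0_iff_gt zero_less_mult_pos)
  then show "2 * (s / (2 * k)) * (v / (1 + s) + u) < 1" by simp
  have "(1 + s) powr (- 1 / 2) * (1 - 2 * (s / (2 * k)) * (v / (1 + s) + u)) powr (- 1 / 2) = (1 - s\<^sup>2 * u / k) powr (- 1 / 2)"
    by (subst powr_mult[symmetric]) (use s pos eq in auto)
  moreover have "(k / v) powr (s / 2) = exp (s * (ln (k / v) / 2))"
    using k assms by (simp add: powr_def)
  ultimately show "(k / v) powr (s / 2) * (1 + s) powr (- 1 / 2) * (1 - 2 * (s / (2 * k)) * (v / (1 + s) + u)) powr (- 1 / 2)
     = exp (s * (ln (k / v) / 2)) * (1 - s\<^sup>2 * u / k) powr (- 1 / 2)"
    by (simp add: mult.assoc)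
qed

text \<open>Applied with \<open>x = s^2 * u / k\<close>, which is at most \<open>s^2\<close>; this
  is the source of the hypothesis \<open>s^2 \<le> 1 / 2\<close> in the moment estimates.\<close>

lemma one_minus_powr_bound:
  assumes "0 \<le> x" "x \<le> 1 / 2"
  shows "(1 - x) powr (- 1 / 2) \<le> exp (x :: real)"
proof -
  have "- ln (1 - x) \<le> 2 * x"
  proof -
    have "ln (1 / (1 - x)) \<le> 1 / (1 - x) - 1"
      using assms by (intro ln_le_minus_one) auto
    also have "\<dots> = x / (1 - x)" using assms by (simp add: field_simps)
    also have "\<dots> \<le> 2 * x" using assms mult_left_mono[of "2 * x" 1 x] by (simp add: field_simps)
    finally show ?thesis using assms by (simp add: ln_div)
  qed
  then show ?thesis using assms by (simp add: powr_def)
qed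

text \<open>With \<^term>\<open>k = v + u\<close>, this is the moment generating function at \<^term>\<open>s\<close> of the information
  density of the channel with input variance \<^term>\<open>u\<close> and noise variance \<^term>\<open>v\<close>.\<close>
lemma tilted_gd_bound:
  assumes "finite I" "v > 0" "u \<ge> 0" "k = v + u" "s\<^sup>2 \<le> 1 / 2"
  shows "ennreal (((k / v) powr (s / 2) * (1 + s) powr (- 1 / 2)) ^ card I) *
     (\<integral>\<^sup>+z. ennreal (gd I (v / (1 + s) + u) z * exp (s / (2 * k) * (\<Sum>i\<in>I. (z i)\<^sup>2))) \<partial>LI I)
     \<le> ennreal (exp (real (card I) * (s * (ln (k / v) / 2) + s\<^sup>2)))"
proof -
  have s1: "\<bar>s\<bar> < 1"
    using assms(5) by (subst abs_square_less_1[symmetric]) simp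
  have v': "v / (1 + s) + u > 0"
    using assms s1 divide_pos_pos[of v "1 + s"] by (intro add_pos_nonneg) linarith+
  note tc = tilt_const[OF assms(2,3,4) s1]
  have "(k / v) powr (s / 2) * (1 + s) powr (- 1 / 2) * (1 - 2 * (s / (2 * k)) * (v / (1 + s) + u)) powr (- 1 / 2)
    \<le> exp (s * (ln (k / v) / 2)) * exp (s\<^sup>2)"
    unfolding tc(1)
  proof (intro mult_left_mono)
    have "s\<^sup>2 * u / k \<le> s\<^sup>2"
      using assms by (simp add: field_simps)
    moreover have "0 \<le> s\<^sup>2 * u / k" using assms by simp
    ultimately show "(1 - s\<^sup>2 * u / k) powr (- 1 / 2) \<le> exp (s\<^sup>2)"
      using one_minus_powr_bound[of "s\<^sup>2 * u / k"] assms(5)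
      by (meson exp_le_cancel_iff order_trans)
  qed simp
  then have "((k / v) powr (s / 2) * (1 + s) powr (- 1 / 2) * (1 - 2 * (s / (2 * k)) * (v / (1 + s) + u)) powr (- 1 / 2)) ^ card I
    \<le> exp (s * (ln (k / v) / 2) + s\<^sup>2) ^ card I"
    by (intro power_mono) (auto simp: exp_add)
  also have "\<dots> = exp (real (card I) * (s * (ln (k / v) / 2) + s\<^sup>2))"
    by (simp add: exp_of_nat_mult)
  finally show ?thesis
    unfolding nn_integral_gd_exp_square[OF assms(1) v' tc(2)]
    by (subst ennreal_mult[symmetric]) (auto simp: power_mult_distrib[symmetric] ennreal_le_iff)
qed

section \<open>Moments of the information density under Gaussian inputs\<close>

lemma Fubini_LI:
  assumes "finite I" "finite J" "(\<lambda>(x, y). f x y) \<in> borel_measurable (LI I \<Otimes>\<^sub>M LI J)"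
  shows "(\<integral>\<^sup>+x. \<integral>\<^sup>+y. f x y \<partial>LI J \<partial>LI I) = (\<integral>\<^sup>+y. \<integral>\<^sup>+x. f x y \<partial>LI I \<partial>LI J)"
proof -
  interpret pair_sigma_finite "LI I" "LI J"
    using assms by (intro pair_sigma_finite.intro sigma_finite_LI)
  show ?thesis using Fubini'[of f] assms(3) by simp
qed

text \<open>For a fixed output the tilted likelihood is again a Gaussian kernel in the input, with
  noise variance \<open>v / (1 + s)\<close>, so the input integrates out by \<open>conv_gd\<close>
  and only an exponential of squares of the output is left. Positive \<open>s\<close> controls large
  ratios in the covering argument, negative \<open>s\<close> small ratios in decoding.\<close>

lemma moment_one_input:
  assumes "finite I" "P > 0" "v > 0" "h \<ge> 0" "k = v + h * P" "s\<^sup>2 \<le> 1 / 2"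
  shows "(\<integral>\<^sup>+x. \<integral>\<^sup>+z. ennreal (gd I P x * (gd I v (\<lambda>i. z i - sqrt h * x i) *
             (gd I v (\<lambda>i. z i - sqrt h * x i) / gd I k z) powr s)) \<partial>LI I \<partial>LI I)
       \<le> ennreal (exp (real (card I) * (s * (ln (k / v) / 2) + s\<^sup>2)))"
proof -
  note [measurable] = gd_measurable
  have s1: "\<bar>s\<bar> < 1"
    using assms(6) by (subst abs_square_less_1[symmetric]) simp
  then have s: "-1 < s" by linarith
  have "h * P \<ge> 0" using assms by simp
  then have k: "k > 0" using assms by linarith
  have vs: "v / (1 + s) > 0" using s assms by (intro divide_pos_pos) linarith+
  let ?c = "((k / v) powr (s / 2) * (1 + s) powr (- 1 / 2)) ^ card I"
  let ?e = "\<lambda>z. exp (s / (2 * k) * (\<Sum>i\<in>I. (z i)\<^sup>2))"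
  have c: "0 \<le> ?c" by simp
  have "(\<integral>\<^sup>+x. \<integral>\<^sup>+z. ennreal (gd I P x * (gd I v (\<lambda>i. z i - sqrt h * x i) *
             (gd I v (\<lambda>i. z i - sqrt h * x i) / gd I k z) powr s)) \<partial>LI I \<partial>LI I)
     = (\<integral>\<^sup>+z. \<integral>\<^sup>+x. ennreal (gd I P x * (gd I v (\<lambda>i. z i - sqrt h * x i) *
             (gd I v (\<lambda>i. z i - sqrt h * x i) / gd I k z) powr s)) \<partial>LI I \<partial>LI I)"
    by (rule Fubini_LI) (use assms in measurable)
  also have "\<dots> = (\<integral>\<^sup>+z. ennreal (?c * ?e z) * (\<integral>\<^sup>+x. ennreal (gd I P x * gd I (v / (1 + s)) (\<lambda>i. z i - sqrt h * x i)) \<partial>LI I) \<partial>LI I)"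
    using assms k s c
    by (subst nn_integral_cmult[symmetric])
       (auto simp: gd_tilt ennreal_mult'[symmetric] mult_ac intro!: nn_integral_cong)
  also have "\<dots> = (\<integral>\<^sup>+z. ennreal ?c * ennreal (gd I (v / (1 + s) + h * P) z * ?e z) \<partial>LI I)"
    using c by (subst conv_gd[OF assms(1,2) vs assms(4)]) (auto simp: ennreal_mult'[symmetric] mult_ac)
  also have "\<dots> = ennreal ?c * (\<integral>\<^sup>+z. ennreal (gd I (v / (1 + s) + h * P) z * ?e z) \<partial>LI I)"
    by (rule nn_integral_cmult) measurable
  also have "\<dots> \<le> ennreal (exp (real (card I) * (s * (ln (k / v) / 2) + s\<^sup>2)))"
    by (rule tilted_gd_bound) (use assms in auto)
  finally show ?thesis .
qed

text \<open>The inputs are integrated out one after the other, each adding its received power to the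
  variance; what results is the one-input bound with input variance \<open>h1 * P1 + h2 * P2\<close>
  and unit noise.\<close>

lemma moment_two_inputs:
  assumes "finite I" "P1 > 0" "P2 > 0" "h1 \<ge> 0" "h2 \<ge> 0" "k = 1 + h1 * P1 + h2 * P2" "s\<^sup>2 \<le> 1 / 2"
  shows "(\<integral>\<^sup>+x. \<integral>\<^sup>+y. \<integral>\<^sup>+z. ennreal (gd I P1 x * (gd I P2 y * (gd I 1 (\<lambda>i. z i - sqrt h1 * x i - sqrt h2 * y i) *
             (gd I 1 (\<lambda>i. z i - sqrt h1 * x i - sqrt h2 * y i) / gd I k z) powr s))) \<partial>LI I \<partial>LI I \<partial>LI I)
       \<le> ennreal (exp (real (card I) * (s * (ln k / 2) + s\<^sup>2)))"
proof -
  note [measurable] = gd_measurable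
  have s1: "\<bar>s\<bar> < 1"
    using assms(7) by (subst abs_square_less_1[symmetric]) simp
  then have s: "-1 < s" by linarith
  have u: "h1 * P1 \<ge> 0" "h2 * P2 \<ge> 0" using assms by auto
  then have k: "k > 0" using assms by linarith
  have vs: "1 / (1 + s) > 0" using s by simp
  then have vs2: "1 / (1 + s) + h2 * P2 > 0" using u by linarith
  let ?c = "((k / 1) powr (s / 2) * (1 + s) powr (- 1 / 2)) ^ card I"
  let ?e = "\<lambda>z. exp (s / (2 * k) * (\<Sum>i\<in>I. (z i)\<^sup>2))"
  let ?f = "\<lambda>x y z. ennreal (gd I P1 x * (gd I P2 y * (gd I 1 (\<lambda>i. z i - sqrt h1 * x i - sqrt h2 * y i) *
             (gd I 1 (\<lambda>i. z i - sqrt h1 * x i - sqrt h2 * y i) / gd I k z) powr s)))"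
  have c: "0 \<le> ?c" by simp
  interpret sigma_finite_measure "LI I" using assms(1) by (rule sigma_finite_LI)
  have "(\<integral>\<^sup>+x. \<integral>\<^sup>+y. \<integral>\<^sup>+z. ?f x y z \<partial>LI I \<partial>LI I \<partial>LI I) = (\<integral>\<^sup>+x. \<integral>\<^sup>+z. \<integral>\<^sup>+y. ?f x y z \<partial>LI I \<partial>LI I \<partial>LI I)"
    by (intro nn_integral_cong Fubini_LI) (use assms in measurable)
  also have "\<dots> = (\<integral>\<^sup>+z. \<integral>\<^sup>+x. \<integral>\<^sup>+y. ?f x y z \<partial>LI I \<partial>LI I \<partial>LI I)"
    by (intro Fubini_LI) (use assms in measurable)
  also have "\<dots> = (\<integral>\<^sup>+z. \<integral>\<^sup>+x. ennreal (?c * ?e z * gd I P1 x) * (\<integral>\<^sup>+y. ennreal (gd I P2 y * gd I (1 / (1 + s)) (\<lambda>i. (z i - sqrt h1 * x i) - sqrt h2 * y i)) \<partial>LI I) \<partial>LI I \<partial>LI I)"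
    using assms k s c
    by (subst nn_integral_cmult[symmetric])
       (auto simp: gd_tilt ennreal_mult'[symmetric] mult_ac intro!: nn_integral_cong)
  also have "\<dots> = (\<integral>\<^sup>+z. ennreal (?c * ?e z) * (\<integral>\<^sup>+x. ennreal (gd I P1 x * gd I (1 / (1 + s) + h2 * P2) (\<lambda>i. z i - sqrt h1 * x i)) \<partial>LI I) \<partial>LI I)"
    using c assms
    by (subst conv_gd[OF assms(1,3) vs assms(5)], subst nn_integral_cmult[symmetric])
       (auto simp: ennreal_mult'[symmetric] mult_ac)
  also have "\<dots> = (\<integral>\<^sup>+z. ennreal ?c * ennreal (gd I (1 / (1 + s) + h2 * P2 + h1 * P1) z * ?e z) \<partial>LI I)"
    using c by (subst conv_gd[OF assms(1,2) vs2 assms(4)]) (auto simp: ennreal_mult'[symmetric] mult_ac)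
  also have "\<dots> = ennreal ?c * (\<integral>\<^sup>+z. ennreal (gd I (1 / (1 + s) + (h1 * P1 + h2 * P2)) z * ?e z) \<partial>LI I)"
    by (subst nn_integral_cmult) (auto simp: add_ac)
  also have "\<dots> \<le> ennreal (exp (real (card I) * (s * (ln (k / 1) / 2) + s\<^sup>2)))"
    by (rule tilted_gd_bound) (use assms u in auto)
  finally show ?thesis by simp
qed

section \<open>Integrals over one or two codewords of a random codebook\<close>

lemma nn_integral_PiM_one:
  assumes "finite K" "prob_space \<mu>" "i \<in> K" "f \<in> borel_measurable \<mu>"
  shows "(\<integral>\<^sup>+X. f (X i) \<partial>PiM K (\<lambda>_. \<mu>)) = (\<integral>\<^sup>+x. f x \<partial>\<mu>)"
proof -
  have "(\<integral>\<^sup>+x. f x \<partial>\<mu>) = (\<integral>\<^sup>+x. f x \<partial>distr (PiM K (\<lambda>_. \<mu>)) \<mu> (\<lambda>X. X i))"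
    using distr_PiM_component[of K "\<lambda>_. \<mu>" i] assms by simp
  also have "\<dots> = (\<integral>\<^sup>+X. f (X i) \<partial>PiM K (\<lambda>_. \<mu>))"
    by (rule nn_integral_distr) (use assms in auto)
  finally show ?thesis ..
qed

text \<open>Distinct codewords are independent. Splitting the coordinate \<open>i\<close> off the
  product leaves the marginal of the single coordinate \<open>j\<close> under the remaining
  product.\<close>

lemma nn_integral_PiM_two:
  fixes K :: "'i set" and \<mu> :: "'a measure"
  assumes "finite K" "prob_space \<mu>" "i \<in> K" "j \<in> K" "i \<noteq> j"
    and f: "(\<lambda>(x, y). f x y) \<in> borel_measurable (\<mu> \<Otimes>\<^sub>M \<mu>)"
  shows "(\<integral>\<^sup>+X. f (X i) (X j) \<partial>PiM K (\<lambda>_. \<mu>)) = (\<integral>\<^sup>+x. \<integral>\<^sup>+y. f x y \<partial>\<mu> \<partial>\<mu>)"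
proof -
  interpret prob_space \<mu> by fact
  interpret P: product_sigma_finite "\<lambda>_ :: 'i. \<mu>" by standard
  have K: "K = insert i (K - {i})" using assms by auto
  have "(\<integral>\<^sup>+X. f (X i) (X j) \<partial>PiM (insert i (K - {i})) (\<lambda>_. \<mu>))
      = (\<integral>\<^sup>+x. \<integral>\<^sup>+X. f ((X(i := x)) i) ((X(i := x)) j) \<partial>PiM (K - {i}) (\<lambda>_. \<mu>) \<partial>\<mu>)"
  proof (rule P.product_nn_integral_insert_rev)
    have "(\<lambda>X. (\<lambda>(x, y). f x y) (X i, X j)) \<in> borel_measurable (PiM (insert i (K - {i})) (\<lambda>_. \<mu>))"
      by (rule measurable_compose[OF _ f], rule measurable_Pair; rule measurable_component_singleton)
         (use assms in auto)
    then show "(\<lambda>X. f (X i) (X j)) \<in> borel_measurable (PiM (insert i (K - {i})) (\<lambda>_. \<mu>))" by simp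
  qed (use assms in auto)
  also have "\<dots> = (\<integral>\<^sup>+x. \<integral>\<^sup>+X. f x (X j) \<partial>PiM (K - {i}) (\<lambda>_. \<mu>) \<partial>\<mu>)"
    using assms by simp
  also have "\<dots> = (\<integral>\<^sup>+x. \<integral>\<^sup>+y. f x y \<partial>\<mu> \<partial>\<mu>)"
    using assms by (intro nn_integral_cong nn_integral_PiM_one) auto
  finally show ?thesis using K by simp
qed

section \<open>Gaussian codewords conditioned on the power constraint\<close>

definition gaussian_measure :: "nat set \<Rightarrow> real \<Rightarrow> (nat \<Rightarrow> real) measure" where
  "gaussian_measure I P = density (LI I) (\<lambda>x. ennreal (gd I P x))"

definition pow_ball :: "nat set \<Rightarrow> real \<Rightarrow> (nat \<Rightarrow> real) set" where
  "pow_ball I Pb = {x \<in> space (LI I). (\<Sum>i\<in>I. (x i)\<^sup>2) \<le> real (card I) * Pb}"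

text \<open>\<open>uniform_measure\<close> of a general measure is conditioning, here on the power
  constraint.\<close>

definition codeword_measure :: "nat set \<Rightarrow> real \<Rightarrow> real \<Rightarrow> (nat \<Rightarrow> real) measure" where
  "codeword_measure I P Pb = uniform_measure (gaussian_measure I P) (pow_ball I Pb)"

lemma gaussian_measure_prob: "finite I \<Longrightarrow> P > 0 \<Longrightarrow> prob_space (gaussian_measure I P)"
  unfolding gaussian_measure_def using nn_integral_gd0[of I P]
  by (intro prob_spaceI) (auto simp: emeasure_density gd_measurable cong: nn_integral_cong)

lemma sets_gaussian_measure [simp, measurable_cong]: "sets (gaussian_measure I P) = sets (LI I)"
  and space_gaussian_measure [simp]: "space (gaussian_measure I P) = space (LI I)"
  by (auto simp: gaussian_measure_def)

lemma sets_codeword_measure [simp, measurable_cong]: "sets (codeword_measure I P Pb) = sets (LI I)"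
  and space_codeword_measure [simp]: "space (codeword_measure I P Pb) = space (LI I)"
  by (auto simp: codeword_measure_def)

lemma pow_ball_sets [measurable]: "finite I \<Longrightarrow> pow_ball I Pb \<in> sets (LI I)"
  unfolding pow_ball_def by measurable

text \<open>Chernoff bound: the variance \<open>P\<close> lies strictly below \<open>Pb\<close>, so
  the probability of violating the constraint decays exponentially. Any fixed positive lower bound
  would do; 1/2 gives the factor 2 in \<open>codeword_measure_le\<close>.\<close>

lemma gaussian_measure_pow_ball_ge_half:
  assumes "0 < P" "P < Pb"
  shows "\<exists>N. \<forall>I. finite I \<and> card I \<ge> N \<longrightarrow> ennreal (1 / 2) \<le> emeasure (gaussian_measure I P) (pow_ball I Pb)"
proof -
  \<comment> \<open>Half the optimal Chernoff parameter, which solves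
    \<open>2 * t * P = 1 - P / Pb\<close>. With this choice \<open>1 - 2 * t * P\<close> stays above
    \<open>P / Pb\<close>, which makes the decay factor \<open>r\<close> per coordinate less than
    1.\<close>
  define t where "t = (1 - P / Pb) / (4 * P)"
  define r where "r = (1 - 2 * t * P) powr (- 1 / 2) * exp (- t * Pb)"
  have Pb: "Pb > 0" using assms by linarith
  have x: "0 < P / Pb" "P / Pb < 1" using assms by auto
  have t: "t > 0" using x assms by (simp add: t_def)
  have tP: "2 * t * P = (1 - P / Pb) / 2" using assms by (simp add: t_def)
  have tP1: "2 * t * P < 1" using tP x by simp
  have "y < 1 - (1 - y) / 2" if "y < 1" for y :: real
    using that by (auto simp: field_simps)
  then have "P / Pb < 1 - 2 * t * P" unfolding tP using x by blast
  have "- ln (1 - 2 * t * P) / 2 < t * Pb"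
  proof -
    let ?y = "2 * t * P"
    have y: "0 < ?y" "0 < 1 - ?y" using t assms tP1 by auto
    have "ln (1 / (1 - ?y)) \<le> 1 / (1 - ?y) - 1"
      using y by (intro ln_le_minus_one) auto
    also have "\<dots> = ?y / (1 - ?y)" using y by (simp add: field_simps)
    also have "\<dots> < ?y / (P / Pb)"
      using y x t assms(1) \<open>P / Pb < 1 - 2 * t * P\<close>
      by (intro divide_strict_left_mono mult_pos_pos) simp_all
    also have "\<dots> = 2 * (t * Pb)" using assms Pb by simp
    finally show ?thesis using y by (simp add: ln_div)
  qed
  then have r: "0 < r" "r < 1"
    using tP1 by (auto simp: r_def powr_def exp_add[symmetric])
  then have "(\<lambda>n. r ^ n) \<longlonglongrightarrow> 0" by (intro LIMSEQ_realpow_zero) auto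
  then have "eventually (\<lambda>n. r ^ n < 1 / 2) sequentially"
    by (rule order_tendstoD) simp
  then obtain N where N: "\<And>n. n \<ge> N \<Longrightarrow> r ^ n < 1 / 2"
    by (auto simp: eventually_sequentially)
  show ?thesis
  proof (intro exI[of _ N] allI impI)
    fix I :: "nat set" assume I: "finite I \<and> card I \<ge> N"
    note [measurable] = gd_measurable
    interpret prob_space "gaussian_measure I P" using I assms by (intro gaussian_measure_prob) auto
    have m: "pow_ball I Pb \<in> sets (gaussian_measure I P)" using I by simp
    have "emeasure (gaussian_measure I P) (space (gaussian_measure I P) - pow_ball I Pb)
        = (\<integral>\<^sup>+x. ennreal (gd I P x) * indicator (space (gaussian_measure I P) - pow_ball I Pb) x \<partial>LI I)"
      unfolding gaussian_measure_def by (rule emeasure_density) (use I in auto)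
    also have "\<dots> \<le> (\<integral>\<^sup>+x. ennreal (exp (- t * Pb) ^ card I) * ennreal (gd I P x * exp (t * (\<Sum>i\<in>I. (x i)\<^sup>2))) \<partial>LI I)"
    proof (rule nn_integral_mono)
      fix x assume x: "x \<in> space (LI I)"
      show "ennreal (gd I P x) * indicator (space (gaussian_measure I P) - pow_ball I Pb) x
        \<le> ennreal (exp (- t * Pb) ^ card I) * ennreal (gd I P x * exp (t * (\<Sum>i\<in>I. (x i)\<^sup>2)))"
      proof (cases "x \<in> pow_ball I Pb")
        case False
        then have "(\<Sum>i\<in>I. (x i)\<^sup>2) > real (card I) * Pb" using x by (simp add: pow_ball_def)
        then have "real (card I) * (t * Pb) \<le> t * (\<Sum>i\<in>I. (x i)\<^sup>2)"
          using t by (metis less_imp_le mult.left_commute mult_left_mono)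
        then have "1 \<le> exp (- t * Pb) ^ card I * exp (t * (\<Sum>i\<in>I. (x i)\<^sup>2))"
          by (simp add: exp_of_nat_mult[symmetric] exp_add[symmetric])
        then have "gd I P x * 1 \<le> gd I P x * (exp (- t * Pb) ^ card I * exp (t * (\<Sum>i\<in>I. (x i)\<^sup>2)))"
          by (intro mult_left_mono) auto
        then show ?thesis
          using False x by (simp add: ennreal_mult'[symmetric] mult_ac ennreal_leI)
      qed simp
    qed
    also have "\<dots> = ennreal (exp (- t * Pb) ^ card I) * ennreal (((1 - 2 * t * P) powr (- 1 / 2)) ^ card I)"
      using I assms tP1 by (subst nn_integral_cmult) (auto simp: nn_integral_gd_exp_square)
    also have "\<dots> = ennreal (r ^ card I)"
      by (simp add: r_def ennreal_mult'[symmetric] power_mult_distrib mult_ac)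
    also have "\<dots> \<le> ennreal (1 / 2)" using N[of "card I"] I by (intro ennreal_leI) auto
    finally have "prob (space (gaussian_measure I P) - pow_ball I Pb) \<le> 1 / 2"
      unfolding emeasure_eq_measure by (subst (asm) ennreal_le_iff) auto
    then have "prob (pow_ball I Pb) \<ge> 1 / 2" using prob_compl[OF m] by linarith
    then show "ennreal (1 / 2) \<le> emeasure (gaussian_measure I P) (pow_ball I Pb)"
      unfolding emeasure_eq_measure by (rule ennreal_leI)
  qed
qed

context
  fixes I P Pb
  assumes I: "finite I" and P: "P > 0"
    and half: "ennreal (1 / 2) \<le> emeasure (gaussian_measure I P) (pow_ball I Pb)"
begin

lemma codeword_measure_prob: "prob_space (codeword_measure I P Pb)"
proof -
  interpret prob_space "gaussian_measure I P" using I P by (rule gaussian_measure_prob)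
  have "1 / 2 \<le> prob (pow_ball I Pb)"
    using half unfolding emeasure_eq_measure by (subst (asm) ennreal_le_iff) auto
  then have "emeasure (gaussian_measure I P) (pow_ball I Pb) \<noteq> 0"
    by (auto simp: emeasure_eq_measure)
  then show ?thesis unfolding codeword_measure_def
    by (intro prob_space_uniform_measure) (auto simp: emeasure_eq_measure)
qed

lemma codeword_measure_AE: "AE x in codeword_measure I P Pb. x \<in> pow_ball I Pb"
  unfolding codeword_measure_def by (rule AE_uniform_measureI) (use I in auto)

text \<open>Dropping the constraint can only increase a nonnegative integral, and dividing by a
  probability of at least 1/2 at most doubles it. Later averages over codewords are estimated
  through this comparison, so that they can be computed with the unconstrained Gaussian.\<close>

lemma codeword_measure_le:
  assumes [measurable]: "f \<in> borel_measurable (LI I)"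
  shows "(\<integral>\<^sup>+x. f x \<partial>codeword_measure I P Pb) \<le> 2 * (\<integral>\<^sup>+x. ennreal (gd I P x) * f x \<partial>LI I)"
proof -
  note [measurable] = gd_measurable
  have pb: "pow_ball I Pb \<in> sets (gaussian_measure I P)" using I by simp
  have "(\<integral>\<^sup>+x. f x \<partial>codeword_measure I P Pb) = (\<integral>\<^sup>+x. f x * indicator (pow_ball I Pb) x \<partial>gaussian_measure I P) / emeasure (gaussian_measure I P) (pow_ball I Pb)"
    unfolding codeword_measure_def by (rule nn_integral_uniform_measure) (use pb in auto)
  also have "\<dots> \<le> (\<integral>\<^sup>+x. f x \<partial>gaussian_measure I P) * 2"
  proof -
    interpret prob_space "gaussian_measure I P" using I P by (rule gaussian_measure_prob)
    have "1 / 2 \<le> prob (pow_ball I Pb)"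
      using half unfolding emeasure_eq_measure by (subst (asm) ennreal_le_iff) auto
    then have "inverse (emeasure (gaussian_measure I P) (pow_ball I Pb)) \<le> ennreal 2"
      by (simp add: emeasure_eq_measure inverse_ennreal ennreal_leI field_simps del: ennreal_numeral)
    then show ?thesis
      unfolding divide_ennreal_def
      by (intro mult_mono nn_integral_mono) (auto split: split_indicator)
  qed
  also have "\<dots> = 2 * (\<integral>\<^sup>+x. f x \<partial>gaussian_measure I P)" by (simp add: mult.commute)
  also have "(\<integral>\<^sup>+x. f x \<partial>gaussian_measure I P) = (\<integral>\<^sup>+x. ennreal (gd I P x) * f x \<partial>LI I)"
    unfolding gaussian_measure_def by (rule nn_integral_density) auto
  finally show ?thesis .
qed

end

subsection \<open>Threshold decoding\<close>

text \<open>Pointwise form of Markov's inequality: multiplied by the true density and integrated, it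
  bounds the probability that the ratio of the true message stays below the threshold by a moment of
  order \<open>- s\<close>.\<close>

lemma likelihood_ratio_powr:
  assumes "0 < (p::real)" "0 < q" "0 < \<theta>" "p < \<theta> * q" "0 \<le> s"
  shows "1 \<le> \<theta> powr s * (p / q) powr (- s)"
proof -
  have "1 \<le> (\<theta> * q / p) powr s"
    using assms by (intro ge_one_powr_ge_zero) auto
  also have "\<theta> * q / p = \<theta> * inverse (p / q)" using assms by (simp add: field_simps)
  also have "(\<theta> * inverse (p / q)) powr s = \<theta> powr s * (p / q) powr (- s)"
    using assms by (subst powr_mult) (auto simp: powr_minus powr_divide)
  finally show ?thesis .
qed

text \<open>The decoder accepts the unique message whose likelihood ratio against \<^term>\<open>q\<close> exceeds
  the threshold; the two terms bound the failure of the true message and the false alarms.\<close>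
lemma threshold_decoder:
  fixes x :: "nat \<times> nat \<Rightarrow> nat \<Rightarrow> real"
  assumes "finite I" "finite K" "0 < \<theta>" "0 \<le> s" "0 < v"
    and q: "q = gd I v"
  obtains D :: "(nat \<Rightarrow> real) \<Rightarrow> nat \<times> nat" where "D \<in> LI I \<rightarrow>\<^sub>M count_space UNIV"
    and "\<And>m. m \<in> K \<Longrightarrow>
      (\<integral>\<^sup>+y. ennreal (gd I 1 (\<lambda>i. y i - x m i)) * indicator {y. D y \<noteq> m} y \<partial>LI I) \<le>
      (\<integral>\<^sup>+y. ennreal (\<theta> powr s * (gd I 1 (\<lambda>i. y i - x m i) * (gd I 1 (\<lambda>i. y i - x m i) / q y) powr (- s))) \<partial>LI I)
      + (\<Sum>m'\<in>K - {m}. \<integral>\<^sup>+y. ennreal (gd I 1 (\<lambda>i. y i - x m i) * gd I 1 (\<lambda>i. y i - x m' i) / (\<theta> * q y)) \<partial>LI I)"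
proof -
  note [measurable] = gd_measurable
  have qm[measurable]: "q \<in> borel_measurable (LI I)" unfolding q by measurable
  have qpos: "q y > 0" for y unfolding q using assms by (intro gd_pos) auto
  define \<phi> where "\<phi> m y = gd I 1 (\<lambda>i. y i - x m i)" for m y
  have \<phi>m[measurable]: "\<phi> m \<in> borel_measurable (LI I)" for m unfolding \<phi>_def by measurable
  have \<phi>pos: "\<phi> m y > 0" for m y unfolding \<phi>_def by (intro gd_pos) auto
  define U where "U m y \<longleftrightarrow> m \<in> K \<and> \<phi> m y \<ge> \<theta> * q y \<and> (\<forall>m'\<in>K - {m}. \<phi> m' y < \<theta> * q y)" for m y
  have Um[measurable]: "Measurable.pred (LI I) (U m)" for m
  proof -
    have c: "Measurable.pred (LI I) (\<lambda>y. \<theta> * q y \<le> \<phi> m y)" for m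
      unfolding pred_def by measurable
    have c': "Measurable.pred (LI I) (\<lambda>y. \<phi> m y < \<theta> * q y)" for m
      by measurable
    show ?thesis unfolding U_def using c c' assms(2)
      by (intro pred_intros_logic pred_intros_finite) auto
  qed
  \<comment> \<open>If no message qualifies, the decoder returns \<open>(0, 0)\<close>. The default
    is harmless for the bound, which only asks what happens when \<open>U m\<close> fails, but it
    needs its own clause in \<open>D_iff\<close> for measurability.\<close>
  define D where "D y = (if \<exists>m\<in>K. U m y then (THE m. U m y) else (0, 0))" for y
  have uniq: "U m y \<Longrightarrow> U m' y \<Longrightarrow> m = m'" for m m' y
    unfolding U_def by (metis Diff_iff linorder_not_le singletonD)
  have DU: "D y = m" if "U m y" for m y
  proof -
    have "\<exists>m\<in>K. U m y" using that U_def by blast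
    moreover have "(THE m. U m y) = m" by (rule the_equality) (use that uniq in auto)
    ultimately show ?thesis by (simp add: D_def)
  qed
  have D0: "D y = (0, 0)" if "\<not> (\<exists>m\<in>K. U m y)" for y using that by (simp add: D_def)
  have D_iff: "D y = m \<longleftrightarrow> U m y \<or> (m = (0, 0) \<and> \<not> (\<exists>m\<in>K. U m y))" for y m
    using DU D0 by metis
  have Dm: "D \<in> LI I \<rightarrow>\<^sub>M count_space UNIV"
  proof (subst measurable_count_space_eq_countable, simp, intro conjI ballI)
    fix m :: "nat \<times> nat"
    have "D -` {m} \<inter> space (LI I) = {y \<in> space (LI I). D y = m}" by auto
    also have "\<dots> = {y \<in> space (LI I). U m y \<or> (m = (0, 0) \<and> \<not> (\<exists>m\<in>K. U m y))}"
      by (simp only: D_iff)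
    also have "\<dots> \<in> sets (LI I)" using assms by measurable
    finally show "D -` {m} \<inter> space (LI I) \<in> sets (LI I)" .
  qed auto
  have bound: "ennreal (\<phi> m y) * indicator {y. D y \<noteq> m} y \<le>
      ennreal (\<theta> powr s * (\<phi> m y * (\<phi> m y / q y) powr (- s))) + (\<Sum>m'\<in>K - {m}. ennreal (\<phi> m y * \<phi> m' y / (\<theta> * q y)))"
    if m: "m \<in> K" for m y
  proof (cases "D y = m")
    case False
    then have "\<not> U m y" using DU by blast
    then consider "\<phi> m y < \<theta> * q y" | m' where "m' \<in> K - {m}" "\<phi> m' y \<ge> \<theta> * q y"
      using m unfolding U_def by (metis linorder_not_le)
    then show ?thesis
    proof cases
      case 1
      have "\<phi> m y * 1 \<le> \<phi> m y * (\<theta> powr s * (\<phi> m y / q y) powr (- s))"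
        using likelihood_ratio_powr[OF \<phi>pos qpos assms(3) 1 assms(4)] \<phi>pos[of m y]
        by (intro mult_left_mono) auto
      then have "ennreal (\<phi> m y) \<le> ennreal (\<theta> powr s * (\<phi> m y * (\<phi> m y / q y) powr (- s)))"
        by (intro ennreal_leI) (simp add: mult_ac)
      then show ?thesis using False by (simp add: add_increasing2)
    next
      case 2
      have "\<phi> m y * 1 \<le> \<phi> m y * (\<phi> m' y / (\<theta> * q y))"
        using 2 \<phi>pos[of m y] qpos[of y] assms by (intro mult_left_mono) auto
      then have "ennreal (\<phi> m y) \<le> ennreal (\<phi> m y * \<phi> m' y / (\<theta> * q y))"
        by (intro ennreal_leI) simp
      also have "\<dots> \<le> (\<Sum>m'\<in>K - {m}. ennreal (\<phi> m y * \<phi> m' y / (\<theta> * q y)))"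
        using 2 assms by (intro member_le_sum) auto
      finally show ?thesis using False by (simp add: add_increasing)
    qed
  qed simp
  show ?thesis
  proof (rule that[OF Dm])
    fix m assume m: "m \<in> K"
    have "(\<integral>\<^sup>+y. ennreal (\<phi> m y) * indicator {y. D y \<noteq> m} y \<partial>LI I)
      \<le> (\<integral>\<^sup>+y. ennreal (\<theta> powr s * (\<phi> m y * (\<phi> m y / q y) powr (- s))) + (\<Sum>m'\<in>K - {m}. ennreal (\<phi> m y * \<phi> m' y / (\<theta> * q y))) \<partial>LI I)"
      by (intro nn_integral_mono bound m)
    also have "\<dots> = (\<integral>\<^sup>+y. ennreal (\<theta> powr s * (\<phi> m y * (\<phi> m y / q y) powr (- s))) \<partial>LI I)
      + (\<Sum>m'\<in>K - {m}. \<integral>\<^sup>+y. ennreal (\<phi> m y * \<phi> m' y / (\<theta> * q y)) \<partial>LI I)"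
      by (subst nn_integral_add, measurable, subst nn_integral_sum) auto
    finally show "(\<integral>\<^sup>+y. ennreal (gd I 1 (\<lambda>i. y i - x m i)) * indicator {y. D y \<noteq> m} y \<partial>LI I) \<le>
      (\<integral>\<^sup>+y. ennreal (\<theta> powr s * (gd I 1 (\<lambda>i. y i - x m i) * (gd I 1 (\<lambda>i. y i - x m i) / q y) powr (- s))) \<partial>LI I)
      + (\<Sum>m'\<in>K - {m}. \<integral>\<^sup>+y. ennreal (gd I 1 (\<lambda>i. y i - x m i) * gd I 1 (\<lambda>i. y i - x m' i) / (\<theta> * q y)) \<partial>LI I)"
      unfolding \<phi>_def .
  qed
qed

text \<open>The bound of \<open>threshold_decoder\<close>, averaged over the messages. Unlike the
  error probability itself it is an explicit function of the codebook, so its expectation can be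
  taken before any decoder is chosen.\<close>

definition decoding_cost :: "nat set \<Rightarrow> real \<Rightarrow> real \<Rightarrow> real \<Rightarrow> (nat \<times> nat) set \<Rightarrow> (nat \<times> nat \<Rightarrow> nat \<Rightarrow> real) \<Rightarrow> ennreal" where
  "decoding_cost I P s \<theta> K x = (\<Sum>m\<in>K. ennreal (1 / real (card K)) * (
      (\<integral>\<^sup>+y. ennreal (\<theta> powr s * (gd I 1 (\<lambda>i. y i - x m i) * (gd I 1 (\<lambda>i. y i - x m i) / gd I (1 + P) y) powr (- s))) \<partial>LI I)
      + (\<Sum>m'\<in>K - {m}. \<integral>\<^sup>+y. ennreal (gd I 1 (\<lambda>i. y i - x m i) * gd I 1 (\<lambda>i. y i - x m' i) / (\<theta> * gd I (1 + P) y)) \<partial>LI I)))"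

lemma nn_integral_PiM_pair_sum_le:
  fixes f :: "'a \<Rightarrow> ennreal" and g :: "'a \<Rightarrow> 'a \<Rightarrow> ennreal" and c :: ennreal
  assumes K: "finite K" and \<mu>: "prob_space \<mu>"
    and f: "f \<in> borel_measurable \<mu>" and g: "(\<lambda>(x, y). g x y) \<in> borel_measurable (\<mu> \<Otimes>\<^sub>M \<mu>)"
    and A: "(\<integral>\<^sup>+x. f x \<partial>\<mu>) \<le> A" and B: "(\<integral>\<^sup>+x. \<integral>\<^sup>+y. g x y \<partial>\<mu> \<partial>\<mu>) \<le> B"
  defines "F \<equiv> (\<lambda>X. \<Sum>m\<in>K. c * (f (X m) + (\<Sum>m'\<in>K - {m}. g (X m) (X m'))))"
  shows "F \<in> borel_measurable (PiM K (\<lambda>_. \<mu>))"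
    and "(\<integral>\<^sup>+X. F X \<partial>PiM K (\<lambda>_. \<mu>)) \<le> of_nat (card K) * (c * (A + of_nat (card K) * B))"
proof -
  let ?M = "PiM K (\<lambda>_. \<mu>)"
  have fm[measurable]: "(\<lambda>X. f (X m)) \<in> borel_measurable ?M" if "m \<in> K" for m
    by (rule measurable_compose[OF measurable_component_singleton[OF that] f])
  have gm[measurable]: "(\<lambda>X. g (X m) (X m')) \<in> borel_measurable ?M" if "m \<in> K" "m' \<in> K" for m m'
  proof -
    have "(\<lambda>X. (X m, X m')) \<in> ?M \<rightarrow>\<^sub>M \<mu> \<Otimes>\<^sub>M \<mu>" using that by measurable
    from measurable_compose[OF this g] show ?thesis by simp
  qed
  have Sm[measurable]: "(\<lambda>X. \<Sum>m'\<in>K - {m}. g (X m) (X m')) \<in> borel_measurable ?M" if "m \<in> K" for m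
    using that by (intro borel_measurable_sum gm) auto
  have tm: "(\<lambda>X. c * (f (X m) + (\<Sum>m'\<in>K - {m}. g (X m) (X m')))) \<in> borel_measurable ?M" if "m \<in> K" for m
    using fm[OF that] Sm[OF that] by (intro borel_measurable_times_ennreal borel_measurable_add) simp_all
  show "F \<in> borel_measurable ?M"
    unfolding F_def by (intro borel_measurable_sum tm)
  have "(\<integral>\<^sup>+X. F X \<partial>?M) = (\<Sum>m\<in>K. \<integral>\<^sup>+X. c * (f (X m) + (\<Sum>m'\<in>K - {m}. g (X m) (X m'))) \<partial>?M)"
    unfolding F_def by (rule nn_integral_sum) (rule tm)
  also have "\<dots> \<le> (\<Sum>m\<in>K. c * (A + of_nat (card K) * B))"
  proof (rule sum_mono)
    fix m assume m: "m \<in> K"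
    have "(\<integral>\<^sup>+X. c * (f (X m) + (\<Sum>m'\<in>K - {m}. g (X m) (X m'))) \<partial>?M)
        = c * (\<integral>\<^sup>+X. f (X m) + (\<Sum>m'\<in>K - {m}. g (X m) (X m')) \<partial>?M)"
      by (rule nn_integral_cmult) (intro borel_measurable_add fm Sm m)
    also have "(\<integral>\<^sup>+X. f (X m) + (\<Sum>m'\<in>K - {m}. g (X m) (X m')) \<partial>?M)
        = (\<integral>\<^sup>+X. f (X m) \<partial>?M) + (\<integral>\<^sup>+X. (\<Sum>m'\<in>K - {m}. g (X m) (X m')) \<partial>?M)"
      by (rule nn_integral_add) (intro fm Sm m)+
    also have "(\<integral>\<^sup>+X. (\<Sum>m'\<in>K - {m}. g (X m) (X m')) \<partial>?M) = (\<Sum>m'\<in>K - {m}. \<integral>\<^sup>+X. g (X m) (X m') \<partial>?M)"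
      by (rule nn_integral_sum) (use m gm in auto)
    also have "\<dots> = (\<Sum>m'\<in>K - {m}. \<integral>\<^sup>+x. \<integral>\<^sup>+y. g x y \<partial>\<mu> \<partial>\<mu>)"
      by (intro sum.cong refl nn_integral_PiM_two) (use m K \<mu> g in auto)
    also have "\<dots> \<le> (\<Sum>m'\<in>K. B)"
      using K B by (intro order_trans[OF sum_mono sum_mono2]) auto
    also have "(\<integral>\<^sup>+X. f (X m) \<partial>?M) = (\<integral>\<^sup>+x. f x \<partial>\<mu>)"
      by (rule nn_integral_PiM_one) (use m K \<mu> f in auto)
    finally show "(\<integral>\<^sup>+X. c * (f (X m) + (\<Sum>m'\<in>K - {m}. g (X m) (X m'))) \<partial>?M) \<le> c * (A + of_nat (card K) * B)"
      using A by (simp add: mult_left_mono add_mono order_trans)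
  qed
  finally show "(\<integral>\<^sup>+X. F X \<partial>?M) \<le> of_nat (card K) * (c * (A + of_nat (card K) * B))" by simp
qed

text \<open>The true codeword contributes a moment of order \<open>- s\<close>. For a false alarm,
  the wrong codeword is independent of the output; averaging its likelihood over the Gaussian input
  gives exactly the reference density, which cancels, so each competitor contributes a multiple of
  \<open>1 / \<theta>\<close>.\<close>

lemma expected_decoding_cost:
  assumes "finite I" "finite K" "K \<noteq> {}" "P > 0" "\<theta> > 0" "s\<^sup>2 \<le> 1 / 2"
    and \<mu>: "prob_space \<mu>" "sets \<mu> = sets (LI I)"
    and le: "\<And>f. f \<in> borel_measurable (LI I) \<Longrightarrow> (\<integral>\<^sup>+x. f x \<partial>\<mu>) \<le> 2 * (\<integral>\<^sup>+x. ennreal (gd I P x) * f x \<partial>LI I)"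
  shows "(\<lambda>X. decoding_cost I P s \<theta> K X) \<in> borel_measurable (PiM K (\<lambda>_. \<mu>))"
    and "(\<integral>\<^sup>+X. decoding_cost I P s \<theta> K X \<partial>PiM K (\<lambda>_. \<mu>))
      \<le> 2 * ennreal (\<theta> powr s * exp (real (card I) * (s\<^sup>2 - s * (ln (1 + P) / 2)))) + 4 * ennreal (real (card K) / \<theta>)"
proof -
  note [measurable] = gd_measurable
  have m1: "measurable \<mu> M = measurable (LI I) M" for M :: "ennreal measure"
    by (rule measurable_cong_sets) (use \<mu>(2) in auto)
  have m2: "measurable (\<mu> \<Otimes>\<^sub>M \<mu>) M = measurable (LI I \<Otimes>\<^sub>M LI I) M" for M :: "ennreal measure"
    by (intro measurable_cong_sets sets_pair_measure_cong refl \<mu>(2))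
  interpret \<mu>: prob_space \<mu> by fact
  interpret L: sigma_finite_measure "LI I" using assms(1) by (rule sigma_finite_LI)
  let ?q = "gd I (1 + P)"
  let ?\<phi> = "\<lambda>x y. gd I 1 (\<lambda>i. y i - x i)"
  let ?f = "\<lambda>x. \<integral>\<^sup>+y. ennreal (\<theta> powr s * (?\<phi> x y * (?\<phi> x y / ?q y) powr (- s))) \<partial>LI I"
  let ?g = "\<lambda>x x'. \<integral>\<^sup>+y. ennreal (?\<phi> x y * ?\<phi> x' y / (\<theta> * ?q y)) \<partial>LI I"
  have fm[measurable]: "?f \<in> borel_measurable (LI I)" by measurable
  have gm[measurable]: "(\<lambda>(x, x'). ?g x x') \<in> borel_measurable (LI I \<Otimes>\<^sub>M LI I)" by measurable
  have q: "?q y > 0" for y using assms by (intro gd_pos) auto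
  let ?F = "\<lambda>x. \<integral>\<^sup>+y. ennreal (gd I P x * (?\<phi> x y * (?\<phi> x y / ?q y) powr (- s))) \<partial>LI I"
  have Ef: "(\<integral>\<^sup>+x. ?f x \<partial>\<mu>) \<le> 2 * ennreal (\<theta> powr s * exp (real (card I) * (s\<^sup>2 - s * (ln (1 + P) / 2))))"
  proof -
    have "(\<integral>\<^sup>+x. ?f x \<partial>\<mu>) \<le> 2 * (\<integral>\<^sup>+x. ennreal (gd I P x) * ?f x \<partial>LI I)" by (rule le) measurable
    also have "(\<integral>\<^sup>+x. ennreal (gd I P x) * ?f x \<partial>LI I) = (\<integral>\<^sup>+x. ennreal (\<theta> powr s) * ?F x \<partial>LI I)"
    proof (rule nn_integral_cong)
      fix x
      have "ennreal (gd I P x) * ?f x = (\<integral>\<^sup>+y. ennreal (gd I P x) * ennreal (\<theta> powr s * (?\<phi> x y * (?\<phi> x y / ?q y) powr (- s))) \<partial>LI I)"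
        by (rule nn_integral_cmult[symmetric]) measurable
      also have "\<dots> = (\<integral>\<^sup>+y. ennreal (\<theta> powr s) * ennreal (gd I P x * (?\<phi> x y * (?\<phi> x y / ?q y) powr (- s))) \<partial>LI I)"
        by (simp add: ennreal_mult'[symmetric] mult.left_commute)
      also have "\<dots> = ennreal (\<theta> powr s) * ?F x"
        by (rule nn_integral_cmult) measurable
      finally show "ennreal (gd I P x) * ?f x = ennreal (\<theta> powr s) * ?F x" .
    qed
    also have "\<dots> = ennreal (\<theta> powr s) * (\<integral>\<^sup>+x. ?F x \<partial>LI I)"
      by (rule nn_integral_cmult) measurable
    also have "\<dots> \<le> ennreal (\<theta> powr s) * ennreal (exp (real (card I) * ((- s) * (ln ((1 + P) / 1) / 2) + (- s)\<^sup>2)))"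
      using moment_one_input[of I P 1 1 "1 + P" "- s"] assms by (intro mult_left_mono) auto
    also have "\<dots> = ennreal (\<theta> powr s * exp (real (card I) * (s\<^sup>2 - s * (ln (1 + P) / 2))))"
      by (simp add: ennreal_mult'[symmetric])
    finally show ?thesis by (rule order_trans) (intro mult_left_mono, auto)
  qed
  have Eg: "(\<integral>\<^sup>+x. \<integral>\<^sup>+x'. ?g x x' \<partial>\<mu> \<partial>\<mu>) \<le> 4 * ennreal (1 / \<theta>)"
  proof -
    have inner: "(\<integral>\<^sup>+x'. ?g x x' \<partial>\<mu>) \<le> 2 * ennreal (1 / \<theta>)" if x: "x \<in> space (LI I)" for x
    proof -
      have "(\<integral>\<^sup>+x'. ?g x x' \<partial>\<mu>) \<le> 2 * (\<integral>\<^sup>+x'. ennreal (gd I P x') * ?g x x' \<partial>LI I)"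
        by (rule le) measurable
      also have "(\<integral>\<^sup>+x'. ennreal (gd I P x') * ?g x x' \<partial>LI I) =
          (\<integral>\<^sup>+x'. \<integral>\<^sup>+y. ennreal (gd I P x' * (?\<phi> x y * ?\<phi> x' y / (\<theta> * ?q y))) \<partial>LI I \<partial>LI I)"
        by (intro nn_integral_cong, subst nn_integral_cmult[symmetric]) (auto simp: ennreal_mult'[symmetric])
      also have "\<dots> = (\<integral>\<^sup>+y. \<integral>\<^sup>+x'. ennreal (gd I P x' * (?\<phi> x y * ?\<phi> x' y / (\<theta> * ?q y))) \<partial>LI I \<partial>LI I)"
        by (rule Fubini_LI) (use assms in measurable)
      also have "\<dots> = (\<integral>\<^sup>+y. ennreal (1 / \<theta>) * ennreal (?\<phi> x y) \<partial>LI I)"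
      proof (rule nn_integral_cong)
        fix y
        have "(\<integral>\<^sup>+x'. ennreal (gd I P x' * (?\<phi> x y * ?\<phi> x' y / (\<theta> * ?q y))) \<partial>LI I)
            = (\<integral>\<^sup>+x'. ennreal (?\<phi> x y / (\<theta> * ?q y)) * ennreal (gd I P x' * ?\<phi> x' y) \<partial>LI I)"
          using assms(5) q[of y] by (simp add: ennreal_mult'[symmetric] mult_ac)
        also have "\<dots> = ennreal (?\<phi> x y / (\<theta> * ?q y)) * ennreal (?q y)"
          using conv_gd[of I P 1 1 y] assms by (subst nn_integral_cmult) auto
        also have "\<dots> = ennreal (1 / \<theta>) * ennreal (?\<phi> x y)"
          using assms(5) q[of y] by (simp add: ennreal_mult'[symmetric])
        finally show "(\<integral>\<^sup>+x'. ennreal (gd I P x' * (?\<phi> x y * ?\<phi> x' y / (\<theta> * ?q y))) \<partial>LI I) = ennreal (1 / \<theta>) * ennreal (?\<phi> x y)" .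
      qed
      also have "\<dots> = ennreal (1 / \<theta>)"
        using nn_integral_gd[of I 1 x] assms by (subst nn_integral_cmult) auto
      finally show ?thesis .
    qed
    have "(\<integral>\<^sup>+x. \<integral>\<^sup>+x'. ?g x x' \<partial>\<mu> \<partial>\<mu>) \<le> (\<integral>\<^sup>+x. 2 * ennreal (1 / \<theta>) \<partial>\<mu>)"
      by (rule nn_integral_mono, rule inner) (simp add: sets_eq_imp_space_eq[OF \<mu>(2)])
    also have "\<dots> = 2 * ennreal (1 / \<theta>)" by (simp add: \<mu>.emeasure_space_1)
    \<comment> \<open>Only the competing codeword was compared with a Gaussian; the constant 2 is
      rounded up to 4.\<close>
    also have "\<dots> \<le> 4 * ennreal (1 / \<theta>)" by (intro mult_right_mono) auto
    finally show ?thesis .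
  qed
  have f': "?f \<in> borel_measurable \<mu>" unfolding m1 by (rule fm)
  have g': "(\<lambda>(x, x'). ?g x x') \<in> borel_measurable (\<mu> \<Otimes>\<^sub>M \<mu>)" unfolding m2 by (rule gm)
  note main = nn_integral_PiM_pair_sum_le[OF assms(2) \<mu>(1) f' g' Ef Eg, of "ennreal (1 / real (card K))"]
  show "(\<lambda>X. decoding_cost I P s \<theta> K X) \<in> borel_measurable (PiM K (\<lambda>_. \<mu>))"
    unfolding decoding_cost_def by (rule main(1))
  have c: "of_nat (card K) * (ennreal (1 / real (card K)) * x) = x" for x
    using assms(2,3) unfolding mult.assoc[symmetric]
    by (simp add: ennreal_of_nat_eq_real_of_nat ennreal_mult'[symmetric])
  have d: "of_nat (card K) * (4 * ennreal (1 / \<theta>)) = 4 * ennreal (real (card K) / \<theta>)"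
    using assms(5) by (simp add: mult.left_commute[of _ 4] ennreal_of_nat_eq_real_of_nat ennreal_mult'[symmetric])
  show "(\<integral>\<^sup>+X. decoding_cost I P s \<theta> K X \<partial>PiM K (\<lambda>_. \<mu>))
      \<le> 2 * ennreal (\<theta> powr s * exp (real (card I) * (s\<^sup>2 - s * (ln (1 + P) / 2)))) + 4 * ennreal (real (card K) / \<theta>)"
    using main(2) unfolding decoding_cost_def[symmetric] c d .
qed

text \<open>Three uses of \<open>ln x \<le> x - 1\<close>. The term \<open>T / c\<close> is linear
  in \<open>T\<close> and can be averaged over codewords, \<open>c powr s / s\<close> replaces
  \<open>ln c\<close> by a moment, and \<open>1 / T\<close> accounts for negative logarithms. The
  absolute value keeps the divergence integrand nonnegative.\<close>

lemma abs_ln_le: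
  fixes T c s :: real
  assumes "T > 0" "c \<ge> 1" "s > 0"
  shows "\<bar>ln T\<bar> \<le> c powr s / s + T / c + 1 / T"
proof -
  have "ln c \<le> c powr s / s"
  proof -
    have "ln (c powr s) \<le> c powr s - 1" using assms by (intro ln_le_minus_one) auto
    then have "s * ln c \<le> c powr s" using assms by (simp add: ln_powr)
    then show ?thesis using assms by (simp add: field_simps)
  qed
  moreover have "ln T \<le> ln c + T / c - 1"
    using ln_le_minus_one[of "T / c"] assms by (simp add: ln_div)
  moreover have "- ln T \<le> 1 / T - 1"
    using ln_le_minus_one[of "1 / T"] assms by (simp add: ln_div)
  moreover have "0 \<le> c powr s / s" "0 < T / c" "0 < 1 / T" using assms by auto
  ultimately show ?thesis by linarith
qed

text \<open>The sum is at most 4 times its largest term, and \<open>4 powr s \<le> 4\<close>. This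
  separates the moments of the four parts of \<open>cc\<close>.\<close>

lemma powr_sum4_le:
  fixes a b c s :: real
  assumes "0 \<le> a" "0 \<le> b" "0 \<le> c" "0 < s" "s \<le> 1"
  shows "(1 + a + b + c) powr s \<le> 4 * (1 + a powr s + b powr s + c powr s)"
proof -
  define m where "m = Max {1, a, b, c}"
  have m: "1 \<le> m" "a \<le> m" "b \<le> m" "c \<le> m" by (auto simp: m_def)
  have "m \<in> {1, a, b, c}" unfolding m_def by (rule Max_in) auto
  have "(1 + a + b + c) powr s \<le> (4 * m) powr s"
    using m assms by (intro powr_mono2) auto
  also have "\<dots> = 4 powr s * m powr s" using m by (simp add: powr_mult)
  also have "\<dots> \<le> 4 powr 1 * m powr s"
    using assms by (intro mult_right_mono powr_mono) auto
  also have "m powr s \<le> 1 + a powr s + b powr s + c powr s"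
    using \<open>m \<in> {1, a, b, c}\<close> assms by (auto simp: add_nonneg_nonneg)
  finally show ?thesis by simp
qed

section \<open>Densities at the eavesdropper and averages over two codebooks\<close>

definition channel_density :: "nat set \<Rightarrow> real \<Rightarrow> real \<Rightarrow> (nat \<Rightarrow> real) \<Rightarrow> (nat \<Rightarrow> real) \<Rightarrow> (nat \<Rightarrow> real) \<Rightarrow> real" where
  "channel_density I h1 h2 x y z = gd I 1 (\<lambda>i. z i - sqrt h1 * x i - sqrt h2 * y i)"

text \<open>The law at the eavesdropper given both secrets: \<open>u\<close> and \<open>w\<close>
  list the codewords that carry the given secrets, one for each open message.\<close>

definition output_density :: "nat set \<Rightarrow> real \<Rightarrow> real \<Rightarrow> nat \<Rightarrow> nat \<Rightarrow> (nat \<Rightarrow> nat \<Rightarrow> real) \<Rightarrow> (nat \<Rightarrow> nat \<Rightarrow> real) \<Rightarrow> (nat \<Rightarrow> real) \<Rightarrow> real" where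
  "output_density I h1 h2 K1 K2 u w z = (\<Sum>a<K1. \<Sum>b<K2. channel_density I h1 h2 (u a) (w b) z) / (real K1 * real K2)"

lemma gd_shift_measurable [measurable (raw)]:
  assumes "f \<in> M \<rightarrow>\<^sub>M LI I"
  shows "(\<lambda>w. gd I v (f w)) \<in> borel_measurable M"
  by (intro gd_measurable measurable_compose[OF assms component_LI])

lemma channel_density_measurable [measurable (raw)]:
  assumes "f \<in> M \<rightarrow>\<^sub>M LI I" "g \<in> M \<rightarrow>\<^sub>M LI I" "h \<in> M \<rightarrow>\<^sub>M LI I"
  shows "(\<lambda>w. channel_density I h1 h2 (f w) (g w) (h w)) \<in> borel_measurable M"
  unfolding channel_density_def
  by (intro gd_measurable borel_measurable_diff borel_measurable_times borel_measurable_const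
      measurable_compose[OF assms(1) component_LI] measurable_compose[OF assms(2) component_LI] measurable_compose[OF assms(3) component_LI])

lemma channel_density_measurable_z [measurable]: "channel_density I h1 h2 x y \<in> borel_measurable (LI I)"
  unfolding channel_density_def[abs_def] by (intro gd_measurable) measurable

lemma channel_density_pos: "channel_density I h1 h2 x y z > 0"
  unfolding channel_density_def by (intro gd_pos) simp

lemma nn_integral_channel_density: "finite I \<Longrightarrow> (\<integral>\<^sup>+z. ennreal (channel_density I h1 h2 x y z) \<partial>LI I) = 1"
  using nn_integral_gd[of I 1 "\<lambda>i. sqrt h1 * x i + sqrt h2 * y i"]
  by (simp add: channel_density_def diff_diff_eq)

lemma output_density_measurable [measurable]: "output_density I h1 h2 K1 K2 u w \<in> borel_measurable (LI I)"
  unfolding output_density_def[abs_def] by measurable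

lemma output_density_pos: "K1 > 0 \<Longrightarrow> K2 > 0 \<Longrightarrow> output_density I h1 h2 K1 K2 u w z > 0"
  unfolding output_density_def by (intro divide_pos_pos sum_pos channel_density_pos) auto

lemma measurable_apply4:
  assumes F: "(\<lambda>(x, y, x', y'). F x y x' y') \<in> A \<Otimes>\<^sub>M B \<Otimes>\<^sub>M C \<Otimes>\<^sub>M D \<rightarrow>\<^sub>M N"
    and "f \<in> M \<rightarrow>\<^sub>M A" "g \<in> M \<rightarrow>\<^sub>M B" "h \<in> M \<rightarrow>\<^sub>M C" "k \<in> M \<rightarrow>\<^sub>M D"
  shows "(\<lambda>w. F (f w) (g w) (h w) (k w)) \<in> M \<rightarrow>\<^sub>M N"
proof -
  have "(\<lambda>w. (f w, g w, h w, k w)) \<in> M \<rightarrow>\<^sub>M A \<Otimes>\<^sub>M B \<Otimes>\<^sub>M C \<Otimes>\<^sub>M D"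
    using assms(2-) by measurable
  from measurable_compose[OF this F] show ?thesis by simp
qed

text \<open>Codewords with equal index are the same random vector, so coincidences between the two
  pairs lead to four cases. The integrals are ordered so that the first pair, later the transmitted
  one, is outermost and the remaining codewords are averaged given it.\<close>

lemma expectation_two_codebooks:
  fixes F :: "'a \<Rightarrow> 'a \<Rightarrow> 'a \<Rightarrow> 'a \<Rightarrow> ennreal"
  assumes K: "finite K1" "finite K2" and \<mu>: "prob_space \<mu>1" "prob_space \<mu>2"
    and F: "(\<lambda>(x, y, x', y'). F x y x' y') \<in> borel_measurable (\<mu>1 \<Otimes>\<^sub>M \<mu>2 \<Otimes>\<^sub>M \<mu>1 \<Otimes>\<^sub>M \<mu>2)"
    and mn: "m \<in> K1" "m' \<in> K1" "n \<in> K2" "n' \<in> K2"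
  shows "(\<integral>\<^sup>+X. \<integral>\<^sup>+Y. F (X m) (Y n) (X m') (Y n') \<partial>PiM K2 (\<lambda>_. \<mu>2) \<partial>PiM K1 (\<lambda>_. \<mu>1)) =
    (if m = m' then if n = n' then \<integral>\<^sup>+x. \<integral>\<^sup>+y. F x y x y \<partial>\<mu>2 \<partial>\<mu>1
                    else \<integral>\<^sup>+x. \<integral>\<^sup>+y. \<integral>\<^sup>+y'. F x y x y' \<partial>\<mu>2 \<partial>\<mu>2 \<partial>\<mu>1
     else if n = n' then \<integral>\<^sup>+x. \<integral>\<^sup>+y. \<integral>\<^sup>+x'. F x y x' y \<partial>\<mu>1 \<partial>\<mu>2 \<partial>\<mu>1
                    else \<integral>\<^sup>+x. \<integral>\<^sup>+y. \<integral>\<^sup>+x'. \<integral>\<^sup>+y'. F x y x' y' \<partial>\<mu>2 \<partial>\<mu>1 \<partial>\<mu>2 \<partial>\<mu>1)"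
proof -
  interpret m1: prob_space \<mu>1 by fact
  interpret m2: prob_space \<mu>2 by fact
  interpret p: pair_sigma_finite \<mu>1 \<mu>2 by standard
  note Fm[measurable (raw)] = measurable_apply4[OF F]
  have inner: "(\<integral>\<^sup>+Y. F x (Y n) x' (Y n') \<partial>PiM K2 (\<lambda>_. \<mu>2)) =
    (if n = n' then \<integral>\<^sup>+y. F x y x' y \<partial>\<mu>2 else \<integral>\<^sup>+y. \<integral>\<^sup>+y'. F x y x' y' \<partial>\<mu>2 \<partial>\<mu>2)"
    if x: "x \<in> space \<mu>1" "x' \<in> space \<mu>1" for x x'
  proof (cases "n = n'")
    case True
    have "(\<lambda>y. F x y x' y) \<in> borel_measurable \<mu>2" using x by (intro Fm) auto
    then show ?thesis using nn_integral_PiM_one[OF K(2) \<mu>(2) mn(3), of "\<lambda>y. F x y x' y"] True by simp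
  next
    case False
    have "(\<lambda>w. F x (fst w) x' (snd w)) \<in> borel_measurable (\<mu>2 \<Otimes>\<^sub>M \<mu>2)" using x by (intro Fm) auto
    then have "(\<lambda>(y, y'). F x y x' y') \<in> borel_measurable (\<mu>2 \<Otimes>\<^sub>M \<mu>2)" by (simp add: case_prod_beta')
    then show ?thesis using nn_integral_PiM_two[OF K(2) \<mu>(2) mn(3,4) False, of "\<lambda>y y'. F x y x' y'"] False by simp
  qed
  define G where "G x x' = (if n = n' then \<integral>\<^sup>+y. F x y x' y \<partial>\<mu>2 else \<integral>\<^sup>+y. \<integral>\<^sup>+y'. F x y x' y' \<partial>\<mu>2 \<partial>\<mu>2)" for x x'
  have Xs: "X m \<in> space \<mu>1" "X m' \<in> space \<mu>1" if "X \<in> space (PiM K1 (\<lambda>_. \<mu>1))" for X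
    using that mn by (auto simp: space_PiM PiE_def)
  have "(\<integral>\<^sup>+X. \<integral>\<^sup>+Y. F (X m) (Y n) (X m') (Y n') \<partial>PiM K2 (\<lambda>_. \<mu>2) \<partial>PiM K1 (\<lambda>_. \<mu>1))
    = (\<integral>\<^sup>+X. G (X m) (X m') \<partial>PiM K1 (\<lambda>_. \<mu>1))"
    unfolding G_def using Xs by (intro nn_integral_cong inner) auto
  also have "\<dots> = (if m = m' then \<integral>\<^sup>+x. G x x \<partial>\<mu>1 else \<integral>\<^sup>+x. \<integral>\<^sup>+x'. G x x' \<partial>\<mu>1 \<partial>\<mu>1)"
  proof (cases "m = m'")
    case True
    have "(\<lambda>x. G x x) \<in> borel_measurable \<mu>1" unfolding G_def by (cases "n = n'") simp_all
    then show ?thesis using nn_integral_PiM_one[OF K(1) \<mu>(1) mn(1), of "\<lambda>x. G x x"] True by simp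
  next
    case False
    have "(\<lambda>(x, x'). G x x') \<in> borel_measurable (\<mu>1 \<Otimes>\<^sub>M \<mu>1)" unfolding G_def by (cases "n = n'") simp_all
    then show ?thesis using nn_integral_PiM_two[OF K(1) \<mu>(1) mn(1,2) False, of "\<lambda>x x'. G x x'"] False by simp
  qed
  also have "(\<integral>\<^sup>+x. \<integral>\<^sup>+x'. G x x' \<partial>\<mu>1 \<partial>\<mu>1) = (if n = n' then \<integral>\<^sup>+x. \<integral>\<^sup>+y. \<integral>\<^sup>+x'. F x y x' y \<partial>\<mu>1 \<partial>\<mu>2 \<partial>\<mu>1
                    else \<integral>\<^sup>+x. \<integral>\<^sup>+y. \<integral>\<^sup>+x'. \<integral>\<^sup>+y'. F x y x' y' \<partial>\<mu>2 \<partial>\<mu>1 \<partial>\<mu>2 \<partial>\<mu>1)"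
  proof (cases "n = n'")
    case True
    have "(\<integral>\<^sup>+x'. \<integral>\<^sup>+y. F x y x' y \<partial>\<mu>2 \<partial>\<mu>1) = (\<integral>\<^sup>+y. \<integral>\<^sup>+x'. F x y x' y \<partial>\<mu>1 \<partial>\<mu>2)" if x: "x \<in> space \<mu>1" for x
      by (rule p.Fubini'[symmetric]) (use x in simp)
    then show ?thesis unfolding G_def using True by (simp cong: nn_integral_cong)
  next
    case False
    have "(\<integral>\<^sup>+x'. \<integral>\<^sup>+y. \<integral>\<^sup>+y'. F x y x' y' \<partial>\<mu>2 \<partial>\<mu>2 \<partial>\<mu>1) = (\<integral>\<^sup>+y. \<integral>\<^sup>+x'. \<integral>\<^sup>+y'. F x y x' y' \<partial>\<mu>2 \<partial>\<mu>1 \<partial>\<mu>2)" if x: "x \<in> space \<mu>1" for x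
      by (rule p.Fubini'[symmetric]) (use x in simp)
    then show ?thesis unfolding G_def using False by (simp cong: nn_integral_cong)
  qed
  finally show ?thesis unfolding G_def by simp
qed

subsection \<open>Soft covering of the multiple-access wiretap channel\<close>

lemma gd_diff_measurable:
  assumes "f \<in> M \<rightarrow>\<^sub>M LI I" "g \<in> M \<rightarrow>\<^sub>M LI I"
  shows "(\<lambda>w. gd I v (\<lambda>i. g w i - c * f w i)) \<in> borel_measurable M"
  by (intro gd_measurable borel_measurable_diff borel_measurable_times borel_measurable_const
      measurable_compose[OF assms(1) component_LI] measurable_compose[OF assms(2) component_LI])

lemma ennreal_double_average:
  fixes A :: "nat \<Rightarrow> nat \<Rightarrow> real" and B :: "nat \<Rightarrow> nat \<Rightarrow> nat \<Rightarrow> nat \<Rightarrow> real"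
  assumes "\<And>a b. 0 \<le> A a b" "\<And>a b a' b'. 0 \<le> B a b a' b'" "0 \<le> c"
  shows "ennreal (\<Sum>a\<in>S. \<Sum>b\<in>T. c * (A a b + (\<Sum>a'\<in>S. \<Sum>b'\<in>T. c * B a b a' b'))) =
    (\<Sum>a\<in>S. \<Sum>b\<in>T. ennreal c * (ennreal (A a b) + (\<Sum>a'\<in>S. \<Sum>b'\<in>T. ennreal c * ennreal (B a b a' b'))))"
  using assms
  by (simp add: ennreal_mult[symmetric] ennreal_plus[symmetric] sum_nonneg del: ennreal_plus)

lemma double_average_nonneg:
  fixes A :: "nat \<Rightarrow> nat \<Rightarrow> real" and B :: "nat \<Rightarrow> nat \<Rightarrow> nat \<Rightarrow> nat \<Rightarrow> real"
  assumes "\<And>a b. 0 \<le> A a b" "\<And>a b a' b'. 0 \<le> B a b a' b'" "0 \<le> c"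
  shows "0 \<le> (\<Sum>a\<in>S. \<Sum>b\<in>T. c * (A a b + (\<Sum>a'\<in>S. \<Sum>b'\<in>T. c * B a b a' b')))"
  using assms by (intro sum_nonneg mult_nonneg_nonneg add_nonneg_nonneg)

text \<open>For codewords \<open>x\<close>, \<open>y\<close> sent to the eavesdropper, \<open>t12\<close> is their own share of the ratio of the
  codebook output density to \<open>q\<close>; \<open>t1\<close> and \<open>t2\<close> are the averages of that ratio over the pairs of codewords
  that share only \<open>x\<close> or only \<open>y\<close>, and the remaining pairs contribute \<open>1\<close>.\<close>
locale mac_cover =
  fixes I :: "nat set" and P1 P2 h1 h2 s :: real and K1 K2 :: nat
  assumes I: "finite I" and P: "P1 > 0" "P2 > 0" and h: "h1 \<ge> 0" "h2 \<ge> 0"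
    and s: "0 < s" "s\<^sup>2 \<le> 1 / 2" and K: "K1 > 0" "K2 > 0"
begin

abbreviation "k \<equiv> 1 + h1 * P1 + h2 * P2"
abbreviation "ph \<equiv> channel_density I h1 h2"
abbreviation "q \<equiv> gd I k"
text \<open>\<open>g1\<close> and \<open>g2\<close> are the densities at the eavesdropper when one
  codeword is known and the other acts as Gaussian noise.\<close>

definition "g1 y z = gd I (1 + h1 * P1) (\<lambda>i. z i - sqrt h2 * y i)"
definition "g2 x z = gd I (1 + h2 * P2) (\<lambda>i. z i - sqrt h1 * x i)"
definition "t12 x y z = ph x y z / (real K1 * real K2 * q z)"
definition "t1 x z = g2 x z / (real K1 * q z)"
definition "t2 y z = g1 y z / (real K2 * q z)"
definition "cc x y z = 1 + t12 x y z + t1 x z + t2 y z"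

lemma pos: "1 + h1 * P1 > 0" "1 + h2 * P2 > 0" "k > 0"
proof -
  have "h1 * P1 \<ge> 0" "h2 * P2 \<ge> 0" using P h by auto
  then show "1 + h1 * P1 > 0" "1 + h2 * P2 > 0" "k > 0" by linarith+
qed

lemma dens_pos: "q z > 0" "g1 y z > 0" "g2 x z > 0" "t12 x y z > 0" "t1 x z > 0" "t2 y z > 0" "cc x y z \<ge> 1" "cc x y z > 0"
proof -
  show *: "q z > 0" "g1 y z > 0" "g2 x z > 0" for x y
    using pos by (simp_all add: g1_def g2_def gd_pos)
  show **: "t12 x y z > 0" "t1 x z > 0" "t2 y z > 0"
    using * K channel_density_pos by (simp_all add: t12_def t1_def t2_def)
  then show "cc x y z \<ge> 1" "cc x y z > 0" by (simp_all add: cc_def)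
qed

lemma meas [measurable (raw)]:
  assumes "f \<in> M \<rightarrow>\<^sub>M LI I" "g \<in> M \<rightarrow>\<^sub>M LI I"
  shows "(\<lambda>w. g1 (f w) (g w)) \<in> borel_measurable M" "(\<lambda>w. g2 (f w) (g w)) \<in> borel_measurable M"
    "(\<lambda>w. t1 (f w) (g w)) \<in> borel_measurable M" "(\<lambda>w. t2 (f w) (g w)) \<in> borel_measurable M"
proof -
  show *[measurable]: "(\<lambda>w. g1 (f w) (g w)) \<in> borel_measurable M" "(\<lambda>w. g2 (f w) (g w)) \<in> borel_measurable M"
    unfolding g1_def g2_def using assms by (simp_all add: gd_diff_measurable)
  have [measurable]: "(\<lambda>w. q (g w)) \<in> borel_measurable M" using assms by measurable
  show "(\<lambda>w. t1 (f w) (g w)) \<in> borel_measurable M" "(\<lambda>w. t2 (f w) (g w)) \<in> borel_measurable M"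
    unfolding t1_def t2_def by measurable
qed

lemma meas3 [measurable (raw)]:
  assumes [measurable]: "e \<in> M \<rightarrow>\<^sub>M LI I" "f \<in> M \<rightarrow>\<^sub>M LI I" "g \<in> M \<rightarrow>\<^sub>M LI I"
  shows "(\<lambda>w. t12 (e w) (f w) (g w)) \<in> borel_measurable M" "(\<lambda>w. cc (e w) (f w) (g w)) \<in> borel_measurable M"
proof -
  show *[measurable]: "(\<lambda>w. t12 (e w) (f w) (g w)) \<in> borel_measurable M"
    unfolding t12_def by measurable
  show "(\<lambda>w. cc (e w) (f w) (g w)) \<in> borel_measurable M"
    unfolding cc_def by measurable
qed

definition "fB x y = (\<integral>\<^sup>+z. ennreal (ph x y z * (cc x y z powr s / s)) \<partial>LI I)"
definition "fC x y x' y' = (\<integral>\<^sup>+z. ennreal (ph x y z * ph x' y' z / (q z * cc x y z)) \<partial>LI I)"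

text \<open>The three terms of \<open>abs_ln_le\<close> after integration: the leading 1 is the mass
  of \<open>q\<close> and comes from \<open>1 / T\<close>, \<open>fB\<close> comes from
  \<open>c powr s / s\<close>, and \<open>fC\<close> from \<open>T / c\<close> with \<open>T\<close>
  expanded into the codeword pairs.\<close>

definition "cost u w = 1 + (\<Sum>a<K1. \<Sum>b<K2. ennreal (1 / (real K1 * real K2)) *
   (fB (u a) (w b) + (\<Sum>a'<K1. \<Sum>b'<K2. ennreal (1 / (real K1 * real K2)) * fC (u a) (w b) (u a') (w b'))))"

text \<open>Since \<open>ln T \<le> ln c + T / c - 1\<close> for every \<open>c\<close>, the expectation over the remaining codewords
  may be taken inside the logarithm; \<^const>\<open>cc\<close> is the conditional expectation of the ratio.\<close>
lemma divergence_le_cost: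
  "(\<integral>\<^sup>+z. ennreal (output_density I h1 h2 K1 K2 u w z * \<bar>ln (output_density I h1 h2 K1 K2 u w z / q z)\<bar>) \<partial>LI I) \<le> cost u w"
proof -
  define N where "N = real K1 * real K2"
  have N: "N > 0" using K by (simp add: N_def)
  then have N': "0 \<le> 1 / N" by simp
  define p where "p = output_density I h1 h2 K1 K2 u w"
  have p: "p z > 0" for z unfolding p_def using K by (rule output_density_pos)
  have p_eq: "p z = (\<Sum>a<K1. \<Sum>b<K2. ph (u a) (w b) z) / N" for z by (simp add: p_def output_density_def N_def)
  have ph0: "0 \<le> ph x y z" for x y z using channel_density_pos less_imp_le by blast
  let ?c = "\<lambda>a b z. cc (u a) (w b) z"
  let ?ph = "\<lambda>a b z. ph (u a) (w b) z"
  have pt: "ennreal (p z * \<bar>ln (p z / q z)\<bar>) \<le> ennreal (q z) + (\<Sum>a<K1. \<Sum>b<K2. ennreal (1 / N) *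
     (ennreal (?ph a b z * (?c a b z powr s / s)) + (\<Sum>a'<K1. \<Sum>b'<K2. ennreal (1 / N) * ennreal (?ph a b z * ?ph a' b' z / (q z * ?c a b z)))))" for z
  proof -
    have T: "p z / q z > 0" using p dens_pos(1) by simp
    have "p z * \<bar>ln (p z / q z)\<bar> = (\<Sum>a<K1. \<Sum>b<K2. (1 / N) * (?ph a b z * \<bar>ln (p z / q z)\<bar>))"
      by (simp add: p_eq[of z] sum_distrib_right[symmetric] sum_distrib_left[symmetric] sum_divide_distrib[symmetric] flip: sum_divide_distrib)
    also have "\<dots> \<le> (\<Sum>a<K1. \<Sum>b<K2. (1 / N) * (?ph a b z * (?c a b z powr s / s + (p z / q z) / ?c a b z + 1 / (p z / q z))))"
      using N ph0 abs_ln_le[OF T dens_pos(7) s(1)] by (intro sum_mono mult_left_mono) auto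
    also have "\<dots> = (\<Sum>a<K1. \<Sum>b<K2. (1 / N) * (?ph a b z * (?c a b z powr s / s) + ?ph a b z * ((p z / q z) / ?c a b z)))
        + (\<Sum>a<K1. \<Sum>b<K2. (1 / N) * (?ph a b z * (1 / (p z / q z))))"
      by (simp only: sum.distrib[symmetric] distrib_left add.assoc)
    also have "(\<Sum>a<K1. \<Sum>b<K2. (1 / N) * (?ph a b z * (1 / (p z / q z)))) = p z * (1 / (p z / q z))"
      by (simp add: p_eq[of z] sum_distrib_right[symmetric] sum_distrib_left[symmetric] flip: sum_divide_distrib)
    \<comment> \<open>The term \<open>1 / T\<close>, the price of the absolute value, averages to
      the reference itself and so contributes mass 1.\<close>
    also have "p z * (1 / (p z / q z)) = q z" using p[of z] by simp
    also have "(\<Sum>a<K1. \<Sum>b<K2. (1 / N) * (?ph a b z * (?c a b z powr s / s) + ?ph a b z * ((p z / q z) / ?c a b z))) =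
      (\<Sum>a<K1. \<Sum>b<K2. (1 / N) * (?ph a b z * (?c a b z powr s / s) + (\<Sum>a'<K1. \<Sum>b'<K2. (1 / N) * (?ph a b z * ?ph a' b' z / (q z * ?c a b z)))))"
    proof (intro sum.cong refl arg_cong2[where f="(*)"] arg_cong2[where f="(+)"])
      fix a b
      have "?ph a b z * ((p z / q z) / ?c a b z) = ?ph a b z / (q z * ?c a b z) * p z" by simp
      also have "\<dots> = (\<Sum>a'<K1. \<Sum>b'<K2. (1 / N) * (?ph a b z * ?ph a' b' z / (q z * ?c a b z)))"
        unfolding p_eq[of z] by (simp add: sum_distrib_left sum_divide_distrib mult_ac)
      finally show "?ph a b z * ((p z / q z) / ?c a b z) = (\<Sum>a'<K1. \<Sum>b'<K2. (1 / N) * (?ph a b z * ?ph a' b' z / (q z * ?c a b z)))" .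
    qed
    finally have le: "p z * \<bar>ln (p z / q z)\<bar> \<le> (\<Sum>a<K1. \<Sum>b<K2. (1 / N) * (?ph a b z * (?c a b z powr s / s) +
       (\<Sum>a'<K1. \<Sum>b'<K2. (1 / N) * (?ph a b z * ?ph a' b' z / (q z * ?c a b z))))) + q z" .
    have nn1: "0 \<le> ?ph a b z * (?c a b z powr s / s)" for a b using ph0 s by simp
    have nn2: "0 \<le> ?ph a b z * ?ph a' b' z / (q z * ?c a b z)" for a b a' b'
      using ph0 dens_pos(1,8)[THEN less_imp_le] by simp
    note ennreal_leI[OF le]
    also note ennreal_plus[OF double_average_nonneg[OF nn1 nn2 N'] less_imp_le[OF dens_pos(1)]]
    also note ennreal_double_average[OF nn1 nn2 N']
    finally show ?thesis by (simp only: add.commute)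
  qed
  have "(\<integral>\<^sup>+z. ennreal (p z * \<bar>ln (p z / q z)\<bar>) \<partial>LI I) \<le> (\<integral>\<^sup>+z. ennreal (q z) + (\<Sum>a<K1. \<Sum>b<K2. ennreal (1 / N) *
     (ennreal (?ph a b z * (?c a b z powr s / s)) + (\<Sum>a'<K1. \<Sum>b'<K2. ennreal (1 / N) * ennreal (?ph a b z * ?ph a' b' z / (q z * ?c a b z))))) \<partial>LI I)"
    by (intro nn_integral_mono pt)
  also have "\<dots> = cost u w"
  proof -
    have [measurable]: "ph x y \<in> borel_measurable (LI I)" "q \<in> borel_measurable (LI I)" "(\<lambda>z. cc x y z) \<in> borel_measurable (LI I)" for x y
    proof -
      have "cc x y \<in> borel_measurable (LI I)"
        unfolding cc_def[abs_def] t12_def t1_def t2_def g1_def g2_def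
        using component_LI by (intro borel_measurable_add borel_measurable_divide borel_measurable_times gd_measurable) measurable
      then show "ph x y \<in> borel_measurable (LI I)" "q \<in> borel_measurable (LI I)" "(\<lambda>z. cc x y z) \<in> borel_measurable (LI I)"
        by measurable
    qed
    show ?thesis
      unfolding cost_def fB_def fC_def N_def[symmetric]
      using nn_integral_gd0[OF I pos(3)]
      by (simp add: nn_integral_add nn_integral_sum nn_integral_cmult)
  qed
  finally show ?thesis unfolding p_def .
qed

end

text \<open>Of the codeword laws only their domination by twice a Gaussian enters. The rate
  conditions compare the open messages with the mutual informations between the eavesdropper and
  both inputs, the first input and the second input, the other input acting as noise in the last
  two; the margin per channel use equals the order \<open>s\<close> of the moments.\<close>

locale mac_cover_codebooks = mac_cover +
  fixes \<mu>1 \<mu>2 :: "(nat \<Rightarrow> real) measure"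
  assumes \<mu>: "prob_space \<mu>1" "prob_space \<mu>2" and sets: "sets \<mu>1 = sets (LI I)" "sets \<mu>2 = sets (LI I)"
    and le1: "\<And>f. f \<in> borel_measurable (LI I) \<Longrightarrow> (\<integral>\<^sup>+x. f x \<partial>\<mu>1) \<le> 2 * (\<integral>\<^sup>+x. ennreal (gd I P1 x) * f x \<partial>LI I)"
    and le2: "\<And>f. f \<in> borel_measurable (LI I) \<Longrightarrow> (\<integral>\<^sup>+x. f x \<partial>\<mu>2) \<le> 2 * (\<integral>\<^sup>+x. ennreal (gd I P2 x) * f x \<partial>LI I)"
    and rates: "real (card I) * (ln k / 2 + s) \<le> ln (real K1 * real K2)"
      "real (card I) * (ln (k / (1 + h2 * P2)) / 2 + s) \<le> ln (real K1)"
      "real (card I) * (ln (k / (1 + h1 * P1)) / 2 + s) \<le> ln (real K2)"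
begin

sublocale L: sigma_finite_measure "LI I" using I by (rule sigma_finite_LI)
sublocale \<mu>1: prob_space \<mu>1 by (rule \<mu>)
sublocale \<mu>2: prob_space \<mu>2 by (rule \<mu>)

lemma spaces: "space \<mu>1 = space (LI I)" "space \<mu>2 = space (LI I)"
  using sets by (auto dest: sets_eq_imp_space_eq)

lemma conv_ph2: "(\<integral>\<^sup>+y. ennreal (gd I P2 y * ph x y z) \<partial>LI I) = ennreal (g2 x z)"
  using conv_gd[OF I P(2) _ h(2), of 1 "\<lambda>i. z i - sqrt h1 * x i"] by (simp add: channel_density_def g2_def)

lemma conv_ph1: "(\<integral>\<^sup>+x. ennreal (gd I P1 x * ph x y z) \<partial>LI I) = ennreal (g1 y z)"
proof -
  have "ph x y z = gd I 1 (\<lambda>i. (z i - sqrt h2 * y i) - sqrt h1 * x i)" for x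
    by (simp add: channel_density_def algebra_simps)
  then show ?thesis
    using conv_gd[OF I P(1) _ h(1), of 1 "\<lambda>i. z i - sqrt h2 * y i"] by (simp add: g1_def)
qed

lemma conv_g2: "(\<integral>\<^sup>+x. ennreal (gd I P1 x * g2 x z) \<partial>LI I) = ennreal (q z)"
  using conv_gd[OF I P(1) pos(2) h(1), of z] by (simp add: g2_def add_ac)

text \<open>Domination by the Gaussian, Fubini and the convolution \<open>conv\<close>. The weight
  \<open>F\<close> must not contain the averaged codeword; this is why \<open>cc\<close> is built
  from the transmitted pair only.\<close>

lemma average_channel_density:
  assumes [measurable]: "F \<in> borel_measurable (LI I)" and nn: "\<And>z. 0 \<le> F z"
    and conv: "\<And>z. (\<integral>\<^sup>+y. ennreal (gd I v y * G y z) \<partial>LI I) = ennreal (H z)"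
    and Gm[measurable]: "(\<lambda>(y, z). G y z) \<in> borel_measurable (LI I \<Otimes>\<^sub>M LI I)" and Gn: "\<And>y z. 0 \<le> G y z"
    and le: "\<And>f. f \<in> borel_measurable (LI I) \<Longrightarrow> (\<integral>\<^sup>+x. f x \<partial>\<nu>) \<le> 2 * (\<integral>\<^sup>+x. ennreal (gd I v x) * f x \<partial>LI I)"
    and Hn: "\<And>z. 0 \<le> H z"
  shows "(\<integral>\<^sup>+y. \<integral>\<^sup>+z. ennreal (F z * G y z) \<partial>LI I \<partial>\<nu>) \<le> 2 * (\<integral>\<^sup>+z. ennreal (F z * H z) \<partial>LI I)"
proof -
  have "(\<integral>\<^sup>+y. \<integral>\<^sup>+z. ennreal (F z * G y z) \<partial>LI I \<partial>\<nu>) \<le> 2 * (\<integral>\<^sup>+y. ennreal (gd I v y) * (\<integral>\<^sup>+z. ennreal (F z * G y z) \<partial>LI I) \<partial>LI I)"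
    by (rule le) measurable
  also have "(\<integral>\<^sup>+y. ennreal (gd I v y) * (\<integral>\<^sup>+z. ennreal (F z * G y z) \<partial>LI I) \<partial>LI I)
    = (\<integral>\<^sup>+y. \<integral>\<^sup>+z. ennreal (gd I v y) * ennreal (F z * G y z) \<partial>LI I \<partial>LI I)"
    by (intro nn_integral_cong nn_integral_cmult[symmetric]) measurable
  also have "\<dots> = (\<integral>\<^sup>+z. \<integral>\<^sup>+y. ennreal (gd I v y) * ennreal (F z * G y z) \<partial>LI I \<partial>LI I)"
    by (rule Fubini_LI) (use I in measurable)
  also have "\<dots> = (\<integral>\<^sup>+z. ennreal (F z) * (\<integral>\<^sup>+y. ennreal (gd I v y * G y z) \<partial>LI I) \<partial>LI I)"
  proof (intro nn_integral_cong)
    fix z assume z: "z \<in> space (LI I)"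
    have [measurable]: "(\<lambda>y. G y z) \<in> borel_measurable (LI I)"
      using measurable_compose[OF measurable_Pair1'[OF z] Gm]
        measurable_Pair[OF measurable_ident measurable_const[OF z], THEN measurable_compose, OF Gm] by simp
    have "(\<integral>\<^sup>+y. ennreal (gd I v y) * ennreal (F z * G y z) \<partial>LI I) = (\<integral>\<^sup>+y. ennreal (F z) * ennreal (gd I v y * G y z) \<partial>LI I)"
      using nn Gn by (simp add: ennreal_mult[symmetric] mult_ac)
    also have "\<dots> = ennreal (F z) * (\<integral>\<^sup>+y. ennreal (gd I v y * G y z) \<partial>LI I)"
      by (rule nn_integral_cmult) measurable
    finally show "(\<integral>\<^sup>+y. ennreal (gd I v y) * ennreal (F z * G y z) \<partial>LI I) = ennreal (F z) * (\<integral>\<^sup>+y. ennreal (gd I v y * G y z) \<partial>LI I)" .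
  qed
  also have "\<dots> = (\<integral>\<^sup>+z. ennreal (F z * H z) \<partial>LI I)"
    using nn Hn by (simp add: conv ennreal_mult)
  finally show ?thesis .
qed

end

lemma powr_scale: "0 \<le> a \<Longrightarrow> 0 < N \<Longrightarrow> (a * (1 / N)) powr s = a powr s * N powr (- s :: real)"
  by (simp add: powr_divide powr_minus_divide)

context mac_cover
begin

lemma fC_eq: "fC x y x' y' = (\<integral>\<^sup>+z. ennreal (ph x y z / (q z * cc x y z) * ph x' y' z) \<partial>LI I)"
  unfolding fC_def by (simp add: mult.commute)

lemma ph_nonneg [simp]: "0 \<le> ph x y z"
  using channel_density_pos less_imp_le by blast

lemma F_nonneg: "0 \<le> ph x y z / (q z * cc x y z)"
  using dens_pos(1,8)[THEN less_imp_le] by simp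

text \<open>Dividing by \<open>cc\<close> caps every ratio that occurs among its summands: the
  integrand is at most \<open>r\<close> times the channel density, which has mass 1. The four parts
  of \<open>cc\<close> are chosen to match the four kinds of coincidence of codeword pairs.\<close>

lemma weighted_le:
  assumes r: "r > 0" and f: "\<And>z. f z / (r * q z) \<le> cc x y z"
  shows "(\<integral>\<^sup>+z. ennreal (ph x y z / (q z * cc x y z) * f z) \<partial>LI I) \<le> ennreal r"
proof -
  have "(\<integral>\<^sup>+z. ennreal (ph x y z / (q z * cc x y z) * f z) \<partial>LI I) \<le> (\<integral>\<^sup>+z. ennreal r * ennreal (ph x y z) \<partial>LI I)"
  proof (intro nn_integral_mono)
    fix z
    have "f z \<le> cc x y z * (r * q z)"
      using f[of z] r dens_pos(1)[of z] by (simp add: pos_divide_le_eq)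
    then have "ph x y z / (q z * cc x y z) * f z \<le> ph x y z / (q z * cc x y z) * (cc x y z * (r * q z))"
      by (intro mult_left_mono F_nonneg)
    also have "\<dots> = r * ph x y z" using dens_pos(1)[of z] dens_pos(8)[of x y z] by simp
    finally show "ennreal (ph x y z / (q z * cc x y z) * f z) \<le> ennreal r * ennreal (ph x y z)"
      using r by (simp add: ennreal_mult[symmetric] ennreal_leI)
  qed
  also have "\<dots> = ennreal r"
    using nn_integral_channel_density[OF I] by (subst nn_integral_cmult) auto
  finally show ?thesis .
qed

lemma cc_ge: "t12 x y z \<le> cc x y z" "t1 x z \<le> cc x y z" "t2 y z \<le> cc x y z"
  using dens_pos(4)[of x y z] dens_pos(5)[of x z] dens_pos(6)[of y z] by (simp_all add: cc_def)

lemma fC_same: "fC x y x y \<le> ennreal (real K1 * real K2)"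
  unfolding fC_eq using K cc_ge(1) by (intro weighted_le) (auto simp: t12_def)

text \<open>The rate margin \<open>s\<close>, multiplied by the moment order \<open>s\<close>,
  exactly pays for the second-order term \<open>s^2\<close> of the moment bound.\<close>

lemma rate_powr:
  assumes "n * (J + s) \<le> ln M" "M > 0"
  shows "M powr (- s) * exp (n * (s * J + s\<^sup>2)) \<le> 1"
proof -
  have "n * (s * J + s\<^sup>2) = s * (n * (J + s))" by (simp add: algebra_simps power2_eq_square)
  also have "\<dots> \<le> s * ln M" using s assms by (intro mult_left_mono) auto
  finally show ?thesis using assms by (simp add: powr_def exp_add[symmetric])
qed

lemma fB_le:
  assumes x[measurable]: "x \<in> space (LI I)" "y \<in> space (LI I)"
  shows "fB x y \<le> ennreal (4 / s) * (1 + (\<integral>\<^sup>+z. ennreal (t12 x y z powr s * ph x y z) \<partial>LI I)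
   + (\<integral>\<^sup>+z. ennreal (t1 x z powr s * ph x y z) \<partial>LI I) + (\<integral>\<^sup>+z. ennreal (t2 y z powr s * ph x y z) \<partial>LI I))"
proof -
  have s1: "s \<le> 1"
    using s abs_square_le_1[of s] by auto
  have [measurable]: "(\<lambda>z. t12 x y z) \<in> borel_measurable (LI I)" "(\<lambda>z. t1 x z) \<in> borel_measurable (LI I)" "(\<lambda>z. t2 y z) \<in> borel_measurable (LI I)"
    using x by measurable
  have "fB x y \<le> (\<integral>\<^sup>+z. ennreal (4 / s) * (ennreal (ph x y z) + ennreal (t12 x y z powr s * ph x y z) + ennreal (t1 x z powr s * ph x y z) + ennreal (t2 y z powr s * ph x y z)) \<partial>LI I)"
    unfolding fB_def
  proof (intro nn_integral_mono)
    fix z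
    have "cc x y z powr s \<le> 4 * (1 + t12 x y z powr s + t1 x z powr s + t2 y z powr s)"
      unfolding cc_def using dens_pos(4,5,6)[THEN less_imp_le] s s1 by (intro powr_sum4_le) auto
    then have "ph x y z * (cc x y z powr s / s) \<le> ph x y z * (4 * (1 + t12 x y z powr s + t1 x z powr s + t2 y z powr s) / s)"
      using s by (intro mult_left_mono divide_right_mono) auto
    also have "\<dots> = (4 / s) * (ph x y z + t12 x y z powr s * ph x y z + t1 x z powr s * ph x y z + t2 y z powr s * ph x y z)"
      by (simp add: algebra_simps add_divide_distrib)
    finally show "ennreal (ph x y z * (cc x y z powr s / s)) \<le> ennreal (4 / s) * (ennreal (ph x y z) + ennreal (t12 x y z powr s * ph x y z) + ennreal (t1 x z powr s * ph x y z) + ennreal (t2 y z powr s * ph x y z))"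
      using s by (simp add: ennreal_mult[symmetric] ennreal_plus[symmetric] ennreal_leI del: ennreal_plus)
  qed
  also have "\<dots> = ennreal (4 / s) * (1 + (\<integral>\<^sup>+z. ennreal (t12 x y z powr s * ph x y z) \<partial>LI I)
   + (\<integral>\<^sup>+z. ennreal (t1 x z powr s * ph x y z) \<partial>LI I) + (\<integral>\<^sup>+z. ennreal (t2 y z powr s * ph x y z) \<partial>LI I))"
    using nn_integral_channel_density[OF I, of h1 h2 x y]
    by (simp add: nn_integral_cmult nn_integral_add)
  finally show ?thesis .
qed

end

context mac_cover_codebooks
begin

lemma channel_density_pair_measurable: "x \<in> space (LI I) \<Longrightarrow> (\<lambda>(y, z). ph x y z) \<in> borel_measurable (LI I \<Otimes>\<^sub>M LI I)"
  "y \<in> space (LI I) \<Longrightarrow> (\<lambda>(x, z). ph x y z) \<in> borel_measurable (LI I \<Otimes>\<^sub>M LI I)"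
  by measurable

lemma F_meas: "x \<in> space (LI I) \<Longrightarrow> y \<in> space (LI I) \<Longrightarrow> (\<lambda>z. ph x y z / (q z * cc x y z)) \<in> borel_measurable (LI I)"
  by measurable

text \<open>Averaging the second codeword replaces the likelihood of the other pair by
  \<open>g2\<close>, which depends on the first codeword only.\<close>

lemma fC_measurable_input2: 
  assumes "x \<in> space (LI I)" "y \<in> space (LI I)" "x' \<in> space (LI I)"
  shows "(\<integral>\<^sup>+y'. fC x y x' y' \<partial>\<mu>2) \<le> 2 * (\<integral>\<^sup>+z. ennreal (ph x y z / (q z * cc x y z) * g2 x' z) \<partial>LI I)"
  unfolding fC_eq
  by (rule average_channel_density[OF F_meas[OF assms(1,2)] F_nonneg conv_ph2 channel_density_pair_measurable(1)[OF assms(3)] ph_nonneg le2])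
     (use dens_pos(3) less_imp_le in blast)+

text \<open>Here the summand \<open>t1\<close> of \<open>cc\<close> applies, because the average
  gives \<open>g2\<close>. The factor \<open>K1\<close> will disappear again, since only a fraction
  \<open>1 / K1\<close> of all pairs share the first codeword.\<close>

lemma fC_12:
  assumes "x \<in> space (LI I)" "y \<in> space (LI I)"
  shows "(\<integral>\<^sup>+y'. fC x y x y' \<partial>\<mu>2) \<le> ennreal (2 * real K1)"
proof -
  have "(\<integral>\<^sup>+z. ennreal (ph x y z / (q z * cc x y z) * g2 x z) \<partial>LI I) \<le> ennreal (real K1)"
    using K cc_ge(2) by (intro weighted_le) (auto simp: t1_def)
  then have "2 * (\<integral>\<^sup>+z. ennreal (ph x y z / (q z * cc x y z) * g2 x z) \<partial>LI I) \<le> 2 * ennreal (real K1)"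
    by (intro mult_left_mono) auto
  then show ?thesis
    using fC_measurable_input2[OF assms assms(1)] by (simp add: ennreal_mult)
qed

lemma fC_21:
  assumes "x \<in> space (LI I)" "y \<in> space (LI I)"
  shows "(\<integral>\<^sup>+x'. fC x y x' y \<partial>\<mu>1) \<le> ennreal (2 * real K2)"
proof -
  have "(\<integral>\<^sup>+z. ennreal (ph x y z / (q z * cc x y z) * g1 y z) \<partial>LI I) \<le> ennreal (real K2)"
    using K cc_ge(3) by (intro weighted_le) (auto simp: t2_def)
  then have "2 * (\<integral>\<^sup>+z. ennreal (ph x y z / (q z * cc x y z) * g1 y z) \<partial>LI I) \<le> 2 * ennreal (real K2)"
    by (intro mult_left_mono) auto
  moreover have "(\<integral>\<^sup>+x'. fC x y x' y \<partial>\<mu>1) \<le> 2 * (\<integral>\<^sup>+z. ennreal (ph x y z / (q z * cc x y z) * g1 y z) \<partial>LI I)"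
    unfolding fC_eq
    by (rule average_channel_density[OF F_meas[OF assms(1,2)] F_nonneg conv_ph1 channel_density_pair_measurable(2)[OF assms(2)] ph_nonneg le1])
     (use dens_pos(2) less_imp_le in blast)+
  ultimately show ?thesis by (simp add: ennreal_mult)
qed

text \<open>Pairs without a common codeword are covered by the summand 1 of \<open>cc\<close>, since
  the two averages together turn the likelihood of the other pair into \<open>q\<close>. Each
  average costs a factor 2.\<close>

lemma fC_22:
  assumes "x \<in> space (LI I)" "y \<in> space (LI I)"
  shows "(\<integral>\<^sup>+x'. \<integral>\<^sup>+y'. fC x y x' y' \<partial>\<mu>2 \<partial>\<mu>1) \<le> ennreal 4"
proof -
  have m: "(\<lambda>(x, z). g2 x z) \<in> borel_measurable (LI I \<Otimes>\<^sub>M LI I)" by measurable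
  have [measurable]: "(\<lambda>(x', z). ph x y z / (q z * cc x y z) * g2 x' z) \<in> borel_measurable (LI I \<Otimes>\<^sub>M LI I)"
    using assms by measurable
  have m': "(\<lambda>x'. \<integral>\<^sup>+z. ennreal (ph x y z / (q z * cc x y z) * g2 x' z) \<partial>LI I) \<in> borel_measurable \<mu>1"
    by (subst measurable_cong_sets[OF sets(1) refl]) measurable
  have "(\<integral>\<^sup>+x'. \<integral>\<^sup>+y'. fC x y x' y' \<partial>\<mu>2 \<partial>\<mu>1) \<le> (\<integral>\<^sup>+x'. 2 * (\<integral>\<^sup>+z. ennreal (ph x y z / (q z * cc x y z) * g2 x' z) \<partial>LI I) \<partial>\<mu>1)"
    using assms fC_measurable_input2 by (intro nn_integral_mono) (auto simp: spaces)
  also have "\<dots> = 2 * (\<integral>\<^sup>+x'. (\<integral>\<^sup>+z. ennreal (ph x y z / (q z * cc x y z) * g2 x' z) \<partial>LI I) \<partial>\<mu>1)"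
    by (rule nn_integral_cmult[OF m'])
  also have "\<dots> \<le> 2 * (2 * (\<integral>\<^sup>+z. ennreal (ph x y z / (q z * cc x y z) * q z) \<partial>LI I))"
    by (rule mult_left_mono[OF _ zero_le], rule average_channel_density[OF F_meas[OF assms(1,2)] F_nonneg conv_g2 m _ le1])
       (use dens_pos(1,3) less_imp_le in blast)+
  also have "(\<integral>\<^sup>+z. ennreal (ph x y z / (q z * cc x y z) * q z) \<partial>LI I) \<le> ennreal 1"
    using dens_pos(1,7) by (intro weighted_le) (auto simp: less_imp_neq[symmetric])
  finally show ?thesis by (simp add: mult_left_mono)
qed

text \<open>By the first rate condition the factor \<open>(K1 * K2) powr (- s)\<close> outweighs the
  moment of order \<open>s\<close> of the two-input channel; the two comparisons with a Gaussian
  leave the constant 4.\<close>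

lemma expected_t12: "(\<integral>\<^sup>+x. \<integral>\<^sup>+y. \<integral>\<^sup>+z. ennreal (t12 x y z powr s * ph x y z) \<partial>LI I \<partial>\<mu>2 \<partial>\<mu>1) \<le> 4"
proof -
  let ?f = "\<lambda>x y. \<integral>\<^sup>+z. ennreal (t12 x y z powr s * ph x y z) \<partial>LI I"
  have fm[measurable]: "(\<lambda>(x, y). ?f x y) \<in> borel_measurable (LI I \<Otimes>\<^sub>M LI I)" by measurable
  let ?N = "real K1 * real K2"
  let ?g = "\<lambda>x y z. gd I P1 x * (gd I P2 y * (ph x y z * (ph x y z / q z) powr s))"
  have N: "?N > 0" using K by simp
  have "(\<integral>\<^sup>+x. \<integral>\<^sup>+y. ?f x y \<partial>\<mu>2 \<partial>\<mu>1) \<le> (\<integral>\<^sup>+x. 2 * (\<integral>\<^sup>+y. ennreal (gd I P2 y) * ?f x y \<partial>LI I) \<partial>\<mu>1)"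
    by (intro nn_integral_mono le2) (simp add: spaces)
  also have "\<dots> \<le> 2 * (\<integral>\<^sup>+x. ennreal (gd I P1 x) * (2 * (\<integral>\<^sup>+y. ennreal (gd I P2 y) * ?f x y \<partial>LI I)) \<partial>LI I)"
    by (rule le1) measurable
  also have "\<dots> = 2 * (\<integral>\<^sup>+x. 2 * (ennreal (gd I P1 x) * (\<integral>\<^sup>+y. ennreal (gd I P2 y) * ?f x y \<partial>LI I)) \<partial>LI I)"
    by (simp only: mult.left_commute)
  also have "\<dots> = 2 * (2 * (\<integral>\<^sup>+x. ennreal (gd I P1 x) * (\<integral>\<^sup>+y. ennreal (gd I P2 y) * ?f x y \<partial>LI I) \<partial>LI I))"
    by (subst nn_integral_cmult) measurable
  also have "\<dots> = 4 * (\<integral>\<^sup>+x. ennreal (gd I P1 x) * (\<integral>\<^sup>+y. ennreal (gd I P2 y) * ?f x y \<partial>LI I) \<partial>LI I)"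
    by (simp add: mult.assoc[symmetric])
  also have "(\<integral>\<^sup>+x. ennreal (gd I P1 x) * (\<integral>\<^sup>+y. ennreal (gd I P2 y) * ?f x y \<partial>LI I) \<partial>LI I)
      = (\<integral>\<^sup>+x. ennreal (?N powr (- s)) * (\<integral>\<^sup>+y. \<integral>\<^sup>+z. ennreal (?g x y z) \<partial>LI I \<partial>LI I) \<partial>LI I)"
  proof (rule nn_integral_cong)
    fix x assume x[measurable]: "x \<in> space (LI I)"
    have gm[measurable]: "(\<lambda>(y, z). ?g x y z) \<in> borel_measurable (LI I \<Otimes>\<^sub>M LI I)" by measurable
    have "ennreal (gd I P1 x) * (\<integral>\<^sup>+y. ennreal (gd I P2 y) * ?f x y \<partial>LI I)
      = (\<integral>\<^sup>+y. ennreal (gd I P1 x) * (ennreal (gd I P2 y) * ?f x y) \<partial>LI I)"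
      by (rule nn_integral_cmult[symmetric]) measurable
    also have "\<dots> = (\<integral>\<^sup>+y. ennreal (?N powr (- s)) * (\<integral>\<^sup>+z. ennreal (?g x y z) \<partial>LI I) \<partial>LI I)"
    proof (rule nn_integral_cong)
      fix y assume y[measurable]: "y \<in> space (LI I)"
      have m1: "(\<lambda>z. ennreal (t12 x y z powr s * ph x y z)) \<in> borel_measurable (LI I)" by measurable
      have m2: "(\<lambda>z. ennreal (?g x y z)) \<in> borel_measurable (LI I)" by measurable
      have pt: "gd I P1 x * gd I P2 y * (t12 x y z powr s * ph x y z) = ?N powr (- s) * ?g x y z" for z
      proof -
        have "t12 x y z = (ph x y z / q z) * (1 / ?N)" by (simp add: t12_def)
        then have "t12 x y z powr s = (ph x y z / q z) powr s * ?N powr (- s)"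
          using dens_pos(1)[of z] N powr_scale[of "ph x y z / q z" ?N s] by simp
        then show ?thesis by (simp add: mult_ac)
      qed
      have "ennreal (gd I P1 x) * (ennreal (gd I P2 y) * ?f x y) = ennreal (gd I P1 x * gd I P2 y) * ?f x y"
        by (simp add: ennreal_mult mult.assoc)
      also have "\<dots> = (\<integral>\<^sup>+z. ennreal (gd I P1 x * gd I P2 y) * ennreal (t12 x y z powr s * ph x y z) \<partial>LI I)"
        by (rule nn_integral_cmult[symmetric, OF m1])
      also have "\<dots> = (\<integral>\<^sup>+z. ennreal (?N powr (- s)) * ennreal (?g x y z) \<partial>LI I)"
        by (simp only: ennreal_mult[symmetric] pt mult_nonneg_nonneg gd_nonneg ph_nonneg powr_ge_zero ennreal_mult'[symmetric])
      also have "\<dots> = ennreal (?N powr (- s)) * (\<integral>\<^sup>+z. ennreal (?g x y z) \<partial>LI I)"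
        by (rule nn_integral_cmult[OF m2])
      finally show "ennreal (gd I P1 x) * (ennreal (gd I P2 y) * ?f x y) = ennreal (?N powr (- s)) * (\<integral>\<^sup>+z. ennreal (?g x y z) \<partial>LI I)" .
    qed
    also have "\<dots> = ennreal (?N powr (- s)) * (\<integral>\<^sup>+y. \<integral>\<^sup>+z. ennreal (?g x y z) \<partial>LI I \<partial>LI I)"
      by (rule nn_integral_cmult) measurable
    finally show "ennreal (gd I P1 x) * (\<integral>\<^sup>+y. ennreal (gd I P2 y) * ?f x y \<partial>LI I) = ennreal (?N powr (- s)) * (\<integral>\<^sup>+y. \<integral>\<^sup>+z. ennreal (?g x y z) \<partial>LI I \<partial>LI I)" .
  qed
  also have "\<dots> = ennreal (?N powr (- s)) * (\<integral>\<^sup>+x. \<integral>\<^sup>+y. \<integral>\<^sup>+z. ennreal (?g x y z) \<partial>LI I \<partial>LI I \<partial>LI I)"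
    by (rule nn_integral_cmult) measurable
  also have "\<dots> \<le> ennreal (?N powr (- s)) * ennreal (exp (real (card I) * (s * (ln k / 2) + s\<^sup>2)))"
    unfolding channel_density_def by (intro mult_left_mono moment_two_inputs) (use I P h s in auto)
  also have "\<dots> \<le> 1"
    using rate_powr[OF rates(1) N] by (simp add: ennreal_mult'[symmetric] ennreal_le_1)
  finally show ?thesis by (simp add: mult_left_mono)
qed

text \<open>Since \<open>t1\<close> does not contain the second codeword, that codeword is averaged
  first and acts as additional noise. What remains is the moment of a one-input channel with noise
  variance \<open>1 + h2 * P2\<close>, controlled by the second rate condition.\<close>

lemma expected_t1: "(\<integral>\<^sup>+x. \<integral>\<^sup>+y. \<integral>\<^sup>+z. ennreal (t1 x z powr s * ph x y z) \<partial>LI I \<partial>\<mu>2 \<partial>\<mu>1) \<le> 4"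
proof -
  let ?N = "real K1"
  let ?g = "\<lambda>x z. gd I P1 x * (g2 x z * (g2 x z / q z) powr s)"
  have N: "?N > 0" using K by simp
  have [measurable]: "(\<lambda>(x, z). t1 x z) \<in> borel_measurable (LI I \<Otimes>\<^sub>M LI I)" by measurable
  have "(\<integral>\<^sup>+x. \<integral>\<^sup>+y. \<integral>\<^sup>+z. ennreal (t1 x z powr s * ph x y z) \<partial>LI I \<partial>\<mu>2 \<partial>\<mu>1)
      \<le> (\<integral>\<^sup>+x. 2 * (\<integral>\<^sup>+z. ennreal (t1 x z powr s * g2 x z) \<partial>LI I) \<partial>\<mu>1)"
  proof (rule nn_integral_mono)
    fix x assume "x \<in> space \<mu>1"
    then have x[measurable]: "x \<in> space (LI I)" by (simp add: spaces)
    have m: "(\<lambda>z. t1 x z powr s) \<in> borel_measurable (LI I)" by measurable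
    show "(\<integral>\<^sup>+y. \<integral>\<^sup>+z. ennreal (t1 x z powr s * ph x y z) \<partial>LI I \<partial>\<mu>2) \<le> 2 * (\<integral>\<^sup>+z. ennreal (t1 x z powr s * g2 x z) \<partial>LI I)"
      by (rule average_channel_density[OF m powr_ge_zero conv_ph2 channel_density_pair_measurable(1)[OF x] ph_nonneg le2])
         (use dens_pos(3) less_imp_le in blast)+
  qed
  also have "\<dots> \<le> 2 * (\<integral>\<^sup>+x. ennreal (gd I P1 x) * (2 * (\<integral>\<^sup>+z. ennreal (t1 x z powr s * g2 x z) \<partial>LI I)) \<partial>LI I)"
    by (rule le1) measurable
  also have "\<dots> = 2 * (\<integral>\<^sup>+x. 2 * (ennreal (gd I P1 x) * (\<integral>\<^sup>+z. ennreal (t1 x z powr s * g2 x z) \<partial>LI I)) \<partial>LI I)"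
    by (simp only: mult.left_commute)
  also have "\<dots> = 2 * (2 * (\<integral>\<^sup>+x. ennreal (gd I P1 x) * (\<integral>\<^sup>+z. ennreal (t1 x z powr s * g2 x z) \<partial>LI I) \<partial>LI I))"
    by (subst nn_integral_cmult) measurable
  also have "\<dots> = 4 * (\<integral>\<^sup>+x. ennreal (gd I P1 x) * (\<integral>\<^sup>+z. ennreal (t1 x z powr s * g2 x z) \<partial>LI I) \<partial>LI I)"
    by (simp add: mult.assoc[symmetric])
  also have "(\<integral>\<^sup>+x. ennreal (gd I P1 x) * (\<integral>\<^sup>+z. ennreal (t1 x z powr s * g2 x z) \<partial>LI I) \<partial>LI I)
     = (\<integral>\<^sup>+x. ennreal (?N powr (- s)) * (\<integral>\<^sup>+z. ennreal (?g x z) \<partial>LI I) \<partial>LI I)"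
  proof (rule nn_integral_cong)
    fix x assume x[measurable]: "x \<in> space (LI I)"
    have m1: "(\<lambda>z. ennreal (t1 x z powr s * g2 x z)) \<in> borel_measurable (LI I)" by measurable
    have m2: "(\<lambda>z. ennreal (?g x z)) \<in> borel_measurable (LI I)" by measurable
    have nn: "0 \<le> g2 x z" for z using dens_pos(3) less_imp_le by blast
    have pt: "gd I P1 x * (t1 x z powr s * g2 x z) = ?N powr (- s) * ?g x z" for z
    proof -
      have "t1 x z = (g2 x z / q z) * (1 / ?N)" by (simp add: t1_def)
      then have "t1 x z powr s = (g2 x z / q z) powr s * ?N powr (- s)"
        using dens_pos(1)[of z] nn[of z] N powr_scale[of "g2 x z / q z" ?N s] by simp
      then show ?thesis by (simp add: mult_ac)
    qed
    have "ennreal (gd I P1 x) * (\<integral>\<^sup>+z. ennreal (t1 x z powr s * g2 x z) \<partial>LI I) = (\<integral>\<^sup>+z. ennreal (gd I P1 x) * ennreal (t1 x z powr s * g2 x z) \<partial>LI I)"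
      by (rule nn_integral_cmult[symmetric, OF m1])
    also have "\<dots> = (\<integral>\<^sup>+z. ennreal (?N powr (- s)) * ennreal (?g x z) \<partial>LI I)"
      by (simp only: ennreal_mult[symmetric] pt mult_nonneg_nonneg gd_nonneg nn powr_ge_zero ennreal_mult'[symmetric])
    also have "\<dots> = ennreal (?N powr (- s)) * (\<integral>\<^sup>+z. ennreal (?g x z) \<partial>LI I)"
      by (rule nn_integral_cmult[OF m2])
    finally show "ennreal (gd I P1 x) * (\<integral>\<^sup>+z. ennreal (t1 x z powr s * g2 x z) \<partial>LI I) = ennreal (?N powr (- s)) * (\<integral>\<^sup>+z. ennreal (?g x z) \<partial>LI I)" .
  qed
  also have "\<dots> = ennreal (?N powr (- s)) * (\<integral>\<^sup>+x. \<integral>\<^sup>+z. ennreal (?g x z) \<partial>LI I \<partial>LI I)"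
    by (rule nn_integral_cmult) measurable
  also have "\<dots> \<le> ennreal (?N powr (- s)) * ennreal (exp (real (card I) * (s * (ln (k / (1 + h2 * P2)) / 2) + s\<^sup>2)))"
    unfolding g2_def by (intro mult_left_mono moment_one_input) (use I P h s pos in auto)
  also have "\<dots> \<le> 1"
    using rate_powr[OF rates(2) N] by (simp add: ennreal_mult'[symmetric] ennreal_le_1)
  finally show ?thesis by (simp add: mult_left_mono)
qed

end

lemma ennreal_double_sum:
  fixes f :: "nat \<Rightarrow> nat \<Rightarrow> real"
  assumes "\<And>a b. 0 \<le> f a b" "0 \<le> c"
  shows "(\<Sum>a\<in>S. \<Sum>b\<in>T. ennreal c * ennreal (f a b)) = ennreal (\<Sum>a\<in>S. \<Sum>b\<in>T. c * f a b)"
  using assms by (simp add: ennreal_mult[symmetric] sum_nonneg)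

context mac_cover_codebooks
begin

lemma Fubini_\<mu>:
  assumes "(\<lambda>(x, y). f x y) \<in> borel_measurable (LI I \<Otimes>\<^sub>M LI I)"
  shows "(\<integral>\<^sup>+x. \<integral>\<^sup>+y. f x y \<partial>\<mu>2 \<partial>\<mu>1) = (\<integral>\<^sup>+y. \<integral>\<^sup>+x. f x y \<partial>\<mu>1 \<partial>\<mu>2)"
proof -
  interpret p: pair_sigma_finite \<mu>1 \<mu>2 by standard
  have "(\<lambda>(x, y). f x y) \<in> borel_measurable (\<mu>1 \<Otimes>\<^sub>M \<mu>2)"
    using assms by (subst measurable_cong_sets[OF sets_pair_measure_cong[OF sets] refl])
  then show ?thesis using p.Fubini'[of f] by simp
qed

lemma expected_t2: "(\<integral>\<^sup>+x. \<integral>\<^sup>+y. \<integral>\<^sup>+z. ennreal (t2 y z powr s * ph x y z) \<partial>LI I \<partial>\<mu>2 \<partial>\<mu>1) \<le> 4"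
proof -
  \<comment> \<open>The same setting with the terminals exchanged, whose \<open>t1\<close> is the
    present \<open>t2\<close>; the order of integration is restored by Fubini.\<close>
  interpret sw: mac_cover_codebooks I P2 P1 h2 h1 s K2 K1 \<mu>2 \<mu>1
  proof unfold_locales
    show "real (card I) * (ln (1 + h2 * P2 + h1 * P1) / 2 + s) \<le> ln (real K2 * real K1)"
      using rates(1) by (simp add: add_ac mult.commute)
    show "real (card I) * (ln ((1 + h2 * P2 + h1 * P1) / (1 + h1 * P1)) / 2 + s) \<le> ln (real K2)"
      using rates(3) by (simp add: add_ac)
    show "real (card I) * (ln ((1 + h2 * P2 + h1 * P1) / (1 + h2 * P2)) / 2 + s) \<le> ln (real K1)"
      using rates(2) by (simp add: add_ac)
  qed (use I P h s K \<mu> sets le1 le2 in auto)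
  have "sw.t1 = t2"
    by (intro ext) (simp add: sw.t1_def t2_def sw.g2_def g1_def add_ac)
  moreover have "sw.ph y x z = ph x y z" for x y z
    by (simp add: channel_density_def algebra_simps)
  ultimately have "(\<integral>\<^sup>+y. \<integral>\<^sup>+x. \<integral>\<^sup>+z. ennreal (t2 y z powr s * ph x y z) \<partial>LI I \<partial>\<mu>1 \<partial>\<mu>2) \<le> 4"
    using sw.expected_t1 by simp
  moreover have "(\<integral>\<^sup>+x. \<integral>\<^sup>+y. \<integral>\<^sup>+z. ennreal (t2 y z powr s * ph x y z) \<partial>LI I \<partial>\<mu>2 \<partial>\<mu>1) = (\<integral>\<^sup>+y. \<integral>\<^sup>+x. \<integral>\<^sup>+z. ennreal (t2 y z powr s * ph x y z) \<partial>LI I \<partial>\<mu>1 \<partial>\<mu>2)"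
    by (rule Fubini_\<mu>) measurable
  ultimately show ?thesis by simp
qed

lemma fC_meas [measurable (raw)]:
  assumes "f \<in> M \<rightarrow>\<^sub>M LI I" "g \<in> M \<rightarrow>\<^sub>M LI I" "f' \<in> M \<rightarrow>\<^sub>M LI I" "g' \<in> M \<rightarrow>\<^sub>M LI I"
  shows "(\<lambda>w. fC (f w) (g w) (f' w) (g' w)) \<in> borel_measurable M"
  unfolding fC_def using assms by measurable

lemma fB_meas [measurable (raw)]:
  assumes "f \<in> M \<rightarrow>\<^sub>M LI I" "g \<in> M \<rightarrow>\<^sub>M LI I"
  shows "(\<lambda>w. fB (f w) (g w)) \<in> borel_measurable M"
  unfolding fB_def using assms by measurable

text \<open>The factor \<open>4 / s\<close> comes from \<open>powr_sum4_le\<close> and from the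
  division by \<open>s\<close> in \<open>fB\<close>; the four parts of \<open>cc\<close> contribute
  1, 4, 4 and 4.\<close>

lemma expected_fB: "(\<integral>\<^sup>+x. \<integral>\<^sup>+y. fB x y \<partial>\<mu>2 \<partial>\<mu>1) \<le> ennreal (52 / s)"
proof -
  let ?a = "\<lambda>x y. \<integral>\<^sup>+z. ennreal (t12 x y z powr s * ph x y z) \<partial>LI I"
  let ?b = "\<lambda>x y. \<integral>\<^sup>+z. ennreal (t1 x z powr s * ph x y z) \<partial>LI I"
  let ?c = "\<lambda>x y. \<integral>\<^sup>+z. ennreal (t2 y z powr s * ph x y z) \<partial>LI I"
  interpret p: pair_prob_space \<mu>1 \<mu>2 by standard
  have sp: "Sigma_Algebra.sets (\<mu>1 \<Otimes>\<^sub>M \<mu>2) = Sigma_Algebra.sets (LI I \<Otimes>\<^sub>M LI I)"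
    by (rule sets_pair_measure_cong[OF sets])
  have m: "(\<lambda>w. ?a (fst w) (snd w)) \<in> borel_measurable (\<mu>1 \<Otimes>\<^sub>M \<mu>2)" "(\<lambda>w. ?b (fst w) (snd w)) \<in> borel_measurable (\<mu>1 \<Otimes>\<^sub>M \<mu>2)"
    "(\<lambda>w. ?c (fst w) (snd w)) \<in> borel_measurable (\<mu>1 \<Otimes>\<^sub>M \<mu>2)" "(\<lambda>w. fB (fst w) (snd w)) \<in> borel_measurable (\<mu>1 \<Otimes>\<^sub>M \<mu>2)"
    unfolding measurable_cong_sets[OF sp refl] by measurable
  have "(\<integral>\<^sup>+x. \<integral>\<^sup>+y. fB x y \<partial>\<mu>2 \<partial>\<mu>1) = (\<integral>\<^sup>+w. fB (fst w) (snd w) \<partial>(\<mu>1 \<Otimes>\<^sub>M \<mu>2))"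
    using \<mu>2.nn_integral_fst[OF m(4)] by simp
  also have "\<dots> \<le> (\<integral>\<^sup>+w. ennreal (4 / s) * (1 + ?a (fst w) (snd w) + ?b (fst w) (snd w) + ?c (fst w) (snd w)) \<partial>(\<mu>1 \<Otimes>\<^sub>M \<mu>2))"
    by (intro nn_integral_mono fB_le) (auto simp: space_pair_measure spaces)
  also have "\<dots> = ennreal (4 / s) * (1 + (\<integral>\<^sup>+w. ?a (fst w) (snd w) \<partial>(\<mu>1 \<Otimes>\<^sub>M \<mu>2)) + (\<integral>\<^sup>+w. ?b (fst w) (snd w) \<partial>(\<mu>1 \<Otimes>\<^sub>M \<mu>2)) + (\<integral>\<^sup>+w. ?c (fst w) (snd w) \<partial>(\<mu>1 \<Otimes>\<^sub>M \<mu>2)))"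
    using m by (simp add: nn_integral_cmult nn_integral_add p.emeasure_space_1)
  also have "\<dots> \<le> ennreal (4 / s) * (1 + 4 + 4 + 4)"
    using expected_t12 expected_t1 expected_t2
      \<mu>2.nn_integral_fst[OF m(1)] \<mu>2.nn_integral_fst[OF m(2)] \<mu>2.nn_integral_fst[OF m(3)]
    by (intro mult_left_mono add_mono) auto
  also have "\<dots> = ennreal (4 / s) * ennreal 13" by simp
  also have "\<dots> = ennreal (52 / s)" using s by (subst ennreal_mult'[symmetric]) auto
  finally show ?thesis .
qed

text \<open>The bounds of all coincidences that hold are added up, although the most special one
  would suffice; in this form the bound is easily summed over all pairs.\<close>

lemma expected_fC:
  assumes "finite J1" "finite J2" "m \<in> J1" "m' \<in> J1" "n \<in> J2" "n' \<in> J2"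
  shows "(\<integral>\<^sup>+X. \<integral>\<^sup>+Y. fC (X m) (Y n) (X m') (Y n') \<partial>PiM J2 (\<lambda>_. \<mu>2) \<partial>PiM J1 (\<lambda>_. \<mu>1))
    \<le> ennreal (of_bool (m = m' \<and> n = n') * (real K1 * real K2) + of_bool (m = m') * (2 * real K1)
      + of_bool (n = n') * (2 * real K2) + 4)" (is "?L \<le> ennreal ?R")
proof -
  have sp: "Sigma_Algebra.sets (\<mu>1 \<Otimes>\<^sub>M \<mu>2 \<Otimes>\<^sub>M \<mu>1 \<Otimes>\<^sub>M \<mu>2) = Sigma_Algebra.sets (LI I \<Otimes>\<^sub>M LI I \<Otimes>\<^sub>M LI I \<Otimes>\<^sub>M LI I)"
    by (intro sets_pair_measure_cong sets)
  have F: "(\<lambda>(x, y, x', y'). fC x y x' y') \<in> borel_measurable (\<mu>1 \<Otimes>\<^sub>M \<mu>2 \<Otimes>\<^sub>M \<mu>1 \<Otimes>\<^sub>M \<mu>2)"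
    unfolding measurable_cong_sets[OF sp refl] by measurable
  have const: "(\<integral>\<^sup>+x. \<integral>\<^sup>+y. f x y \<partial>\<mu>2 \<partial>\<mu>1) \<le> c"
    if "\<And>x y. x \<in> space (LI I) \<Longrightarrow> y \<in> space (LI I) \<Longrightarrow> f x y \<le> c" for f c
  proof -
    have "(\<integral>\<^sup>+x. \<integral>\<^sup>+y. f x y \<partial>\<mu>2 \<partial>\<mu>1) \<le> (\<integral>\<^sup>+x. \<integral>\<^sup>+y. c \<partial>\<mu>2 \<partial>\<mu>1)"
      using that by (intro nn_integral_mono) (auto simp: spaces)
    then show ?thesis by (simp add: \<mu>1.emeasure_space_1 \<mu>2.emeasure_space_1)
  qed
  have "(\<integral>\<^sup>+x. \<integral>\<^sup>+y. fC x y x y \<partial>\<mu>2 \<partial>\<mu>1) \<le> ennreal (real K1 * real K2)"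
    by (rule const, rule fC_same)
  moreover have "(\<integral>\<^sup>+x. \<integral>\<^sup>+y. \<integral>\<^sup>+y'. fC x y x y' \<partial>\<mu>2 \<partial>\<mu>2 \<partial>\<mu>1) \<le> ennreal (2 * real K1)"
    by (rule const, rule fC_12)
  moreover have "(\<integral>\<^sup>+x. \<integral>\<^sup>+y. \<integral>\<^sup>+x'. fC x y x' y \<partial>\<mu>1 \<partial>\<mu>2 \<partial>\<mu>1) \<le> ennreal (2 * real K2)"
    by (rule const, rule fC_21)
  moreover have "(\<integral>\<^sup>+x. \<integral>\<^sup>+y. \<integral>\<^sup>+x'. \<integral>\<^sup>+y'. fC x y x' y' \<partial>\<mu>2 \<partial>\<mu>1 \<partial>\<mu>2 \<partial>\<mu>1) \<le> ennreal 4"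
    by (rule const, rule fC_22)
  ultimately show ?thesis
    unfolding expectation_two_codebooks[OF assms(1,2) \<mu> F assms(3,4,5,6)]
    by (auto elim!: order_trans intro!: ennreal_leI)
qed

text \<open>The maps \<open>m\<close> and \<open>n\<close> pick from the full codebooks the
  codewords that carry one pair of secrets. The constant consists of 1 for the mass of
  \<open>q\<close>, 9 for the correlations \<open>fC\<close> and \<open>52 / s\<close> for
  \<open>fB\<close>, and it is free of the block length and of the code sizes.\<close>

lemma expected_cost:
  assumes J: "finite J1" "finite J2" and m: "\<And>a. a < K1 \<Longrightarrow> m a \<in> J1" "\<And>b. b < K2 \<Longrightarrow> n b \<in> J2"
    and inj: "inj_on m {..<K1}" "inj_on n {..<K2}"
  shows "(\<lambda>(X, Y). cost (\<lambda>a. X (m a)) (\<lambda>b. Y (n b))) \<in> borel_measurable (PiM J1 (\<lambda>_. \<mu>1) \<Otimes>\<^sub>M PiM J2 (\<lambda>_. \<mu>2))"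
    and "(\<integral>\<^sup>+(X, Y). cost (\<lambda>a. X (m a)) (\<lambda>b. Y (n b)) \<partial>(PiM J1 (\<lambda>_. \<mu>1) \<Otimes>\<^sub>M PiM J2 (\<lambda>_. \<mu>2))) \<le> ennreal (10 + 52 / s)"
proof -
  let ?A = "PiM J1 (\<lambda>_. \<mu>1)" and ?B = "PiM J2 (\<lambda>_. \<mu>2)"
  let ?N = "real K1 * real K2"
  have N: "?N > 0" using K by simp
  interpret A: prob_space ?A by (intro prob_space_PiM \<mu>)
  interpret B: prob_space ?B by (intro prob_space_PiM \<mu>)
  interpret p: pair_prob_space ?A ?B by standard
  have X: "(\<lambda>w. fst w i) \<in> ?A \<Otimes>\<^sub>M ?B \<rightarrow>\<^sub>M LI I" if "i \<in> J1" for i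
    unfolding measurable_cong_sets[OF refl sets(1)[symmetric]]
    by (rule measurable_compose[OF measurable_fst measurable_component_singleton[OF that]])
  have Y: "(\<lambda>w. snd w i) \<in> ?A \<Otimes>\<^sub>M ?B \<rightarrow>\<^sub>M LI I" if "i \<in> J2" for i
    unfolding measurable_cong_sets[OF refl sets(2)[symmetric]]
    by (rule measurable_compose[OF measurable_snd measurable_component_singleton[OF that]])
  let ?fB = "\<lambda>a b w. fB (fst w (m a)) (snd w (n b))"
  let ?fC = "\<lambda>a b a' b' w. fC (fst w (m a)) (snd w (n b)) (fst w (m a')) (snd w (n b'))"
  have Bm: "?fB a b \<in> borel_measurable (?A \<Otimes>\<^sub>M ?B)" if "a < K1" "b < K2" for a b
    using that m by (intro fB_meas X Y)
  have Cm: "?fC a b a' b' \<in> borel_measurable (?A \<Otimes>\<^sub>M ?B)" if "a < K1" "b < K2" "a' < K1" "b' < K2" for a b a' b'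
    using that m by (intro fC_meas X Y)
  have Bi: "(\<integral>\<^sup>+w. ?fB a b w \<partial>(?A \<Otimes>\<^sub>M ?B)) \<le> ennreal (52 / s)" if ab: "a < K1" "b < K2" for a b
  proof -
    have sp: "Sigma_Algebra.sets (\<mu>1 \<Otimes>\<^sub>M \<mu>2 \<Otimes>\<^sub>M \<mu>1 \<Otimes>\<^sub>M \<mu>2) = Sigma_Algebra.sets (LI I \<Otimes>\<^sub>M LI I \<Otimes>\<^sub>M LI I \<Otimes>\<^sub>M LI I)"
      by (intro sets_pair_measure_cong sets)
    have F: "(\<lambda>(x, y, x', y'). fB x y) \<in> borel_measurable (\<mu>1 \<Otimes>\<^sub>M \<mu>2 \<Otimes>\<^sub>M \<mu>1 \<Otimes>\<^sub>M \<mu>2)"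
      unfolding measurable_cong_sets[OF sp refl] by measurable
    show ?thesis
      using B.nn_integral_fst[OF Bm[OF ab]] expected_fB
        expectation_two_codebooks[OF J \<mu> F m(1)[OF ab(1)] m(1)[OF ab(1)] m(2)[OF ab(2)] m(2)[OF ab(2)]]
      by simp
  qed
  have Ci: "(\<integral>\<^sup>+w. ?fC a b a' b' w \<partial>(?A \<Otimes>\<^sub>M ?B)) \<le> ennreal (of_bool (a = a' \<and> b = b') * ?N + of_bool (a = a') * (2 * real K1)
      + of_bool (b = b') * (2 * real K2) + 4)" if ab: "a < K1" "b < K2" "a' < K1" "b' < K2" for a b a' b'
  proof -
    have "m a = m a' \<longleftrightarrow> a = a'" "n b = n b' \<longleftrightarrow> b = b'"
      using inj ab by (auto dest: inj_onD)
    then show ?thesis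
      using B.nn_integral_fst[OF Cm[OF ab]]
        expected_fC[OF J m(1)[OF ab(1)] m(1)[OF ab(3)] m(2)[OF ab(2)] m(2)[OF ab(4)]]
      by simp
  qed
  have cost_eq: "cost (\<lambda>a. X (m a)) (\<lambda>b. Y (n b)) = 1 + (\<Sum>a<K1. \<Sum>b<K2. ennreal (1 / ?N) *
     (?fB a b (X, Y) + (\<Sum>a'<K1. \<Sum>b'<K2. ennreal (1 / ?N) * ?fC a b a' b' (X, Y))))" for X Y
    by (simp add: cost_def)
  have Sm: "(\<lambda>w. \<Sum>a'<K1. \<Sum>b'<K2. ennreal (1 / ?N) * ?fC a b a' b' w) \<in> borel_measurable (?A \<Otimes>\<^sub>M ?B)" if "a < K1" "b < K2" for a b
    using that by (intro borel_measurable_sum borel_measurable_times_ennreal borel_measurable_const Cm) auto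
  have Tm: "(\<lambda>w. ennreal (1 / ?N) * (?fB a b w + (\<Sum>a'<K1. \<Sum>b'<K2. ennreal (1 / ?N) * ?fC a b a' b' w))) \<in> borel_measurable (?A \<Otimes>\<^sub>M ?B)"
    if "a < K1" "b < K2" for a b
    using that by (intro borel_measurable_times_ennreal borel_measurable_const borel_measurable_add Bm Sm) auto
  have Um: "(\<lambda>w. \<Sum>b<K2. ennreal (1 / ?N) * (?fB a b w + (\<Sum>a'<K1. \<Sum>b'<K2. ennreal (1 / ?N) * ?fC a b a' b' w))) \<in> borel_measurable (?A \<Otimes>\<^sub>M ?B)"
    if "a < K1" for a
    using that by (intro borel_measurable_sum Tm) auto
  show "(\<lambda>(X, Y). cost (\<lambda>a. X (m a)) (\<lambda>b. Y (n b))) \<in> borel_measurable (?A \<Otimes>\<^sub>M ?B)"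
    unfolding cost_eq case_prod_beta' prod.collapse
    by (intro borel_measurable_add borel_measurable_const borel_measurable_sum Tm) auto
  have "(\<integral>\<^sup>+(X, Y). cost (\<lambda>a. X (m a)) (\<lambda>b. Y (n b)) \<partial>(?A \<Otimes>\<^sub>M ?B))
    = 1 + (\<Sum>a<K1. \<Sum>b<K2. \<integral>\<^sup>+w. ennreal (1 / ?N) * (?fB a b w + (\<Sum>a'<K1. \<Sum>b'<K2. ennreal (1 / ?N) * ?fC a b a' b' w)) \<partial>(?A \<Otimes>\<^sub>M ?B))"
  proof -
    let ?U = "\<lambda>a w. \<Sum>b<K2. ennreal (1 / ?N) * (?fB a b w + (\<Sum>a'<K1. \<Sum>b'<K2. ennreal (1 / ?N) * ?fC a b a' b' w))"
    have "(\<integral>\<^sup>+w. 1 + (\<Sum>a<K1. ?U a w) \<partial>(?A \<Otimes>\<^sub>M ?B)) = 1 + (\<integral>\<^sup>+w. (\<Sum>a<K1. ?U a w) \<partial>(?A \<Otimes>\<^sub>M ?B))"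
      by (subst nn_integral_add) (auto intro!: borel_measurable_sum Um Tm simp: p.emeasure_space_1)
    also have "(\<integral>\<^sup>+w. (\<Sum>a<K1. ?U a w) \<partial>(?A \<Otimes>\<^sub>M ?B)) = (\<Sum>a<K1. \<integral>\<^sup>+w. ?U a w \<partial>(?A \<Otimes>\<^sub>M ?B))"
      by (rule nn_integral_sum) (use Um in auto)
    also have "\<dots> = (\<Sum>a<K1. \<Sum>b<K2. \<integral>\<^sup>+w. ennreal (1 / ?N) * (?fB a b w + (\<Sum>a'<K1. \<Sum>b'<K2. ennreal (1 / ?N) * ?fC a b a' b' w)) \<partial>(?A \<Otimes>\<^sub>M ?B))"
      by (intro sum.cong refl nn_integral_sum) (use Tm in auto)
    finally show ?thesis unfolding cost_eq case_prod_beta' prod.collapse .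
  qed
  also have "\<dots> \<le> 1 + (\<Sum>a<K1. \<Sum>b<K2. ennreal (1 / ?N) * (ennreal (52 / s) + 9))"
  proof (intro add_mono sum_mono order_refl)
    fix a b assume "a \<in> {..<K1}" "b \<in> {..<K2}"
    then have ab: "a < K1" "b < K2" by auto
    \<comment> \<open>Each bound is cancelled by the fraction of pairs with that coincidence, and 9
      is 1 + 2 + 2 + 4.\<close>
    have "(\<Sum>a'<K1. \<Sum>b'<K2. of_bool (a = a' \<and> b = b') * ?N + of_bool (a = a') * (2 * real K1) + of_bool (b = b') * (2 * real K2) + 4)
      = ?N * 9"
    proof -
      have "(\<Sum>a'<K1. of_bool (a = a')) = (1::real)" "(\<Sum>b'<K2. of_bool (b = b')) = (1::real)"
        using ab by (auto simp: of_bool_def sum.delta)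
      then show ?thesis
        by (simp add: sum.distrib of_bool_conj sum_distrib_left[symmetric] sum_distrib_right[symmetric] mult.assoc algebra_simps)
    qed
    then have S9: "(\<Sum>a'<K1. \<Sum>b'<K2. (1 / ?N) * (of_bool (a = a' \<and> b = b') * ?N + of_bool (a = a') * (2 * real K1) + of_bool (b = b') * (2 * real K2) + 4)) = 9"
      unfolding sum_distrib_left[symmetric] using K by simp
    have "(\<integral>\<^sup>+w. (\<Sum>a'<K1. \<Sum>b'<K2. ennreal (1 / ?N) * ?fC a b a' b' w) \<partial>(?A \<Otimes>\<^sub>M ?B))
      = (\<Sum>a'<K1. \<Sum>b'<K2. ennreal (1 / ?N) * (\<integral>\<^sup>+w. ?fC a b a' b' w \<partial>(?A \<Otimes>\<^sub>M ?B)))"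
    proof -
      have *: "(\<lambda>w. ennreal (1 / ?N) * ?fC a b a' b' w) \<in> borel_measurable (?A \<Otimes>\<^sub>M ?B)" if "a' < K1" "b' < K2" for a' b'
        using that ab by (intro borel_measurable_times_ennreal borel_measurable_const Cm)
      have "(\<integral>\<^sup>+w. (\<Sum>a'<K1. \<Sum>b'<K2. ennreal (1 / ?N) * ?fC a b a' b' w) \<partial>(?A \<Otimes>\<^sub>M ?B))
        = (\<Sum>a'<K1. \<integral>\<^sup>+w. (\<Sum>b'<K2. ennreal (1 / ?N) * ?fC a b a' b' w) \<partial>(?A \<Otimes>\<^sub>M ?B))"
        by (rule nn_integral_sum) (use * in \<open>auto intro!: borel_measurable_sum\<close>)
      also have "\<dots> = (\<Sum>a'<K1. \<Sum>b'<K2. \<integral>\<^sup>+w. ennreal (1 / ?N) * ?fC a b a' b' w \<partial>(?A \<Otimes>\<^sub>M ?B))"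
        by (intro sum.cong refl nn_integral_sum) (use * in auto)
      also have "\<dots> = (\<Sum>a'<K1. \<Sum>b'<K2. ennreal (1 / ?N) * (\<integral>\<^sup>+w. ?fC a b a' b' w \<partial>(?A \<Otimes>\<^sub>M ?B)))"
        by (intro sum.cong refl nn_integral_cmult Cm) (use ab in auto)
      finally show ?thesis .
    qed
    also have "\<dots> \<le> (\<Sum>a'<K1. \<Sum>b'<K2. ennreal (1 / ?N) * ennreal (of_bool (a = a' \<and> b = b') * ?N + of_bool (a = a') * (2 * real K1)
      + of_bool (b = b') * (2 * real K2) + 4))"
      using Ci ab by (intro sum_mono mult_left_mono) auto
    also have "\<dots> = ennreal (\<Sum>a'<K1. \<Sum>b'<K2. (1 / ?N) * (of_bool (a = a' \<and> b = b') * ?N + of_bool (a = a') * (2 * real K1) + of_bool (b = b') * (2 * real K2) + 4))"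
      by (rule ennreal_double_sum) auto
    also have "\<dots> = 9" unfolding S9 by simp
    finally have C9: "(\<integral>\<^sup>+w. (\<Sum>a'<K1. \<Sum>b'<K2. ennreal (1 / ?N) * ?fC a b a' b' w) \<partial>(?A \<Otimes>\<^sub>M ?B)) \<le> 9" .
    have "(\<integral>\<^sup>+w. ennreal (1 / ?N) * (?fB a b w + (\<Sum>a'<K1. \<Sum>b'<K2. ennreal (1 / ?N) * ?fC a b a' b' w)) \<partial>(?A \<Otimes>\<^sub>M ?B))
      = ennreal (1 / ?N) * ((\<integral>\<^sup>+w. ?fB a b w \<partial>(?A \<Otimes>\<^sub>M ?B)) + (\<integral>\<^sup>+w. (\<Sum>a'<K1. \<Sum>b'<K2. ennreal (1 / ?N) * ?fC a b a' b' w) \<partial>(?A \<Otimes>\<^sub>M ?B)))"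
      using Bm[OF ab] Sm[OF ab] by (simp add: nn_integral_cmult nn_integral_add)
    also have "\<dots> \<le> ennreal (1 / ?N) * (ennreal (52 / s) + 9)"
      using Bi[OF ab] C9 by (intro mult_left_mono add_mono) auto
    finally show "(\<integral>\<^sup>+w. ennreal (1 / ?N) * (?fB a b w + (\<Sum>a'<K1. \<Sum>b'<K2. ennreal (1 / ?N) * ?fC a b a' b' w)) \<partial>(?A \<Otimes>\<^sub>M ?B))
      \<le> ennreal (1 / ?N) * (ennreal (52 / s) + 9)" .
  qed
  also have "\<dots> = 1 + ennreal ?N * ennreal (1 / ?N) * (ennreal (52 / s) + 9)"
    by (simp add: ennreal_of_nat_eq_real_of_nat ennreal_mult' mult.assoc)
  also have "ennreal ?N * ennreal (1 / ?N) = 1"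
    using K by (simp add: ennreal_mult'[symmetric])
  also have "1 + 1 * (ennreal (52 / s) + 9) = ennreal (10 + 52 / s)"
    using s by (simp add: ennreal_plus add.commute[of _ 9] add.assoc[symmetric])
  finally show "(\<integral>\<^sup>+(X, Y). cost (\<lambda>a. X (m a)) (\<lambda>b. Y (n b)) \<partial>(?A \<Otimes>\<^sub>M ?B)) \<le> ennreal (10 + 52 / s)" .
qed

end

subsection \<open>Random codebooks\<close>

text \<open>Once the own codeword is subtracted, both directions are the same unit-noise channel, so
  one notion without gains serves both.\<close>

definition avg_error :: "nat set \<Rightarrow> (nat \<times> nat) set \<Rightarrow> (nat \<times> nat \<Rightarrow> nat \<Rightarrow> real) \<Rightarrow> ((nat \<Rightarrow> real) \<Rightarrow> nat \<times> nat) \<Rightarrow> ennreal" where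
  "avg_error I K x D = (\<Sum>m\<in>K. ennreal (1 / real (card K)) *
     (\<integral>\<^sup>+y. ennreal (gd I 1 (\<lambda>i. y i - x m i)) * indicator {y. D y \<noteq> m} y \<partial>LI I))"

text \<open>An upper bound for the average divergence from \<open>q\<close> and hence, if
  \<open>q\<close> has mass at most 1, for the information in nats that the eavesdropper has about
  the secrets.\<close>

definition leak :: "nat set \<Rightarrow> real \<Rightarrow> real \<Rightarrow> nat \<Rightarrow> nat \<Rightarrow> nat \<Rightarrow> nat \<Rightarrow> (nat \<times> nat \<Rightarrow> nat \<Rightarrow> real) \<Rightarrow> (nat \<times> nat \<Rightarrow> nat \<Rightarrow> real) \<Rightarrow> ((nat \<Rightarrow> real) \<Rightarrow> real) \<Rightarrow> ennreal" where
  "leak I h1 h2 M1 O1 M2 O2 x1 x2 q = (\<Sum>s1<M1. \<Sum>s2<M2. ennreal (1 / (real M1 * real M2)) *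
     (\<integral>\<^sup>+z. ennreal (output_density I h1 h2 O1 O2 (\<lambda>a. x1 (s1, a)) (\<lambda>b. x2 (s2, b)) z *
         \<bar>ln (output_density I h1 h2 O1 O2 (\<lambda>a. x1 (s1, a)) (\<lambda>b. x2 (s2, b)) z / q z)\<bar>) \<partial>LI I))"

lemma (in prob_space) exists_less_one:
  assumes "AE x in M. Q x" "(\<integral>\<^sup>+x. f x \<partial>M) < 1"
  shows "\<exists>x\<in>space M. Q x \<and> f x < 1"
proof (rule ccontr)
  assume "\<not> ?thesis"
  then have "AE x in M. 1 \<le> f x"
    by (intro AE_mp[OF assms(1) AE_I2]) (auto simp: not_less)
  then have "(\<integral>\<^sup>+x. 1 \<partial>M) \<le> (\<integral>\<^sup>+x. f x \<partial>M)" by (rule nn_integral_mono_AE)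
  then show False using assms(2) by (simp add: emeasure_space_1)
qed

text \<open>Three costs, each divided by its target: if the sum is below 1, then so is every
  summand, and one pair of codebooks meets all targets at once.\<close>

lemma scaled_sum_less_one:
  fixes x y z :: ennreal and a b c :: real
  assumes less: "ennreal (1 / a) * x + ennreal (1 / b) * y + ennreal (1 / c) * z < 1" and pos: "a > 0" "b > 0" "c > 0"
  shows "x \<le> ennreal a" "y \<le> ennreal b" "z \<le> ennreal c"
proof -
  have le: "w \<le> ennreal r" if "ennreal (1 / r) * w < 1" "r > 0" for w r
  proof -
    have "w = ennreal r * (ennreal (1 / r) * w)"
      using that by (simp add: mult.assoc[symmetric] ennreal_mult'[symmetric])
    also have "\<dots> \<le> ennreal r * 1" using that by (intro mult_left_mono) auto
    finally show ?thesis by simp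
  qed
  have l: "ennreal (1 / a) * x \<le> ennreal (1 / a) * x + ennreal (1 / b) * y + ennreal (1 / c) * z"
    "ennreal (1 / b) * y \<le> ennreal (1 / a) * x + ennreal (1 / b) * y + ennreal (1 / c) * z"
    "ennreal (1 / c) * z \<le> ennreal (1 / a) * x + ennreal (1 / b) * y + ennreal (1 / c) * z"
    by (auto simp: add_increasing add_increasing2)
  show "x \<le> ennreal a" "y \<le> ennreal b" "z \<le> ennreal c"
    using le[OF le_less_trans[OF l(1) less] pos(1)] le[OF le_less_trans[OF l(2) less] pos(2)]
      le[OF le_less_trans[OF l(3) less] pos(3)] by blast+
qed

text \<open>Probabilistic method for both codebooks together. The explicit bounds
  \<open>decoding_cost\<close> and \<open>cost\<close> stand in for errors and leakage; their
  weighted expectation is below 1, so one realization is good for everything. Each pair of secrets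
  selects two subcodebooks indexed by open messages, to which the covering bound applies.\<close>

lemma random_coding:
  assumes I: "finite I" and P: "P1 > 0" "P2 > 0" and h: "h1 \<ge> 0" "h2 \<ge> 0"
    and s: "0 < s" "s\<^sup>2 \<le> 1 / 2" and M: "M1 > 0" "O1 > 0" "M2 > 0" "O2 > 0"
    and half: "ennreal (1 / 2) \<le> emeasure (gaussian_measure I P1) (pow_ball I Pb1)"
      "ennreal (1 / 2) \<le> emeasure (gaussian_measure I P2) (pow_ball I Pb2)"
    and \<theta>: "\<theta>1 > 0" "\<theta>2 > 0" and eps: "\<epsilon> > 0" "\<Lambda> > 0"
    and rates: "real (card I) * (ln (1 + h1 * P1 + h2 * P2) / 2 + s) \<le> ln (real O1 * real O2)"
      "real (card I) * (ln ((1 + h1 * P1 + h2 * P2) / (1 + h2 * P2)) / 2 + s) \<le> ln (real O1)"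
      "real (card I) * (ln ((1 + h1 * P1 + h2 * P2) / (1 + h1 * P1)) / 2 + s) \<le> ln (real O2)"
    and small: "(2 * (\<theta>1 powr s * exp (real (card I) * (s\<^sup>2 - s * (ln (1 + P1) / 2)))) + 4 * (real (M1 * O1) / \<theta>1)) / \<epsilon>
      + (2 * (\<theta>2 powr s * exp (real (card I) * (s\<^sup>2 - s * (ln (1 + P2) / 2)))) + 4 * (real (M2 * O2) / \<theta>2)) / \<epsilon>
      + (10 + 52 / s) / \<Lambda> < 1"
  shows "\<exists>x1 x2 D1 D2. (\<forall>m\<in>{..<M1} \<times> {..<O1}. (\<Sum>i\<in>I. (x1 m i)\<^sup>2) \<le> real (card I) * Pb1)
    \<and> (\<forall>m\<in>{..<M2} \<times> {..<O2}. (\<Sum>i\<in>I. (x2 m i)\<^sup>2) \<le> real (card I) * Pb2)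
    \<and> D1 \<in> LI I \<rightarrow>\<^sub>M count_space UNIV \<and> D2 \<in> LI I \<rightarrow>\<^sub>M count_space UNIV
    \<and> avg_error I ({..<M1} \<times> {..<O1}) x1 D1 \<le> ennreal \<epsilon> \<and> avg_error I ({..<M2} \<times> {..<O2}) x2 D2 \<le> ennreal \<epsilon>
    \<and> leak I h1 h2 M1 O1 M2 O2 x1 x2 (gd I (1 + h1 * P1 + h2 * P2)) \<le> ennreal \<Lambda>"
proof -
  define \<mu>1 where "\<mu>1 = codeword_measure I P1 Pb1"
  define \<mu>2 where "\<mu>2 = codeword_measure I P2 Pb2"
  let ?J1 = "{..<M1} \<times> {..<O1}" and ?J2 = "{..<M2} \<times> {..<O2}"
  interpret mac_cover_codebooks I P1 P2 h1 h2 s O1 O2 \<mu>1 \<mu>2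
  proof (intro mac_cover_codebooks.intro mac_cover.intro mac_cover_codebooks_axioms.intro)
    show "prob_space \<mu>1" "prob_space \<mu>2"
      unfolding \<mu>1_def \<mu>2_def using codeword_measure_prob[OF I P(1) half(1)] codeword_measure_prob[OF I P(2) half(2)] by blast+
    show "sets \<mu>1 = sets (LI I)" "sets \<mu>2 = sets (LI I)" by (simp_all add: \<mu>1_def \<mu>2_def)
    show "(\<integral>\<^sup>+x. f x \<partial>\<mu>1) \<le> 2 * (\<integral>\<^sup>+x. ennreal (gd I P1 x) * f x \<partial>LI I)"
      "(\<integral>\<^sup>+x. f x \<partial>\<mu>2) \<le> 2 * (\<integral>\<^sup>+x. ennreal (gd I P2 x) * f x \<partial>LI I)" if "f \<in> borel_measurable (LI I)" for f
      unfolding \<mu>1_def \<mu>2_def using codeword_measure_le[OF I P(1) half(1) that] codeword_measure_le[OF I P(2) half(2) that] by blast+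
  qed (fact I P h s M rates)+
  let ?A = "PiM ?J1 (\<lambda>_. \<mu>1)" and ?B = "PiM ?J2 (\<lambda>_. \<mu>2)"
  interpret A: prob_space ?A by (intro prob_space_PiM \<mu>)
  interpret B: prob_space ?B by (intro prob_space_PiM \<mu>)
  interpret p: pair_prob_space ?A ?B by standard
  have J: "finite ?J1" "finite ?J2" "?J1 \<noteq> {}" "?J2 \<noteq> {}" using M by auto
  note e1 = expected_decoding_cost[OF I J(1,3) P(1) \<theta>(1) s(2) \<mu>(1) sets(1) le1]
  note e2 = expected_decoding_cost[OF I J(2,4) P(2) \<theta>(2) s(2) \<mu>(2) sets(2) le2]
  let ?E1 = "decoding_cost I P1 s \<theta>1 ?J1" and ?E2 = "decoding_cost I P2 s \<theta>2 ?J2"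
  let ?C = "\<lambda>s1 s2 w. cost (\<lambda>a. fst w (s1, a)) (\<lambda>b. snd w (s2, b))"
  have c1: "?C s1 s2 \<in> borel_measurable (?A \<Otimes>\<^sub>M ?B)" and c2: "(\<integral>\<^sup>+w. ?C s1 s2 w \<partial>(?A \<Otimes>\<^sub>M ?B)) \<le> ennreal (10 + 52 / s)"
    if "s1 < M1" "s2 < M2" for s1 s2
    using expected_cost[OF J(1,2), of "Pair s1" "Pair s2"] that by (auto simp: inj_on_def case_prod_beta')
  let ?S = "\<lambda>w. \<Sum>s1<M1. \<Sum>s2<M2. ennreal (1 / (real M1 * real M2)) * ?C s1 s2 w"
  have Sm: "?S \<in> borel_measurable (?A \<Otimes>\<^sub>M ?B)"
    by (intro borel_measurable_sum borel_measurable_times_ennreal borel_measurable_const c1) auto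
  have Si: "(\<integral>\<^sup>+w. ?S w \<partial>(?A \<Otimes>\<^sub>M ?B)) \<le> ennreal (10 + 52 / s)"
  proof -
    have *: "(\<lambda>w. ennreal (1 / (real M1 * real M2)) * ?C s1 s2 w) \<in> borel_measurable (?A \<Otimes>\<^sub>M ?B)" if "s1 < M1" "s2 < M2" for s1 s2
      using that by (intro borel_measurable_times_ennreal borel_measurable_const c1)
    have "(\<integral>\<^sup>+w. ?S w \<partial>(?A \<Otimes>\<^sub>M ?B)) = (\<Sum>s1<M1. \<integral>\<^sup>+w. (\<Sum>s2<M2. ennreal (1 / (real M1 * real M2)) * ?C s1 s2 w) \<partial>(?A \<Otimes>\<^sub>M ?B))"
      by (rule nn_integral_sum) (use * in \<open>auto intro!: borel_measurable_sum\<close>)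
    also have "\<dots> = (\<Sum>s1<M1. \<Sum>s2<M2. \<integral>\<^sup>+w. ennreal (1 / (real M1 * real M2)) * ?C s1 s2 w \<partial>(?A \<Otimes>\<^sub>M ?B))"
      by (intro sum.cong refl nn_integral_sum) (use * in auto)
    also have "\<dots> = (\<Sum>s1<M1. \<Sum>s2<M2. ennreal (1 / (real M1 * real M2)) * (\<integral>\<^sup>+w. ?C s1 s2 w \<partial>(?A \<Otimes>\<^sub>M ?B)))"
      by (intro sum.cong refl nn_integral_cmult c1) auto
    also have "\<dots> \<le> (\<Sum>s1<M1. \<Sum>s2<M2. ennreal (1 / (real M1 * real M2)) * ennreal (10 + 52 / s))"
      using c2 by (intro sum_mono mult_left_mono) auto
    also have "\<dots> = ennreal (10 + 52 / s)"
      using s M by (subst ennreal_double_sum) auto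
    finally show ?thesis .
  qed
  let ?F = "\<lambda>w. ennreal (1 / \<epsilon>) * ?E1 (fst w) + ennreal (1 / \<epsilon>) * ?E2 (snd w) + ennreal (1 / \<Lambda>) * ?S w"
  have E1m: "(\<lambda>w. ?E1 (fst w)) \<in> borel_measurable (?A \<Otimes>\<^sub>M ?B)"
    by (rule measurable_compose[OF measurable_fst e1(1)])
  have E2m: "(\<lambda>w. ?E2 (snd w)) \<in> borel_measurable (?A \<Otimes>\<^sub>M ?B)"
    by (rule measurable_compose[OF measurable_snd e2(1)])
  have Fm: "?F \<in> borel_measurable (?A \<Otimes>\<^sub>M ?B)"
    by (intro borel_measurable_add borel_measurable_times_ennreal borel_measurable_const E1m E2m Sm)
  have E1i: "(\<integral>\<^sup>+w. ?E1 (fst w) \<partial>(?A \<Otimes>\<^sub>M ?B)) = (\<integral>\<^sup>+X. ?E1 X \<partial>?A)"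
    using B.nn_integral_fst[OF E1m] by (simp add: B.emeasure_space_1)
  have E2i: "(\<integral>\<^sup>+w. ?E2 (snd w) \<partial>(?A \<Otimes>\<^sub>M ?B)) = (\<integral>\<^sup>+Y. ?E2 Y \<partial>?B)"
    using B.nn_integral_fst[OF E2m] by (simp add: A.emeasure_space_1)
  have "(\<integral>\<^sup>+w. ?F w \<partial>(?A \<Otimes>\<^sub>M ?B)) = ennreal (1 / \<epsilon>) * (\<integral>\<^sup>+X. ?E1 X \<partial>?A) + ennreal (1 / \<epsilon>) * (\<integral>\<^sup>+Y. ?E2 Y \<partial>?B) + ennreal (1 / \<Lambda>) * (\<integral>\<^sup>+w. ?S w \<partial>(?A \<Otimes>\<^sub>M ?B))"
    unfolding E1i[symmetric] E2i[symmetric] using E1m E2m Sm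
    by (simp only: nn_integral_add nn_integral_cmult borel_measurable_add borel_measurable_times_ennreal borel_measurable_const)
  also have "\<dots> \<le> ennreal (1 / \<epsilon>) * (2 * ennreal (\<theta>1 powr s * exp (real (card I) * (s\<^sup>2 - s * (ln (1 + P1) / 2)))) + 4 * ennreal (real (card ?J1) / \<theta>1))
     + ennreal (1 / \<epsilon>) * (2 * ennreal (\<theta>2 powr s * exp (real (card I) * (s\<^sup>2 - s * (ln (1 + P2) / 2)))) + 4 * ennreal (real (card ?J2) / \<theta>2))
     + ennreal (1 / \<Lambda>) * ennreal (10 + 52 / s)"
    by (intro add_mono mult_left_mono e1(2) e2(2) Si) auto
  also have "\<dots> = ennreal ((2 * (\<theta>1 powr s * exp (real (card I) * (s\<^sup>2 - s * (ln (1 + P1) / 2)))) + 4 * (real (M1 * O1) / \<theta>1)) / \<epsilon>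
      + (2 * (\<theta>2 powr s * exp (real (card I) * (s\<^sup>2 - s * (ln (1 + P2) / 2)))) + 4 * (real (M2 * O2) / \<theta>2)) / \<epsilon>
      + (10 + 52 / s) / \<Lambda>)"
  proof -
    have *: "ennreal (1 / \<epsilon>) * (2 * ennreal a + 4 * ennreal b) = ennreal ((2 * a + 4 * b) / \<epsilon>)" if "a \<ge> 0" "b \<ge> 0" for a b
    proof -
      have e: "2 * ennreal a + 4 * ennreal b = ennreal (2 * a + 4 * b)"
        using that by (simp add: ennreal_plus ennreal_mult)
      show ?thesis unfolding e using that eps by (subst ennreal_mult'[symmetric]) auto
    qed
    have c: "ennreal (1 / \<Lambda>) * ennreal (10 + 52 / s) = ennreal ((10 + 52 / s) / \<Lambda>)"
      using eps s by (subst ennreal_mult'[symmetric]) auto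
    have card: "card ?J1 = M1 * O1" "card ?J2 = M2 * O2" by (simp_all add: card_cartesian_product)
    let ?a1 = "\<theta>1 powr s * exp (real (card I) * (s\<^sup>2 - s * (ln (1 + P1) / 2)))"
    let ?a2 = "\<theta>2 powr s * exp (real (card I) * (s\<^sup>2 - s * (ln (1 + P2) / 2)))"
    have nn: "0 \<le> ?a1" "0 \<le> ?a2" "0 \<le> real (M1 * O1) / \<theta>1" "0 \<le> real (M2 * O2) / \<theta>2" using \<theta> by auto
    have sum: "ennreal x + ennreal y + ennreal z = ennreal (x + y + z)" if "0 \<le> x" "0 \<le> y" "0 \<le> z" for x y z
      using that by (simp add: ennreal_plus)
    have q: "0 \<le> (2 * a + 4 * b) / \<epsilon>" if "0 \<le> a" "0 \<le> b" for a b using that eps by simp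
    have r: "0 \<le> (10 + 52 / s) / \<Lambda>" using eps s by (intro divide_nonneg_nonneg add_nonneg_nonneg) simp_all
    show ?thesis
      unfolding c card *[OF nn(1,3)] *[OF nn(2,4)] by (rule sum[OF q[OF nn(1,3)] q[OF nn(2,4)] r])
  qed
  also have "\<dots> < 1" using small by (simp add: ennreal_less_one_iff)
  finally have F1: "(\<integral>\<^sup>+w. ?F w \<partial>(?A \<Otimes>\<^sub>M ?B)) < 1" .
  have a1: "AE x in \<mu>1. x \<in> pow_ball I Pb1"
    unfolding \<mu>1_def by (rule codeword_measure_AE[OF I P(1) half(1)])
  have a2: "AE x in \<mu>2. x \<in> pow_ball I Pb2"
    unfolding \<mu>2_def by (rule codeword_measure_AE[OF I P(2) half(2)])
  have AEX: "AE X in ?A. \<forall>m\<in>?J1. X m \<in> pow_ball I Pb1"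
    by (intro AE_finite_allI[OF J(1)] AE_PiM_component \<mu>(1) a1)
  have AEY: "AE Y in ?B. \<forall>m\<in>?J2. Y m \<in> pow_ball I Pb2"
    by (intro AE_finite_allI[OF J(2)] AE_PiM_component \<mu>(2) a2)
  have "(\<integral>\<^sup>+X. \<integral>\<^sup>+Y. ?F (X, Y) \<partial>?B \<partial>?A) = (\<integral>\<^sup>+w. ?F w \<partial>(?A \<Otimes>\<^sub>M ?B))"
    by (rule B.nn_integral_fst[OF Fm])
  then have "(\<integral>\<^sup>+X. \<integral>\<^sup>+Y. ?F (X, Y) \<partial>?B \<partial>?A) < 1"
    using F1 by (simp only:)
  \<comment> \<open>The codebooks are fixed one after the other, since the power constraints are
    known to hold almost surely in each factor separately.\<close>
  from A.exists_less_one[OF AEX this] obtain X where X: "X \<in> space ?A" "\<forall>m\<in>?J1. X m \<in> pow_ball I Pb1"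
    and FX: "(\<integral>\<^sup>+Y. ?F (X, Y) \<partial>?B) < 1" by blast
  from B.exists_less_one[OF AEY FX] obtain Y where Y: "Y \<in> space ?B" "\<forall>m\<in>?J2. Y m \<in> pow_ball I Pb2"
    and F: "?F (X, Y) < 1" by blast
  have F': "ennreal (1 / \<epsilon>) * ?E1 X + ennreal (1 / \<epsilon>) * ?E2 Y + ennreal (1 / \<Lambda>) * ?S (X, Y) < 1"
    using F unfolding fst_conv snd_conv .
  note parts = scaled_sum_less_one[OF F' eps(1,1,2)]
  have s0: "0 \<le> s" and pp: "0 < 1 + P1" "0 < 1 + P2" using s P by simp_all
  obtain D1 where D1: "D1 \<in> LI I \<rightarrow>\<^sub>M count_space UNIV" and d1: "\<And>m. m \<in> ?J1 \<Longrightarrow>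
      (\<integral>\<^sup>+y. ennreal (gd I 1 (\<lambda>i. y i - X m i)) * indicator {y. D1 y \<noteq> m} y \<partial>LI I) \<le>
      (\<integral>\<^sup>+y. ennreal (\<theta>1 powr s * (gd I 1 (\<lambda>i. y i - X m i) * (gd I 1 (\<lambda>i. y i - X m i) / gd I (1 + P1) y) powr (- s))) \<partial>LI I)
      + (\<Sum>m'\<in>?J1 - {m}. \<integral>\<^sup>+y. ennreal (gd I 1 (\<lambda>i. y i - X m i) * gd I 1 (\<lambda>i. y i - X m' i) / (\<theta>1 * gd I (1 + P1) y)) \<partial>LI I)"
    by (rule threshold_decoder[OF I J(1) \<theta>(1) s0 pp(1) refl, of X]) (rule that)
  obtain D2 where D2: "D2 \<in> LI I \<rightarrow>\<^sub>M count_space UNIV" and d2: "\<And>m. m \<in> ?J2 \<Longrightarrow>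
      (\<integral>\<^sup>+y. ennreal (gd I 1 (\<lambda>i. y i - Y m i)) * indicator {y. D2 y \<noteq> m} y \<partial>LI I) \<le>
      (\<integral>\<^sup>+y. ennreal (\<theta>2 powr s * (gd I 1 (\<lambda>i. y i - Y m i) * (gd I 1 (\<lambda>i. y i - Y m i) / gd I (1 + P2) y) powr (- s))) \<partial>LI I)
      + (\<Sum>m'\<in>?J2 - {m}. \<integral>\<^sup>+y. ennreal (gd I 1 (\<lambda>i. y i - Y m i) * gd I 1 (\<lambda>i. y i - Y m' i) / (\<theta>2 * gd I (1 + P2) y)) \<partial>LI I)"
    by (rule threshold_decoder[OF I J(2) \<theta>(2) s0 pp(2) refl, of Y]) (rule that)
  have r1: "avg_error I ?J1 X D1 \<le> ?E1 X"
    unfolding avg_error_def decoding_cost_def by (intro sum_mono mult_left_mono d1) simp_all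
  have r2: "avg_error I ?J2 Y D2 \<le> ?E2 Y"
    unfolding avg_error_def decoding_cost_def by (intro sum_mono mult_left_mono d2) simp_all
  have r3: "leak I h1 h2 M1 O1 M2 O2 X Y (gd I (1 + h1 * P1 + h2 * P2)) \<le> ?S (X, Y)"
    unfolding leak_def fst_conv snd_conv by (intro sum_mono mult_left_mono divergence_le_cost) simp_all
  have p1: "\<forall>m\<in>?J1. (\<Sum>i\<in>I. (X m i)\<^sup>2) \<le> real (card I) * Pb1"
    and p2: "\<forall>m\<in>?J2. (\<Sum>i\<in>I. (Y m i)\<^sup>2) \<le> real (card I) * Pb2"
    using bspec[OF X(2)] bspec[OF Y(2)] by (intro ballI; simp only: pow_ball_def mem_Collect_eq)+
  show ?thesis
    by (rule exI[of _ X], rule exI[of _ Y], rule exI[of _ D1], rule exI[of _ D2])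
       (intro conjI p1 p2 D1 D2 order_trans[OF r1 parts(1)] order_trans[OF r2 parts(2)] order_trans[OF r3 parts(3)])
qed

subsection \<open>Concatenation of codes\<close>

text \<open>Indexing codewords by pairs (secret, open) makes the open message the only randomization of the
  encoder. The decoders act on what is left after subtracting the own codeword. The secrecy requirement is
  a divergence from an arbitrary reference density \<open>q\<close>, which bounds the information leaked to the eavesdropper.\<close>
definition wiretap_code :: "nat set \<Rightarrow> real \<Rightarrow> real \<Rightarrow> real \<Rightarrow> real \<Rightarrow> real \<Rightarrow> nat \<Rightarrow> nat \<Rightarrow> nat \<Rightarrow> nat \<Rightarrow> bool" where
  "wiretap_code I Pb1 Pb2 h1 h2 \<epsilon> M1 O1 M2 O2 \<longleftrightarrow> 0 < M1 \<and> 0 < O1 \<and> 0 < M2 \<and> 0 < O2 \<and>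
    (\<exists>x1 x2 D1 D2 q. (\<forall>m\<in>{..<M1} \<times> {..<O1}. (\<Sum>i\<in>I. (x1 m i)\<^sup>2) \<le> real (card I) * Pb1)
    \<and> (\<forall>m\<in>{..<M2} \<times> {..<O2}. (\<Sum>i\<in>I. (x2 m i)\<^sup>2) \<le> real (card I) * Pb2)
    \<and> D1 \<in> LI I \<rightarrow>\<^sub>M count_space UNIV \<and> D2 \<in> LI I \<rightarrow>\<^sub>M count_space UNIV
    \<and> avg_error I ({..<M1} \<times> {..<O1}) x1 D1 \<le> ennreal \<epsilon> \<and> avg_error I ({..<M2} \<times> {..<O2}) x2 D2 \<le> ennreal \<epsilon>
    \<and> q \<in> borel_measurable (LI I) \<and> (\<forall>z. 0 < q z) \<and> (\<integral>\<^sup>+z. ennreal (q z) \<partial>LI I) \<le> 1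
    \<and> leak I h1 h2 M1 O1 M2 O2 x1 x2 q \<le> ennreal (\<epsilon> * ln (real M1 * real M2)))"

text \<open>Division with remainder identifies numbers below \<open>M * M'\<close> with pairs.
  Secret and open indices are split separately, so that the secret of a concatenated code is the
  pair of the secrets of its blocks, and likewise for the open parts.\<close>

definition split_message :: "nat \<Rightarrow> nat \<Rightarrow> nat \<times> nat \<Rightarrow> (nat \<times> nat) \<times> (nat \<times> nat)" where
  "split_message M' K' m = ((fst m div M', snd m div K'), (fst m mod M', snd m mod K'))"

definition join_message :: "nat \<Rightarrow> nat \<Rightarrow> nat \<times> nat \<Rightarrow> nat \<times> nat \<Rightarrow> nat \<times> nat" where
  "join_message M' K' m m' = (fst m * M' + fst m', snd m * K' + snd m')"

lemma less_mult_divmod: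
  assumes "(k::nat) < M * M'" shows "k div M' < M" "k mod M' < M'"
proof -
  have "M' > 0" using assms by (cases M') auto
  then show "k div M' < M" "k mod M' < M'" using assms by (simp_all add: less_mult_imp_div_less)
qed

lemma add_mult_less:
  assumes "(i::nat) < M" "j < M'" shows "i * M' + j < M * M'"
proof -
  have "i * M' + j < (i + 1) * M'" using assms by simp
  also have "\<dots> \<le> M * M'" using assms by (intro mult_right_mono) auto
  finally show ?thesis .
qed

lemma bij_split_message: "bij_betw (split_message M' K') ({..<M * M'} \<times> {..<K * K'}) (({..<M} \<times> {..<K}) \<times> ({..<M'} \<times> {..<K'}))"
proof (rule bij_betw_byWitness[where f' = "\<lambda>(m, m'). join_message M' K' m m'"])
  show "\<forall>m\<in>{..<M * M'} \<times> {..<K * K'}. (case split_message M' K' m of (m, m') \<Rightarrow> join_message M' K' m m') = m"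
    by (auto simp: split_message_def join_message_def)
  show "\<forall>p\<in>({..<M} \<times> {..<K}) \<times> ({..<M'} \<times> {..<K'}). split_message M' K' (case p of (m, m') \<Rightarrow> join_message M' K' m m') = p"
    by (auto simp: split_message_def join_message_def)
  show "split_message M' K' ` ({..<M * M'} \<times> {..<K * K'}) \<subseteq> ({..<M} \<times> {..<K}) \<times> ({..<M'} \<times> {..<K'})"
    by (auto simp: split_message_def less_mult_divmod)
  show "(\<lambda>(m, m'). join_message M' K' m m') ` (({..<M} \<times> {..<K}) \<times> ({..<M'} \<times> {..<K'})) \<subseteq> {..<M * M'} \<times> {..<K * K'}"
    by (auto simp: join_message_def add_mult_less)
qed

lemma join_split_message [simp]: "join_message M' K' (fst (split_message M' K' m)) (snd (split_message M' K' m)) = m"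
  by (simp add: split_message_def join_message_def)

lemma split_message_in:
  assumes "m \<in> {..<M * M'} \<times> {..<K * K'}"
  shows "fst (split_message M' K' m) \<in> {..<M} \<times> {..<K}" "snd (split_message M' K' m) \<in> {..<M'} \<times> {..<K'}"
  using assms by (auto simp: split_message_def less_mult_divmod)

lemma sum_split_message:
  fixes f :: "nat \<times> nat \<Rightarrow> nat \<times> nat \<Rightarrow> 'a::comm_monoid_add"
  shows "(\<Sum>m\<in>{..<M * M'} \<times> {..<K * K'}. f (fst (split_message M' K' m)) (snd (split_message M' K' m)))
    = (\<Sum>m\<in>{..<M} \<times> {..<K}. \<Sum>m'\<in>{..<M'} \<times> {..<K'}. f m m')"
  using sum.reindex_bij_betw[OF bij_split_message[of M' K' M "K"], of "\<lambda>p. f (fst p) (snd p)"]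
  by (simp add: sum.cartesian_product case_prod_beta')

lemma ennreal_average_add:
  fixes e e' :: "'a \<Rightarrow> ennreal"
  assumes "finite K" "K \<noteq> {}" "finite K'" "K' \<noteq> {}"
  shows "(\<Sum>m\<in>K. \<Sum>m'\<in>K'. ennreal (1 / (real (card K) * real (card K'))) * (e m + e' m'))
    = (\<Sum>m\<in>K. ennreal (1 / real (card K)) * e m) + (\<Sum>m'\<in>K'. ennreal (1 / real (card K')) * e' m')"
proof -
  have c: "of_nat (card K') * (ennreal (1 / (real (card K) * real (card K'))) * x) = ennreal (1 / real (card K)) * x" for x
    using assms by (simp add: mult.assoc[symmetric] ennreal_of_nat_eq_real_of_nat ennreal_mult'[symmetric])
  have c': "of_nat (card K) * (ennreal (1 / (real (card K) * real (card K'))) * x) = ennreal (1 / real (card K')) * x" for x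
    using assms by (simp add: mult.assoc[symmetric] ennreal_of_nat_eq_real_of_nat ennreal_mult'[symmetric])
  show ?thesis
    unfolding distrib_left sum.distrib
    by (simp add: c c' sum_distrib_left flip: sum_distrib_left)
qed

lemma nn_integral_LI_Un:
  assumes "I \<inter> J = {}" "finite I" "finite J" "f \<in> borel_measurable (LI (I \<union> J))"
  shows "(\<integral>\<^sup>+z. f z \<partial>LI (I \<union> J)) = (\<integral>\<^sup>+x. \<integral>\<^sup>+y. f (merge I J (x, y)) \<partial>LI J \<partial>LI I)"
  using lborel_prod.product_nn_integral_fold[OF assms(1-3)] assms(4) unfolding LI_def by blast

text \<open>When the cost of one block is integrated, the density of the other contributes its mass
  1. This serves for error indicators as well as for absolute log-ratios.\<close>

lemma nn_integral_two_blocks_le: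
  assumes IJ: "I \<inter> J = {}" "finite I" "finite J"
    and F: "F \<in> borel_measurable (LI (I \<union> J))"
    and [measurable]: "a \<in> borel_measurable (LI I)" "b \<in> borel_measurable (LI J)" "u \<in> borel_measurable (LI I)" "v \<in> borel_measurable (LI J)"
    and one: "(\<integral>\<^sup>+x. a x \<partial>LI I) = 1" "(\<integral>\<^sup>+y. b y \<partial>LI J) = 1"
    and le: "\<And>x y. x \<in> space (LI I) \<Longrightarrow> y \<in> space (LI J) \<Longrightarrow> F (merge I J (x, y)) \<le> a x * b y * (u x + v y)"
  shows "(\<integral>\<^sup>+z. F z \<partial>LI (I \<union> J)) \<le> (\<integral>\<^sup>+x. a x * u x \<partial>LI I) + (\<integral>\<^sup>+y. b y * v y \<partial>LI J)"
proof -
  have "(\<integral>\<^sup>+z. F z \<partial>LI (I \<union> J)) \<le> (\<integral>\<^sup>+x. \<integral>\<^sup>+y. (a x * u x) * b y + a x * (b y * v y) \<partial>LI J \<partial>LI I)"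
    unfolding nn_integral_LI_Un[OF IJ F]
    by (intro nn_integral_mono order_trans[OF le]) (auto simp: algebra_simps)
  also have "\<dots> = (\<integral>\<^sup>+x. a x * u x + a x * (\<integral>\<^sup>+y. b y * v y \<partial>LI J) \<partial>LI I)"
    by (simp add: nn_integral_add nn_integral_cmult one)
  also have "\<dots> = (\<integral>\<^sup>+x. a x * u x \<partial>LI I) + (\<integral>\<^sup>+y. b y * v y \<partial>LI J)"
    by (simp add: nn_integral_add nn_integral_multc one)
  finally show ?thesis .
qed

lemma restrict_measurable_LI [measurable]:
  "I \<subseteq> K \<Longrightarrow> (\<lambda>z. restrict z I) \<in> LI K \<rightarrow>\<^sub>M LI I"
  unfolding LI_def by (rule measurable_restrict_subset)

lemma restrict_merge_LI:
  assumes "I \<inter> J = {}" "x \<in> space (LI I)" "y \<in> space (LI J)"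
  shows "restrict (merge I J (x, y)) I = x" "restrict (merge I J (x, y)) J = y"
  using assms by (auto simp: space_LI extensional_restrict)

lemma measurable_combine_countable:
  assumes "f \<in> M \<rightarrow>\<^sub>M count_space (UNIV :: 'a::countable set)" "g \<in> M \<rightarrow>\<^sub>M count_space UNIV"
  shows "(\<lambda>z. c (f z) (g z)) \<in> M \<rightarrow>\<^sub>M count_space UNIV"
proof (rule measurable_compose_countable[where f = "\<lambda>i z. c i (g z)" and g = f])
  fix i show "(\<lambda>z. c i (g z)) \<in> M \<rightarrow>\<^sub>M count_space UNIV"
    by (rule measurable_compose[OF assms(2)]) simp
qed (rule assms(1))

lemma indicator_neq_measurable:
  assumes "D \<in> M \<rightarrow>\<^sub>M count_space UNIV"
  shows "(indicator {y. D y \<noteq> m} :: _ \<Rightarrow> ennreal) \<in> borel_measurable M"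
proof -
  have "(\<lambda>y. if D y = m then 0 else 1 :: ennreal) \<in> borel_measurable M"
    by (rule measurable_compose[OF assms]) simp
  moreover have "(indicator {y. D y \<noteq> m} :: _ \<Rightarrow> ennreal) = (\<lambda>y. if D y = m then 0 else 1)"
    by (auto simp: indicator_def)
  ultimately show ?thesis by simp
qed

text \<open>A concatenated message is decoded wrongly only if one of its blocks is: a union bound in
  terms of indicators.\<close>

lemma avg_error_concat:
  fixes x x' :: "nat \<times> nat \<Rightarrow> nat \<Rightarrow> real"
  assumes IJ: "I \<inter> J = {}" "finite I" "finite J" and pos: "0 < M" "0 < K" "0 < M'" "0 < K'"
    and D: "D \<in> LI I \<rightarrow>\<^sub>M count_space UNIV" "D' \<in> LI J \<rightarrow>\<^sub>M count_space UNIV"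
  defines "x'' \<equiv> \<lambda>m i. if i \<in> I then x (fst (split_message M' K' m)) i else x' (snd (split_message M' K' m)) i"
    and "D'' \<equiv> \<lambda>z. join_message M' K' (D (restrict z I)) (D' (restrict z J))"
  shows "D'' \<in> LI (I \<union> J) \<rightarrow>\<^sub>M count_space UNIV"
    and "avg_error (I \<union> J) ({..<M * M'} \<times> {..<K * K'}) x'' D'' \<le> avg_error I ({..<M} \<times> {..<K}) x D + avg_error J ({..<M'} \<times> {..<K'}) x' D'"
proof -
  show Dm: "D'' \<in> LI (I \<union> J) \<rightarrow>\<^sub>M count_space UNIV"
    unfolding D''_def
    by (rule measurable_combine_countable; rule measurable_compose[OF restrict_measurable_LI]; (rule D)?; blast?)
  define e where "e m = (\<integral>\<^sup>+y. ennreal (gd I 1 (\<lambda>i. y i - x m i)) * indicator {y. D y \<noteq> m} y \<partial>LI I)" for m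
  define e' where "e' m = (\<integral>\<^sup>+y. ennreal (gd J 1 (\<lambda>i. y i - x' m i)) * indicator {y. D' y \<noteq> m} y \<partial>LI J)" for m
  have split: "gd (I \<union> J) 1 (\<lambda>i. merge I J (y, y') i - x'' m i) =
      gd I 1 (\<lambda>i. y i - x (fst (split_message M' K' m)) i) * gd J 1 (\<lambda>i. y' i - x' (snd (split_message M' K' m)) i)" for y y' m
    unfolding gd_def using IJ
    by (subst prod.union_disjoint) (auto simp: x''_def intro!: arg_cong2[where f="(*)"] prod.cong)
  have each: "(\<integral>\<^sup>+y. ennreal (gd (I \<union> J) 1 (\<lambda>i. y i - x'' m i)) * indicator {y. D'' y \<noteq> m} y \<partial>LI (I \<union> J))
     \<le> e (fst (split_message M' K' m)) + e' (snd (split_message M' K' m))" for m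
    unfolding e_def e'_def
  proof (rule nn_integral_two_blocks_le[OF IJ])
    show "(\<lambda>y. ennreal (gd (I \<union> J) 1 (\<lambda>i. y i - x'' m i)) * indicator {y. D'' y \<noteq> m} y) \<in> borel_measurable (LI (I \<union> J))"
      by (intro borel_measurable_times_ennreal measurable_compose[OF _ measurable_ennreal] gd_measurable indicator_neq_measurable[OF Dm]) measurable
    show "(indicator {y. D y \<noteq> fst (split_message M' K' m)} :: _ \<Rightarrow> ennreal) \<in> borel_measurable (LI I)"
      by (rule indicator_neq_measurable[OF D(1)])
    show "(indicator {y. D' y \<noteq> snd (split_message M' K' m)} :: _ \<Rightarrow> ennreal) \<in> borel_measurable (LI J)"
      by (rule indicator_neq_measurable[OF D(2)])
    show "(\<lambda>y. ennreal (gd I 1 (\<lambda>i. y i - x (fst (split_message M' K' m)) i))) \<in> borel_measurable (LI I)"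
      "(\<lambda>y. ennreal (gd J 1 (\<lambda>i. y i - x' (snd (split_message M' K' m)) i))) \<in> borel_measurable (LI J)"
      by (intro measurable_compose[OF _ measurable_ennreal] gd_measurable; measurable)+
    show "(\<integral>\<^sup>+y. ennreal (gd I 1 (\<lambda>i. y i - x (fst (split_message M' K' m)) i)) \<partial>LI I) = 1"
      "(\<integral>\<^sup>+y. ennreal (gd J 1 (\<lambda>i. y i - x' (snd (split_message M' K' m)) i)) \<partial>LI J) = 1"
      using IJ by (simp_all add: nn_integral_gd)
    fix y y' assume yy: "y \<in> space (LI I)" "y' \<in> space (LI J)"
    have "indicator {y. D'' y \<noteq> m} (merge I J (y, y')) \<le> (indicator {y. D y \<noteq> fst (split_message M' K' m)} y + indicator {y. D' y \<noteq> snd (split_message M' K' m)} y' :: ennreal)"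
    proof (cases "D y = fst (split_message M' K' m) \<and> D' y' = snd (split_message M' K' m)")
      case True
      then show ?thesis by (simp add: D''_def restrict_merge_LI[OF IJ(1) yy])
    qed (auto simp: indicator_def)
    then show "ennreal (gd (I \<union> J) 1 (\<lambda>i. merge I J (y, y') i - x'' m i)) * indicator {y. D'' y \<noteq> m} (merge I J (y, y'))
      \<le> ennreal (gd I 1 (\<lambda>i. y i - x (fst (split_message M' K' m)) i)) * ennreal (gd J 1 (\<lambda>i. y' i - x' (snd (split_message M' K' m)) i)) *
        (indicator {y. D y \<noteq> fst (split_message M' K' m)} y + indicator {y. D' y \<noteq> snd (split_message M' K' m)} y')"
      unfolding split by (simp add: ennreal_mult mult_left_mono)
  qed
  have "avg_error (I \<union> J) ({..<M * M'} \<times> {..<K * K'}) x'' D'' \<le> (\<Sum>m\<in>{..<M * M'} \<times> {..<K * K'}.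
      ennreal (1 / (real (card ({..<M} \<times> {..<K})) * real (card ({..<M'} \<times> {..<K'})))) * (e (fst (split_message M' K' m)) + e' (snd (split_message M' K' m))))"
    unfolding avg_error_def by (intro sum_mono mult_mono each) (auto simp: card_cartesian_product mult_ac)
  also have "\<dots> = (\<Sum>m\<in>{..<M} \<times> {..<K}. \<Sum>m'\<in>{..<M'} \<times> {..<K'}. ennreal (1 / (real (card ({..<M} \<times> {..<K})) * real (card ({..<M'} \<times> {..<K'})))) * (e m + e' m'))"
    by (rule sum_split_message)
  also have "\<dots> = avg_error I ({..<M} \<times> {..<K}) x D + avg_error J ({..<M'} \<times> {..<K'}) x' D'"
    unfolding avg_error_def e_def[symmetric] e'_def[symmetric] using pos by (intro ennreal_average_add) auto
  finally show "avg_error (I \<union> J) ({..<M * M'} \<times> {..<K * K'}) x'' D'' \<le> avg_error I ({..<M} \<times> {..<K}) x D + avg_error J ({..<M'} \<times> {..<K'}) x' D'" .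
qed

lemma nn_integral_output_density:
  assumes "finite I" "K1 > 0" "K2 > 0"
  shows "(\<integral>\<^sup>+z. ennreal (output_density I h1 h2 K1 K2 u w z) \<partial>LI I) = 1"
proof -
  have ph: "0 \<le> channel_density I h1 h2 x y z" for x y z using channel_density_pos less_imp_le by blast
  have "ennreal (output_density I h1 h2 K1 K2 u w z) = ennreal (1 / (real K1 * real K2)) * (\<Sum>a<K1. \<Sum>b<K2. ennreal (channel_density I h1 h2 (u a) (w b) z))" for z
    unfolding output_density_def by (simp add: ph sum_nonneg ennreal_mult'[symmetric])
  then have "(\<integral>\<^sup>+z. ennreal (output_density I h1 h2 K1 K2 u w z) \<partial>LI I)
      = ennreal (1 / (real K1 * real K2)) * (\<Sum>a<K1. \<Sum>b<K2. (\<integral>\<^sup>+z. ennreal (channel_density I h1 h2 (u a) (w b) z) \<partial>LI I))"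
    by (simp add: nn_integral_cmult nn_integral_sum del: sum_ennreal)
  also have "\<dots> = 1"
    using assms by (simp add: nn_integral_channel_density ennreal_of_nat_eq_real_of_nat ennreal_mult'[symmetric])
  finally show ?thesis .
qed

lemma leak_pairs: "leak I h1 h2 M1 O1 M2 O2 x1 x2 q = (\<Sum>m\<in>{..<M1} \<times> {..<M2}. ennreal (1 / real (card ({..<M1} \<times> {..<M2}))) *
     (\<integral>\<^sup>+z. ennreal (output_density I h1 h2 O1 O2 (\<lambda>a. x1 (fst m, a)) (\<lambda>b. x2 (snd m, b)) z *
         \<bar>ln (output_density I h1 h2 O1 O2 (\<lambda>a. x1 (fst m, a)) (\<lambda>b. x2 (snd m, b)) z / q z)\<bar>) \<partial>LI I))"
  by (simp add: leak_def sum.cartesian_product case_prod_beta' card_cartesian_product)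

lemma output_density_pairs: "output_density I h1 h2 K1 K2 u w z = (\<Sum>p\<in>{..<K1} \<times> {..<K2}. channel_density I h1 h2 (u (fst p)) (w (snd p)) z) / (real K1 * real K2)"
  by (simp add: output_density_def sum.cartesian_product case_prod_beta')

lemma channel_density_merge:
  assumes "I \<inter> J = {}" "finite I" "finite J"
  shows "channel_density (I \<union> J) h1 h2 (\<lambda>i. if i \<in> I then x i else x' i) (\<lambda>i. if i \<in> I then y i else y' i) (merge I J (z, z'))
    = channel_density I h1 h2 x y z * channel_density J h1 h2 x' y' z'"
  unfolding channel_density_def gd_def using assms
  by (subst prod.union_disjoint) (auto intro!: arg_cong2[where f="(*)"] prod.cong)

text \<open>The open message consists of independent uniform open messages for the two blocks, so
  for fixed secrets the averaged output density is a product.\<close>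

lemma output_density_concat:
  fixes x1 x1' x2 x2' :: "nat \<times> nat \<Rightarrow> nat \<Rightarrow> real" and M1' O1' M2' O2' :: nat
  assumes IJ: "I \<inter> J = {}" "finite I" "finite J"
  defines "x1'' \<equiv> \<lambda>m i. if i \<in> I then x1 (fst (split_message M1' O1' m)) i else x1' (snd (split_message M1' O1' m)) i"
    and "x2'' \<equiv> \<lambda>m i. if i \<in> I then x2 (fst (split_message M2' O2' m)) i else x2' (snd (split_message M2' O2' m)) i"
  shows "output_density (I \<union> J) h1 h2 (O1 * O1') (O2 * O2') (\<lambda>a. x1'' (s1, a)) (\<lambda>b. x2'' (s2, b)) (merge I J (z, z'))
   = output_density I h1 h2 O1 O2 (\<lambda>a. x1 (s1 div M1', a)) (\<lambda>b. x2 (s2 div M2', b)) z *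
     output_density J h1 h2 O1' O2' (\<lambda>a. x1' (s1 mod M1', a)) (\<lambda>b. x2' (s2 mod M2', b)) z'"
proof -
  let ?f = "\<lambda>p. channel_density I h1 h2 (x1 (s1 div M1', fst p)) (x2 (s2 div M2', snd p)) z"
  let ?g = "\<lambda>p. channel_density J h1 h2 (x1' (s1 mod M1', fst p)) (x2' (s2 mod M2', snd p)) z'"
  have "channel_density (I \<union> J) h1 h2 (x1'' (s1, fst p)) (x2'' (s2, snd p)) (merge I J (z, z')) =
     ?f (fst (split_message O1' O2' p)) * ?g (snd (split_message O1' O2' p))" for p
    unfolding x1''_def x2''_def channel_density_merge[OF IJ] by (simp add: split_message_def)
  then have "(\<Sum>p\<in>{..<O1 * O1'} \<times> {..<O2 * O2'}. channel_density (I \<union> J) h1 h2 (x1'' (s1, fst p)) (x2'' (s2, snd p)) (merge I J (z, z')))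
    = (\<Sum>p\<in>{..<O1 * O1'} \<times> {..<O2 * O2'}. ?f (fst (split_message O1' O2' p)) * ?g (snd (split_message O1' O2' p)))" by simp
  also have "\<dots> = (\<Sum>p\<in>{..<O1} \<times> {..<O2}. \<Sum>p'\<in>{..<O1'} \<times> {..<O2'}. ?f p * ?g p')"
    by (rule sum_split_message[where f = "\<lambda>p p'. ?f p * ?g p'"])
  also have "\<dots> = (\<Sum>p\<in>{..<O1} \<times> {..<O2}. ?f p) * (\<Sum>p'\<in>{..<O1'} \<times> {..<O2'}. ?g p')"
    by (simp add: sum_product)
  finally show ?thesis unfolding output_density_pairs by (simp add: field_simps)
qed

text \<open>With the product of the references, the log-ratio of the concatenated code is the sum of
  the log-ratios of the blocks, and the triangle inequality makes its absolute value
  subadditive.\<close>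

lemma leak_concat:
  fixes x1 x1' x2 x2' :: "nat \<times> nat \<Rightarrow> nat \<Rightarrow> real" and M1' O1' M2' O2' :: nat and q q' :: "(nat \<Rightarrow> real) \<Rightarrow> real"
  assumes IJ: "I \<inter> J = {}" "finite I" "finite J"
    and pos: "0 < M1" "0 < O1" "0 < M2" "0 < O2" "0 < M1'" "0 < O1'" "0 < M2'" "0 < O2'"
    and q: "q \<in> borel_measurable (LI I)" "\<And>z. 0 < q z" and q': "q' \<in> borel_measurable (LI J)" "\<And>z. 0 < q' z"
  defines "x1'' \<equiv> \<lambda>m i. if i \<in> I then x1 (fst (split_message M1' O1' m)) i else x1' (snd (split_message M1' O1' m)) i"
    and "x2'' \<equiv> \<lambda>m i. if i \<in> I then x2 (fst (split_message M2' O2' m)) i else x2' (snd (split_message M2' O2' m)) i"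
    and "q'' \<equiv> \<lambda>z. q (restrict z I) * q' (restrict z J)"
  shows "q'' \<in> borel_measurable (LI (I \<union> J))"
    and "leak (I \<union> J) h1 h2 (M1 * M1') (O1 * O1') (M2 * M2') (O2 * O2') x1'' x2'' q''
      \<le> leak I h1 h2 M1 O1 M2 O2 x1 x2 q + leak J h1 h2 M1' O1' M2' O2' x1' x2' q'"
proof -
  have "(\<lambda>z. q (restrict z I)) \<in> borel_measurable (LI (I \<union> J))" "(\<lambda>z. q' (restrict z J)) \<in> borel_measurable (LI (I \<union> J))"
    by (rule measurable_compose[OF restrict_measurable_LI q(1)] measurable_compose[OF restrict_measurable_LI q'(1)]; blast)+
  then show qm[measurable]: "q'' \<in> borel_measurable (LI (I \<union> J))"
    unfolding q''_def by (rule borel_measurable_times)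
  note [measurable] = q(1) q'(1)
  define P where "P m = output_density I h1 h2 O1 O2 (\<lambda>a. x1 (fst m, a)) (\<lambda>b. x2 (snd m, b))" for m
  define P' where "P' m = output_density J h1 h2 O1' O2' (\<lambda>a. x1' (fst m, a)) (\<lambda>b. x2' (snd m, b))" for m
  define P'' where "P'' m = output_density (I \<union> J) h1 h2 (O1 * O1') (O2 * O2') (\<lambda>a. x1'' (fst m, a)) (\<lambda>b. x2'' (snd m, b))" for m
  have P''_eq: "P'' m (merge I J (z, z')) = P (fst (split_message M1' M2' m)) z * P' (snd (split_message M1' M2' m)) z'" for m z z'
    unfolding P_def P'_def P''_def x1''_def x2''_def output_density_concat[OF IJ] by (simp add: split_message_def)
  have Pm[measurable]: "P m \<in> borel_measurable (LI I)" "P' m \<in> borel_measurable (LI J)" "P'' m \<in> borel_measurable (LI (I \<union> J))" for m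
    unfolding P_def P'_def P''_def by (rule output_density_measurable)+
  have Ppos: "P m z > 0" "P' m z > 0" for m z
    unfolding P_def P'_def using pos by (simp_all add: output_density_pos)
  let ?e = "\<lambda>m. \<integral>\<^sup>+z. ennreal (P m z * \<bar>ln (P m z / q z)\<bar>) \<partial>LI I"
  let ?e' = "\<lambda>m. \<integral>\<^sup>+z. ennreal (P' m z * \<bar>ln (P' m z / q' z)\<bar>) \<partial>LI J"
  have each: "(\<integral>\<^sup>+z. ennreal (P'' m z * \<bar>ln (P'' m z / q'' z)\<bar>) \<partial>LI (I \<union> J)) \<le> ?e (fst (split_message M1' M2' m)) + ?e' (snd (split_message M1' M2' m))" for m
  proof -
    let ?m = "fst (split_message M1' M2' m)" and ?m' = "snd (split_message M1' M2' m)"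
    have "(\<integral>\<^sup>+z. ennreal (P'' m z * \<bar>ln (P'' m z / q'' z)\<bar>) \<partial>LI (I \<union> J))
      \<le> (\<integral>\<^sup>+z. ennreal (P ?m z) * ennreal \<bar>ln (P ?m z / q z)\<bar> \<partial>LI I) + (\<integral>\<^sup>+z. ennreal (P' ?m' z) * ennreal \<bar>ln (P' ?m' z / q' z)\<bar> \<partial>LI J)"
    proof (rule nn_integral_two_blocks_le[OF IJ])
      show "(\<integral>\<^sup>+z. ennreal (P ?m z) \<partial>LI I) = 1" "(\<integral>\<^sup>+z. ennreal (P' ?m' z) \<partial>LI J) = 1"
        unfolding P_def P'_def using IJ pos by (simp_all add: nn_integral_output_density)
      fix z z' assume zz: "z \<in> space (LI I)" "z' \<in> space (LI J)"
      have "P'' m (merge I J (z, z')) / q'' (merge I J (z, z')) = (P ?m z / q z) * (P' ?m' z' / q' z')"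
        unfolding P''_eq q''_def restrict_merge_LI[OF IJ(1) zz] by simp
      then have "\<bar>ln (P'' m (merge I J (z, z')) / q'' (merge I J (z, z')))\<bar> \<le> \<bar>ln (P ?m z / q z)\<bar> + \<bar>ln (P' ?m' z' / q' z')\<bar>"
        using Ppos q(2) q'(2) by (simp add: ln_mult abs_triangle_ineq del: ln_div times_divide_eq_right times_divide_eq_left)
      then have "P'' m (merge I J (z, z')) * \<bar>ln (P'' m (merge I J (z, z')) / q'' (merge I J (z, z')))\<bar>
        \<le> P ?m z * P' ?m' z' * (\<bar>ln (P ?m z / q z)\<bar> + \<bar>ln (P' ?m' z' / q' z')\<bar>)"
        unfolding P''_eq using Ppos[THEN less_imp_le] by (intro mult_left_mono) auto
      then show "ennreal (P'' m (merge I J (z, z')) * \<bar>ln (P'' m (merge I J (z, z')) / q'' (merge I J (z, z')))\<bar>)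
        \<le> ennreal (P ?m z) * ennreal (P' ?m' z') * (ennreal \<bar>ln (P ?m z / q z)\<bar> + ennreal \<bar>ln (P' ?m' z' / q' z')\<bar>)"
        using Ppos[THEN less_imp_le] by (simp add: ennreal_mult[symmetric] ennreal_plus[symmetric] ennreal_leI del: ennreal_plus)
    qed measurable
    then show ?thesis using Ppos[THEN less_imp_le] by (simp add: ennreal_mult)
  qed
  have "leak (I \<union> J) h1 h2 (M1 * M1') (O1 * O1') (M2 * M2') (O2 * O2') x1'' x2'' q''
     \<le> (\<Sum>m\<in>{..<M1 * M1'} \<times> {..<M2 * M2'}. ennreal (1 / (real (card ({..<M1} \<times> {..<M2})) * real (card ({..<M1'} \<times> {..<M2'})))) *
        (?e (fst (split_message M1' M2' m)) + ?e' (snd (split_message M1' M2' m))))"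
    unfolding leak_pairs P''_def[symmetric] by (intro sum_mono mult_mono each) (auto simp: card_cartesian_product mult_ac)
  also have "\<dots> = (\<Sum>m\<in>{..<M1} \<times> {..<M2}. \<Sum>m'\<in>{..<M1'} \<times> {..<M2'}. ennreal (1 / (real (card ({..<M1} \<times> {..<M2})) * real (card ({..<M1'} \<times> {..<M2'})))) * (?e m + ?e' m'))"
    by (rule sum_split_message)
  also have "\<dots> = leak I h1 h2 M1 O1 M2 O2 x1 x2 q + leak J h1 h2 M1' O1' M2' O2' x1' x2' q'"
    unfolding leak_pairs P_def[symmetric] P'_def[symmetric] using pos by (intro ennreal_average_add) auto
  finally show "leak (I \<union> J) h1 h2 (M1 * M1') (O1 * O1') (M2 * M2') (O2 * O2') x1'' x2'' q''
      \<le> leak I h1 h2 M1 O1 M2 O2 x1 x2 q + leak J h1 h2 M1' O1' M2' O2' x1' x2' q'" .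
qed

lemma power_concat:
  fixes x x' :: "nat \<times> nat \<Rightarrow> nat \<Rightarrow> real"
  assumes IJ: "I \<inter> J = {}" "finite I" "finite J"
    and "\<forall>m\<in>{..<M} \<times> {..<K}. (\<Sum>i\<in>I. (x m i)\<^sup>2) \<le> real (card I) * Pb"
    and "\<forall>m\<in>{..<M'} \<times> {..<K'}. (\<Sum>i\<in>J. (x' m i)\<^sup>2) \<le> real (card J) * Pb"
  shows "\<forall>m\<in>{..<M * M'} \<times> {..<K * K'}. (\<Sum>i\<in>I \<union> J. (if i \<in> I then x (fst (split_message M' K' m)) i else x' (snd (split_message M' K' m)) i)\<^sup>2) \<le> real (card (I \<union> J)) * Pb"
proof
  fix m assume m: "m \<in> {..<M * M'} \<times> {..<K * K'}"
  have "(\<Sum>i\<in>I \<union> J. (if i \<in> I then x (fst (split_message M' K' m)) i else x' (snd (split_message M' K' m)) i)\<^sup>2)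
    = (\<Sum>i\<in>I. (x (fst (split_message M' K' m)) i)\<^sup>2) + (\<Sum>i\<in>J. (x' (snd (split_message M' K' m)) i)\<^sup>2)"
    using IJ by (subst sum.union_disjoint) (auto intro!: arg_cong2[where f="(+)"] sum.cong)
  also have "\<dots> \<le> real (card I) * Pb + real (card J) * Pb"
    by (intro add_mono bspec[OF assms(4)] bspec[OF assms(5)] split_message_in[OF m])
  also have "\<dots> = real (card (I \<union> J)) * Pb"
    using IJ by (simp add: card_Un_disjoint algebra_simps)
  finally show "(\<Sum>i\<in>I \<union> J. (if i \<in> I then x (fst (split_message M' K' m)) i else x' (snd (split_message M' K' m)) i)\<^sup>2) \<le> real (card (I \<union> J)) * Pb" .
qed

lemma wiretap_codeE:
  assumes "wiretap_code I Pb1 Pb2 h1 h2 \<epsilon> M1 O1 M2 O2"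
  obtains x1 x2 D1 D2 q where "0 < M1" "0 < O1" "0 < M2" "0 < O2"
    "\<forall>m\<in>{..<M1} \<times> {..<O1}. (\<Sum>i\<in>I. (x1 m i)\<^sup>2) \<le> real (card I) * Pb1"
    "\<forall>m\<in>{..<M2} \<times> {..<O2}. (\<Sum>i\<in>I. (x2 m i)\<^sup>2) \<le> real (card I) * Pb2"
    "D1 \<in> LI I \<rightarrow>\<^sub>M count_space UNIV" "D2 \<in> LI I \<rightarrow>\<^sub>M count_space UNIV"
    "avg_error I ({..<M1} \<times> {..<O1}) x1 D1 \<le> ennreal \<epsilon>" "avg_error I ({..<M2} \<times> {..<O2}) x2 D2 \<le> ennreal \<epsilon>"
    "q \<in> borel_measurable (LI I)" "\<And>z. 0 < q z" "(\<integral>\<^sup>+z. ennreal (q z) \<partial>LI I) \<le> 1"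
    "leak I h1 h2 M1 O1 M2 O2 x1 x2 q \<le> ennreal (\<epsilon> * ln (real M1 * real M2))"
  using assms unfolding wiretap_code_def by blast

lemma wiretap_codeI:
  assumes "0 < M1" "0 < O1" "0 < M2" "0 < O2"
    "\<forall>m\<in>{..<M1} \<times> {..<O1}. (\<Sum>i\<in>I. (x1 m i)\<^sup>2) \<le> real (card I) * Pb1"
    "\<forall>m\<in>{..<M2} \<times> {..<O2}. (\<Sum>i\<in>I. (x2 m i)\<^sup>2) \<le> real (card I) * Pb2"
    "D1 \<in> LI I \<rightarrow>\<^sub>M count_space UNIV" "D2 \<in> LI I \<rightarrow>\<^sub>M count_space UNIV"
    "avg_error I ({..<M1} \<times> {..<O1}) x1 D1 \<le> ennreal \<epsilon>" "avg_error I ({..<M2} \<times> {..<O2}) x2 D2 \<le> ennreal \<epsilon>"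
    "q \<in> borel_measurable (LI I)" "\<And>z. 0 < q z" "(\<integral>\<^sup>+z. ennreal (q z) \<partial>LI I) \<le> 1"
    "leak I h1 h2 M1 O1 M2 O2 x1 x2 q \<le> ennreal (\<epsilon> * ln (real M1 * real M2))"
  shows "wiretap_code I Pb1 Pb2 h1 h2 \<epsilon> M1 O1 M2 O2"
  unfolding wiretap_code_def using assms
  by (intro conjI exI[of _ x1] exI[of _ x2] exI[of _ D1] exI[of _ D2] exI[of _ q] allI) assumption+

lemma wiretap_code_concat:
  assumes IJ: "I \<inter> J = {}" "finite I" "finite J" and e: "0 \<le> \<epsilon>" "0 \<le> \<epsilon>'"
    and c: "wiretap_code I Pb1 Pb2 h1 h2 \<epsilon> M1 O1 M2 O2" and c': "wiretap_code J Pb1 Pb2 h1 h2 \<epsilon>' M1' O1' M2' O2'"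
  shows "wiretap_code (I \<union> J) Pb1 Pb2 h1 h2 (\<epsilon> + \<epsilon>') (M1 * M1') (O1 * O1') (M2 * M2') (O2 * O2')"
proof -
  have pos: "0 < M1" "0 < O1" "0 < M2" "0 < O2" "0 < M1'" "0 < O1'" "0 < M2'" "0 < O2'"
    using c c' by (auto simp: wiretap_code_def)
  from c obtain x1 x2 D1 D2 q where
    p: "\<forall>m\<in>{..<M1} \<times> {..<O1}. (\<Sum>i\<in>I. (x1 m i)\<^sup>2) \<le> real (card I) * Pb1" "\<forall>m\<in>{..<M2} \<times> {..<O2}. (\<Sum>i\<in>I. (x2 m i)\<^sup>2) \<le> real (card I) * Pb2"
    and D: "D1 \<in> LI I \<rightarrow>\<^sub>M count_space UNIV" "D2 \<in> LI I \<rightarrow>\<^sub>M count_space UNIV"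
    and d: "avg_error I ({..<M1} \<times> {..<O1}) x1 D1 \<le> ennreal \<epsilon>" "avg_error I ({..<M2} \<times> {..<O2}) x2 D2 \<le> ennreal \<epsilon>"
    and q: "q \<in> borel_measurable (LI I)" "\<And>z. 0 < q z" "(\<integral>\<^sup>+z. ennreal (q z) \<partial>LI I) \<le> 1"
    and l: "leak I h1 h2 M1 O1 M2 O2 x1 x2 q \<le> ennreal (\<epsilon> * ln (real M1 * real M2))"
    unfolding wiretap_code_def by blast
  from c' obtain x1' x2' D1' D2' q' where
    p': "\<forall>m\<in>{..<M1'} \<times> {..<O1'}. (\<Sum>i\<in>J. (x1' m i)\<^sup>2) \<le> real (card J) * Pb1" "\<forall>m\<in>{..<M2'} \<times> {..<O2'}. (\<Sum>i\<in>J. (x2' m i)\<^sup>2) \<le> real (card J) * Pb2"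
    and D': "D1' \<in> LI J \<rightarrow>\<^sub>M count_space UNIV" "D2' \<in> LI J \<rightarrow>\<^sub>M count_space UNIV"
    and d': "avg_error J ({..<M1'} \<times> {..<O1'}) x1' D1' \<le> ennreal \<epsilon>'" "avg_error J ({..<M2'} \<times> {..<O2'}) x2' D2' \<le> ennreal \<epsilon>'"
    and q': "q' \<in> borel_measurable (LI J)" "\<And>z. 0 < q' z" "(\<integral>\<^sup>+z. ennreal (q' z) \<partial>LI J) \<le> 1"
    and l': "leak J h1 h2 M1' O1' M2' O2' x1' x2' q' \<le> ennreal (\<epsilon>' * ln (real M1' * real M2'))"
    unfolding wiretap_code_def by blast
  note dc1 = avg_error_concat(1)[OF IJ pos(1,2,5,6) D(1) D'(1)] avg_error_concat(2)[OF IJ pos(1,2,5,6) D(1) D'(1), where x = x1 and x' = x1']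
  note dc2 = avg_error_concat(1)[OF IJ pos(3,4,7,8) D(2) D'(2)] avg_error_concat(2)[OF IJ pos(3,4,7,8) D(2) D'(2), where x = x2 and x' = x2']
  note lc = leak_concat(1)[OF IJ pos q(1,2) q'(1,2)] leak_concat(2)[OF IJ pos q(1,2) q'(1,2), where ?x1.0 = x1 and x1' = x1' and ?x2.0 = x2 and x2' = x2' and ?h1.0 = h1 and ?h2.0 = h2]
  have sum_le: "a \<le> ennreal (\<epsilon> + \<epsilon>')" if "a \<le> b + b'" "b \<le> ennreal \<epsilon>" "b' \<le> ennreal \<epsilon>'" for a b b'
    using that e by (simp add: ennreal_plus) (meson add_mono order_trans)
  have Q: "(\<integral>\<^sup>+z. ennreal (q (restrict z I) * q' (restrict z J)) \<partial>LI (I \<union> J)) \<le> 1"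
  proof -
    note [measurable] = q(1) q'(1)
    have "(\<integral>\<^sup>+z. ennreal (q (restrict z I) * q' (restrict z J)) \<partial>LI (I \<union> J))
      = (\<integral>\<^sup>+x. \<integral>\<^sup>+y. ennreal (q x) * ennreal (q' y) \<partial>LI J \<partial>LI I)"
      using lc(1) q(2)[THEN less_imp_le] q'(2)[THEN less_imp_le]
      by (subst nn_integral_LI_Un[OF IJ]) (auto simp: restrict_merge_LI[OF IJ(1)] ennreal_mult intro!: nn_integral_cong)
    also have "\<dots> = (\<integral>\<^sup>+x. ennreal (q x) \<partial>LI I) * (\<integral>\<^sup>+y. ennreal (q' y) \<partial>LI J)"
      by (simp add: nn_integral_cmult nn_integral_multc)
    also have "\<dots> \<le> 1 * 1" using q(3) q'(3) by (intro mult_mono) auto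
    finally show ?thesis by simp
  qed
  let ?l = "ln (real M1 * real M2)" and ?l' = "ln (real M1' * real M2')"
  have lpos: "0 \<le> ?l" "0 \<le> ?l'"
    using pos by (auto intro!: ln_ge_zero mult_ge1_I simp: Suc_le_eq)
  have "ln (real (M1 * M1') * real (M2 * M2')) = ?l + ?l'"
    using pos by (simp add: ln_mult)
  \<comment> \<open>The leakage tolerance is relative to the logarithm of the number of secret
    pairs, so tolerances may simply be added: the cross terms are nonnegative.\<close>
  moreover have "\<epsilon> * ?l + \<epsilon>' * ?l' \<le> (\<epsilon> + \<epsilon>') * (?l + ?l')"
    using e lpos by (simp add: algebra_simps)
  ultimately have L: "ennreal (\<epsilon> * ?l) + ennreal (\<epsilon>' * ?l') \<le> ennreal ((\<epsilon> + \<epsilon>') * ln (real (M1 * M1') * real (M2 * M2')))"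
    using e lpos by (simp add: ennreal_plus[symmetric] ennreal_leI del: ennreal_plus)
  show ?thesis
    by (rule wiretap_codeI[OF _ _ _ _ power_concat[OF IJ p(1) p'(1)] power_concat[OF IJ p(2) p'(2)] dc1(1) dc2(1)
          sum_le[OF dc1(2) d(1) d'(1)] sum_le[OF dc2(2) d(2) d'(2)] lc(1) _ Q order_trans[OF lc(2) order_trans[OF add_mono[OF l l'] L]]])
       (use pos q(2) q'(2) in simp_all)
qed

lemma wiretap_code_mono:
  assumes "wiretap_code I Pb1 Pb2 h1 h2 \<epsilon> M1 O1 M2 O2" "\<epsilon> \<le> \<epsilon>'"
  shows "wiretap_code I Pb1 Pb2 h1 h2 \<epsilon>' M1 O1 M2 O2"
proof -
  have pos: "0 < M1" "0 < M2" using assms by (auto simp: wiretap_code_def)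
  then have "0 \<le> ln (real M1 * real M2)"
    by (auto intro!: ln_ge_zero mult_ge1_I simp: Suc_le_eq)
  then have "ennreal (\<epsilon> * ln (real M1 * real M2)) \<le> ennreal (\<epsilon>' * ln (real M1 * real M2))"
    using assms(2) by (intro ennreal_leI mult_right_mono)
  moreover have "ennreal \<epsilon> \<le> ennreal \<epsilon>'" using assms(2) by (rule ennreal_leI)
  ultimately show ?thesis
    by - (rule wiretap_codeE[OF assms(1)], rule wiretap_codeI; (assumption | (erule order_trans, assumption)))
qed

subsection \<open>Closedness and convexity of the rate region\<close>

text \<open>Codes are indexed by arbitrary finite sets \<open>I\<close> of channel uses and are required for every large
  cardinality, so that codes on disjoint index sets can be glued together for time sharing.\<close>
definition strongly_achievable :: "real \<Rightarrow> real \<Rightarrow> real \<Rightarrow> real \<Rightarrow> rate \<Rightarrow> bool" where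
  "strongly_achievable Pb1 Pb2 h1 h2 R \<longleftrightarrow> (\<forall>\<epsilon>>0. \<exists>N. \<forall>I. finite I \<and> card I \<ge> N \<longrightarrow>
    (\<exists>M1 O1 M2 O2. wiretap_code I Pb1 Pb2 h1 h2 \<epsilon> M1 O1 M2 O2
      \<and> real (card I) * (Rsec R 1 - \<epsilon>) \<le> log 2 (real M1) \<and> real (card I) * (Ropen R 1 - \<epsilon>) \<le> log 2 (real O1)
      \<and> real (card I) * (Rsec R 2 - \<epsilon>) \<le> log 2 (real M2) \<and> real (card I) * (Ropen R 2 - \<epsilon>) \<le> log 2 (real O2)))"

text \<open>Half the tolerance is spent on the distance of the rates, half on the code for
  \<open>R'\<close>. Since only lower bounds on \<open>R'\<close> are asked, this serves closedness
  as well as the approximation of boundary rates by slightly smaller ones.\<close>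

lemma strongly_achievable_approx:
  assumes "\<And>\<delta>. \<delta> > 0 \<Longrightarrow> \<exists>R'. strongly_achievable Pb1 Pb2 h1 h2 R' \<and> (\<forall>k\<in>{1,2}. Rsec R k - \<delta> \<le> Rsec R' k \<and> Ropen R k - \<delta> \<le> Ropen R' k)"
  shows "strongly_achievable Pb1 Pb2 h1 h2 R"
  unfolding strongly_achievable_def
proof (intro allI impI)
  fix \<epsilon> :: real assume e: "\<epsilon> > 0"
  then obtain R' where R': "strongly_achievable Pb1 Pb2 h1 h2 R'" and le: "\<forall>k\<in>{1,2}. Rsec R k - \<epsilon> / 2 \<le> Rsec R' k \<and> Ropen R k - \<epsilon> / 2 \<le> Ropen R' k"
    using assms[of "\<epsilon> / 2"] by auto
  have e2: "\<epsilon> / 2 > 0" using e by simp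
  have half: "real n * (a - \<epsilon>) \<le> l" if "a - \<epsilon> / 2 \<le> b" "real n * (b - \<epsilon> / 2) \<le> l" for n a b l
  proof -
    have "real n * (a - \<epsilon>) \<le> real n * (b - \<epsilon> / 2)" using that(1) by (intro mult_left_mono) auto
    then show ?thesis using that(2) by simp
  qed
  from R' e2 obtain N where N: "\<And>I. finite I \<and> card I \<ge> N \<Longrightarrow> (\<exists>M1 O1 M2 O2. wiretap_code I Pb1 Pb2 h1 h2 (\<epsilon> / 2) M1 O1 M2 O2
      \<and> real (card I) * (Rsec R' 1 - \<epsilon> / 2) \<le> log 2 (real M1) \<and> real (card I) * (Ropen R' 1 - \<epsilon> / 2) \<le> log 2 (real O1)
      \<and> real (card I) * (Rsec R' 2 - \<epsilon> / 2) \<le> log 2 (real M2) \<and> real (card I) * (Ropen R' 2 - \<epsilon> / 2) \<le> log 2 (real O2))"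
    unfolding strongly_achievable_def by blast
  show "\<exists>N. \<forall>I. finite I \<and> card I \<ge> N \<longrightarrow>
    (\<exists>M1 O1 M2 O2. wiretap_code I Pb1 Pb2 h1 h2 \<epsilon> M1 O1 M2 O2
      \<and> real (card I) * (Rsec R 1 - \<epsilon>) \<le> log 2 (real M1) \<and> real (card I) * (Ropen R 1 - \<epsilon>) \<le> log 2 (real O1)
      \<and> real (card I) * (Rsec R 2 - \<epsilon>) \<le> log 2 (real M2) \<and> real (card I) * (Ropen R 2 - \<epsilon>) \<le> log 2 (real O2))"
  proof (rule exI[of _ N], intro allI impI)
    fix I :: "nat set" assume "finite I \<and> card I \<ge> N"
    from N[OF this] obtain M1 O1 M2 O2 where c: "wiretap_code I Pb1 Pb2 h1 h2 (\<epsilon> / 2) M1 O1 M2 O2"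
      and r: "real (card I) * (Rsec R' 1 - \<epsilon> / 2) \<le> log 2 (real M1)" "real (card I) * (Ropen R' 1 - \<epsilon> / 2) \<le> log 2 (real O1)"
       "real (card I) * (Rsec R' 2 - \<epsilon> / 2) \<le> log 2 (real M2)" "real (card I) * (Ropen R' 2 - \<epsilon> / 2) \<le> log 2 (real O2)" by blast
    have "wiretap_code I Pb1 Pb2 h1 h2 \<epsilon> M1 O1 M2 O2" by (rule wiretap_code_mono[OF c]) (use e in simp)
    then show "\<exists>M1 O1 M2 O2. wiretap_code I Pb1 Pb2 h1 h2 \<epsilon> M1 O1 M2 O2
      \<and> real (card I) * (Rsec R 1 - \<epsilon>) \<le> log 2 (real M1) \<and> real (card I) * (Ropen R 1 - \<epsilon>) \<le> log 2 (real O1)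
      \<and> real (card I) * (Rsec R 2 - \<epsilon>) \<le> log 2 (real M2) \<and> real (card I) * (Ropen R 2 - \<epsilon>) \<le> log 2 (real O2)"
      using le r by (intro exI[of _ M1] exI[of _ O1] exI[of _ M2] exI[of _ O2]) (auto intro: half)
  qed
qed

lemma rate_diff_le:
  "\<bar>Rsec R k - Rsec R' k\<bar> \<le> dist R' R" "\<bar>Ropen R k - Ropen R' k\<bar> \<le> dist R' R"
proof -
  have "\<bar>fst p - fst p'\<bar> \<le> dist p' p" "\<bar>snd p - snd p'\<bar> \<le> dist p' p" for p p' :: "real \<times> real"
    using dist_fst_le[of p' p] dist_snd_le[of p' p] by (auto simp: dist_real_def abs_minus_commute)
  then have "\<bar>fst p - fst p'\<bar> \<le> d" "\<bar>snd p - snd p'\<bar> \<le> d" if "dist p' p \<le> d" for p p' :: "real \<times> real" and d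
    using that by (meson order_trans)+
  then show "\<bar>Rsec R k - Rsec R' k\<bar> \<le> dist R' R" "\<bar>Ropen R k - Ropen R' k\<bar> \<le> dist R' R"
    using dist_fst_le[of R' R] dist_snd_le[of R' R] by (auto simp: Rsec_def Ropen_def)
qed

lemma strongly_achievable_closed: "closed {R. strongly_achievable Pb1 Pb2 h1 h2 R}"
  unfolding closure_subset_eq[symmetric]
proof
  fix R assume R: "R \<in> closure {R. strongly_achievable Pb1 Pb2 h1 h2 R}"
  have "strongly_achievable Pb1 Pb2 h1 h2 R"
  proof (rule strongly_achievable_approx)
    fix \<delta> :: real assume "\<delta> > 0"
    then obtain R' where R': "strongly_achievable Pb1 Pb2 h1 h2 R'" "dist R' R < \<delta>"
      using R unfolding closure_approachable by blast
    have "Rsec R k - \<delta> \<le> Rsec R' k \<and> Ropen R k - \<delta> \<le> Ropen R' k" for k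
      using rate_diff_le[of R k R'] R'(2) by linarith
    then show "\<exists>R'. strongly_achievable Pb1 Pb2 h1 h2 R' \<and> (\<forall>k\<in>{1,2}. Rsec R k - \<delta> \<le> Rsec R' k \<and> Ropen R k - \<delta> \<le> Ropen R' k)"
      using R'(1) by blast
  qed
  then show "R \<in> {R. strongly_achievable Pb1 Pb2 h1 h2 R}" by simp
qed

text \<open>Rounding \<open>u * n\<close> to an integer \<open>m\<close> moves at most one channel
  use between the blocks. This costs at most the sum of the absolute rates, which half the tolerance
  absorbs for large \<open>n\<close>; the other half belongs to the component codes.\<close>

lemma time_sharing_rate:
  fixes n m n' :: nat and a b u e l l' :: real
  assumes n: "n = m + n'" and m: "real m \<le> u * real n" "u * real n - 1 \<le> real m" and e: "e > 0"
    and big: "2 * (\<bar>a\<bar> + \<bar>b\<bar>) \<le> e * real n"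
    and l: "real m * (a - e / 2) \<le> l" "real n' * (b - e / 2) \<le> l'"
  shows "real n * (u * a + (1 - u) * b - e) \<le> l + l'"
proof -
  define t where "t = u * real n - real m"
  have t: "0 \<le> t" "t \<le> 1" using m by (auto simp: t_def)
  have mm: "real m = u * real n - t" by (simp add: t_def)
  have nn: "real n' = real n - real m" using n by simp
  have "real m * (a - e / 2) + real n' * (b - e / 2) = real n * (u * a + (1 - u) * b) - t * (a - b) - real n * e / 2"
    unfolding nn unfolding mm by (simp add: algebra_simps)
  moreover have "t * (a - b) \<le> \<bar>a\<bar> + \<bar>b\<bar>"
  proof -
    have "t * (a - b) \<le> \<bar>t * (a - b)\<bar>" by simp
    also have "\<dots> \<le> 1 * (\<bar>a\<bar> + \<bar>b\<bar>)" unfolding abs_mult using t by (intro mult_mono) auto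
    finally show ?thesis by simp
  qed
  ultimately have "real n * (u * a + (1 - u) * b) - real n * e / 2 - (\<bar>a\<bar> + \<bar>b\<bar>) \<le> l + l'"
    using l by linarith
  moreover have "\<bar>a\<bar> + \<bar>b\<bar> \<le> real n * e / 2" using big by (simp add: mult.commute)
  ultimately have "real n * (u * a + (1 - u) * b) - real n * e \<le> l + l'" by linarith
  then show ?thesis by (simp add: algebra_simps)
qed

lemma strongly_achievable_time_sharing:
  assumes R: "strongly_achievable Pb1 Pb2 h1 h2 R" and R': "strongly_achievable Pb1 Pb2 h1 h2 R'" and u: "0 < u" "u < 1"
  shows "strongly_achievable Pb1 Pb2 h1 h2 (u *\<^sub>R R + (1 - u) *\<^sub>R R')"
  unfolding strongly_achievable_def
proof (intro allI impI)
  fix \<epsilon> :: real assume e: "\<epsilon> > 0"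
  then have e2: "\<epsilon> / 2 > 0" by simp
  let ?Q = "u *\<^sub>R R + (1 - u) *\<^sub>R R'"
  have Q: "Rsec ?Q k = u * Rsec R k + (1 - u) * Rsec R' k" "Ropen ?Q k = u * Ropen R k + (1 - u) * Ropen R' k" for k
    by (auto simp: Rsec_def Ropen_def)
  from R e2 obtain N where N: "\<And>I. finite I \<and> card I \<ge> N \<Longrightarrow> (\<exists>M1 O1 M2 O2. wiretap_code I Pb1 Pb2 h1 h2 (\<epsilon> / 2) M1 O1 M2 O2
      \<and> real (card I) * (Rsec R 1 - \<epsilon> / 2) \<le> log 2 (real M1) \<and> real (card I) * (Ropen R 1 - \<epsilon> / 2) \<le> log 2 (real O1)
      \<and> real (card I) * (Rsec R 2 - \<epsilon> / 2) \<le> log 2 (real M2) \<and> real (card I) * (Ropen R 2 - \<epsilon> / 2) \<le> log 2 (real O2))"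
    unfolding strongly_achievable_def by blast
  from R' e2 obtain N' where N': "\<And>I. finite I \<and> card I \<ge> N' \<Longrightarrow> (\<exists>M1 O1 M2 O2. wiretap_code I Pb1 Pb2 h1 h2 (\<epsilon> / 2) M1 O1 M2 O2
      \<and> real (card I) * (Rsec R' 1 - \<epsilon> / 2) \<le> log 2 (real M1) \<and> real (card I) * (Ropen R' 1 - \<epsilon> / 2) \<le> log 2 (real O1)
      \<and> real (card I) * (Rsec R' 2 - \<epsilon> / 2) \<le> log 2 (real M2) \<and> real (card I) * (Ropen R' 2 - \<epsilon> / 2) \<le> log 2 (real O2))"
    unfolding strongly_achievable_def by blast
  define B where "B = \<bar>Rsec R 1\<bar> + \<bar>Rsec R' 1\<bar> + \<bar>Ropen R 1\<bar> + \<bar>Ropen R' 1\<bar> + \<bar>Rsec R 2\<bar> + \<bar>Rsec R' 2\<bar> + \<bar>Ropen R 2\<bar> + \<bar>Ropen R' 2\<bar>"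
  \<comment> \<open>The three bounds give the first block at least \<open>N\<close> uses, where
    \<open>+ 1\<close> covers rounding down, give the second block at least \<open>N'\<close> uses,
    and make the rounding loss at most half the tolerance.\<close>
  define L where "L = max (real (N + 1) / u) (max (real N' / (1 - u)) (2 * B / \<epsilon>))"
  define N'' where "N'' = nat \<lceil>L\<rceil>"
  show "\<exists>N. \<forall>I. finite I \<and> card I \<ge> N \<longrightarrow>
    (\<exists>M1 O1 M2 O2. wiretap_code I Pb1 Pb2 h1 h2 \<epsilon> M1 O1 M2 O2
      \<and> real (card I) * (Rsec ?Q 1 - \<epsilon>) \<le> log 2 (real M1) \<and> real (card I) * (Ropen ?Q 1 - \<epsilon>) \<le> log 2 (real O1)
      \<and> real (card I) * (Rsec ?Q 2 - \<epsilon>) \<le> log 2 (real M2) \<and> real (card I) * (Ropen ?Q 2 - \<epsilon>) \<le> log 2 (real O2))"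
  proof (rule exI[of _ N''], intro allI impI)
    fix I :: "nat set" assume I: "finite I \<and> card I \<ge> N''"
    let ?n = "real (card I)"
    have "L \<le> real N''" unfolding N''_def by linarith
    then have "L \<le> ?n" using I by linarith
    then have n: "real (N + 1) / u \<le> ?n" "real N' / (1 - u) \<le> ?n" "2 * B / \<epsilon> \<le> ?n"
      unfolding L_def by auto
    define m where "m = nat \<lfloor>u * ?n\<rfloor>"
    have m: "real m \<le> u * ?n" "u * ?n - 1 \<le> real m"
      using u by (auto simp: m_def)
    have "real (N + 1) \<le> u * ?n" using n(1) u by (simp add: pos_divide_le_eq mult.commute)
    then have mN: "m \<ge> N" using m(2) by linarith
    have "u * ?n \<le> 1 * ?n" using u by (intro mult_right_mono) auto
    then have mn: "m \<le> card I" using m(1) by linarith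
    obtain J where J: "J \<subseteq> I" "card J = m" using obtain_subset_with_card_n[OF mn] by blast
    define J' where "J' = I - J"
    have fin: "finite J" "finite J'" "J \<inter> J' = {}" "J \<union> J' = I"
      using J I by (auto simp: J'_def intro: finite_subset)
    then have cJ: "card I = m + card J'" using J card_Un_disjoint[of J J'] by simp
    have "real N' \<le> (1 - u) * ?n" using n(2) u by (simp add: pos_divide_le_eq mult.commute)
    also have "\<dots> = ?n - u * ?n" by (simp add: algebra_simps)
    also have "\<dots> \<le> real (card J')" using m(1) cJ by simp
    finally have N'J: "N' \<le> card J'" by simp
    from N[of J] fin J mN obtain M1 O1 M2 O2 where c: "wiretap_code J Pb1 Pb2 h1 h2 (\<epsilon> / 2) M1 O1 M2 O2"
      and r: "real m * (Rsec R 1 - \<epsilon> / 2) \<le> log 2 (real M1)" "real m * (Ropen R 1 - \<epsilon> / 2) \<le> log 2 (real O1)"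
        "real m * (Rsec R 2 - \<epsilon> / 2) \<le> log 2 (real M2)" "real m * (Ropen R 2 - \<epsilon> / 2) \<le> log 2 (real O2)" by auto
    from N'[of J'] fin N'J obtain M1' O1' M2' O2' where c': "wiretap_code J' Pb1 Pb2 h1 h2 (\<epsilon> / 2) M1' O1' M2' O2'"
      and r': "real (card J') * (Rsec R' 1 - \<epsilon> / 2) \<le> log 2 (real M1')" "real (card J') * (Ropen R' 1 - \<epsilon> / 2) \<le> log 2 (real O1')"
        "real (card J') * (Rsec R' 2 - \<epsilon> / 2) \<le> log 2 (real M2')" "real (card J') * (Ropen R' 2 - \<epsilon> / 2) \<le> log 2 (real O2')" by auto
    have pos: "0 < M1" "0 < O1" "0 < M2" "0 < O2" "0 < M1'" "0 < O1'" "0 < M2'" "0 < O2'"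
      using c c' by (auto simp: wiretap_code_def)
    have "wiretap_code I Pb1 Pb2 h1 h2 \<epsilon> (M1 * M1') (O1 * O1') (M2 * M2') (O2 * O2')"
      using wiretap_code_concat[OF fin(3,1,2) _ _ c c'] e fin(4) by simp
    moreover have big: "2 * B \<le> \<epsilon> * ?n" using n(3) e by (simp add: pos_divide_le_eq mult.commute)
    have lg: "log 2 (real (x * y)) = log 2 (real x) + log 2 (real y)" if "0 < x" "0 < y" for x y :: nat
      using that by (simp add: log_mult)
    have bigs: "2 * (\<bar>Rsec R 1\<bar> + \<bar>Rsec R' 1\<bar>) \<le> \<epsilon> * ?n" "2 * (\<bar>Ropen R 1\<bar> + \<bar>Ropen R' 1\<bar>) \<le> \<epsilon> * ?n"
      "2 * (\<bar>Rsec R 2\<bar> + \<bar>Rsec R' 2\<bar>) \<le> \<epsilon> * ?n" "2 * (\<bar>Ropen R 2\<bar> + \<bar>Ropen R' 2\<bar>) \<le> \<epsilon> * ?n"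
    proof -
      have *: "2 * (\<bar>a\<bar> + \<bar>b\<bar>) \<le> \<epsilon> * ?n" if "\<bar>a\<bar> + \<bar>b\<bar> \<le> B" for a b
        using big mult_left_mono[OF that, of 2] by linarith
      show "2 * (\<bar>Rsec R 1\<bar> + \<bar>Rsec R' 1\<bar>) \<le> \<epsilon> * ?n" "2 * (\<bar>Ropen R 1\<bar> + \<bar>Ropen R' 1\<bar>) \<le> \<epsilon> * ?n"
        "2 * (\<bar>Rsec R 2\<bar> + \<bar>Rsec R' 2\<bar>) \<le> \<epsilon> * ?n" "2 * (\<bar>Ropen R 2\<bar> + \<bar>Ropen R' 2\<bar>) \<le> \<epsilon> * ?n"
        by (rule *; simp add: B_def)+
    qed
    have "?n * (Rsec ?Q 1 - \<epsilon>) \<le> log 2 (real (M1 * M1'))" "?n * (Ropen ?Q 1 - \<epsilon>) \<le> log 2 (real (O1 * O1'))"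
      "?n * (Rsec ?Q 2 - \<epsilon>) \<le> log 2 (real (M2 * M2'))" "?n * (Ropen ?Q 2 - \<epsilon>) \<le> log 2 (real (O2 * O2'))"
      unfolding Q lg[OF pos(1,5)] lg[OF pos(2,6)] lg[OF pos(3,7)] lg[OF pos(4,8)]
      by (rule time_sharing_rate[OF cJ m e bigs(1) r(1) r'(1)] time_sharing_rate[OF cJ m e bigs(2) r(2) r'(2)]
          time_sharing_rate[OF cJ m e bigs(3) r(3) r'(3)] time_sharing_rate[OF cJ m e bigs(4) r(4) r'(4)])+
    ultimately show "\<exists>M1 O1 M2 O2. wiretap_code I Pb1 Pb2 h1 h2 \<epsilon> M1 O1 M2 O2
      \<and> ?n * (Rsec ?Q 1 - \<epsilon>) \<le> log 2 (real M1) \<and> ?n * (Ropen ?Q 1 - \<epsilon>) \<le> log 2 (real O1)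
      \<and> ?n * (Rsec ?Q 2 - \<epsilon>) \<le> log 2 (real M2) \<and> ?n * (Ropen ?Q 2 - \<epsilon>) \<le> log 2 (real O2)"
      by blast
  qed
qed

lemma strongly_achievable_convex: "convex {R. strongly_achievable Pb1 Pb2 h1 h2 R}"
  unfolding convex_alt
proof (intro ballI allI impI)
  fix R R' :: rate and u :: real
  assume "R \<in> {R. strongly_achievable Pb1 Pb2 h1 h2 R}" "R' \<in> {R. strongly_achievable Pb1 Pb2 h1 h2 R}" "0 \<le> u \<and> u \<le> 1"
  then consider "u = 0" | "u = 1" | "0 < u" "u < 1" by fastforce
  then show "(1 - u) *\<^sub>R R + u *\<^sub>R R' \<in> {R. strongly_achievable Pb1 Pb2 h1 h2 R}"
  proof cases
    case 3
    then show ?thesis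
      using strongly_achievable_time_sharing[of Pb1 Pb2 h1 h2 R' R u] \<open>R \<in> _\<close> \<open>R' \<in> _\<close> by (simp add: add.commute)
  qed (use \<open>R \<in> _\<close> \<open>R' \<in> _\<close> in auto)
qed

subsection \<open>Equivocation of a uniform secret\<close>

lemma nn_integral_count_pair:
  fixes W :: "'s::countable set"
  assumes T: "sigma_finite_measure T" and W: "finite W"
    and f: "f \<in> borel_measurable (count_space UNIV \<Otimes>\<^sub>M T)" and z: "\<And>s z. s \<notin> W \<Longrightarrow> f (s, z) = 0"
  shows "(\<integral>\<^sup>+w. f w \<partial>(count_space UNIV \<Otimes>\<^sub>M T)) = (\<Sum>s\<in>W. \<integral>\<^sup>+z. f (s, z) \<partial>T)"
proof -
  interpret T: sigma_finite_measure T by fact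
  have "(\<integral>\<^sup>+w. f w \<partial>(count_space UNIV \<Otimes>\<^sub>M T)) = (\<integral>\<^sup>+s. \<integral>\<^sup>+z. f (s, z) \<partial>T \<partial>count_space UNIV)"
    by (rule T.nn_integral_fst[symmetric, OF f])
  also have "\<dots> = (\<Sum>s\<in>W. \<integral>\<^sup>+z. f (s, z) \<partial>T)"
    by (rule nn_integral_count_space') (use W z in auto)
  finally show ?thesis .
qed

lemma integrable_nonneg_le:
  fixes f :: "'a \<Rightarrow> real"
  assumes "f \<in> borel_measurable N" "\<And>x. 0 \<le> f x" "(\<integral>\<^sup>+x. ennreal (f x) \<partial>N) \<le> ennreal c" "0 \<le> c"
  shows "integrable N f" "integral\<^sup>L N f \<le> c"
proof -
  show i: "integrable N f"
    using assms by (intro integrableI_nonneg) (auto intro: le_less_trans)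
  have "ennreal (integral\<^sup>L N f) = (\<integral>\<^sup>+x. ennreal (f x) \<partial>N)"
    by (rule nn_integral_eq_integral[symmetric, OF i]) (use assms in auto)
  then show "integral\<^sup>L N f \<le> c"
    using assms(3,4) by (metis ennreal_le_iff)
qed

text \<open>The equivocation of a uniform secret is its entropy minus the average divergence of
  \<open>P s\<close> from the true output density \<open>Q\<close>. No density \<open>q\<close> of
  mass at most 1 yields a smaller average than \<open>Q\<close>: replacing \<open>Q\<close> by
  \<open>q\<close> is controlled by \<open>ln (q / Q) \<le> q / Q - 1\<close>, whose right side has
  nonpositive mean under \<open>Q\<close>.\<close>

lemma (in information_space) conditional_entropy_uniform_ge:
  fixes X :: "'a \<Rightarrow> 's::countable" and P :: "'s \<Rightarrow> 'z \<Rightarrow> real" and q :: "'z \<Rightarrow> real"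
  assumes T: "sigma_finite_measure T" and W: "finite W" "W \<noteq> {}"
    and Pm: "\<And>s. P s \<in> borel_measurable T" and Ppos: "\<And>s z. 0 < P s z" and P1: "\<And>s. s \<in> W \<Longrightarrow> (\<integral>\<^sup>+z. ennreal (P s z) \<partial>T) = 1"
    and qm: "q \<in> borel_measurable T" and qpos: "\<And>z. 0 < q z" and q1: "(\<integral>\<^sup>+z. ennreal (q z) \<partial>T) \<le> 1"
    and dXY: "distributed M (count_space UNIV \<Otimes>\<^sub>M T) (\<lambda>x. (X x, Y x)) (\<lambda>(s, z). ennreal (if s \<in> W then P s z / real (card W) else 0))"
    and dY: "distributed M T Y (\<lambda>z. ennreal ((\<Sum>s\<in>W. P s z) / real (card W)))"
    and leak: "(\<Sum>s\<in>W. ennreal (1 / real (card W)) * (\<integral>\<^sup>+z. ennreal (P s z * \<bar>ln (P s z / q z)\<bar>) \<partial>T)) \<le> ennreal l" and l: "0 \<le> l"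
  shows "conditional_entropy b (count_space UNIV) T X Y \<ge> log b (real (card W)) - l / ln b"
proof -
  note [measurable] = Pm qm
  let ?N = "count_space UNIV \<Otimes>\<^sub>M T"
  define n where "n = real (card W)"
  have n: "n > 0" unfolding n_def using W by (simp add: card_gt_0_iff)
  define Q where "Q z = (\<Sum>s\<in>W. P s z) / n" for z
  have Qpos: "Q z > 0" for z unfolding Q_def using n W Ppos by (intro divide_pos_pos sum_pos) auto
  have Qm[measurable]: "Q \<in> borel_measurable T" unfolding Q_def[abs_def] by measurable
  define J where "J w = (if fst w \<in> W then P (fst w) (snd w) / n else 0)" for w
  have lnb: "ln b > 0" using b_gt_1 by simp
  have meas: "(\<lambda>w. if fst w \<in> W then g (fst w) (snd w) else 0) \<in> borel_measurable ?N" if "\<And>s. g s \<in> borel_measurable T" for g :: "'s \<Rightarrow> 'z \<Rightarrow> real"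
  proof -
    have "(\<lambda>w. (\<lambda>s w. if s \<in> W then g s (snd w) else 0) (fst w) w) \<in> borel_measurable ?N"
    proof (rule measurable_compose_countable[where f = "\<lambda>s w. if s \<in> W then g s (snd w) else 0" and g = fst])
      fix s show "(\<lambda>w. if s \<in> W then g s (snd w) else 0) \<in> borel_measurable ?N"
        using that[of s] by (cases "s \<in> W") simp_all
    qed simp
    then show ?thesis by simp
  qed
  have PQ: "P s z / n \<le> Q z" if "s \<in> W" for s z
    unfolding Q_def using that W Ppos n by (intro divide_right_mono member_le_sum) (auto simp: less_imp_le)
  \<comment> \<open>Up to the unit of the logarithm, \<open>g\<close> is the integrand of the
    negative conditional entropy, \<open>a\<close> that of the leakage, \<open>c - d\<close> the
    cost of replacing \<open>Q\<close> by \<open>q\<close>, with integral at most 0, and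
    \<open>e\<close> that of the entropy of the secret.\<close>
  define g where "g s z = P s z / n * log b (P s z / n / Q z)" for s z
  define a where "a s z = P s z * \<bar>ln (P s z / q z)\<bar> / (n * ln b)" for s z
  define c where "c s z = P s z * (q z / Q z) / (n * ln b)" for s z
  define d where "d s z = P s z / n * (1 / ln b)" for s z
  define e where "e s z = P s z / n * log b n" for s z
  let ?L = "\<lambda>g w. if fst w \<in> W then g (fst w) (snd w) else 0 :: real"
  have gm: "g s \<in> borel_measurable T" and am: "a s \<in> borel_measurable T" and cm: "c s \<in> borel_measurable T"
    and dm: "d s \<in> borel_measurable T" and em: "e s \<in> borel_measurable T" for s
    unfolding g_def a_def c_def d_def e_def by measurable
  have nn: "(\<integral>\<^sup>+w. ennreal (?L g w) \<partial>?N) = (\<Sum>s\<in>W. \<integral>\<^sup>+z. ennreal (g s z) \<partial>T)" if "\<And>s. g s \<in> borel_measurable T" for g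
  proof (subst nn_integral_count_pair[OF T W(1)])
    show "(\<lambda>w. ennreal (?L g w)) \<in> borel_measurable ?N" using meas[OF that] by simp
  qed (auto intro!: sum.cong)
  have n1: "of_nat (card W) * ennreal (1 / n * x) = ennreal x" if "x \<ge> 0" for x
    using n W that by (simp add: n_def ennreal_of_nat_eq_real_of_nat ennreal_mult'[symmetric])
  have A: "integrable ?N (?L a)" "integral\<^sup>L ?N (?L a) \<le> l / ln b"
  proof -
    have "(\<integral>\<^sup>+w. ennreal (?L a w) \<partial>?N) = (\<Sum>s\<in>W. \<integral>\<^sup>+z. ennreal (a s z) \<partial>T)"
      by (rule nn[OF am])
    also have "\<dots> = (\<Sum>s\<in>W. ennreal (1 / ln b) * (ennreal (1 / n) * (\<integral>\<^sup>+z. ennreal (P s z * \<bar>ln (P s z / q z)\<bar>) \<partial>T)))"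
    proof (intro sum.cong refl)
      fix s
      have "(\<integral>\<^sup>+z. ennreal (a s z) \<partial>T) = (\<integral>\<^sup>+z. ennreal (1 / (n * ln b)) * ennreal (P s z * \<bar>ln (P s z / q z)\<bar>) \<partial>T)"
        using n lnb by (simp add: a_def ennreal_mult'[symmetric])
      also have "\<dots> = ennreal (1 / (n * ln b)) * (\<integral>\<^sup>+z. ennreal (P s z * \<bar>ln (P s z / q z)\<bar>) \<partial>T)"
        by (rule nn_integral_cmult) measurable
      finally show "(\<integral>\<^sup>+z. ennreal (a s z) \<partial>T) = ennreal (1 / ln b) * (ennreal (1 / n) * (\<integral>\<^sup>+z. ennreal (P s z * \<bar>ln (P s z / q z)\<bar>) \<partial>T))"
        using n lnb by (simp add: mult.assoc[symmetric] ennreal_mult'[symmetric] mult.commute)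
    qed
    also have "\<dots> \<le> ennreal (1 / ln b) * ennreal l"
      using leak unfolding sum_distrib_left[symmetric] n_def by (intro mult_left_mono) auto
    also have "\<dots> = ennreal (l / ln b)" using lnb l by (simp add: ennreal_mult'[symmetric])
    finally have "(\<integral>\<^sup>+w. ennreal (?L a w) \<partial>?N) \<le> ennreal (l / ln b)" .
    note fin = this
    have "0 \<le> ?L a w" for w using n lnb Ppos[THEN less_imp_le] by (simp add: a_def)
    note i = integrable_nonneg_le[OF meas[OF am] this fin]
    show "integrable ?N (?L a)" "integral\<^sup>L ?N (?L a) \<le> l / ln b"
      using i lnb l by simp_all
  qed
  have C: "integrable ?N (?L c)" "integral\<^sup>L ?N (?L c) \<le> 1 / ln b"
  proof -
    have "(\<Sum>s\<in>W. \<integral>\<^sup>+z. ennreal (c s z) \<partial>T) = (\<integral>\<^sup>+z. ennreal (\<Sum>s\<in>W. c s z) \<partial>T)"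
      using cm n lnb Ppos[THEN less_imp_le] qpos[THEN less_imp_le] Qpos[THEN less_imp_le]
      by (subst nn_integral_sum[symmetric]) (auto simp: c_def)
    also have "\<dots> = (\<integral>\<^sup>+z. ennreal (1 / ln b) * ennreal (q z) \<partial>T)"
    proof (intro nn_integral_cong)
      fix z
      have "(\<Sum>s\<in>W. c s z) = (\<Sum>s\<in>W. P s z) * (q z / Q z) / (n * ln b)"
        by (simp add: c_def sum_distrib_right sum_divide_distrib)
      also have "(\<Sum>s\<in>W. P s z) = n * Q z" using n by (simp add: Q_def)
      also have "n * Q z * (q z / Q z) / (n * ln b) = (1 / ln b) * q z" using n Qpos[of z] by simp
      finally show "ennreal (\<Sum>s\<in>W. c s z) = ennreal (1 / ln b) * ennreal (q z)"
        using lnb by (simp add: ennreal_mult'[symmetric])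
    qed
    also have "\<dots> = ennreal (1 / ln b) * (\<integral>\<^sup>+z. ennreal (q z) \<partial>T)" by (rule nn_integral_cmult) measurable
    also have "\<dots> \<le> ennreal (1 / ln b) * 1" by (intro mult_left_mono q1) auto
    finally have "(\<integral>\<^sup>+w. ennreal (?L c w) \<partial>?N) \<le> ennreal (1 / ln b)" by (subst nn[OF cm]) simp
    note fin = this
    have "0 \<le> ?L c w" for w
      using n lnb Ppos[THEN less_imp_le] qpos[THEN less_imp_le] Qpos[THEN less_imp_le] by (simp add: c_def)
    note i = integrable_nonneg_le[OF meas[OF cm] this fin]
    show "integrable ?N (?L c)" "integral\<^sup>L ?N (?L c) \<le> 1 / ln b"
      using i lnb by simp_all
  qed
  have K: "integrable ?N (?L (\<lambda>s z. P s z / n * r))" "integral\<^sup>L ?N (?L (\<lambda>s z. P s z / n * r)) = r" for r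
  proof -
    have m: "(\<lambda>z. P s z / n) \<in> borel_measurable T" for s by measurable
    have 1: "(\<integral>\<^sup>+w. ennreal (?L (\<lambda>s z. P s z / n) w) \<partial>?N) = 1"
    proof -
      have "(\<integral>\<^sup>+z. ennreal (P s z / n) \<partial>T) = ennreal (1 / n)" if "s \<in> W" for s
      proof -
        have "(\<integral>\<^sup>+z. ennreal (P s z / n) \<partial>T) = (\<integral>\<^sup>+z. ennreal (1 / n) * ennreal (P s z) \<partial>T)"
          using n by (simp add: ennreal_mult'[symmetric])
        also have "\<dots> = ennreal (1 / n) * 1" unfolding P1[OF that, symmetric] by (rule nn_integral_cmult) measurable
        finally show ?thesis by simp
      qed
      then show ?thesis using n1[of 1] by (subst nn[OF m]) simp
    qed
    have i: "integrable ?N (?L (\<lambda>s z. P s z / n))"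
      using n Ppos[THEN less_imp_le] 1 by (intro integrable_nonneg_le(1)[OF meas[OF m], where c = 1]) auto
    have "ennreal (integral\<^sup>L ?N (?L (\<lambda>s z. P s z / n))) = ennreal 1"
      using 1 n Ppos[THEN less_imp_le] by (subst nn_integral_eq_integral[symmetric, OF i]) auto
    then have "integral\<^sup>L ?N (?L (\<lambda>s z. P s z / n)) = 1"
      using n Ppos[THEN less_imp_le] by (subst (asm) ennreal_inj) (auto intro!: integral_nonneg_AE)
    moreover have "?L (\<lambda>s z. P s z / n * r) = (\<lambda>w. ?L (\<lambda>s z. P s z / n) w * r)" by auto
    ultimately show "integrable ?N (?L (\<lambda>s z. P s z / n * r))" "integral\<^sup>L ?N (?L (\<lambda>s z. P s z / n * r)) = r"
      using i by auto
  qed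
  have D: "integrable ?N (?L d)" "integral\<^sup>L ?N (?L d) = 1 / ln b" and E: "integrable ?N (?L e)" "integral\<^sup>L ?N (?L e) = log b n"
    unfolding d_def e_def by (rule K)+
  \<comment> \<open>The ratio \<open>t = P s z / n / Q z\<close> is at most 1, and there
    \<open>t\<close> times the absolute value of \<open>ln t\<close> is at most 1. So
    \<open>Q z / ln b\<close> dominates \<open>g\<close>, and it is integrable over the finitely
    many secrets.\<close>
  have G: "integrable ?N (?L g)"
  proof (rule Bochner_Integration.integrable_bound)
    have m: "Q \<in> borel_measurable T" by measurable
    have "(\<integral>\<^sup>+w. ennreal (?L (\<lambda>s z. Q z / ln b) w) \<partial>?N) = of_nat (card W) * (\<integral>\<^sup>+z. ennreal (Q z / ln b) \<partial>T)"
      by (subst nn) auto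
    also have "(\<integral>\<^sup>+z. ennreal (Q z / ln b) \<partial>T) = ennreal (1 / ln b)"
    proof -
      have "(\<integral>\<^sup>+z. ennreal (Q z / ln b) \<partial>T) = (\<integral>\<^sup>+z. (\<Sum>s\<in>W. ennreal (1 / n * (1 / ln b)) * ennreal (P s z)) \<partial>T)"
        using n lnb Ppos[THEN less_imp_le]
        by (intro nn_integral_cong) (simp add: Q_def ennreal_mult'[symmetric] sum_divide_distrib[symmetric] sum_nonneg mult.commute)
      also have "\<dots> = (\<Sum>s\<in>W. ennreal (1 / n * (1 / ln b)) * (\<integral>\<^sup>+z. ennreal (P s z) \<partial>T))"
        by (subst nn_integral_sum) (auto simp: nn_integral_cmult)
      also have "\<dots> = of_nat (card W) * ennreal (1 / n * (1 / ln b))" using P1 by simp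
      also have "\<dots> = ennreal (1 / ln b)" by (rule n1) (use lnb in simp)
      finally show ?thesis .
    qed
    also have "of_nat (card W) * ennreal (1 / ln b) = ennreal (n * (1 / ln b))"
      using lnb by (simp add: n_def ennreal_of_nat_eq_real_of_nat ennreal_mult'[symmetric])
    finally show "integrable ?N (?L (\<lambda>s z. Q z / ln b))"
      using n lnb Qpos[THEN less_imp_le] by (intro integrable_nonneg_le(1)[OF meas, where c = "n * (1 / ln b)"]) auto
    show "?L g \<in> borel_measurable ?N" by (rule meas[OF gm])
    show "AE w in ?N. norm (?L g w) \<le> norm (?L (\<lambda>s z. Q z / ln b) w)"
    proof (intro AE_I2)
      fix w
      show "norm (?L g w) \<le> norm (?L (\<lambda>s z. Q z / ln b) w)"
      proof (cases "fst w \<in> W")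
        case True
        let ?s = "fst w" and ?z = "snd w"
        define t where "t = P ?s ?z / n / Q ?z"
        have t: "0 < t" "t \<le> 1" unfolding t_def using PQ[OF True, of ?z] Ppos[of ?s ?z] Qpos[of ?z] n by (auto simp: field_simps)
        have "- ln t \<le> 1 / t - 1" using ln_le_minus_one[of "1 / t"] t by (simp add: ln_div)
        then have "t * (- ln t) \<le> t * (1 / t)" using t by (intro mult_left_mono) auto
        then have "t * \<bar>ln t\<bar> \<le> 1" using t by simp
        then have "Q ?z / ln b * (t * \<bar>ln t\<bar>) \<le> Q ?z / ln b * 1"
          using Qpos[of ?z] lnb by (intro mult_left_mono) auto
        moreover have "\<bar>g ?s ?z\<bar> = Q ?z / ln b * (t * \<bar>ln t\<bar>)"
        proof -
          have "P ?s ?z / n = Q ?z * t" using Qpos[of ?z] by (simp add: t_def)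
          then have "g ?s ?z = Q ?z * t * (ln t / ln b)" unfolding g_def t_def[symmetric] log_def by simp
          then show ?thesis using Qpos[of ?z] t lnb by (simp add: abs_mult)
        qed
        ultimately show ?thesis using True Qpos[of ?z] lnb by simp
      qed simp
    qed
  qed
  have pt: "?L g w \<le> ?L a w + ?L c w - ?L d w - ?L e w" for w
  proof (cases "fst w \<in> W")
    case True
    let ?s = "fst w" and ?z = "snd w"
    note p = Ppos[of ?s ?z] Qpos[of ?z] qpos[of ?z]
    have "ln (q ?z / Q ?z) \<le> q ?z / Q ?z - 1" using p by (intro ln_le_minus_one) auto
    then have "ln (P ?s ?z / n / Q ?z) \<le> \<bar>ln (P ?s ?z / q ?z)\<bar> + (q ?z / Q ?z) - 1 - ln n"
      using p n by (simp add: ln_div ln_mult)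
    then have "P ?s ?z / (n * ln b) * ln (P ?s ?z / n / Q ?z) \<le> P ?s ?z / (n * ln b) * (\<bar>ln (P ?s ?z / q ?z)\<bar> + (q ?z / Q ?z) - 1 - ln n)"
      using p n lnb by (intro mult_left_mono) auto
    moreover have "g ?s ?z = P ?s ?z / (n * ln b) * ln (P ?s ?z / n / Q ?z)" by (simp add: g_def log_def)
    moreover have "P ?s ?z / (n * ln b) * (\<bar>ln (P ?s ?z / q ?z)\<bar> + (q ?z / Q ?z) - 1 - ln n) = a ?s ?z + c ?s ?z - d ?s ?z - e ?s ?z"
      by (simp add: a_def c_def d_def e_def log_def algebra_simps diff_divide_distrib add_divide_distrib)
    ultimately show ?thesis using True by simp
  qed simp
  have "integral\<^sup>L ?N (?L g) \<le> integral\<^sup>L ?N (\<lambda>w. ?L a w + ?L c w - ?L d w - ?L e w)"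
    by (rule integral_mono) (use G A(1) C(1) D(1) E(1) pt in auto)
  also have "\<dots> = integral\<^sup>L ?N (?L a) + integral\<^sup>L ?N (?L c) - integral\<^sup>L ?N (?L d) - integral\<^sup>L ?N (?L e)"
    using A(1) C(1) D(1) E(1) by simp
  also have "\<dots> \<le> l / ln b - log b n" using A(2) C(2) D(2) E(2) by simp
  finally have fin: "integral\<^sup>L ?N (?L g) \<le> l / ln b - log b n" .
  have S: "sigma_finite_measure (count_space (UNIV :: 's set))" by (rule sigma_finite_measure_count_space)
  have "conditional_entropy b (count_space UNIV) T X Y = - (\<integral>(s, z). J (s, z) * log b (J (s, z) / Q z) \<partial>?N)"
  proof (rule conditional_entropy_generic_eq[OF S T])
    show "distributed M T Y (\<lambda>z. ennreal (Q z))" using dY by (simp add: Q_def n_def)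
    show "distributed M ?N (\<lambda>x. (X x, Y x)) (\<lambda>w. ennreal (J w))"
      using dXY unfolding J_def n_def case_prod_beta' .
  qed (use Qpos Ppos n in \<open>auto simp: J_def less_imp_le\<close>)
  also have "(\<integral>(s, z). J (s, z) * log b (J (s, z) / Q z) \<partial>?N) = integral\<^sup>L ?N (?L g)"
    by (intro Bochner_Integration.integral_cong refl) (auto simp: J_def g_def)
  finally show ?thesis using fin by (simp add: n_def)
qed

subsection \<open>Codes on the channel model\<close>

lemma Rn_eq: "Rn n = LI {..<n}"
  by (simp add: Rn_def LI_def)

lemma LI_shift:
  assumes "finite I"
  shows "distr (LI I) (LI I) (\<lambda>x. \<lambda>i\<in>I. c i + x i) = LI I"
proof -
  have m: "(\<lambda>x. \<lambda>i\<in>I. c i + x i) \<in> LI I \<rightarrow>\<^sub>M LI I"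
    unfolding LI_def by measurable
  have "distr (LI I) (LI I) (\<lambda>x. \<lambda>i\<in>I. c i + x i) = PiM I (\<lambda>_. lborel)"
  proof (rule lborel_prod.PiM_eqI)
    show "finite I" by fact
    show "sets (distr (LI I) (LI I) (\<lambda>x. \<lambda>i\<in>I. c i + x i)) = sets (Pi\<^sub>M I (\<lambda>_. lborel))" by (simp add: LI_def)
    fix A :: "nat \<Rightarrow> real set" assume A: "\<And>i. i \<in> I \<Longrightarrow> A i \<in> sets lborel"
    have B: "(\<lambda>x. c i + x) -` A i \<in> sets lborel" if "i \<in> I" for i
      using measurable_sets[of "\<lambda>x. c i + x" borel borel "A i"] A[OF that] by simp
    have "emeasure (distr (LI I) (LI I) (\<lambda>x. \<lambda>i\<in>I. c i + x i)) (Pi\<^sub>E I A)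
      = emeasure (LI I) ((\<lambda>x. \<lambda>i\<in>I. c i + x i) -` Pi\<^sub>E I A \<inter> space (LI I))"
      by (rule emeasure_distr[OF m]) (use assms A in \<open>auto simp: LI_def intro!: sets_PiM_I_finite\<close>)
    also have "(\<lambda>x. \<lambda>i\<in>I. c i + x i) -` Pi\<^sub>E I A \<inter> space (LI I) = Pi\<^sub>E I (\<lambda>i. (\<lambda>x. c i + x) -` A i)"
      by (auto simp: space_LI PiE_iff extensional_def)
    also have "emeasure (LI I) \<dots> = (\<Prod>i\<in>I. emeasure lborel ((\<lambda>x. c i + x) -` A i))"
      unfolding LI_def by (rule lborel_prod.emeasure_PiM) (use assms B in auto)
    also have "\<dots> = (\<Prod>i\<in>I. emeasure lborel (A i))"
    proof (rule prod.cong[OF refl])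
      fix i assume i: "i \<in> I"
      have "emeasure lborel (A i) = emeasure (distr lborel borel ((+) (c i))) (A i)"
        by (simp add: lborel_distr_plus)
      also have "\<dots> = emeasure lborel ((\<lambda>x. c i + x) -` A i)"
        using A[OF i] by (subst emeasure_distr) auto
      finally show "emeasure lborel ((\<lambda>x. c i + x) -` A i) = emeasure lborel (A i)" ..
    qed
    finally show "emeasure (distr (LI I) (LI I) (\<lambda>x. \<lambda>i\<in>I. c i + x i)) (Pi\<^sub>E I A) = (\<Prod>i\<in>I. emeasure lborel (A i))" .
  qed
  then show ?thesis by (simp add: LI_def)
qed

lemma noise_eq: "noise n = density (LI {..<n}) (\<lambda>x. ennreal (gd {..<n} 1 x))"
proof -
  let ?I = "{..<n}"
  note [measurable] = gd_measurable
  interpret P: prob_space "density lborel (\<lambda>x. ennreal (std_normal_density x))"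
    by (rule prob_space_normal_density) simp
  interpret product_sigma_finite "\<lambda>_::nat. density lborel (\<lambda>x. ennreal (std_normal_density x))" by standard
  have nd1: "nd 1 = std_normal_density" by (auto simp: nd_def)
  have "density (LI ?I) (\<lambda>x. ennreal (gd ?I 1 x)) = PiM ?I (\<lambda>_. density lborel (\<lambda>x. ennreal (std_normal_density x)))"
  proof (rule PiM_eqI)
    have "sets (LI ?I) = sets (PiM ?I (\<lambda>_. density lborel (\<lambda>x. ennreal (std_normal_density x))))"
      unfolding LI_def by (intro sets_PiM_cong) auto
    then show "sets (density (LI ?I) (\<lambda>x. ennreal (gd ?I 1 x))) = sets (Pi\<^sub>M ?I (\<lambda>_. density lborel (\<lambda>x. ennreal (std_normal_density x))))" by simp
    fix A assume A: "\<And>i. i \<in> ?I \<Longrightarrow> A i \<in> sets (density lborel (\<lambda>x. ennreal (std_normal_density x)))"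
    have As: "Pi\<^sub>E ?I A \<in> sets (LI ?I)" unfolding LI_def using A by (intro sets_PiM_I_finite) auto
    have "emeasure (density (LI ?I) (\<lambda>x. ennreal (gd ?I 1 x))) (Pi\<^sub>E ?I A) = (\<integral>\<^sup>+x. ennreal (gd ?I 1 x) * indicator (Pi\<^sub>E ?I A) x \<partial>LI ?I)"
      by (rule emeasure_density) (use As in auto)
    also have "\<dots> = (\<integral>\<^sup>+x. ennreal (\<Prod>i\<in>?I. nd 1 (x i) * indicator (A i) (x i)) \<partial>LI ?I)"
    proof (rule nn_integral_cong)
      fix x assume "x \<in> space (LI ?I)"
      then have "indicator (Pi\<^sub>E ?I A) x = (\<Prod>i\<in>?I. indicator (A i) (x i) :: real)"
        by (auto simp: indicator_def space_LI PiE_iff)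
      then have "indicator (Pi\<^sub>E ?I A) x = ennreal (\<Prod>i\<in>?I. indicator (A i) (x i) :: real)"
        by (metis ennreal_indicator)
      then show "ennreal (gd ?I 1 x) * indicator (Pi\<^sub>E ?I A) x = ennreal (\<Prod>i\<in>?I. nd 1 (x i) * indicator (A i) (x i))"
        by (simp add: gd_def prod.distrib ennreal_mult prod_nonneg)
    qed
    also have "\<dots> = (\<Prod>i\<in>?I. \<integral>\<^sup>+x. ennreal (nd 1 x * indicator (A i) x) \<partial>lborel)"
      by (rule nn_integral_LI_prod[of ?I "\<lambda>i x. nd 1 x * indicator (A i) x"]) (use A in auto)
    also have "\<dots> = (\<Prod>i\<in>?I. emeasure (density lborel (\<lambda>x. ennreal (std_normal_density x))) (A i))"
      using A by (intro prod.cong refl) (auto simp: emeasure_density nd1 ennreal_mult ennreal_indicator)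
    finally show "emeasure (density (LI ?I) (\<lambda>x. ennreal (gd ?I 1 x))) (Pi\<^sub>E ?I A) = (\<Prod>i\<in>?I. emeasure (density lborel (\<lambda>x. ennreal (std_normal_density x))) (A i))" .
  qed simp
  then show ?thesis by (simp add: noise_def)
qed

lemma noise_prob: "prob_space (noise n)"
  using gaussian_measure_prob[of "{..<n}" 1] by (simp add: noise_eq gaussian_measure_def)

lemma sets_noise [simp, measurable_cong]: "sets (noise n) = sets (LI {..<n})"
  and space_noise [simp]: "space (noise n) = space (LI {..<n})"
  by (auto simp: noise_eq)

lemma nn_integral_noise_shift:
  assumes f: "f \<in> borel_measurable (LI {..<n})"
  shows "(\<integral>\<^sup>+x. f (\<lambda>i\<in>{..<n}. c i + x i) \<partial>noise n) = (\<integral>\<^sup>+y. ennreal (gd {..<n} 1 (\<lambda>i. y i - c i)) * f y \<partial>LI {..<n})"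
proof -
  let ?I = "{..<n}" and ?S = "\<lambda>x. \<lambda>i\<in>{..<n}. c i + x i"
  note [measurable] = gd_measurable f
  have m[measurable]: "?S \<in> LI ?I \<rightarrow>\<^sub>M LI ?I" unfolding LI_def by measurable
  have g[measurable]: "(\<lambda>y. ennreal (gd ?I 1 (\<lambda>i. y i - c i)) * f y) \<in> borel_measurable (LI ?I)" by measurable
  have "(\<integral>\<^sup>+x. f (?S x) \<partial>noise n) = (\<integral>\<^sup>+x. ennreal (gd ?I 1 x) * f (?S x) \<partial>LI ?I)"
    unfolding noise_eq by (rule nn_integral_density) measurable
  also have "\<dots> = (\<integral>\<^sup>+x. ennreal (gd ?I 1 (\<lambda>i. ?S x i - c i)) * f (?S x) \<partial>LI ?I)"
    by (intro nn_integral_cong arg_cong2[where f="(*)"] arg_cong[where f=ennreal] gd_cong) auto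
  also have "\<dots> = (\<integral>\<^sup>+y. ennreal (gd ?I 1 (\<lambda>i. y i - c i)) * f y \<partial>distr (LI ?I) (LI ?I) ?S)"
    by (rule nn_integral_distr[symmetric, OF m]) (use g in simp)
  also have "\<dots> = (\<integral>\<^sup>+y. ennreal (gd ?I 1 (\<lambda>i. y i - c i)) * f y \<partial>LI ?I)"
    by (simp add: LI_shift)
  finally show ?thesis .
qed

lemma nn_integral_pair_return:
  assumes f: "f \<in> borel_measurable ((A \<Otimes>\<^sub>M B) \<Otimes>\<^sub>M C)" and a: "a \<in> space A" and b: "b \<in> space B" and C: "sigma_finite_measure C"
  shows "(\<integral>\<^sup>+v. f v \<partial>((return A a \<Otimes>\<^sub>M return B b) \<Otimes>\<^sub>M C)) = (\<integral>\<^sup>+c. f ((a, b), c) \<partial>C)"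
proof -
  interpret C: sigma_finite_measure C by fact
  interpret RA: prob_space "return A a" by (rule prob_space_return[OF a])
  interpret RB: prob_space "return B b" by (rule prob_space_return[OF b])
  have s: "sets ((return A a \<Otimes>\<^sub>M return B b) \<Otimes>\<^sub>M C) = sets ((A \<Otimes>\<^sub>M B) \<Otimes>\<^sub>M C)"
    by (intro sets_pair_measure_cong) auto
  have f': "f \<in> borel_measurable ((return A a \<Otimes>\<^sub>M return B b) \<Otimes>\<^sub>M C)"
    using f by (subst measurable_cong_sets[OF s refl])
  have g: "(\<lambda>p. \<integral>\<^sup>+c. f (p, c) \<partial>C) \<in> borel_measurable (A \<Otimes>\<^sub>M B)"
    by (rule C.borel_measurable_nn_integral_fst[OF f])
  then have g': "(\<lambda>p. \<integral>\<^sup>+c. f (p, c) \<partial>C) \<in> borel_measurable (return A a \<Otimes>\<^sub>M return B b)"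
    by (subst measurable_cong_sets[OF sets_pair_measure_cong refl]) auto
  have "(\<integral>\<^sup>+v. f v \<partial>((return A a \<Otimes>\<^sub>M return B b) \<Otimes>\<^sub>M C)) = (\<integral>\<^sup>+p. \<integral>\<^sup>+c. f (p, c) \<partial>C \<partial>(return A a \<Otimes>\<^sub>M return B b))"
    by (rule C.nn_integral_fst[symmetric, OF f'])
  also have "\<dots> = (\<integral>\<^sup>+x. \<integral>\<^sup>+y. \<integral>\<^sup>+c. f ((x, y), c) \<partial>C \<partial>return B b \<partial>return A a)"
    by (rule RB.nn_integral_fst[symmetric, OF g'])
  also have "\<dots> = (\<integral>\<^sup>+x. \<integral>\<^sup>+c. f ((x, b), c) \<partial>C \<partial>return A a)"
  proof (intro nn_integral_cong nn_integral_return[OF b])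
    fix x assume "x \<in> space (return A a)"
    then have "x \<in> space A" by simp
    then show "(\<lambda>y. \<integral>\<^sup>+c. f ((x, y), c) \<partial>C) \<in> borel_measurable B"
      using measurable_compose[OF measurable_Pair1' g] by simp
  qed
  also have "\<dots> = (\<integral>\<^sup>+c. f ((a, b), c) \<partial>C)"
  proof (rule nn_integral_return[OF a])
    show "(\<lambda>x. \<integral>\<^sup>+c. f ((x, b), c) \<partial>C) \<in> borel_measurable A"
      using measurable_compose[OF measurable_Pair2'[OF b] g] by simp
  qed
  finally show ?thesis .
qed

text \<open>With point masses as encoders the outcome is a uniform mixture, over the messages, of
  fixed codewords joined with the three noises. Error probability and the law of the eavesdropper's
  output are read off from this integral formula.\<close>

lemma gtw_joint_deterministic:
  fixes c1 c2 :: "nat \<Rightarrow> nat \<Rightarrow> nat \<Rightarrow> real"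
  assumes c: "\<And>s k. c1 s k \<in> space (Rn n)" "\<And>s k. c2 s k \<in> space (Rn n)" and pos: "0 < M1" "0 < O1" "0 < M2" "0 < O2"
  defines "G \<equiv> gtw_joint n M1 O1 M2 O2 (\<lambda>s k. return (Rn n) (c1 s k)) (\<lambda>s k. return (Rn n) (c2 s k))"
  shows "prob_space G" "sets G = sets (outcome_space n)"
    "f \<in> borel_measurable (outcome_space n) \<Longrightarrow> (\<integral>\<^sup>+\<omega>. f \<omega> \<partial>G) =
      (\<Sum>w\<in>msg_set M1 O1 M2 O2. \<integral>\<^sup>+v. f (w, (c1 (fst (fst w)) (snd (fst w)), c2 (fst (snd w)) (snd (snd w))), v) \<partial>(noise n \<Otimes>\<^sub>M noise n \<Otimes>\<^sub>M noise n))
        / of_nat (card (msg_set M1 O1 M2 O2))"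
proof -
  let ?W = "msg_set M1 O1 M2 O2" and ?N = "noise n \<Otimes>\<^sub>M noise n \<Otimes>\<^sub>M noise n"
  have W: "finite ?W" "?W \<noteq> {}" using pos by (auto simp: msg_set_def)
  interpret N1: prob_space "noise n" by (rule noise_prob)
  interpret N2: pair_prob_space "noise n" "noise n" by standard
  interpret N3: pair_prob_space "noise n" "noise n \<Otimes>\<^sub>M noise n" by standard
  let ?R = "\<lambda>w. return (Rn n) (c1 (fst (fst w)) (snd (fst w))) \<Otimes>\<^sub>M return (Rn n) (c2 (fst (snd w)) (snd (snd w)))"
  let ?K = "\<lambda>w. distr (?R w \<Otimes>\<^sub>M ?N) (outcome_space n) (\<lambda>v. (w, v))"
  have sv: "sets (?R w \<Otimes>\<^sub>M ?N) = sets ((Rn n \<Otimes>\<^sub>M Rn n) \<Otimes>\<^sub>M (Rn n \<Otimes>\<^sub>M Rn n \<Otimes>\<^sub>M Rn n))" for w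
    by (intro sets_pair_measure_cong) (auto simp: Rn_eq)
  have pm: "(\<lambda>v. (w, v)) \<in> (?R w \<Otimes>\<^sub>M ?N) \<rightarrow>\<^sub>M outcome_space n" for w
    unfolding measurable_cong_sets[OF sv refl] outcome_space_def by measurable
  have pR: "prob_space (?R w \<Otimes>\<^sub>M ?N)" for w
  proof -
    interpret a: prob_space "return (Rn n) (c1 (fst (fst w)) (snd (fst w)))" by (rule prob_space_return[OF c(1)])
    interpret b: prob_space "return (Rn n) (c2 (fst (snd w)) (snd (snd w)))" by (rule prob_space_return[OF c(2)])
    interpret ab: pair_prob_space "return (Rn n) (c1 (fst (fst w)) (snd (fst w)))" "return (Rn n) (c2 (fst (snd w)) (snd (snd w)))" by standard
    interpret abN: pair_prob_space "?R w" ?N by standard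
    show ?thesis by (rule abN.prob_space_axioms)
  qed
  have pK: "prob_space (?K w)" for w by (rule prob_space.prob_space_distr[OF pR pm])
  have Km: "?K \<in> measure_pmf (pmf_of_set ?W) \<rightarrow>\<^sub>M subprob_algebra (outcome_space n)"
    using pK by (auto simp: space_subprob_algebra intro: prob_space_imp_subprob_space)
  have G: "G = measure_pmf (pmf_of_set ?W) \<bind> ?K" by (simp add: G_def gtw_joint_def)
  show "prob_space G" unfolding G
    by (rule prob_space.prob_space_bind[OF measure_pmf.prob_space_axioms _ Km]) (use pK in auto)
  show "sets G = sets (outcome_space n)" unfolding G by (rule sets_bind) auto
  assume f: "f \<in> borel_measurable (outcome_space n)"
  have "(\<integral>\<^sup>+\<omega>. f \<omega> \<partial>G) = (\<integral>\<^sup>+w. \<integral>\<^sup>+\<omega>. f \<omega> \<partial>?K w \<partial>measure_pmf (pmf_of_set ?W))"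
    unfolding G by (rule nn_integral_bind[OF f Km])
  also have "\<dots> = (\<Sum>w\<in>?W. \<integral>\<^sup>+\<omega>. f \<omega> \<partial>?K w) / of_nat (card ?W)"
    using W by (simp add: nn_integral_pmf_of_set)
  also have "(\<Sum>w\<in>?W. \<integral>\<^sup>+\<omega>. f \<omega> \<partial>?K w) = (\<Sum>w\<in>?W. \<integral>\<^sup>+v. f (w, (c1 (fst (fst w)) (snd (fst w)), c2 (fst (snd w)) (snd (snd w))), v) \<partial>?N)"
  proof (rule sum.cong[OF refl])
    fix w
    have fm: "(\<lambda>v. f (w, v)) \<in> borel_measurable ((Rn n \<Otimes>\<^sub>M Rn n) \<Otimes>\<^sub>M ?N)"
    proof -
      have "(\<lambda>v. f (w, v)) \<in> borel_measurable (?R w \<Otimes>\<^sub>M ?N)"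
        by (rule measurable_compose[OF pm f])
      then show ?thesis
        by (subst (asm) measurable_cong_sets[OF sets_pair_measure_cong[OF sets_pair_measure_cong refl] refl]) auto
    qed
    have "(\<integral>\<^sup>+\<omega>. f \<omega> \<partial>?K w) = (\<integral>\<^sup>+v. f (w, v) \<partial>(?R w \<Otimes>\<^sub>M ?N))"
      by (rule nn_integral_distr[OF pm]) (use f in simp)
    also have "\<dots> = (\<integral>\<^sup>+v. f (w, (c1 (fst (fst w)) (snd (fst w)), c2 (fst (snd w)) (snd (snd w))), v) \<partial>?N)"
      by (rule nn_integral_pair_return[OF fm c(1) c(2)]) (rule N3.sigma_finite_measure_axioms)
    finally show "(\<integral>\<^sup>+\<omega>. f \<omega> \<partial>?K w) = (\<integral>\<^sup>+v. f (w, (c1 (fst (fst w)) (snd (fst w)), c2 (fst (snd w)) (snd (snd w))), v) \<partial>?N)" .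
  qed
  finally show "(\<integral>\<^sup>+\<omega>. f \<omega> \<partial>G) = (\<Sum>w\<in>?W. \<integral>\<^sup>+v. f (w, (c1 (fst (fst w)) (snd (fst w)), c2 (fst (snd w)) (snd (snd w))), v) \<partial>?N) / of_nat (card ?W)" .
qed

lemma nn_integral_pair_component:
  assumes "prob_space A" "prob_space B"
  shows "f \<in> borel_measurable A \<Longrightarrow> (\<integral>\<^sup>+v. f (fst v) \<partial>(A \<Otimes>\<^sub>M B)) = (\<integral>\<^sup>+x. f x \<partial>A)"
    and "g \<in> borel_measurable B \<Longrightarrow> (\<integral>\<^sup>+v. g (snd v) \<partial>(A \<Otimes>\<^sub>M B)) = (\<integral>\<^sup>+x. g x \<partial>B)"
proof -
  interpret A: prob_space A by fact
  interpret B: prob_space B by fact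
  show "(\<integral>\<^sup>+v. f (fst v) \<partial>(A \<Otimes>\<^sub>M B)) = (\<integral>\<^sup>+x. f x \<partial>A)" if f: "f \<in> borel_measurable A"
    using B.nn_integral_fst[OF measurable_compose[OF measurable_fst f]] by (simp add: B.emeasure_space_1)
  show "(\<integral>\<^sup>+v. g (snd v) \<partial>(A \<Otimes>\<^sub>M B)) = (\<integral>\<^sup>+x. g x \<partial>B)" if g: "g \<in> borel_measurable B"
    using B.nn_integral_fst[OF measurable_compose[OF measurable_snd[of A B] g]] by (simp add: A.emeasure_space_1)
qed

lemma nn_integral_noise_components:
  assumes f: "f \<in> borel_measurable (noise n)"
  defines "N \<equiv> noise n \<Otimes>\<^sub>M noise n \<Otimes>\<^sub>M noise n"
  shows "(\<integral>\<^sup>+v. f (fst v) \<partial>N) = (\<integral>\<^sup>+x. f x \<partial>noise n)" "(\<integral>\<^sup>+v. f (fst (snd v)) \<partial>N) = (\<integral>\<^sup>+x. f x \<partial>noise n)"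
    "(\<integral>\<^sup>+v. f (snd (snd v)) \<partial>N) = (\<integral>\<^sup>+x. f x \<partial>noise n)"
proof -
  interpret a: prob_space "noise n" by (rule noise_prob)
  interpret p: pair_prob_space "noise n" "noise n" by standard
  note 1 = nn_integral_pair_component[OF a.prob_space_axioms a.prob_space_axioms]
  note 2 = nn_integral_pair_component[OF a.prob_space_axioms p.prob_space_axioms]
  show "(\<integral>\<^sup>+v. f (fst v) \<partial>N) = (\<integral>\<^sup>+x. f x \<partial>noise n)"
    unfolding N_def by (rule 2(1)[OF f])
  show "(\<integral>\<^sup>+v. f (fst (snd v)) \<partial>N) = (\<integral>\<^sup>+x. f x \<partial>noise n)"
    unfolding N_def using 2(2)[OF measurable_compose[OF measurable_fst f]] 1(1)[OF f] by simp
  show "(\<integral>\<^sup>+v. f (snd (snd v)) \<partial>N) = (\<integral>\<^sup>+x. f x \<partial>noise n)"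
    unfolding N_def using 2(2)[OF measurable_compose[OF measurable_snd f]] 1(2)[OF f] by simp
qed

lemma distributed_by_indicators:
  assumes h: "h \<in> M \<rightarrow>\<^sub>M N" and f: "f \<in> borel_measurable N"
    and eq: "\<And>A. A \<in> sets N \<Longrightarrow> (\<integral>\<^sup>+x. indicator A (h x) \<partial>M) = (\<integral>\<^sup>+y. f y * indicator A y \<partial>N)"
  shows "distributed M N h f"
  unfolding distributed_def
proof (intro conjI measure_eqI)
  fix A assume "A \<in> sets (distr M N h)"
  then have A: "A \<in> sets N" by simp
  have "emeasure (distr M N h) A = (\<integral>\<^sup>+y. indicator A y \<partial>distr M N h)" using A by simp
  also have "\<dots> = (\<integral>\<^sup>+x. indicator A (h x) \<partial>M)" by (rule nn_integral_distr[OF h]) (use A in simp)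
  also have "\<dots> = emeasure (density N f) A" using eq[OF A] A f by (simp add: emeasure_density)
  finally show "emeasure (distr M N h) A = emeasure (density N f) A" .
qed (use h f in auto)

lemma Wsec_of_measurable: "Wsec_of \<in> outcome_space n \<rightarrow>\<^sub>M count_space UNIV"
  unfolding Wsec_of_def[abs_def] outcome_space_def
  by (rule measurable_compose[OF measurable_fst]) simp

lemma Z_of_measurable: "Z_of n h1 h2 \<in> outcome_space n \<rightarrow>\<^sub>M LI {..<n}"
proof -
  have "Z_of n h1 h2 = (\<lambda>\<omega>. \<lambda>i\<in>{..<n}. sqrt h1 * fst (fst (snd \<omega>)) i + sqrt h2 * snd (fst (snd \<omega>)) i + snd (snd (snd (snd \<omega>))) i)"
    by (auto simp: Z_of_def case_prod_beta')
  moreover have "\<dots> \<in> outcome_space n \<rightarrow>\<^sub>M LI {..<n}"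
  proof -
    have c: "(\<lambda>\<omega>. f \<omega> i) \<in> borel_measurable (outcome_space n)" if "f \<in> outcome_space n \<rightarrow>\<^sub>M LI {..<n}" "i \<in> {..<n}" for f i
      using that(1) component_LI[OF that(2)] by (rule measurable_compose)
    have f: "(\<lambda>\<omega>. fst (fst (snd \<omega>))) \<in> outcome_space n \<rightarrow>\<^sub>M LI {..<n}" "(\<lambda>\<omega>. snd (fst (snd \<omega>))) \<in> outcome_space n \<rightarrow>\<^sub>M LI {..<n}"
      "(\<lambda>\<omega>. snd (snd (snd (snd \<omega>)))) \<in> outcome_space n \<rightarrow>\<^sub>M LI {..<n}"
      unfolding outcome_space_def Rn_eq by measurable
    have "(\<lambda>\<omega>. \<lambda>i\<in>{..<n}. sqrt h1 * fst (fst (snd \<omega>)) i + sqrt h2 * snd (fst (snd \<omega>)) i + snd (snd (snd (snd \<omega>))) i) \<in> outcome_space n \<rightarrow>\<^sub>M PiM {..<n} (\<lambda>_. lborel)"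
      by (rule measurable_restrict) (use c[OF f(1)] c[OF f(2)] c[OF f(3)] in \<open>simp add: borel_measurable_add borel_measurable_times\<close>)
    then show ?thesis by (simp add: LI_def)
  qed
  ultimately show ?thesis by simp
qed

text \<open>Passage from codes to the channel model. The factor 2 is the union bound over the two
  terminals; the nonnegative entropy is recorded because a relative tolerance can be enlarged only
  against a nonnegative quantity.\<close>

lemma wiretap_code_achieves:
  assumes g: "wiretap_code {..<n} Pb1 Pb2 h1 h2 \<epsilon> M1 O1 M2 O2" and n: "0 < n" and Pb: "0 < Pb1" "0 < Pb2" and eps: "0 \<le> \<epsilon>"
  shows "\<exists>enc1 enc2 dec1 dec2. valid_encoder n Pb1 enc1 \<and> valid_encoder n Pb2 enc2 \<and>
        valid_decoder n dec1 \<and> valid_decoder n dec2 \<and>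
        (let M = gtw_joint n M1 O1 M2 O2 enc1 enc2 in
           measure M {\<omega> \<in> space M. decoding_error n a1 a2 dec1 dec2 \<omega>} \<le> 2 * \<epsilon> \<and>
           prob_space.conditional_entropy M 2 (count_space UNIV) (Rn n) Wsec_of (Z_of n h1 h2)
             \<ge> (1 - \<epsilon>) * prob_space.entropy M 2 (count_space UNIV) Wsec_of \<and>
           0 \<le> prob_space.entropy M 2 (count_space UNIV) Wsec_of)"
  using g
proof (rule wiretap_codeE)
  let ?I = "{..<n}"
  fix x1 x2 :: "nat \<times> nat \<Rightarrow> nat \<Rightarrow> real" and D1 D2 :: "(nat \<Rightarrow> real) \<Rightarrow> nat \<times> nat" and q :: "(nat \<Rightarrow> real) \<Rightarrow> real"
  assume pos: "0 < M1" "0 < O1" "0 < M2" "0 < O2"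
    and pw1: "\<forall>m\<in>{..<M1} \<times> {..<O1}. (\<Sum>i\<in>?I. (x1 m i)\<^sup>2) \<le> real (card ?I) * Pb1"
    and pw2: "\<forall>m\<in>{..<M2} \<times> {..<O2}. (\<Sum>i\<in>?I. (x2 m i)\<^sup>2) \<le> real (card ?I) * Pb2"
    and D: "D1 \<in> LI ?I \<rightarrow>\<^sub>M count_space UNIV" "D2 \<in> LI ?I \<rightarrow>\<^sub>M count_space UNIV"
    and d1: "avg_error ?I ({..<M1} \<times> {..<O1}) x1 D1 \<le> ennreal \<epsilon>" and d2: "avg_error ?I ({..<M2} \<times> {..<O2}) x2 D2 \<le> ennreal \<epsilon>"
    and q: "q \<in> borel_measurable (LI ?I)" "\<And>z. 0 < q z" "(\<integral>\<^sup>+z. ennreal (q z) \<partial>LI ?I) \<le> 1"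
    and lk: "leak ?I h1 h2 M1 O1 M2 O2 x1 x2 q \<le> ennreal (\<epsilon> * ln (real M1 * real M2))"
  let ?K1 = "{..<M1} \<times> {..<O1}" and ?K2 = "{..<M2} \<times> {..<O2}"
  \<comment> \<open>A valid encoder must obey the power limit for all indices, also outside the
    message sets, where the zero word serves. The restriction makes the words extensional, hence
    elements of the space of \<open>Rn n\<close>.\<close>
  define cw where "cw K x s k = (\<lambda>i\<in>?I. if (s, k) \<in> K then x (s, k) i else 0)" for K :: "(nat \<times> nat) set" and x :: "nat \<times> nat \<Rightarrow> nat \<Rightarrow> real" and s k
  define c1 where "c1 = cw ?K1 x1"
  define c2 where "c2 = cw ?K2 x2"
  have csp: "c1 s k \<in> space (Rn n)" "c2 s k \<in> space (Rn n)" for s k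
    by (auto simp: c1_def c2_def cw_def Rn_eq space_LI)
  have c_eq: "i \<in> ?I \<Longrightarrow> (s, k) \<in> ?K1 \<Longrightarrow> c1 s k i = x1 (s, k) i" "i \<in> ?I \<Longrightarrow> (s, k) \<in> ?K2 \<Longrightarrow> c2 s k i = x2 (s, k) i" for s k i
    by (simp_all add: c1_def c2_def cw_def)
  define enc1 where "enc1 s k = return (Rn n) (c1 s k)" for s k
  define enc2 where "enc2 s k = return (Rn n) (c2 s k)" for s k
  \<comment> \<open>A terminal subtracts its own codeword with its gain and applies the decoder for
    the codebook of the other terminal: \<open>D2\<close> at terminal 1 and \<open>D1\<close> at
    terminal 2.\<close>
  define dec where "dec a D' (s::nat) (k::nat) x y = D' (\<lambda>i\<in>?I. y i - sqrt a * x i)" for a and D' :: "(nat \<Rightarrow> real) \<Rightarrow> nat \<times> nat" and s k and x y :: "nat \<Rightarrow> real"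
  have venc: "valid_encoder n Pb (\<lambda>s k. return (Rn n) (cw K x s k))"
    if pw: "\<forall>m\<in>K. (\<Sum>i\<in>?I. (x m i)\<^sup>2) \<le> real (card ?I) * Pb" and Pb: "0 < Pb" for K x Pb
    unfolding valid_encoder_def
  proof (intro allI conjI)
    fix s k
    have sp: "cw K x s k \<in> space (Rn n)" by (auto simp: cw_def Rn_eq space_LI)
    show "prob_space (return (Rn n) (cw K x s k))" by (rule prob_space_return[OF sp])
    show "sets (return (Rn n) (cw K x s k)) = sets (Rn n)" by simp
    have m: "Measurable.pred (Rn n) (\<lambda>x. 1 / real n * (\<Sum>i<n. (x i)\<^sup>2) \<le> Pb)"
      unfolding Rn_eq by measurable
    have "(\<Sum>i<n. (cw K x s k i)\<^sup>2) \<le> real n * Pb"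
      using pw Pb by (cases "(s, k) \<in> K") (auto simp: cw_def)
    then have "1 / real n * (\<Sum>i<n. (cw K x s k i)\<^sup>2) \<le> Pb"
      using n by (simp add: field_simps)
    then show "AE y in return (Rn n) (cw K x s k). 1 / real n * (\<Sum>i<n. (y i)\<^sup>2) \<le> Pb"
      by (subst AE_return[OF sp m])
  qed
  have vdec: "valid_decoder n (dec a D')" if D': "D' \<in> LI ?I \<rightarrow>\<^sub>M count_space UNIV" for a D'
    unfolding valid_decoder_def
  proof (intro allI)
    fix s k
    have "(\<lambda>(x, y). \<lambda>i\<in>?I. y i - sqrt a * x i) \<in> LI ?I \<Otimes>\<^sub>M LI ?I \<rightarrow>\<^sub>M PiM ?I (\<lambda>_. lborel)"
      unfolding case_prod_beta'
      by (rule measurable_restrict)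
         (simp, intro borel_measurable_diff borel_measurable_times borel_measurable_const
            measurable_compose[OF measurable_fst component_LI] measurable_compose[OF measurable_snd component_LI]; simp)
    then have "(\<lambda>(x, y). \<lambda>i\<in>?I. y i - sqrt a * x i) \<in> Rn n \<Otimes>\<^sub>M Rn n \<rightarrow>\<^sub>M LI ?I" by (simp add: Rn_eq LI_def)
    from measurable_compose[OF this D'] show "(\<lambda>(x, y). dec a D' s k x y) \<in> Rn n \<Otimes>\<^sub>M Rn n \<rightarrow>\<^sub>M count_space UNIV"
      by (simp add: dec_def case_prod_beta')
  qed
  define G where "G = gtw_joint n M1 O1 M2 O2 enc1 enc2"
  have G_eq: "G = gtw_joint n M1 O1 M2 O2 (\<lambda>s k. return (Rn n) (c1 s k)) (\<lambda>s k. return (Rn n) (c2 s k))"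
    by (simp add: G_def enc1_def[abs_def] enc2_def[abs_def])
  note joint = gtw_joint_deterministic[where ?c1.0 = c1 and ?c2.0 = c2, OF csp pos, folded G_eq]
  interpret G: prob_space G by (rule joint(1))
  interpret info: information_space G 2 by standard simp
  let ?W = "msg_set M1 O1 M2 O2" and ?N = "noise n \<Otimes>\<^sub>M noise n \<Otimes>\<^sub>M noise n"
  have cardW: "card ?W = card ?K1 * card ?K2" by (simp add: msg_set_def card_cartesian_product)
  have divW: "x / of_nat (card ?W) = ennreal (1 / (real (card ?K1) * real (card ?K2))) * x" for x
  proof -
    have "real (card ?K1 * card ?K2) > 0" using pos by (simp add: card_cartesian_product)
    then show ?thesis
      unfolding cardW divide_ennreal_def ennreal_of_nat_eq_real_of_nat
      by (subst inverse_ennreal) (simp_all add: inverse_eq_divide mult.commute)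
  qed
  have sumW: "(\<Sum>w\<in>?W. f (fst w) (snd w)) = (\<Sum>m\<in>?K1. \<Sum>m'\<in>?K2. f m m')" for f :: "_ \<Rightarrow> _ \<Rightarrow> ennreal"
    by (simp add: msg_set_def sum.cartesian_product case_prod_beta')
  have err: "measure G {\<omega> \<in> space G. decoding_error n a1 a2 (dec a1 D2) (dec a2 D1) \<omega>} \<le> 2 * \<epsilon>"
  proof (cases "{\<omega> \<in> space G. decoding_error n a1 a2 (dec a1 D2) (dec a2 D1) \<omega>} \<in> sets G")
    case True
    let ?A = "{\<omega> \<in> space G. decoding_error n a1 a2 (dec a1 D2) (dec a2 D1) \<omega>}"
    let ?e1 = "\<lambda>m. \<integral>\<^sup>+y. ennreal (gd ?I 1 (\<lambda>i. y i - x1 m i)) * indicator {y. D1 y \<noteq> m} y \<partial>LI ?I"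
    let ?e2 = "\<lambda>m. \<integral>\<^sup>+y. ennreal (gd ?I 1 (\<lambda>i. y i - x2 m i)) * indicator {y. D2 y \<noteq> m} y \<partial>LI ?I"
    have each: "(\<integral>\<^sup>+v. indicator ?A (w, (c1 (fst (fst w)) (snd (fst w)), c2 (fst (snd w)) (snd (snd w))), v) \<partial>?N) \<le> ?e1 (fst w) + ?e2 (snd w)"
      if w: "w \<in> ?W" for w
    proof -
      obtain s1 o1 s2 o2 where w_eq: "w = ((s1, o1), (s2, o2))" by (metis surj_pair)
      have in1: "(s1, o1) \<in> ?K1" and in2: "(s2, o2) \<in> ?K2" using w by (auto simp: w_eq msg_set_def)
      let ?f1 = "\<lambda>y. indicator {y. D1 y \<noteq> (s1, o1)} (\<lambda>i\<in>?I. c1 s1 o1 i + y i) :: ennreal"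
      let ?f2 = "\<lambda>y. indicator {y. D2 y \<noteq> (s2, o2)} (\<lambda>i\<in>?I. c2 s2 o2 i + y i) :: ennreal"
      have sh: "(\<lambda>y. \<lambda>i\<in>?I. c i + y i) \<in> noise n \<rightarrow>\<^sub>M LI ?I" for c
        unfolding measurable_cong_sets[OF sets_noise refl] unfolding LI_def by measurable
      have m1: "?f1 \<in> borel_measurable (noise n)" and m2: "?f2 \<in> borel_measurable (noise n)"
        by (rule measurable_compose[OF sh indicator_neq_measurable[OF D(1)]] measurable_compose[OF sh indicator_neq_measurable[OF D(2)]])+
      have "(\<integral>\<^sup>+v. indicator ?A (w, (c1 (fst (fst w)) (snd (fst w)), c2 (fst (snd w)) (snd (snd w))), v) \<partial>?N)
        \<le> (\<integral>\<^sup>+v. ?f2 (fst v) + ?f1 (fst (snd v)) \<partial>?N)"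
      proof (rule nn_integral_mono)
        fix v :: "(nat \<Rightarrow> real) \<times> (nat \<Rightarrow> real) \<times> (nat \<Rightarrow> real)"
        obtain n1 n2 nw where v: "v = (n1, n2, nw)" by (metis surj_pair)
        have y1: "(\<lambda>i\<in>?I. Y1_of n a1 (w, (c1 s1 o1, c2 s2 o2), v) i - sqrt a1 * c1 s1 o1 i) = (\<lambda>i\<in>?I. c2 s2 o2 i + n1 i)"
          by (rule restrict_ext) (simp add: Y1_of_def v)
        have y2: "(\<lambda>i\<in>?I. Y2_of n a2 (w, (c1 s1 o1, c2 s2 o2), v) i - sqrt a2 * c2 s2 o2 i) = (\<lambda>i\<in>?I. c1 s1 o1 i + n2 i)"
          by (rule restrict_ext) (simp add: Y2_of_def v)
        have "decoding_error n a1 a2 (dec a1 D2) (dec a2 D1) (w, (c1 s1 o1, c2 s2 o2), v) \<longleftrightarrow>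
          D2 (\<lambda>i\<in>?I. c2 s2 o2 i + n1 i) \<noteq> (s2, o2) \<or> D1 (\<lambda>i\<in>?I. c1 s1 o1 i + n2 i) \<noteq> (s1, o1)"
          unfolding y1[symmetric] y2[symmetric] decoding_error_def dec_def by (simp add: w_eq)
        then show "indicator ?A (w, (c1 (fst (fst w)) (snd (fst w)), c2 (fst (snd w)) (snd (snd w))), v) \<le> ?f2 (fst v) + ?f1 (fst (snd v))"
          by (auto simp: indicator_def w_eq v)
      qed
      also have "\<dots> = (\<integral>\<^sup>+y. ?f2 y \<partial>noise n) + (\<integral>\<^sup>+y. ?f1 y \<partial>noise n)"
        using nn_integral_noise_components[OF m2] nn_integral_noise_components[OF m1]
        by (subst nn_integral_add) (auto intro: measurable_compose[OF measurable_fst m2]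
            measurable_compose[OF measurable_compose[OF measurable_snd measurable_fst] m1])
      also have "(\<integral>\<^sup>+y. ?f2 y \<partial>noise n) = ?e2 (snd w)"
      proof -
        have "gd ?I 1 (\<lambda>i. y i - c2 s2 o2 i) = gd ?I 1 (\<lambda>i. y i - x2 (s2, o2) i)" for y
          by (intro gd_cong) (simp add: c_eq(2)[OF _ in2])
        then show ?thesis
          by (subst nn_integral_noise_shift[OF indicator_neq_measurable[OF D(2)]]) (simp add: w_eq)
      qed
      also have "(\<integral>\<^sup>+y. ?f1 y \<partial>noise n) = ?e1 (fst w)"
      proof -
        have "gd ?I 1 (\<lambda>i. y i - c1 s1 o1 i) = gd ?I 1 (\<lambda>i. y i - x1 (s1, o1) i)" for y
          by (intro gd_cong) (simp add: c_eq(1)[OF _ in1])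
        then show ?thesis
          by (subst nn_integral_noise_shift[OF indicator_neq_measurable[OF D(1)]]) (simp add: w_eq)
      qed
      finally show ?thesis by (simp only: add.commute)
    qed
    have "emeasure G ?A = (\<integral>\<^sup>+\<omega>. indicator ?A \<omega> \<partial>G)" using True by simp
    also have "\<dots> = (\<Sum>w\<in>?W. \<integral>\<^sup>+v. indicator ?A (w, (c1 (fst (fst w)) (snd (fst w)), c2 (fst (snd w)) (snd (snd w))), v) \<partial>?N) / of_nat (card ?W)"
      by (rule joint(3)) (use True joint(2) in simp)
    also have "\<dots> \<le> (\<Sum>w\<in>?W. ?e1 (fst w) + ?e2 (snd w)) / of_nat (card ?W)"
      by (intro divide_right_mono_ennreal sum_mono each)
    also have "\<dots> = (\<Sum>m\<in>?K1. \<Sum>m'\<in>?K2. ennreal (1 / (real (card ?K1) * real (card ?K2))) * (?e1 m + ?e2 m'))"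
      unfolding divW sumW[of "\<lambda>m m'. ?e1 m + ?e2 m'"] by (simp only: sum_distrib_left)
    also have "\<dots> = avg_error ?I ?K1 x1 D1 + avg_error ?I ?K2 x2 D2"
      unfolding avg_error_def using pos by (intro ennreal_average_add) auto
    also have "\<dots> \<le> ennreal \<epsilon> + ennreal \<epsilon>" by (intro add_mono d1 d2)
    also have "\<dots> = ennreal (2 * \<epsilon>)" using eps by (simp add: ennreal_plus[symmetric] del: ennreal_plus)
    finally show ?thesis using eps by (simp add: G.emeasure_eq_measure)
  next
    \<comment> \<open>\<open>measure\<close> is 0 on sets that are not measurable, so the bound
      holds without a proof that the error event is measurable.\<close>
    case False
    then show ?thesis using eps by (simp add: measure_notin_sets)
  qed
  let ?S = "{..<M1} \<times> {..<M2}"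
  define P where "P s = output_density ?I h1 h2 O1 O2 (\<lambda>a. x1 (fst s, a)) (\<lambda>b. x2 (snd s, b))" for s
  have Pm[measurable]: "P s \<in> borel_measurable (LI ?I)" for s unfolding P_def by measurable
  have Ppos: "0 < P s z" for s z unfolding P_def using pos by (intro output_density_pos)
  have P1: "(\<integral>\<^sup>+z. ennreal (P s z) \<partial>LI ?I) = 1" for s unfolding P_def using pos by (intro nn_integral_output_density) auto
  have cS: "real (card ?S) = real M1 * real M2" by (simp add: card_cartesian_product)
  have Wm: "Wsec_of \<in> G \<rightarrow>\<^sub>M count_space UNIV" and Zm: "Z_of n h1 h2 \<in> G \<rightarrow>\<^sub>M LI ?I"
    unfolding measurable_cong_sets[OF joint(2) refl] by (rule Wsec_of_measurable Z_of_measurable)+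
  \<comment> \<open>The joint law of secrets and eavesdropper output: uniform secrets, and density
    \<open>P s\<close> given the secrets, since averaging over the open messages produces
    \<open>output_density\<close>. It is stated for arbitrary \<open>g\<close> so that the three
    \<open>distributed\<close> facts follow by inserting indicators.\<close>
  have law: "(\<integral>\<^sup>+\<omega>. g (Wsec_of \<omega>) (Z_of n h1 h2 \<omega>) \<partial>G) =
      (\<Sum>s\<in>?S. ennreal (1 / real (card ?S)) * (\<integral>\<^sup>+z. ennreal (P s z) * g s z \<partial>LI ?I))"
    if gm: "\<And>s. g s \<in> borel_measurable (LI ?I)" for g :: "nat \<times> nat \<Rightarrow> (nat \<Rightarrow> real) \<Rightarrow> ennreal"
  proof -
    let ?ch = "\<lambda>m m' z. channel_density ?I h1 h2 (x1 m) (x2 m') z"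
    have ch0: "0 \<le> ?ch m m' z" for m m' z using channel_density_pos less_imp_le by blast
    have fm: "(\<lambda>\<omega>. g (Wsec_of \<omega>) (Z_of n h1 h2 \<omega>)) \<in> borel_measurable (outcome_space n)"
      by (rule measurable_compose_countable[OF _ Wsec_of_measurable]) (rule measurable_compose[OF Z_of_measurable gm])
    have each: "(\<integral>\<^sup>+v. g (Wsec_of (w, (c1 (fst (fst w)) (snd (fst w)), c2 (fst (snd w)) (snd (snd w))), v))
          (Z_of n h1 h2 (w, (c1 (fst (fst w)) (snd (fst w)), c2 (fst (snd w)) (snd (snd w))), v)) \<partial>?N)
        = (\<integral>\<^sup>+z. ennreal (?ch (fst w) (snd w) z) * g (fst (fst w), fst (snd w)) z \<partial>LI ?I)" if w: "w \<in> ?W" for w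
    proof -
      obtain s1 o1 s2 o2 where w_eq: "w = ((s1, o1), (s2, o2))" by (metis surj_pair)
      have in1: "(s1, o1) \<in> ?K1" and in2: "(s2, o2) \<in> ?K2" using w by (auto simp: w_eq msg_set_def)
      let ?c = "\<lambda>i. sqrt h1 * c1 s1 o1 i + sqrt h2 * c2 s2 o2 i"
      have sh: "(\<lambda>y. \<lambda>i\<in>?I. c i + y i) \<in> noise n \<rightarrow>\<^sub>M LI ?I" for c
        unfolding measurable_cong_sets[OF sets_noise refl] unfolding LI_def by measurable
      have "(\<integral>\<^sup>+v. g (Wsec_of (w, (c1 (fst (fst w)) (snd (fst w)), c2 (fst (snd w)) (snd (snd w))), v))
          (Z_of n h1 h2 (w, (c1 (fst (fst w)) (snd (fst w)), c2 (fst (snd w)) (snd (snd w))), v)) \<partial>?N)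
        = (\<integral>\<^sup>+v. g (s1, s2) (\<lambda>i\<in>?I. ?c i + snd (snd v) i) \<partial>?N)"
        by (intro nn_integral_cong) (auto simp: w_eq Wsec_of_def Z_of_def)
      also have "\<dots> = (\<integral>\<^sup>+y. g (s1, s2) (\<lambda>i\<in>?I. ?c i + y i) \<partial>noise n)"
        by (rule nn_integral_noise_components(3)) (rule measurable_compose[OF sh gm])
      also have "\<dots> = (\<integral>\<^sup>+z. ennreal (gd ?I 1 (\<lambda>i. z i - ?c i)) * g (s1, s2) z \<partial>LI ?I)"
        by (rule nn_integral_noise_shift[OF gm])
      also have "\<dots> = (\<integral>\<^sup>+z. ennreal (?ch (s1, o1) (s2, o2) z) * g (s1, s2) z \<partial>LI ?I)"
      proof -
        have "gd ?I 1 (\<lambda>i. z i - ?c i) = ?ch (s1, o1) (s2, o2) z" for z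
          unfolding channel_density_def by (intro gd_cong) (simp add: c_eq(1)[OF _ in1] c_eq(2)[OF _ in2])
        then show ?thesis by simp
      qed
      finally show ?thesis by (simp add: w_eq)
    qed
    let ?X = "\<lambda>m m'. \<integral>\<^sup>+z. ennreal (?ch m m' z) * g (fst m, fst m') z \<partial>LI ?I"
    have "(\<integral>\<^sup>+\<omega>. g (Wsec_of \<omega>) (Z_of n h1 h2 \<omega>) \<partial>G) = (\<Sum>w\<in>?W. ?X (fst w) (snd w)) / of_nat (card ?W)"
      unfolding joint(3)[OF fm] using each by (intro arg_cong2[where f="(/)"] sum.cong refl)
    also have "\<dots> = ennreal (1 / (real (card ?K1) * real (card ?K2))) * (\<Sum>m\<in>?K1. \<Sum>m'\<in>?K2. ?X m m')"
      unfolding divW sumW[of ?X] ..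
    also have "(\<Sum>m\<in>?K1. \<Sum>m'\<in>?K2. ?X m m') = (\<Sum>s1<M1. \<Sum>a<O1. \<Sum>s2<M2. \<Sum>b<O2. ?X (s1, a) (s2, b))"
      by (simp only: sum.cartesian_product[symmetric] sum.cartesian_product')
    also have "\<dots> = (\<Sum>s1<M1. \<Sum>s2<M2. \<Sum>a<O1. \<Sum>b<O2. ?X (s1, a) (s2, b))"
      by (intro sum.cong refl sum.swap)
    also have "\<dots> = (\<Sum>s\<in>?S. \<Sum>a<O1. \<Sum>b<O2. ?X (fst s, a) (snd s, b))"
      by (simp only: sum.cartesian_product' fst_conv snd_conv)
    also have "ennreal (1 / (real (card ?K1) * real (card ?K2))) * \<dots> = (\<Sum>s\<in>?S. ennreal (1 / real (card ?S)) * (ennreal (1 / (real O1 * real O2)) * (\<Sum>a<O1. \<Sum>b<O2. ?X (fst s, a) (snd s, b))))"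
      unfolding sum_distrib_left[symmetric] mult.assoc[symmetric]
      by (subst ennreal_mult'[symmetric]) (auto simp: card_cartesian_product mult_ac)
    also have "\<dots> = (\<Sum>s\<in>?S. ennreal (1 / real (card ?S)) * (\<integral>\<^sup>+z. ennreal (P s z) * g s z \<partial>LI ?I))"
    proof (intro sum.cong refl arg_cong2[where f="(*)"])
      fix s :: "nat \<times> nat"
      have gs: "g (fst s, snd s) \<in> borel_measurable (LI ?I)" by (rule gm)
      have "(\<integral>\<^sup>+z. ennreal (P s z) * g s z \<partial>LI ?I) = (\<integral>\<^sup>+z. ennreal (1 / (real O1 * real O2)) * (\<Sum>a<O1. \<Sum>b<O2. ennreal (?ch (fst s, a) (snd s, b) z) * g (fst s, snd s) z) \<partial>LI ?I)"
      proof (intro nn_integral_cong)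
        fix z
        have "ennreal (P s z) = ennreal (1 / (real O1 * real O2)) * (\<Sum>a<O1. \<Sum>b<O2. ennreal (?ch (fst s, a) (snd s, b) z))"
          unfolding P_def output_density_def by (simp add: ch0 sum_nonneg ennreal_mult'[symmetric])
        then show "ennreal (P s z) * g s z = ennreal (1 / (real O1 * real O2)) * (\<Sum>a<O1. \<Sum>b<O2. ennreal (?ch (fst s, a) (snd s, b) z) * g (fst s, snd s) z)"
          by (simp add: sum_distrib_right mult.assoc)
      qed
      also have "\<dots> = ennreal (1 / (real O1 * real O2)) * (\<Sum>a<O1. \<Sum>b<O2. ?X (fst s, a) (snd s, b))"
        using gs by (simp add: nn_integral_cmult nn_integral_sum)
      finally show "ennreal (1 / (real O1 * real O2)) * (\<Sum>a<O1. \<Sum>b<O2. ?X (fst s, a) (snd s, b)) = (\<integral>\<^sup>+z. ennreal (P s z) * g s z \<partial>LI ?I)" ..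
    qed
    finally show ?thesis .
  qed
  have sf: "sigma_finite_measure (LI ?I)" by (rule sigma_finite_LI) simp
  have dXY: "distributed G (count_space UNIV \<Otimes>\<^sub>M LI ?I) (\<lambda>x. (Wsec_of x, Z_of n h1 h2 x))
      (\<lambda>(s, z). ennreal (if s \<in> ?S then P s z / real (card ?S) else 0))"
  proof (rule distributed_by_indicators)
    show "(\<lambda>x. (Wsec_of x, Z_of n h1 h2 x)) \<in> G \<rightarrow>\<^sub>M count_space UNIV \<Otimes>\<^sub>M LI ?I" using Wm Zm by measurable
    have "(\<lambda>w. (\<lambda>s w. ennreal (if s \<in> ?S then P s (snd w) / real (card ?S) else 0)) (fst w) w) \<in> borel_measurable (count_space UNIV \<Otimes>\<^sub>M LI ?I)"
    proof (rule measurable_compose_countable[OF _ measurable_fst])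
      fix s show "(\<lambda>w. ennreal (if s \<in> ?S then P s (snd w) / real (card ?S) else 0)) \<in> borel_measurable (count_space UNIV \<Otimes>\<^sub>M LI ?I)"
        by (cases "s \<in> ?S") simp_all
    qed
    then show fm: "(\<lambda>(s, z). ennreal (if s \<in> ?S then P s z / real (card ?S) else 0)) \<in> borel_measurable (count_space UNIV \<Otimes>\<^sub>M LI ?I)"
      by (simp only: case_prod_beta')
    fix A :: "((nat \<times> nat) \<times> (nat \<Rightarrow> real)) set" assume A: "A \<in> sets (count_space UNIV \<Otimes>\<^sub>M LI ?I)"
    have ind: "(\<lambda>z. indicator A (s, z) :: ennreal) \<in> borel_measurable (LI ?I)" for s :: "nat \<times> nat"
      using A by (intro measurable_compose[OF measurable_Pair1' borel_measurable_indicator]) auto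
    have "(\<integral>\<^sup>+x. indicator A (Wsec_of x, Z_of n h1 h2 x) \<partial>G) = (\<Sum>s\<in>?S. ennreal (1 / real (card ?S)) * (\<integral>\<^sup>+z. ennreal (P s z) * indicator A (s, z) \<partial>LI ?I))"
      by (rule law[of "\<lambda>s z. indicator A (s, z)", OF ind])
    also have "\<dots> = (\<Sum>s\<in>?S. \<integral>\<^sup>+z. ennreal (P s z / real (card ?S)) * indicator A (s, z) \<partial>LI ?I)"
    proof (intro sum.cong refl)
      fix s
      have "ennreal (1 / real (card ?S)) * (\<integral>\<^sup>+z. ennreal (P s z) * indicator A (s, z) \<partial>LI ?I) = (\<integral>\<^sup>+z. ennreal (1 / real (card ?S)) * (ennreal (P s z) * indicator A (s, z)) \<partial>LI ?I)"
        by (intro nn_integral_cmult[symmetric] borel_measurable_times_ennreal ind measurable_compose[OF Pm measurable_ennreal])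
      then show "ennreal (1 / real (card ?S)) * (\<integral>\<^sup>+z. ennreal (P s z) * indicator A (s, z) \<partial>LI ?I) = (\<integral>\<^sup>+z. ennreal (P s z / real (card ?S)) * indicator A (s, z) \<partial>LI ?I)"
        by (simp add: mult.assoc[symmetric] ennreal_mult'[symmetric])
    qed
    also have "\<dots> = (\<integral>\<^sup>+y. (case y of (s, z) \<Rightarrow> ennreal (if s \<in> ?S then P s z / real (card ?S) else 0)) * indicator A y \<partial>(count_space UNIV \<Otimes>\<^sub>M LI ?I))"
      by (subst nn_integral_count_pair[OF sf, of ?S]) (use fm A in \<open>auto intro!: sum.cong borel_measurable_times_ennreal\<close>)
    finally show "(\<integral>\<^sup>+x. indicator A (Wsec_of x, Z_of n h1 h2 x) \<partial>G) = (\<integral>\<^sup>+y. (case y of (s, z) \<Rightarrow> ennreal (if s \<in> ?S then P s z / real (card ?S) else 0)) * indicator A y \<partial>(count_space UNIV \<Otimes>\<^sub>M LI ?I))" .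
  qed
  have dY: "distributed G (LI ?I) (Z_of n h1 h2) (\<lambda>z. ennreal ((\<Sum>s\<in>?S. P s z) / real (card ?S)))"
  proof (rule distributed_by_indicators[OF Zm])
    show "(\<lambda>z. ennreal ((\<Sum>s\<in>?S. P s z) / real (card ?S))) \<in> borel_measurable (LI ?I)" by measurable
    fix A assume A[measurable]: "A \<in> sets (LI ?I)"
    have "(\<integral>\<^sup>+x. indicator A (Z_of n h1 h2 x) \<partial>G) = (\<Sum>s\<in>?S. ennreal (1 / real (card ?S)) * (\<integral>\<^sup>+z. ennreal (P s z) * indicator A z \<partial>LI ?I))"
      by (rule law[of "\<lambda>s z. indicator A z"]) measurable
    also have "\<dots> = (\<integral>\<^sup>+z. (\<Sum>s\<in>?S. ennreal (1 / real (card ?S)) * (ennreal (P s z) * indicator A z)) \<partial>LI ?I)"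
      by (subst nn_integral_sum) (auto simp: nn_integral_cmult)
    also have "\<dots> = (\<integral>\<^sup>+z. ennreal ((\<Sum>s\<in>?S. P s z) / real (card ?S)) * indicator A z \<partial>LI ?I)"
    proof (intro nn_integral_cong)
      fix z
      have "ennreal ((\<Sum>s\<in>?S. P s z) / real (card ?S)) = ennreal (1 / real (card ?S)) * (\<Sum>s\<in>?S. ennreal (P s z))"
        using Ppos[THEN less_imp_le] by (simp add: sum_nonneg ennreal_mult'[symmetric])
      then show "(\<Sum>s\<in>?S. ennreal (1 / real (card ?S)) * (ennreal (P s z) * indicator A z)) = ennreal ((\<Sum>s\<in>?S. P s z) / real (card ?S)) * indicator A z"
        by (simp only: sum_distrib_left sum_distrib_right mult.assoc)
    qed
    finally show "(\<integral>\<^sup>+x. indicator A (Z_of n h1 h2 x) \<partial>G) = (\<integral>\<^sup>+z. ennreal ((\<Sum>s\<in>?S. P s z) / real (card ?S)) * indicator A z \<partial>LI ?I)" .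
  qed
  have mS: "measure (count_space UNIV) ?S = real (card ?S)" by (simp add: measure_count_space)
  have dX: "distributed G (count_space UNIV) Wsec_of (\<lambda>s. ennreal (indicator ?S s / measure (count_space UNIV) ?S))"
  proof (rule distributed_by_indicators[OF Wm])
    fix A :: "(nat \<times> nat) set"
    have "(\<integral>\<^sup>+x. indicator A (Wsec_of x) \<partial>G) = (\<Sum>s\<in>?S. ennreal (1 / real (card ?S)) * (\<integral>\<^sup>+z. ennreal (P s z) * indicator A s \<partial>LI ?I))"
      by (rule law[of "\<lambda>s z. indicator A s"]) measurable
    also have "\<dots> = (\<Sum>s\<in>?S. ennreal (1 / real (card ?S)) * indicator A s)"
      by (simp add: nn_integral_multc P1)
    also have "\<dots> = (\<integral>\<^sup>+s. ennreal (indicator ?S s / measure (count_space UNIV) ?S) * indicator A s \<partial>count_space UNIV)"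
      unfolding mS by (subst nn_integral_count_space'[of ?S]) auto
    finally show "(\<integral>\<^sup>+x. indicator A (Wsec_of x) \<partial>G) = (\<integral>\<^sup>+s. ennreal (indicator ?S s / measure (count_space UNIV) ?S) * indicator A s \<partial>count_space UNIV)" .
  qed simp
  have ent: "G.entropy 2 (count_space UNIV) Wsec_of = log 2 (real (card ?S))"
    using info.entropy_uniform[OF dX] unfolding mS .
  have lpos: "0 \<le> ln (real M1 * real M2)" using pos by (auto intro!: ln_ge_zero mult_ge1_I simp: Suc_le_eq)
  have "G.conditional_entropy 2 (count_space UNIV) (LI ?I) Wsec_of (Z_of n h1 h2) \<ge> log 2 (real (card ?S)) - \<epsilon> * ln (real M1 * real M2) / ln 2"
  proof (rule info.conditional_entropy_uniform_ge[where P = P and q = q and W = ?S, OF sf _ _ Pm Ppos P1 q dXY dY])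
    show "(\<Sum>s\<in>?S. ennreal (1 / real (card ?S)) * (\<integral>\<^sup>+z. ennreal (P s z * \<bar>ln (P s z / q z)\<bar>) \<partial>LI ?I)) \<le> ennreal (\<epsilon> * ln (real M1 * real M2))"
      using lk unfolding leak_pairs P_def .
  qed (use pos eps lpos in auto)
  \<comment> \<open>The leakage allowance of \<open>wiretap_code\<close> is proportional to the
    logarithm of the number of secret pairs exactly so that the loss becomes the fraction
    \<open>\<epsilon>\<close> of the entropy.\<close>
  also have "log 2 (real (card ?S)) - \<epsilon> * ln (real M1 * real M2) / ln 2 = (1 - \<epsilon>) * log 2 (real (card ?S))"
    unfolding cS by (simp add: log_def algebra_simps diff_divide_distrib)
  finally have sec: "(1 - \<epsilon>) * G.entropy 2 (count_space UNIV) Wsec_of \<le> G.conditional_entropy 2 (count_space UNIV) (Rn n) Wsec_of (Z_of n h1 h2)"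
    unfolding ent Rn_eq .
  have ent_nonneg: "0 \<le> G.entropy 2 (count_space UNIV) Wsec_of"
    unfolding ent cS log_def using lpos by simp
  have v1: "valid_encoder n Pb1 enc1" using venc[OF pw1 Pb(1)] by (simp add: enc1_def[abs_def] c1_def)
  have v2: "valid_encoder n Pb2 enc2" using venc[OF pw2 Pb(2)] by (simp add: enc2_def[abs_def] c2_def)
  show ?thesis
    by (rule exI[of _ enc1], rule exI[of _ enc2], rule exI[of _ "dec a1 D2"], rule exI[of _ "dec a2 D1"])
       (unfold Let_def G_def[symmetric], intro conjI v1 v2 vdec D err sec ent_nonneg)
qed

subsection \<open>Rates of random codes\<close>

text \<open>The rate is in nats. Rounding up turns rate 0 into exactly one message, which is how a
  terminal without secret is represented.\<close>

abbreviation code_size :: "real \<Rightarrow> nat \<Rightarrow> nat" where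
  "code_size r n \<equiv> nat \<lceil>exp (real n * r)\<rceil>"

lemma code_size_bounds:
  assumes "0 \<le> r"
  shows "0 < code_size r n" "real n * r \<le> ln (real (code_size r n))" "real (code_size r n) \<le> 2 * exp (real n * r)"
proof -
  have e: "1 \<le> exp (real n * r)" using assms by simp
  then show c: "0 < code_size r n" by linarith
  have le: "exp (real n * r) \<le> real (code_size r n)" using e by linarith
  then show "real n * r \<le> ln (real (code_size r n))"
    using c by (subst ln_ge_iff) auto
  show "real (code_size r n) \<le> 2 * exp (real n * r)" using e by linarith
qed

text \<open>The leakage bound \<open>\<Lambda>\<close> is quantified first because it depends
  neither on the block length nor on the error tolerance, only on the gap between the rates and
  their limits.\<close>

lemma random_codes:
  assumes P: "0 < P1" "P1 < Pb1" "0 < P2" "P2 < Pb2" and h: "0 \<le> h1" "0 \<le> h2"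
    and S: "0 \<le> S1" "0 \<le> S2" and T: "0 \<le> T1" "0 \<le> T2"
    and rel: "S1 + T1 < ln (1 + P1) / 2" "S2 + T2 < ln (1 + P2) / 2"
    and sec: "ln (1 + h1 * P1 + h2 * P2) / 2 < T1 + T2"
      "ln ((1 + h1 * P1 + h2 * P2) / (1 + h2 * P2)) / 2 < T1"
      "ln ((1 + h1 * P1 + h2 * P2) / (1 + h1 * P1)) / 2 < T2"
  shows "\<exists>\<Lambda>>0. \<forall>\<epsilon>>0. \<exists>N. \<forall>I. finite I \<and> card I \<ge> N \<longrightarrow> (\<exists>x1 x2 D1 D2.
      (\<forall>m\<in>{..<code_size S1 (card I)} \<times> {..<code_size T1 (card I)}. (\<Sum>i\<in>I. (x1 m i)\<^sup>2) \<le> real (card I) * Pb1)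
    \<and> (\<forall>m\<in>{..<code_size S2 (card I)} \<times> {..<code_size T2 (card I)}. (\<Sum>i\<in>I. (x2 m i)\<^sup>2) \<le> real (card I) * Pb2)
    \<and> D1 \<in> LI I \<rightarrow>\<^sub>M count_space UNIV \<and> D2 \<in> LI I \<rightarrow>\<^sub>M count_space UNIV
    \<and> avg_error I ({..<code_size S1 (card I)} \<times> {..<code_size T1 (card I)}) x1 D1 \<le> ennreal \<epsilon>
    \<and> avg_error I ({..<code_size S2 (card I)} \<times> {..<code_size T2 (card I)}) x2 D2 \<le> ennreal \<epsilon>
    \<and> leak I h1 h2 (code_size S1 (card I)) (code_size T1 (card I)) (code_size S2 (card I)) (code_size T2 (card I)) x1 x2 (gd I (1 + h1 * P1 + h2 * P2)) \<le> ennreal \<Lambda>)"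
proof -
  \<comment> \<open>The gaps to capacity are halved since they are spent twice: the decoding
    threshold lies \<open>g\<close> below capacity and the total rate another \<open>g\<close> below
    the threshold. The secrecy gaps are spent once.\<close>
  define g where "g = Min {(ln (1 + P1) / 2 - (S1 + T1)) / 2, (ln (1 + P2) / 2 - (S2 + T2)) / 2,
     T1 + T2 - ln (1 + h1 * P1 + h2 * P2) / 2, T1 - ln ((1 + h1 * P1 + h2 * P2) / (1 + h2 * P2)) / 2,
     T2 - ln ((1 + h1 * P1 + h2 * P2) / (1 + h1 * P1)) / 2}"
  have g0: "g > 0" unfolding g_def using rel sec by (subst Min_gr_iff) auto
  have gl: "S1 + T1 + 2 * g \<le> ln (1 + P1) / 2" "S2 + T2 + 2 * g \<le> ln (1 + P2) / 2"
    "ln (1 + h1 * P1 + h2 * P2) / 2 + g \<le> T1 + T2" "ln ((1 + h1 * P1 + h2 * P2) / (1 + h2 * P2)) / 2 + g \<le> T1"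
    "ln ((1 + h1 * P1 + h2 * P2) / (1 + h1 * P1)) / 2 + g \<le> T2"
  proof -
    have "g \<le> (ln (1 + P1) / 2 - (S1 + T1)) / 2" "g \<le> (ln (1 + P2) / 2 - (S2 + T2)) / 2"
      "g \<le> T1 + T2 - ln (1 + h1 * P1 + h2 * P2) / 2" "g \<le> T1 - ln ((1 + h1 * P1 + h2 * P2) / (1 + h2 * P2)) / 2"
      "g \<le> T2 - ln ((1 + h1 * P1 + h2 * P2) / (1 + h1 * P1)) / 2"
      unfolding g_def by (rule Min_le; simp)+
    then show "S1 + T1 + 2 * g \<le> ln (1 + P1) / 2" "S2 + T2 + 2 * g \<le> ln (1 + P2) / 2"
      "ln (1 + h1 * P1 + h2 * P2) / 2 + g \<le> T1 + T2" "ln ((1 + h1 * P1 + h2 * P2) / (1 + h2 * P2)) / 2 + g \<le> T1"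
      "ln ((1 + h1 * P1 + h2 * P2) / (1 + h1 * P1)) / 2 + g \<le> T2" by (simp_all add: field_simps)
  qed
  \<comment> \<open>From \<open>s \<le> g / 2\<close> the exponent \<open>s^2 - s * g\<close> of the
    missed detections is at most \<open>- s^2\<close>; from \<open>s \<le> 1 / 2\<close> the moment
    estimates apply.\<close>
  define s where "s = min (g / 2) (1 / 2)"
  have s: "0 < s" "s \<le> g" "2 * s \<le> g" "s \<le> 1 / 2" using g0 by (auto simp: s_def)
  have s2: "s\<^sup>2 \<le> 1 / 2"
  proof -
    have "s * s \<le> 1 * (1 / 2)" using s by (intro mult_mono) auto
    then show ?thesis by (simp add: power2_eq_square)
  qed
  \<comment> \<open>Three times the bound on the expected leakage, so that after normalization the
    leakage uses one third of the total 1; each terminal's decoding error gets another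
    third.\<close>
  define \<Lambda> where "\<Lambda> = 3 * (10 + 52 / s)"
  have \<Lambda>: "\<Lambda> > 0" "(10 + 52 / s) / \<Lambda> = 1 / 3"
  proof -
    have "10 + 52 / s > 0" using s by (intro add_pos_pos) auto
    then show "\<Lambda> > 0" "(10 + 52 / s) / \<Lambda> = 1 / 3" by (simp_all add: \<Lambda>_def)
  qed
  obtain N1 where N1: "\<And>I. finite I \<and> card I \<ge> N1 \<Longrightarrow> ennreal (1 / 2) \<le> emeasure (gaussian_measure I P1) (pow_ball I Pb1)"
    using gaussian_measure_pow_ball_ge_half[OF P(1,2)] by blast
  obtain N2 where N2: "\<And>I. finite I \<and> card I \<ge> N2 \<Longrightarrow> ennreal (1 / 2) \<le> emeasure (gaussian_measure I P2) (pow_ball I Pb2)"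
    using gaussian_measure_pow_ball_ge_half[OF P(3,4)] by blast
  show ?thesis
  proof (intro exI[of _ \<Lambda>] conjI \<Lambda>(1) allI impI)
    fix \<epsilon> :: real assume e: "\<epsilon> > 0"
    have l: "(\<lambda>n. exp (- s\<^sup>2) ^ n) \<longlonglongrightarrow> 0" "(\<lambda>n. exp (- g) ^ n) \<longlonglongrightarrow> 0"
      by (rule LIMSEQ_realpow_zero; use s g0 in simp)+
    \<comment> \<open>The 16 is the factor 4 of the false alarms times 2 * 2 for rounding up both
      code sizes.\<close>
    have "(\<lambda>n. (2 * exp (- s\<^sup>2) ^ n + 16 * exp (- g) ^ n) / \<epsilon>) \<longlonglongrightarrow> (2 * 0 + 16 * 0) / \<epsilon>"
      by (intro tendsto_divide tendsto_add tendsto_mult tendsto_const l) (use e in simp)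
    then have "eventually (\<lambda>n. (2 * exp (- s\<^sup>2) ^ n + 16 * exp (- g) ^ n) / \<epsilon> < 1 / 3) sequentially"
      by (rule order_tendstoD) simp
    then obtain N3 where N3: "\<And>n. n \<ge> N3 \<Longrightarrow> (2 * exp (- s\<^sup>2) ^ n + 16 * exp (- g) ^ n) / \<epsilon> < 1 / 3"
      by (auto simp: eventually_sequentially)
    show "\<exists>N. \<forall>I. finite I \<and> card I \<ge> N \<longrightarrow> (\<exists>x1 x2 D1 D2.
      (\<forall>m\<in>{..<code_size S1 (card I)} \<times> {..<code_size T1 (card I)}. (\<Sum>i\<in>I. (x1 m i)\<^sup>2) \<le> real (card I) * Pb1)
    \<and> (\<forall>m\<in>{..<code_size S2 (card I)} \<times> {..<code_size T2 (card I)}. (\<Sum>i\<in>I. (x2 m i)\<^sup>2) \<le> real (card I) * Pb2)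
    \<and> D1 \<in> LI I \<rightarrow>\<^sub>M count_space UNIV \<and> D2 \<in> LI I \<rightarrow>\<^sub>M count_space UNIV
    \<and> avg_error I ({..<code_size S1 (card I)} \<times> {..<code_size T1 (card I)}) x1 D1 \<le> ennreal \<epsilon>
    \<and> avg_error I ({..<code_size S2 (card I)} \<times> {..<code_size T2 (card I)}) x2 D2 \<le> ennreal \<epsilon>
    \<and> leak I h1 h2 (code_size S1 (card I)) (code_size T1 (card I)) (code_size S2 (card I)) (code_size T2 (card I)) x1 x2 (gd I (1 + h1 * P1 + h2 * P2)) \<le> ennreal \<Lambda>)"
    proof (rule exI[of _ "max N1 (max N2 N3)"], intro allI impI)
      fix I :: "nat set" assume I: "finite I \<and> card I \<ge> max N1 (max N2 N3)"
      let ?n = "real (card I)"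
      \<comment> \<open>The threshold is the exponential of the mean information density of the
        Gaussian channel, lowered by \<open>g\<close> per channel use.\<close>
      define \<theta> where "\<theta> P = exp (?n * (ln (1 + P) / 2 - g))" for P
      have err: "(2 * (\<theta> P powr s * exp (?n * (s\<^sup>2 - s * (ln (1 + P) / 2)))) + 4 * (real (code_size S (card I) * code_size T (card I)) / \<theta> P)) / \<epsilon> < 1 / 3"
        if ST: "S + T + 2 * g \<le> ln (1 + P) / 2" "0 \<le> S" "0 \<le> T" for S T P
      proof -
        have "\<theta> P powr s * exp (?n * (s\<^sup>2 - s * (ln (1 + P) / 2))) = exp (?n * (s\<^sup>2 - s * g))"
          by (simp add: \<theta>_def powr_def exp_add[symmetric] algebra_simps)
        also have "\<dots> \<le> exp (?n * (- s\<^sup>2))"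
        proof -
          have "s * (2 * s) \<le> s * g" using s by (intro mult_left_mono) auto
          then have "s\<^sup>2 - s * g \<le> - s\<^sup>2" by (simp add: power2_eq_square)
          then have "?n * (s\<^sup>2 - s * g) \<le> ?n * (- s\<^sup>2)" by (intro mult_left_mono) simp_all
          then show ?thesis by (simp only: exp_le_cancel_iff)
        qed
        also have "\<dots> = exp (- s\<^sup>2) ^ card I" by (simp add: exp_of_nat_mult[symmetric])
        finally have 1: "\<theta> P powr s * exp (?n * (s\<^sup>2 - s * (ln (1 + P) / 2))) \<le> exp (- s\<^sup>2) ^ card I" .
        have "real (code_size S (card I) * code_size T (card I)) \<le> (2 * exp (?n * S)) * (2 * exp (?n * T))"
          unfolding of_nat_mult
          by (rule mult_mono[OF code_size_bounds(3)[OF ST(2)] code_size_bounds(3)[OF ST(3)] mult_nonneg_nonneg[OF zero_le_numeral exp_ge_zero] of_nat_0_le_iff])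
        then have "real (code_size S (card I) * code_size T (card I)) / \<theta> P \<le> (2 * exp (?n * S)) * (2 * exp (?n * T)) / \<theta> P"
          by (intro divide_right_mono) (auto simp: \<theta>_def)
        also have "\<dots> = 4 * exp (?n * (S + T - ln (1 + P) / 2 + g))"
        proof -
          have "exp (?n * S) * exp (?n * T) / \<theta> P = exp (?n * S + ?n * T - ?n * (ln (1 + P) / 2 - g))"
            by (simp add: \<theta>_def exp_add exp_diff)
          also have "?n * S + ?n * T - ?n * (ln (1 + P) / 2 - g) = ?n * (S + T - ln (1 + P) / 2 + g)"
            by (simp add: algebra_simps)
          finally show ?thesis by simp
        qed
        also have "\<dots> \<le> 4 * exp (?n * (- g))"
        proof -
          have "?n * (S + T - ln (1 + P) / 2 + g) \<le> ?n * (- g)"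
            using ST(1) by (intro mult_left_mono) linarith+
          then show ?thesis by simp
        qed
        also have "\<dots> = 4 * exp (- g) ^ card I" by (simp add: exp_of_nat_mult[symmetric])
        finally have 2: "real (code_size S (card I) * code_size T (card I)) / \<theta> P \<le> 4 * exp (- g) ^ card I" .
        have "(2 * (\<theta> P powr s * exp (?n * (s\<^sup>2 - s * (ln (1 + P) / 2)))) + 4 * (real (code_size S (card I) * code_size T (card I)) / \<theta> P)) / \<epsilon>
          \<le> (2 * exp (- s\<^sup>2) ^ card I + 16 * exp (- g) ^ card I) / \<epsilon>"
          using 1 2 e by (intro divide_right_mono) linarith+
        also have "\<dots> < 1 / 3" using N3[of "card I"] I by simp
        finally show ?thesis .
      qed
      have lnO: "?n * (c + s) \<le> ln (real (code_size T (card I)))" if "c + g \<le> T" "0 \<le> T" for c T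
      proof -
        have "?n * (c + s) \<le> ?n * T" using that s by (intro mult_left_mono) auto
        then show ?thesis using code_size_bounds(2)[OF that(2), of "card I"] by linarith
      qed
      have lnOO: "?n * (ln (1 + h1 * P1 + h2 * P2) / 2 + s) \<le> ln (real (code_size T1 (card I)) * real (code_size T2 (card I)))"
      proof -
        have "?n * (ln (1 + h1 * P1 + h2 * P2) / 2 + s) \<le> ?n * (T1 + T2)" using gl(3) s by (intro mult_left_mono) auto
        moreover have "ln (real (code_size T1 (card I)) * real (code_size T2 (card I))) = ln (real (code_size T1 (card I))) + ln (real (code_size T2 (card I)))"
          by (rule ln_mult_pos) (use code_size_bounds(1)[OF T(1), of "card I"] code_size_bounds(1)[OF T(2), of "card I"] in \<open>simp_all only: of_nat_0_less_iff\<close>)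
        ultimately show ?thesis
          using code_size_bounds(2)[OF T(1), of "card I"] code_size_bounds(2)[OF T(2), of "card I"] by (simp add: distrib_left)
      qed
      have th: "\<theta> P1 > 0" "\<theta> P2 > 0" by (simp_all add: \<theta>_def)
      have fin: "finite I" and hf: "ennreal (1 / 2) \<le> emeasure (gaussian_measure I P1) (pow_ball I Pb1)" "ennreal (1 / 2) \<le> emeasure (gaussian_measure I P2) (pow_ball I Pb2)"
        using I N1[of I] N2[of I] by auto
      show "\<exists>x1 x2 D1 D2.
      (\<forall>m\<in>{..<code_size S1 (card I)} \<times> {..<code_size T1 (card I)}. (\<Sum>i\<in>I. (x1 m i)\<^sup>2) \<le> real (card I) * Pb1)
    \<and> (\<forall>m\<in>{..<code_size S2 (card I)} \<times> {..<code_size T2 (card I)}. (\<Sum>i\<in>I. (x2 m i)\<^sup>2) \<le> real (card I) * Pb2)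
    \<and> D1 \<in> LI I \<rightarrow>\<^sub>M count_space UNIV \<and> D2 \<in> LI I \<rightarrow>\<^sub>M count_space UNIV
    \<and> avg_error I ({..<code_size S1 (card I)} \<times> {..<code_size T1 (card I)}) x1 D1 \<le> ennreal \<epsilon>
    \<and> avg_error I ({..<code_size S2 (card I)} \<times> {..<code_size T2 (card I)}) x2 D2 \<le> ennreal \<epsilon>
    \<and> leak I h1 h2 (code_size S1 (card I)) (code_size T1 (card I)) (code_size S2 (card I)) (code_size T2 (card I)) x1 x2 (gd I (1 + h1 * P1 + h2 * P2)) \<le> ennreal \<Lambda>"
        by (rule random_coding[OF fin P(1,3) h s(1) s2 code_size_bounds(1)[OF S(1)] code_size_bounds(1)[OF T(1)] code_size_bounds(1)[OF S(2)] code_size_bounds(1)[OF T(2)]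
            hf th e \<Lambda>(1) lnOO lnO[OF gl(4) T(1)] lnO[OF gl(5) T(2)]])
           (use err[OF gl(1) S(1) T(1)] err[OF gl(2) S(2) T(2)] \<Lambda>(2) in linarith)
    qed
  qed
qed

section \<open>Revealing the codeword of a terminal without secret\<close>

lemma nn_integral_LI_shift:
  assumes "finite I" "f \<in> borel_measurable (LI I)"
  shows "(\<integral>\<^sup>+x. f (\<lambda>i\<in>I. c i + x i) \<partial>LI I) = (\<integral>\<^sup>+x. f x \<partial>LI I)"
proof -
  have m: "(\<lambda>x. \<lambda>i\<in>I. c i + x i) \<in> LI I \<rightarrow>\<^sub>M LI I"
    unfolding LI_def by measurable
  have "(\<integral>\<^sup>+x. f (\<lambda>i\<in>I. c i + x i) \<partial>LI I) = (\<integral>\<^sup>+x. f x \<partial>distr (LI I) (LI I) (\<lambda>x. \<lambda>i\<in>I. c i + x i))"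
    by (rule nn_integral_distr[symmetric, OF m]) (use assms in simp)
  then show ?thesis by (simp add: LI_shift assms)
qed

text \<open>Linearization of the logarithm at an arbitrary \<open>u\<close>. In
  \<open>leak_genie\<close> the ratio for one revealed codeword serves as \<open>u\<close> and the
  overall ratio as \<open>t\<close>, so that the two extra terms average to the two densities
  themselves: a log-sum inequality for absolute logarithms.\<close>

lemma abs_ln_ratio_le:
  fixes t u :: real assumes "t > 0" "u > 0"
  shows "\<bar>ln t\<bar> \<le> \<bar>ln u\<bar> + t / u + 1 / t"
proof -
  have "ln t \<le> ln u + t / u - 1" using ln_le_minus_one[of "t / u"] assms by (simp add: ln_div)
  moreover have "- ln t \<le> 1 / t - 1" using ln_le_minus_one[of "1 / t"] assms by (simp add: ln_div)
  moreover have "0 < t / u" "0 < 1 / t" using assms by auto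
  ultimately show ?thesis by linarith
qed

text \<open>A reference for a terminal 1 whose only secret is 0: its actual codebook is kept, and
  the rest of the received signal is replaced by a Gaussian of variance \<open>v\<close>. For a
  revealed codeword this is, up to a shift, the Gaussian reference of the channel with gain
  0.\<close>

definition genie_density :: "nat set \<Rightarrow> real \<Rightarrow> real \<Rightarrow> nat \<Rightarrow> (nat \<times> nat \<Rightarrow> nat \<Rightarrow> real) \<Rightarrow> (nat \<Rightarrow> real) \<Rightarrow> real" where
  "genie_density I h1 v K1 x1 z = (\<Sum>a<K1. gd I v (\<lambda>i. z i - sqrt h1 * x1 (0, a) i)) / real K1"

lemma genie_density_props:
  assumes "finite I" "0 < K1" "0 < v"
  shows "genie_density I h1 v K1 x1 \<in> borel_measurable (LI I)" "0 < genie_density I h1 v K1 x1 z"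
    "(\<integral>\<^sup>+z. ennreal (genie_density I h1 v K1 x1 z) \<partial>LI I) = 1"
proof -
  note [measurable] = gd_measurable
  show "genie_density I h1 v K1 x1 \<in> borel_measurable (LI I)"
    unfolding genie_density_def[abs_def] by measurable
  show "0 < genie_density I h1 v K1 x1 z"
    unfolding genie_density_def using assms by (intro divide_pos_pos sum_pos gd_pos) auto
  have "ennreal (genie_density I h1 v K1 x1 z) = ennreal (1 / real K1) * (\<Sum>a<K1. ennreal (gd I v (\<lambda>i. z i - sqrt h1 * x1 (0, a) i)))" for z
    unfolding genie_density_def by (simp add: sum_nonneg ennreal_mult'[symmetric])
  then have "(\<integral>\<^sup>+z. ennreal (genie_density I h1 v K1 x1 z) \<partial>LI I)
      = ennreal (1 / real K1) * (\<Sum>a<K1. \<integral>\<^sup>+z. ennreal (gd I v (\<lambda>i. z i - sqrt h1 * x1 (0, a) i)) \<partial>LI I)"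
    by (simp add: nn_integral_cmult nn_integral_sum del: sum_ennreal)
  then show "(\<integral>\<^sup>+z. ennreal (genie_density I h1 v K1 x1 z) \<partial>LI I) = 1"
    using assms by (simp add: nn_integral_gd ennreal_of_nat_eq_real_of_nat ennreal_mult'[symmetric])
qed

text \<open>If terminal 1 carries no secret, its codeword may be revealed to the eavesdropper:
  by the log-sum inequality the leakage is at most that of the channel with \<open>h1 = 0\<close>, up to a constant.\<close>
lemma leak_genie:
  assumes I: "finite I" and pos: "0 < K1" "0 < M2" "0 < K2" "0 < v"
  shows "leak I h1 h2 1 K1 M2 K2 x1 x2 (genie_density I h1 v K1 x1) \<le> leak I 0 h2 1 K1 M2 K2 x1 x2 (gd I v) + 2"
proof -
  note [measurable] = gd_measurable
  let ?q = "genie_density I h1 v K1 x1"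
  note gp = genie_density_props[OF I pos(1,4), of h1 x1]
  have each: "(\<integral>\<^sup>+z. ennreal (output_density I h1 h2 K1 K2 (\<lambda>a. x1 (0, a)) (\<lambda>b. x2 (s, b)) z *
         \<bar>ln (output_density I h1 h2 K1 K2 (\<lambda>a. x1 (0, a)) (\<lambda>b. x2 (s, b)) z / ?q z)\<bar>) \<partial>LI I)
     \<le> (\<integral>\<^sup>+z. ennreal (output_density I 0 h2 K1 K2 (\<lambda>a. x1 (0, a)) (\<lambda>b. x2 (s, b)) z *
         \<bar>ln (output_density I 0 h2 K1 K2 (\<lambda>a. x1 (0, a)) (\<lambda>b. x2 (s, b)) z / gd I v z)\<bar>) \<partial>LI I) + 2" for s
  proof -
    define r where "r z = (\<Sum>b<K2. gd I 1 (\<lambda>i. z i - sqrt h2 * x2 (s, b) i)) / real K2" for z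
    define p where "p = output_density I h1 h2 K1 K2 (\<lambda>a. x1 (0, a)) (\<lambda>b. x2 (s, b))"
    \<comment> \<open>Subtraction of the revealed codeword: in the shifted coordinate the output
      density is \<open>r\<close>, that of the channel with gain 0, and the reference is the plain
      Gaussian.\<close>
    define sh where "sh a z = (\<lambda>i\<in>I. - (sqrt h1 * x1 (0, a) i) + z i)" for a z
    have rm[measurable]: "r \<in> borel_measurable (LI I)" unfolding r_def[abs_def] by measurable
    have rpos: "r z > 0" for z unfolding r_def using pos by (intro divide_pos_pos sum_pos gd_pos) auto
    have r0: "output_density I 0 h2 K1 K2 (\<lambda>a. x1 (0, a)) (\<lambda>b. x2 (s, b)) z = r z" for z
      unfolding output_density_def channel_density_def r_def using pos by simp
    have p_eq: "p z = (\<Sum>a<K1. r (sh a z)) / real K1" for z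
    proof -
      have "channel_density I h1 h2 (x1 (0, a)) (x2 (s, b)) z = gd I 1 (\<lambda>i. sh a z i - sqrt h2 * x2 (s, b) i)" for a b
        unfolding channel_density_def by (intro gd_cong) (simp add: sh_def)
      then show ?thesis
        unfolding p_def output_density_def r_def by (simp add: sum_divide_distrib[symmetric])
    qed
    have q_eq: "?q z = (\<Sum>a<K1. gd I v (sh a z)) / real K1" for z
    proof -
      have "gd I v (\<lambda>i. z i - sqrt h1 * x1 (0, a) i) = gd I v (sh a z)" for a
        by (intro gd_cong) (simp add: sh_def)
      then show ?thesis unfolding genie_density_def by simp
    qed
    have shm[measurable]: "sh a \<in> LI I \<rightarrow>\<^sub>M LI I" for a
      unfolding sh_def[abs_def] LI_def by measurable
    have ppos: "p z > 0" for z unfolding p_def using pos by (intro output_density_pos)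
    have gpos: "gd I v z > 0" for z using pos by (intro gd_pos)
    have pm[measurable]: "p \<in> borel_measurable (LI I)" unfolding p_def by measurable
    note [measurable] = gp(1)
    define F where "F z = r z * \<bar>ln (r z / gd I v z)\<bar>" for z
    have Fm[measurable]: "F \<in> borel_measurable (LI I)" unfolding F_def[abs_def] by measurable
    have F0: "0 \<le> F z" for z unfolding F_def using rpos[of z] by simp
    \<comment> \<open>The two extra densities have mass 1 each and give the constant 2 of the lemma;
      the shifts in \<open>F\<close> disappear by translation invariance.\<close>
    have pt: "ennreal (p z * \<bar>ln (p z / ?q z)\<bar>) \<le> ennreal (1 / real K1) * (\<Sum>a<K1. ennreal (F (sh a z))) + ennreal (p z) + ennreal (?q z)" for z
    proof -
      let ?T = "p z / ?q z"
      have T: "?T > 0" using ppos gp(2) by simp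
      have "p z * \<bar>ln ?T\<bar> = (\<Sum>a<K1. r (sh a z) * \<bar>ln ?T\<bar>) / real K1"
        unfolding p_eq[of z] by (simp add: sum_distrib_right sum_divide_distrib)
      also have "\<dots> \<le> (\<Sum>a<K1. F (sh a z) + gd I v (sh a z) * ?T + r (sh a z) * (1 / ?T)) / real K1"
      proof (intro divide_right_mono sum_mono)
        fix a
        let ?u = "r (sh a z) / gd I v (sh a z)"
        have u: "?u > 0" using rpos gpos by simp
        have "r (sh a z) * \<bar>ln ?T\<bar> \<le> r (sh a z) * (\<bar>ln ?u\<bar> + ?T / ?u + 1 / ?T)"
          using abs_ln_ratio_le[OF T u] rpos[of "sh a z"] by (intro mult_left_mono) auto
        also have "\<dots> = F (sh a z) + r (sh a z) * (?T / ?u) + r (sh a z) * (1 / ?T)"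
          by (simp only: F_def distrib_left)
        also have "r (sh a z) * (?T / ?u) = gd I v (sh a z) * ?T"
          using rpos[of "sh a z"] gpos[of "sh a z"] by simp
        finally show "r (sh a z) * \<bar>ln ?T\<bar> \<le> F (sh a z) + gd I v (sh a z) * ?T + r (sh a z) * (1 / ?T)" .
      qed simp
      also have "\<dots> = (\<Sum>a<K1. F (sh a z)) / real K1 + ?q z * ?T + p z * (1 / ?T)"
        unfolding p_eq[of z] q_eq[of z]
        by (simp only: sum.distrib add_divide_distrib sum_distrib_right[symmetric] times_divide_eq_left)
      also have "?q z * ?T = p z" using gp(2)[of z] by simp
      also have "p z * (1 / ?T) = ?q z" using ppos[of z] by simp
      finally have "p z * \<bar>ln ?T\<bar> \<le> (1 / real K1) * (\<Sum>a<K1. F (sh a z)) + p z + ?q z" by simp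
      then show ?thesis
        using F0 ppos[of z] gp(2)[of z]
        by (simp add: sum_nonneg ennreal_mult'[symmetric] ennreal_plus[symmetric] ennreal_leI del: ennreal_plus)
    qed
    have "(\<integral>\<^sup>+z. ennreal (p z * \<bar>ln (p z / ?q z)\<bar>) \<partial>LI I) \<le> (\<integral>\<^sup>+z. ennreal (1 / real K1) * (\<Sum>a<K1. ennreal (F (sh a z))) + ennreal (p z) + ennreal (?q z) \<partial>LI I)"
      by (intro nn_integral_mono pt)
    also have "\<dots> = ennreal (1 / real K1) * (\<Sum>a<K1. \<integral>\<^sup>+z. ennreal (F (sh a z)) \<partial>LI I) + (\<integral>\<^sup>+z. ennreal (p z) \<partial>LI I) + (\<integral>\<^sup>+z. ennreal (?q z) \<partial>LI I)"
      by (simp add: nn_integral_add nn_integral_cmult nn_integral_sum del: sum_ennreal)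
    also have "(\<Sum>a<K1. \<integral>\<^sup>+z. ennreal (F (sh a z)) \<partial>LI I) = of_nat K1 * (\<integral>\<^sup>+z. ennreal (F z) \<partial>LI I)"
      unfolding sh_def by (subst nn_integral_LI_shift[OF I, of "\<lambda>z. ennreal (F z)"]) auto
    also have "ennreal (1 / real K1) * (of_nat K1 * (\<integral>\<^sup>+z. ennreal (F z) \<partial>LI I)) = (\<integral>\<^sup>+z. ennreal (F z) \<partial>LI I)"
      using pos by (simp add: mult.assoc[symmetric] ennreal_of_nat_eq_real_of_nat ennreal_mult'[symmetric])
    also have "(\<integral>\<^sup>+z. ennreal (p z) \<partial>LI I) = 1" unfolding p_def using I pos by (intro nn_integral_output_density)
    also have "(\<integral>\<^sup>+z. ennreal (?q z) \<partial>LI I) = 1" by (rule gp(3))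
    finally show ?thesis unfolding r0 F_def p_def by (simp add: add.assoc)
  qed
  have "leak I h1 h2 1 K1 M2 K2 x1 x2 ?q \<le> (\<Sum>s<M2. ennreal (1 / (real 1 * real M2)) *
     ((\<integral>\<^sup>+z. ennreal (output_density I 0 h2 K1 K2 (\<lambda>a. x1 (0, a)) (\<lambda>b. x2 (s, b)) z *
         \<bar>ln (output_density I 0 h2 K1 K2 (\<lambda>a. x1 (0, a)) (\<lambda>b. x2 (s, b)) z / gd I v z)\<bar>) \<partial>LI I) + 2))"
    unfolding leak_def by (simp add: sum_mono mult_left_mono each)
  also have "\<dots> = leak I 0 h2 1 K1 M2 K2 x1 x2 (gd I v) + of_nat M2 * (ennreal (1 / real M2) * 2)"
    unfolding leak_def by (simp add: distrib_left sum.distrib)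
  also have "of_nat M2 * (ennreal (1 / real M2) * 2) = 2"
    using pos by (simp add: mult.assoc[symmetric] ennreal_of_nat_eq_real_of_nat ennreal_mult'[symmetric])
  finally show ?thesis .
qed

section \<open>Exchange of the terminals and achievable rates from random codes\<close>

lemma channel_density_swap: "channel_density I h2 h1 y x z = channel_density I h1 h2 x y z"
  unfolding channel_density_def by (intro gd_cong) simp

lemma output_density_swap: "output_density I h2 h1 K2 K1 w u z = output_density I h1 h2 K1 K2 u w z"
  unfolding output_density_def by (subst sum.swap) (simp add: channel_density_swap mult.commute)

lemma leak_swap: "leak I h2 h1 M2 O2 M1 O1 x2 x1 q = leak I h1 h2 M1 O1 M2 O2 x1 x2 q"
  unfolding leak_def by (subst sum.swap) (simp add: output_density_swap[of I h2 h1] mult.commute)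

lemma wiretap_code_swap:
  assumes "wiretap_code I Pb1 Pb2 h1 h2 \<epsilon> M1 O1 M2 O2"
  shows "wiretap_code I Pb2 Pb1 h2 h1 \<epsilon> M2 O2 M1 O1"
  using assms
  by (rule wiretap_codeE) (rule wiretap_codeI; (assumption | simp add: leak_swap mult.commute))

lemma strongly_achievable_swap:
  assumes "strongly_achievable Pb1 Pb2 h1 h2 R"
  shows "strongly_achievable Pb2 Pb1 h2 h1 (snd R, fst R)"
proof -
  have "Rsec (snd R, fst R) 1 = Rsec R 2" "Rsec (snd R, fst R) 2 = Rsec R 1"
    "Ropen (snd R, fst R) 1 = Ropen R 2" "Ropen (snd R, fst R) 2 = Ropen R 1"
    by (simp_all add: Rsec_def Ropen_def)
  then show ?thesis
    using assms unfolding strongly_achievable_def by (auto) (meson wiretap_code_swap)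
qed

text \<open>The codes are drawn for the gains \<open>h1'\<close> and \<open>h2'\<close>, while
  secrecy is claimed for \<open>h1\<close> and \<open>h2\<close>; \<open>conv\<close> carries a
  constant leakage over from one channel to the other. Setting \<open>h1'\<close> or
  \<open>h2'\<close> to 0 reduces the individual covering condition of that terminal to a positive
  open rate.\<close>

lemma strongly_achievable_of_random_codes:
  assumes P: "0 < P1" "P1 < Pb1" "0 < P2" "P2 < Pb2" and h: "0 \<le> h1'" "0 \<le> h2'"
    and S: "0 \<le> S1" "0 \<le> S2" and T: "0 \<le> T1" "0 \<le> T2"
    and rel: "S1 + T1 < ln (1 + P1) / 2" "S2 + T2 < ln (1 + P2) / 2"
    and sec: "ln (1 + h1' * P1 + h2' * P2) / 2 < T1 + T2"
      "ln ((1 + h1' * P1 + h2' * P2) / (1 + h2' * P2)) / 2 < T1"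
      "ln ((1 + h1' * P1 + h2' * P2) / (1 + h1' * P1)) / 2 < T2"
    and conv: "\<And>\<Lambda> \<epsilon>. \<Lambda> > 0 \<Longrightarrow> \<epsilon> > 0 \<Longrightarrow> \<exists>N. \<forall>I x1 x2. finite I \<and> card I \<ge> N \<and>
        leak I h1' h2' (code_size S1 (card I)) (code_size T1 (card I)) (code_size S2 (card I)) (code_size T2 (card I)) x1 x2 (gd I (1 + h1' * P1 + h2' * P2)) \<le> ennreal \<Lambda> \<longrightarrow>
        (\<exists>q. q \<in> borel_measurable (LI I) \<and> (\<forall>z. 0 < q z) \<and> (\<integral>\<^sup>+z. ennreal (q z) \<partial>LI I) \<le> 1 \<and>
          leak I h1 h2 (code_size S1 (card I)) (code_size T1 (card I)) (code_size S2 (card I)) (code_size T2 (card I)) x1 x2 q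
            \<le> ennreal (\<epsilon> * ln (real (code_size S1 (card I)) * real (code_size S2 (card I)))))"
  shows "strongly_achievable Pb1 Pb2 h1 h2 ((S1 / ln 2, T1 / ln 2), (S2 / ln 2, T2 / ln 2))"
  unfolding strongly_achievable_def
proof (intro allI impI)
  fix \<epsilon> :: real assume e: "\<epsilon> > 0"
  obtain \<Lambda> where L: "\<Lambda> > 0" and codes: "\<forall>\<epsilon>>0. \<exists>N. \<forall>I. finite I \<and> card I \<ge> N \<longrightarrow> (\<exists>x1 x2 D1 D2.
      (\<forall>m\<in>{..<code_size S1 (card I)} \<times> {..<code_size T1 (card I)}. (\<Sum>i\<in>I. (x1 m i)\<^sup>2) \<le> real (card I) * Pb1)
    \<and> (\<forall>m\<in>{..<code_size S2 (card I)} \<times> {..<code_size T2 (card I)}. (\<Sum>i\<in>I. (x2 m i)\<^sup>2) \<le> real (card I) * Pb2)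
    \<and> D1 \<in> LI I \<rightarrow>\<^sub>M count_space UNIV \<and> D2 \<in> LI I \<rightarrow>\<^sub>M count_space UNIV
    \<and> avg_error I ({..<code_size S1 (card I)} \<times> {..<code_size T1 (card I)}) x1 D1 \<le> ennreal \<epsilon>
    \<and> avg_error I ({..<code_size S2 (card I)} \<times> {..<code_size T2 (card I)}) x2 D2 \<le> ennreal \<epsilon>
    \<and> leak I h1' h2' (code_size S1 (card I)) (code_size T1 (card I)) (code_size S2 (card I)) (code_size T2 (card I)) x1 x2 (gd I (1 + h1' * P1 + h2' * P2)) \<le> ennreal \<Lambda>)"
    using random_codes[OF P h S T rel sec] by blast
  from codes e obtain N where N: "\<And>I. finite I \<and> card I \<ge> N \<Longrightarrow> (\<exists>x1 x2 D1 D2.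
      (\<forall>m\<in>{..<code_size S1 (card I)} \<times> {..<code_size T1 (card I)}. (\<Sum>i\<in>I. (x1 m i)\<^sup>2) \<le> real (card I) * Pb1)
    \<and> (\<forall>m\<in>{..<code_size S2 (card I)} \<times> {..<code_size T2 (card I)}. (\<Sum>i\<in>I. (x2 m i)\<^sup>2) \<le> real (card I) * Pb2)
    \<and> D1 \<in> LI I \<rightarrow>\<^sub>M count_space UNIV \<and> D2 \<in> LI I \<rightarrow>\<^sub>M count_space UNIV
    \<and> avg_error I ({..<code_size S1 (card I)} \<times> {..<code_size T1 (card I)}) x1 D1 \<le> ennreal \<epsilon>
    \<and> avg_error I ({..<code_size S2 (card I)} \<times> {..<code_size T2 (card I)}) x2 D2 \<le> ennreal \<epsilon>
    \<and> leak I h1' h2' (code_size S1 (card I)) (code_size T1 (card I)) (code_size S2 (card I)) (code_size T2 (card I)) x1 x2 (gd I (1 + h1' * P1 + h2' * P2)) \<le> ennreal \<Lambda>)"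
    by blast
  from conv[OF L e] obtain N' where N': "\<And>I x1 x2. finite I \<and> card I \<ge> N' \<and>
        leak I h1' h2' (code_size S1 (card I)) (code_size T1 (card I)) (code_size S2 (card I)) (code_size T2 (card I)) x1 x2 (gd I (1 + h1' * P1 + h2' * P2)) \<le> ennreal \<Lambda> \<Longrightarrow>
        (\<exists>q. q \<in> borel_measurable (LI I) \<and> (\<forall>z. 0 < q z) \<and> (\<integral>\<^sup>+z. ennreal (q z) \<partial>LI I) \<le> 1 \<and>
          leak I h1 h2 (code_size S1 (card I)) (code_size T1 (card I)) (code_size S2 (card I)) (code_size T2 (card I)) x1 x2 q
            \<le> ennreal (\<epsilon> * ln (real (code_size S1 (card I)) * real (code_size S2 (card I)))))" by blast
  let ?R = "((S1 / ln 2, T1 / ln 2), (S2 / ln 2, T2 / ln 2))"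
  have rate: "real n * (r / ln 2 - \<epsilon>) \<le> log 2 (real (code_size r n))" if "0 \<le> r" for r n
  proof -
    have "real n * r / ln 2 \<le> ln (real (code_size r n)) / ln 2"
      using code_size_bounds(2)[OF that, of n] by (intro divide_right_mono) auto
    moreover have "0 \<le> real n * \<epsilon>" using e by simp
    ultimately show ?thesis by (simp add: log_def algebra_simps)
  qed
  show "\<exists>N. \<forall>I. finite I \<and> card I \<ge> N \<longrightarrow>
    (\<exists>M1 O1 M2 O2. wiretap_code I Pb1 Pb2 h1 h2 \<epsilon> M1 O1 M2 O2
      \<and> real (card I) * (Rsec ?R 1 - \<epsilon>) \<le> log 2 (real M1) \<and> real (card I) * (Ropen ?R 1 - \<epsilon>) \<le> log 2 (real O1)
      \<and> real (card I) * (Rsec ?R 2 - \<epsilon>) \<le> log 2 (real M2) \<and> real (card I) * (Ropen ?R 2 - \<epsilon>) \<le> log 2 (real O2))"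
  proof (rule exI[of _ "max N N'"], intro allI impI)
    fix I :: "nat set" assume I: "finite I \<and> card I \<ge> max N N'"
    then obtain x1 x2 D1 D2 where c:
      "\<forall>m\<in>{..<code_size S1 (card I)} \<times> {..<code_size T1 (card I)}. (\<Sum>i\<in>I. (x1 m i)\<^sup>2) \<le> real (card I) * Pb1"
      "\<forall>m\<in>{..<code_size S2 (card I)} \<times> {..<code_size T2 (card I)}. (\<Sum>i\<in>I. (x2 m i)\<^sup>2) \<le> real (card I) * Pb2"
      "D1 \<in> LI I \<rightarrow>\<^sub>M count_space UNIV" "D2 \<in> LI I \<rightarrow>\<^sub>M count_space UNIV"
      "avg_error I ({..<code_size S1 (card I)} \<times> {..<code_size T1 (card I)}) x1 D1 \<le> ennreal \<epsilon>"
      "avg_error I ({..<code_size S2 (card I)} \<times> {..<code_size T2 (card I)}) x2 D2 \<le> ennreal \<epsilon>"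
      and lk: "leak I h1' h2' (code_size S1 (card I)) (code_size T1 (card I)) (code_size S2 (card I)) (code_size T2 (card I)) x1 x2 (gd I (1 + h1' * P1 + h2' * P2)) \<le> ennreal \<Lambda>"
      using N[of I] by auto
    have "finite I \<and> card I \<ge> N' \<and>
        leak I h1' h2' (code_size S1 (card I)) (code_size T1 (card I)) (code_size S2 (card I)) (code_size T2 (card I)) x1 x2 (gd I (1 + h1' * P1 + h2' * P2)) \<le> ennreal \<Lambda>"
      using I lk by simp
    from N'[OF this] obtain q where q: "q \<in> borel_measurable (LI I)" "\<And>z. 0 < q z" "(\<integral>\<^sup>+z. ennreal (q z) \<partial>LI I) \<le> 1"
      "leak I h1 h2 (code_size S1 (card I)) (code_size T1 (card I)) (code_size S2 (card I)) (code_size T2 (card I)) x1 x2 q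
            \<le> ennreal (\<epsilon> * ln (real (code_size S1 (card I)) * real (code_size S2 (card I))))" by blast
    have g: "wiretap_code I Pb1 Pb2 h1 h2 \<epsilon> (code_size S1 (card I)) (code_size T1 (card I)) (code_size S2 (card I)) (code_size T2 (card I))"
      by (rule wiretap_codeI[OF code_size_bounds(1)[OF S(1)] code_size_bounds(1)[OF T(1)] code_size_bounds(1)[OF S(2)] code_size_bounds(1)[OF T(2)] c q])
    have R: "Rsec ?R 1 = S1 / ln 2" "Ropen ?R 1 = T1 / ln 2" "Rsec ?R 2 = S2 / ln 2" "Ropen ?R 2 = T2 / ln 2"
      by (simp_all add: Rsec_def Ropen_def)
    show "\<exists>M1 O1 M2 O2. wiretap_code I Pb1 Pb2 h1 h2 \<epsilon> M1 O1 M2 O2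
      \<and> real (card I) * (Rsec ?R 1 - \<epsilon>) \<le> log 2 (real M1) \<and> real (card I) * (Ropen ?R 1 - \<epsilon>) \<le> log 2 (real O1)
      \<and> real (card I) * (Rsec ?R 2 - \<epsilon>) \<le> log 2 (real M2) \<and> real (card I) * (Ropen ?R 2 - \<epsilon>) \<le> log 2 (real O2)"
      unfolding R
      by (rule exI[of _ "code_size S1 (card I)"], rule exI[of _ "code_size T1 (card I)"], rule exI[of _ "code_size S2 (card I)"], rule exI[of _ "code_size T2 (card I)"])
         (intro conjI g rate S T)
  qed
qed

lemma ln_sizes_ge:
  assumes "0 \<le> S1" "0 \<le> S2"
  shows "real n * (S1 + S2) \<le> ln (real (code_size S1 n) * real (code_size S2 n))"
proof -
  have "ln (real (code_size S1 n) * real (code_size S2 n)) = ln (real (code_size S1 n)) + ln (real (code_size S2 n))"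
    by (rule ln_mult_pos) (use code_size_bounds(1)[OF assms(1), of n] code_size_bounds(1)[OF assms(2), of n] in \<open>simp_all only: of_nat_0_less_iff\<close>)
  then show ?thesis
    using code_size_bounds(2)[OF assms(1), of n] code_size_bounds(2)[OF assms(2), of n] by (simp add: distrib_left)
qed

lemma leak_bound_eventually:
  assumes "0 \<le> S1" "0 \<le> S2" "0 < S1 + S2" "0 < \<epsilon>"
  shows "\<exists>N. \<forall>n\<ge>N. (\<Lambda> :: real) \<le> \<epsilon> * ln (real (code_size S1 n) * real (code_size S2 n))"
proof (intro exI allI impI)
  fix n assume "nat \<lceil>\<Lambda> / (\<epsilon> * (S1 + S2))\<rceil> \<le> n"
  then have "\<Lambda> / (\<epsilon> * (S1 + S2)) \<le> real n" by linarith
  then have "\<Lambda> \<le> real n * (\<epsilon> * (S1 + S2))" using assms by (simp add: pos_divide_le_eq)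
  also have "\<dots> = \<epsilon> * (real n * (S1 + S2))" by simp
  also have "\<dots> \<le> \<epsilon> * ln (real (code_size S1 n) * real (code_size S2 n))"
    using ln_sizes_ge[OF assms(1,2)] assms(4) by (intro mult_left_mono) auto
  finally show "\<Lambda> \<le> \<epsilon> * ln (real (code_size S1 n) * real (code_size S2 n))" .
qed

lemma strongly_achievable_both_secret:
  assumes P: "0 < P1" "P1 < Pb1" "0 < P2" "P2 < Pb2" and h: "0 \<le> h1" "0 \<le> h2"
    and S: "0 \<le> S1" "0 \<le> S2" "0 < S1 + S2" and T: "0 \<le> T1" "0 \<le> T2"
    and rel: "S1 + T1 < ln (1 + P1) / 2" "S2 + T2 < ln (1 + P2) / 2"
    and sec: "ln (1 + h1 * P1 + h2 * P2) / 2 < T1 + T2"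
      "ln ((1 + h1 * P1 + h2 * P2) / (1 + h2 * P2)) / 2 < T1"
      "ln ((1 + h1 * P1 + h2 * P2) / (1 + h1 * P1)) / 2 < T2"
  shows "strongly_achievable Pb1 Pb2 h1 h2 ((S1 / ln 2, T1 / ln 2), (S2 / ln 2, T2 / ln 2))"
proof (rule strongly_achievable_of_random_codes[OF P h S(1,2) T rel sec])
  fix \<Lambda> \<epsilon> :: real assume L: "\<Lambda> > 0" and e: "\<epsilon> > 0"
  obtain N where N: "\<And>n. n \<ge> N \<Longrightarrow> \<Lambda> \<le> \<epsilon> * ln (real (code_size S1 n) * real (code_size S2 n))"
    using leak_bound_eventually[OF S e, of \<Lambda>] by blast
  have k: "1 + h1 * P1 + h2 * P2 > 0" using P h by (simp add: add_pos_nonneg)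
  show "\<exists>N. \<forall>I x1 x2. finite I \<and> card I \<ge> N \<and>
        leak I h1 h2 (code_size S1 (card I)) (code_size T1 (card I)) (code_size S2 (card I)) (code_size T2 (card I)) x1 x2 (gd I (1 + h1 * P1 + h2 * P2)) \<le> ennreal \<Lambda> \<longrightarrow>
        (\<exists>q. q \<in> borel_measurable (LI I) \<and> (\<forall>z. 0 < q z) \<and> (\<integral>\<^sup>+z. ennreal (q z) \<partial>LI I) \<le> 1 \<and>
          leak I h1 h2 (code_size S1 (card I)) (code_size T1 (card I)) (code_size S2 (card I)) (code_size T2 (card I)) x1 x2 q
            \<le> ennreal (\<epsilon> * ln (real (code_size S1 (card I)) * real (code_size S2 (card I)))))"
  proof (rule exI[of _ N], intro allI impI)
    fix I and x1 x2 :: "nat \<times> nat \<Rightarrow> nat \<Rightarrow> real"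
    assume a: "finite I \<and> card I \<ge> N \<and>
        leak I h1 h2 (code_size S1 (card I)) (code_size T1 (card I)) (code_size S2 (card I)) (code_size T2 (card I)) x1 x2 (gd I (1 + h1 * P1 + h2 * P2)) \<le> ennreal \<Lambda>"
    have le: "ennreal \<Lambda> \<le> ennreal (\<epsilon> * ln (real (code_size S1 (card I)) * real (code_size S2 (card I))))"
      using N[of "card I"] a by (intro ennreal_leI) blast
    have m: "gd I (1 + h1 * P1 + h2 * P2) \<in> borel_measurable (LI I)" by measurable
    show "\<exists>q. q \<in> borel_measurable (LI I) \<and> (\<forall>z. 0 < q z) \<and> (\<integral>\<^sup>+z. ennreal (q z) \<partial>LI I) \<le> 1 \<and>
          leak I h1 h2 (code_size S1 (card I)) (code_size T1 (card I)) (code_size S2 (card I)) (code_size T2 (card I)) x1 x2 q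
            \<le> ennreal (\<epsilon> * ln (real (code_size S1 (card I)) * real (code_size S2 (card I))))"
    proof (rule exI[of _ "gd I (1 + h1 * P1 + h2 * P2)"], intro conjI allI m)
      show "0 < gd I (1 + h1 * P1 + h2 * P2) z" for z using k by (rule gd_pos)
      show "(\<integral>\<^sup>+z. ennreal (gd I (1 + h1 * P1 + h2 * P2) z) \<partial>LI I) \<le> 1"
        using nn_integral_gd0[OF _ k, of I] a by simp
      show "leak I h1 h2 (code_size S1 (card I)) (code_size T1 (card I)) (code_size S2 (card I)) (code_size T2 (card I)) x1 x2 (gd I (1 + h1 * P1 + h2 * P2))
            \<le> ennreal (\<epsilon> * ln (real (code_size S1 (card I)) * real (code_size S2 (card I))))"
        using a le by (blast intro: order_trans)
    qed
  qed
qed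

text \<open>The codes are drawn as if the eavesdropper did not receive terminal 1, so
  \<open>T1\<close> only has to be positive and \<open>T2\<close> only has to exceed the
  point-to-point mutual information of terminal 2. Passing to the true gain \<open>h1\<close> by
  \<open>leak_genie\<close> adds 2 to the leakage.\<close>

lemma strongly_achievable_one_secret:
  assumes P: "0 < P1" "P1 < Pb1" "0 < P2" "P2 < Pb2" and h: "0 \<le> h2"
    and S: "0 < S2" and T: "0 < T1" "ln (1 + h2 * P2) / 2 < T2"
    and rel: "T1 < ln (1 + P1) / 2" "S2 + T2 < ln (1 + P2) / 2"
  shows "strongly_achievable Pb1 Pb2 h1 h2 ((0, T1 / ln 2), (S2 / ln 2, T2 / ln 2))"
proof -
  have k: "1 + h2 * P2 \<ge> 1" using P h by simp
  then have T2: "0 \<le> T2" using T(2) ln_ge_zero[OF k] by linarith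
  have "strongly_achievable Pb1 Pb2 h1 h2 ((0 / ln 2, T1 / ln 2), (S2 / ln 2, T2 / ln 2))"
  proof (rule strongly_achievable_of_random_codes[OF P order_refl h order_refl less_imp_le[OF S] less_imp_le[OF T(1)] T2])
    show "0 + T1 < ln (1 + P1) / 2" "S2 + T2 < ln (1 + P2) / 2" using rel by simp_all
    show "ln (1 + 0 * P1 + h2 * P2) / 2 < T1 + T2" "ln ((1 + 0 * P1 + h2 * P2) / (1 + h2 * P2)) / 2 < T1"
      "ln ((1 + 0 * P1 + h2 * P2) / (1 + 0 * P1)) / 2 < T2" using T k by simp_all
    fix \<Lambda> \<epsilon> :: real assume L: "\<Lambda> > 0" and e: "\<epsilon> > 0"
    obtain N where N: "\<And>n. n \<ge> N \<Longrightarrow> \<Lambda> + 2 \<le> \<epsilon> * ln (real (code_size 0 n) * real (code_size S2 n))"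
      using leak_bound_eventually[OF order_refl less_imp_le[OF S] _ e, of "\<Lambda> + 2"] S by auto
    show "\<exists>N. \<forall>I x1 x2. finite I \<and> card I \<ge> N \<and>
        leak I 0 h2 (code_size 0 (card I)) (code_size T1 (card I)) (code_size S2 (card I)) (code_size T2 (card I)) x1 x2 (gd I (1 + 0 * P1 + h2 * P2)) \<le> ennreal \<Lambda> \<longrightarrow>
        (\<exists>q. q \<in> borel_measurable (LI I) \<and> (\<forall>z. 0 < q z) \<and> (\<integral>\<^sup>+z. ennreal (q z) \<partial>LI I) \<le> 1 \<and>
          leak I h1 h2 (code_size 0 (card I)) (code_size T1 (card I)) (code_size S2 (card I)) (code_size T2 (card I)) x1 x2 q
            \<le> ennreal (\<epsilon> * ln (real (code_size 0 (card I)) * real (code_size S2 (card I)))))"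
    proof (rule exI[of _ N], intro allI impI)
      fix I and x1 x2 :: "nat \<times> nat \<Rightarrow> nat \<Rightarrow> real"
      assume a: "finite I \<and> card I \<ge> N \<and>
        leak I 0 h2 (code_size 0 (card I)) (code_size T1 (card I)) (code_size S2 (card I)) (code_size T2 (card I)) x1 x2 (gd I (1 + 0 * P1 + h2 * P2)) \<le> ennreal \<Lambda>"
      then have I: "finite I" and lk: "leak I 0 h2 1 (code_size T1 (card I)) (code_size S2 (card I)) (code_size T2 (card I)) x1 x2 (gd I (1 + h2 * P2)) \<le> ennreal \<Lambda>"
        by simp_all
      have v: "0 < 1 + h2 * P2" using k by linarith
      note cb = code_size_bounds(1)[OF less_imp_le[OF T(1)], of "card I"] code_size_bounds(1)[OF less_imp_le[OF S], of "card I"] code_size_bounds(1)[OF T2, of "card I"]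
      let ?q = "genie_density I h1 (1 + h2 * P2) (code_size T1 (card I)) x1"
      note gp = genie_density_props[OF I cb(1) v, of h1 x1]
      have "leak I h1 h2 1 (code_size T1 (card I)) (code_size S2 (card I)) (code_size T2 (card I)) x1 x2 ?q \<le> ennreal \<Lambda> + 2"
        using leak_genie[OF I cb(1,2,3) v, of h1 h2 x1 x2] lk by (meson add_right_mono order_trans)
      also have "\<dots> = ennreal (\<Lambda> + 2)" using L by (simp add: ennreal_plus)
      also have "\<dots> \<le> ennreal (\<epsilon> * ln (real (code_size 0 (card I)) * real (code_size S2 (card I))))"
        using N[of "card I"] a by (intro ennreal_leI) blast
      finally have "leak I h1 h2 (code_size 0 (card I)) (code_size T1 (card I)) (code_size S2 (card I)) (code_size T2 (card I)) x1 x2 ?q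
            \<le> ennreal (\<epsilon> * ln (real (code_size 0 (card I)) * real (code_size S2 (card I))))" by simp
      then show "\<exists>q. q \<in> borel_measurable (LI I) \<and> (\<forall>z. 0 < q z) \<and> (\<integral>\<^sup>+z. ennreal (q z) \<partial>LI I) \<le> 1 \<and>
          leak I h1 h2 (code_size 0 (card I)) (code_size T1 (card I)) (code_size S2 (card I)) (code_size T2 (card I)) x1 x2 q
            \<le> ennreal (\<epsilon> * ln (real (code_size 0 (card I)) * real (code_size S2 (card I))))"
        using gp by (intro exI[of _ ?q] conjI allI) simp_all
    qed
  qed
  then show ?thesis by simp
qed

text \<open>Only reliability matters, so the codes are drawn with both gains set to 0, where the
  covering conditions ask for nothing but positive open rates.\<close>

lemma strongly_achievable_no_secret:
  assumes P: "0 < P1" "P1 < Pb1" "0 < P2" "P2 < Pb2" and T: "0 < T1" "0 < T2"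
    and rel: "T1 < ln (1 + P1) / 2" "T2 < ln (1 + P2) / 2"
  shows "strongly_achievable Pb1 Pb2 h1 h2 ((0, T1 / ln 2), (0, T2 / ln 2))"
proof -
  have "strongly_achievable Pb1 Pb2 h1 h2 ((0 / ln 2, T1 / ln 2), (0 / ln 2, T2 / ln 2))"
  proof (rule strongly_achievable_of_random_codes[OF P order_refl order_refl order_refl order_refl less_imp_le[OF T(1)] less_imp_le[OF T(2)]])
    show "0 + T1 < ln (1 + P1) / 2" "0 + T2 < ln (1 + P2) / 2" using rel by simp_all
    show "ln (1 + 0 * P1 + 0 * P2) / 2 < T1 + T2" "ln ((1 + 0 * P1 + 0 * P2) / (1 + 0 * P2)) / 2 < T1"
      "ln ((1 + 0 * P1 + 0 * P2) / (1 + 0 * P1)) / 2 < T2" using T by simp_all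
    fix \<Lambda> \<epsilon> :: real assume e: "\<epsilon> > 0"
    show "\<exists>N. \<forall>I x1 x2. finite I \<and> card I \<ge> N \<and>
        leak I 0 0 (code_size 0 (card I)) (code_size T1 (card I)) (code_size 0 (card I)) (code_size T2 (card I)) x1 x2 (gd I (1 + 0 * P1 + 0 * P2)) \<le> ennreal \<Lambda> \<longrightarrow>
        (\<exists>q. q \<in> borel_measurable (LI I) \<and> (\<forall>z. 0 < q z) \<and> (\<integral>\<^sup>+z. ennreal (q z) \<partial>LI I) \<le> 1 \<and>
          leak I h1 h2 (code_size 0 (card I)) (code_size T1 (card I)) (code_size 0 (card I)) (code_size T2 (card I)) x1 x2 q
            \<le> ennreal (\<epsilon> * ln (real (code_size 0 (card I)) * real (code_size 0 (card I)))))"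
    proof (rule exI[of _ 0], intro allI impI)
      fix I and x1 x2 :: "nat \<times> nat \<Rightarrow> nat \<Rightarrow> real"
      assume a: "finite I \<and> card I \<ge> 0 \<and>
        leak I 0 0 (code_size 0 (card I)) (code_size T1 (card I)) (code_size 0 (card I)) (code_size T2 (card I)) x1 x2 (gd I (1 + 0 * P1 + 0 * P2)) \<le> ennreal \<Lambda>"
      note cb = code_size_bounds(1)[OF less_imp_le[OF T(1)], of "card I"] code_size_bounds(1)[OF less_imp_le[OF T(2)], of "card I"]
      \<comment> \<open>There is one pair of secrets, so the allowance is
        \<open>\<epsilon> * ln 1 = 0\<close> and no constant leakage is tolerated. With the true
        output density as reference the log-ratio vanishes identically.\<close>
      let ?q = "output_density I h1 h2 (code_size T1 (card I)) (code_size T2 (card I)) (\<lambda>a. x1 (0, a)) (\<lambda>b. x2 (0, b))"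
      have qp: "0 < ?q z" for z by (rule output_density_pos[OF cb])
      have "leak I h1 h2 1 (code_size T1 (card I)) 1 (code_size T2 (card I)) x1 x2 ?q = 0"
        unfolding leak_def using qp by (simp add: less_imp_neq[symmetric])
      then show "\<exists>q. q \<in> borel_measurable (LI I) \<and> (\<forall>z. 0 < q z) \<and> (\<integral>\<^sup>+z. ennreal (q z) \<partial>LI I) \<le> 1 \<and>
          leak I h1 h2 (code_size 0 (card I)) (code_size T1 (card I)) (code_size 0 (card I)) (code_size T2 (card I)) x1 x2 q
            \<le> ennreal (\<epsilon> * ln (real (code_size 0 (card I)) * real (code_size 0 (card I))))"
        using qp nn_integral_output_density[OF _ cb, of I] a by (intro exI[of _ ?q] conjI allI) simp_all
    qed
  qed
  then show ?thesis by simp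
qed

subsection \<open>The achievable region\<close>

text \<open>The powers in the region may be 0 or equal to their limits, whereas random codes need
  them strictly in between. Mixing with \<open>Pb / 2\<close> approaches them from the interior of
  the box.\<close>

lemma interior_powers:
  fixes P1 P2 Pb1 Pb2 :: real
  assumes "0 \<le> P1" "P1 \<le> Pb1" "0 < Pb1" "0 \<le> P2" "P2 \<le> Pb2" "0 < Pb2"
  obtains p1 p2 :: "nat \<Rightarrow> real" where "p1 \<longlonglongrightarrow> P1" "p2 \<longlonglongrightarrow> P2"
    "\<And>n. 0 < p1 n" "\<And>n. p1 n < Pb1" "\<And>n. 0 < p2 n" "\<And>n. p2 n < Pb2"
proof -
  define t where "t n = 1 / (real n + 2)" for n
  define p where "p P Pb n = (1 - t n) * P + t n * (Pb / 2)" for P Pb n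
  have t: "t \<longlonglongrightarrow> 0" 
    unfolding t_def[abs_def]
    using LIMSEQ_ignore_initial_segment[OF lim_inverse_n[where 'a = real], of 2] by (simp add: inverse_eq_divide add.commute)
  have t01: "0 < t n" "t n < 1" for n by (auto simp: t_def)
  have lim: "p P Pb \<longlonglongrightarrow> P" for P Pb
  proof -
    have "(\<lambda>n. (1 - t n) * P + t n * (Pb / 2)) \<longlonglongrightarrow> (1 - 0) * P + 0 * (Pb / 2)"
      by (intro tendsto_intros t)
    then show ?thesis unfolding p_def[abs_def] by simp
  qed
  have box: "0 < p P Pb n" "p P Pb n < Pb" if "0 \<le> P" "P \<le> Pb" "0 < Pb" for P Pb n
  proof -
    have "0 \<le> (1 - t n) * P" "0 < t n * (Pb / 2)" using that t01[of n] by auto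
    then show "0 < p P Pb n" unfolding p_def by linarith
    have "(1 - t n) * P \<le> (1 - t n) * Pb" using that t01[of n] by (intro mult_left_mono) auto
    moreover have "t n * (Pb / 2) < t n * Pb" using that t01[of n] by (intro mult_strict_left_mono) auto
    ultimately have "p P Pb n < (1 - t n) * Pb + t n * Pb" unfolding p_def by linarith
    then show "p P Pb n < Pb" by (simp add: algebra_simps)
  qed
  show ?thesis
    by (rule that[OF lim lim box(1)[OF assms(1-3)] box(2)[OF assms(1-3)] box(1)[OF assms(4-6)] box(2)[OF assms(4-6)]])
qed

lemma strongly_achievable_approx_nats:
  assumes "\<And>\<eta>. \<eta> > 0 \<Longrightarrow> \<exists>S1' T1' S2' T2'. strongly_achievable Pb1 Pb2 h1 h2 ((S1' / ln 2, T1' / ln 2), (S2' / ln 2, T2' / ln 2))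
      \<and> S1 - \<eta> \<le> S1' \<and> T1 - \<eta> \<le> T1' \<and> S2 - \<eta> \<le> S2' \<and> T2 - \<eta> \<le> T2'"
  shows "strongly_achievable Pb1 Pb2 h1 h2 ((S1 / ln 2, T1 / ln 2), (S2 / ln 2, T2 / ln 2))"
proof (rule strongly_achievable_approx)
  fix \<delta> :: real assume d: "\<delta> > 0"
  then have "\<delta> * ln 2 > 0" by simp
  from assms[OF this] obtain S1' T1' S2' T2' where R': "strongly_achievable Pb1 Pb2 h1 h2 ((S1' / ln 2, T1' / ln 2), (S2' / ln 2, T2' / ln 2))"
    and le: "S1 - \<delta> * ln 2 \<le> S1'" "T1 - \<delta> * ln 2 \<le> T1'" "S2 - \<delta> * ln 2 \<le> S2'" "T2 - \<delta> * ln 2 \<le> T2'" by blast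
  have b: "a / ln 2 - \<delta> \<le> a' / ln 2" if "a - \<delta> * ln 2 \<le> a'" for a a'
    using divide_right_mono[OF that, of "ln 2"] by (simp add: diff_divide_distrib)
  show "\<exists>R'. strongly_achievable Pb1 Pb2 h1 h2 R' \<and> (\<forall>k\<in>{1,2}. Rsec ((S1 / ln 2, T1 / ln 2), (S2 / ln 2, T2 / ln 2)) k - \<delta> \<le> Rsec R' k
      \<and> Ropen ((S1 / ln 2, T1 / ln 2), (S2 / ln 2, T2 / ln 2)) k - \<delta> \<le> Ropen R' k)"
    using R' le by (intro exI[of _ "((S1' / ln 2, T1' / ln 2), (S2' / ln 2, T2' / ln 2))"]) (auto simp: Rsec_def Ropen_def intro!: b)
qed

context
  fixes P1 P2 Pb1 Pb2 h1 h2 :: real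
  assumes P: "0 \<le> P1" "P1 \<le> Pb1" "0 < Pb1" "0 \<le> P2" "P2 \<le> Pb2" "0 < Pb2" and h: "0 < h1" "0 < h2"
begin

lemma strongly_achievable_zero_secret_region:
  assumes "T1 \<le> ln (1 + P1) / 2" "T2 \<le> ln (1 + P2) / 2"
  shows "strongly_achievable Pb1 Pb2 h1 h2 ((0 / ln 2, T1 / ln 2), (0 / ln 2, T2 / ln 2))"
proof (rule strongly_achievable_approx_nats)
  fix \<eta> :: real assume e: "\<eta> > 0"
  obtain p1 p2 :: "nat \<Rightarrow> real" where lim: "p1 \<longlonglongrightarrow> P1" "p2 \<longlonglongrightarrow> P2"
    and p: "\<And>n. 0 < p1 n" "\<And>n. p1 n < Pb1" "\<And>n. 0 < p2 n" "\<And>n. p2 n < Pb2"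
    using interior_powers[OF P] by blast
  have cl: "(\<lambda>n. ln (1 + p1 n) / 2) \<longlonglongrightarrow> ln (1 + P1) / 2" "(\<lambda>n. ln (1 + p2 n) / 2) \<longlonglongrightarrow> ln (1 + P2) / 2"
    by (intro tendsto_intros lim; use P in simp)+
  have "eventually (\<lambda>n. ln (1 + P1) / 2 - \<eta> / 2 < ln (1 + p1 n) / 2) sequentially"
    "eventually (\<lambda>n. ln (1 + P2) / 2 - \<eta> / 2 < ln (1 + p2 n) / 2) sequentially"
    by (rule order_tendstoD(1)[OF cl(1)], use e in simp) (rule order_tendstoD(1)[OF cl(2)], use e in simp)
  then have "eventually (\<lambda>n. ln (1 + P1) / 2 - \<eta> / 2 < ln (1 + p1 n) / 2 \<and> ln (1 + P2) / 2 - \<eta> / 2 < ln (1 + p2 n) / 2) sequentially"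
    by (rule eventually_conj)
  then obtain n where n: "ln (1 + P1) / 2 - \<eta> / 2 < ln (1 + p1 n) / 2" "ln (1 + P2) / 2 - \<eta> / 2 < ln (1 + p2 n) / 2"
    using eventually_happens trivial_limit_sequentially by blast
  have c: "0 < ln (1 + p1 n) / 2" "0 < ln (1 + p2 n) / 2" using p[of n] by simp_all
  define d where "d = min (\<eta> / 2) (min (ln (1 + p1 n) / 2) (ln (1 + p2 n) / 2)) / 2"
  have d: "0 < d" "d \<le> \<eta> / 2" "d < ln (1 + p1 n) / 2" "d < ln (1 + p2 n) / 2"
    using c e unfolding d_def by (auto simp: min_def)
  have "strongly_achievable Pb1 Pb2 h1 h2 ((0, (ln (1 + p1 n) / 2 - d) / ln 2), (0, (ln (1 + p2 n) / 2 - d) / ln 2))"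
    by (rule strongly_achievable_no_secret[of "p1 n" Pb1 "p2 n" Pb2]) (use p d in simp_all)
  then show "\<exists>S1' T1' S2' T2'. strongly_achievable Pb1 Pb2 h1 h2 ((S1' / ln 2, T1' / ln 2), (S2' / ln 2, T2' / ln 2))
      \<and> 0 - \<eta> \<le> S1' \<and> T1 - \<eta> \<le> T1' \<and> 0 - \<eta> \<le> S2' \<and> T2 - \<eta> \<le> T2'"
    using n d e assms
    by - (rule exI[of _ 0], rule exI[of _ "ln (1 + p1 n) / 2 - d"], rule exI[of _ 0], rule exI[of _ "ln (1 + p2 n) / 2 - d"], auto)
qed

text \<open>By the chain rule the joint mutual information is that of terminal 1 plus
  \<open>ln (1 + h2 * P2) / 2\<close>. As the first part is at least the capacity of terminal 1, the
  bound on the sum of secrets leaves for \<open>S2\<close> exactly the condition of the channel in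
  which the codeword of terminal 1 is known.\<close>

lemma strongly_achievable_one_secret_region:
  assumes T: "T1 \<le> ln (1 + P1) / 2" "S2 + T2 \<le> ln (1 + P2) / 2" and S: "0 < S2"
    and J: "ln (1 + P1) / 2 \<le> ln ((1 + h1 * P1 + h2 * P2) / (1 + h2 * P2)) / 2"
    and sum: "S2 \<le> ln (1 + P1) / 2 + ln (1 + P2) / 2 - ln (1 + h1 * P1 + h2 * P2) / 2"
  shows "strongly_achievable Pb1 Pb2 h1 h2 ((0 / ln 2, T1 / ln 2), (S2 / ln 2, T2 / ln 2))"
proof (rule strongly_achievable_approx_nats)
  fix \<eta> :: real assume e: "\<eta> > 0"
  obtain p1 p2 :: "nat \<Rightarrow> real" where lim: "p1 \<longlonglongrightarrow> P1" "p2 \<longlonglongrightarrow> P2"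
    and p: "\<And>n. 0 < p1 n" "\<And>n. p1 n < Pb1" "\<And>n. 0 < p2 n" "\<And>n. p2 n < Pb2"
    using interior_powers[OF P] by blast
  have hp: "0 \<le> h1 * P1" "0 \<le> h2 * P2" using P h by auto
  have "ln ((1 + h1 * P1 + h2 * P2) / (1 + h2 * P2)) = ln (1 + h1 * P1 + h2 * P2) - ln (1 + h2 * P2)"
    using hp by (subst ln_div) auto
  then have S2: "S2 + ln (1 + h2 * P2) / 2 \<le> ln (1 + P2) / 2" using J sum by linarith
  \<comment> \<open>Lowering the secret rate by at most \<open>\<eta>\<close> makes room for an open
    rate strictly above the mutual information; at most half of \<open>S2\<close> is removed, so
    that a secret remains.\<close>
  define S' where "S' = S2 - min \<eta> (S2 / 2)"
  have S': "0 < S'" "S' < S2" "S2 - \<eta> \<le> S'" using S e by (auto simp: S'_def min_def)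
  have cl: "(\<lambda>n. ln (1 + p1 n) / 2) \<longlonglongrightarrow> ln (1 + P1) / 2" "(\<lambda>n. ln (1 + p2 n) / 2) \<longlonglongrightarrow> ln (1 + P2) / 2"
    by (intro tendsto_intros lim; use P in simp)+
  have 1: "eventually (\<lambda>n. ln (1 + P1) / 2 - \<eta> / 2 < ln (1 + p1 n) / 2) sequentially"
    "eventually (\<lambda>n. ln (1 + P2) / 2 - \<eta> / 2 < ln (1 + p2 n) / 2) sequentially"
    by (rule order_tendstoD(1)[OF cl(1)], use e in simp) (rule order_tendstoD(1)[OF cl(2)], use e in simp)
  have l2: "(\<lambda>n. ln (1 + p2 n) / 2 - S' - ln (1 + h2 * p2 n) / 2) \<longlonglongrightarrow> ln (1 + P2) / 2 - S' - ln (1 + h2 * P2) / 2"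
    by (intro tendsto_intros lim; use P hp in linarith)
  have 2: "eventually (\<lambda>n. 0 < ln (1 + p2 n) / 2 - S' - ln (1 + h2 * p2 n) / 2) sequentially"
    by (rule order_tendstoD(1)[OF l2]) (use S2 S'(2) in linarith)
  from eventually_conj[OF 1(1) eventually_conj[OF 1(2) 2]]
  obtain n where n: "ln (1 + P1) / 2 - \<eta> / 2 < ln (1 + p1 n) / 2" "ln (1 + P2) / 2 - \<eta> / 2 < ln (1 + p2 n) / 2"
    "0 < ln (1 + p2 n) / 2 - S' - ln (1 + h2 * p2 n) / 2"
    using eventually_happens trivial_limit_sequentially by blast
  have c: "0 < ln (1 + p1 n) / 2" using p[of n] by simp
  define d where "d = min (\<eta> / 2) (min (ln (1 + p1 n) / 2) (ln (1 + p2 n) / 2 - S' - ln (1 + h2 * p2 n) / 2)) / 2"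
  have d: "0 < d" "d \<le> \<eta> / 2" "d < ln (1 + p1 n) / 2" "d < ln (1 + p2 n) / 2 - S' - ln (1 + h2 * p2 n) / 2"
    using c e n(3) unfolding d_def by (auto simp: min_def)
  have "strongly_achievable Pb1 Pb2 h1 h2 ((0, (ln (1 + p1 n) / 2 - d) / ln 2), (S' / ln 2, (ln (1 + p2 n) / 2 - S' - d) / ln 2))"
    by (rule strongly_achievable_one_secret[of "p1 n" Pb1 "p2 n" Pb2]) (use p d h S' in simp_all)
  then show "\<exists>S1' T1' S2' T2'. strongly_achievable Pb1 Pb2 h1 h2 ((S1' / ln 2, T1' / ln 2), (S2' / ln 2, T2' / ln 2))
      \<and> 0 - \<eta> \<le> S1' \<and> T1 - \<eta> \<le> T1' \<and> S2 - \<eta> \<le> S2' \<and> T2 - \<eta> \<le> T2'"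
    using n d e T S'
    by - (rule exI[of _ 0], rule exI[of _ "ln (1 + p1 n) / 2 - d"], rule exI[of _ S'], rule exI[of _ "ln (1 + p2 n) / 2 - S' - d"], auto)
qed

text \<open>The open messages take nearly all of the rate that the secrets leave, which turns the
  covering conditions into the brackets of the region. The perturbation has to create slack in all
  three conditions and still keep a positive secret rate at some terminal.\<close>

lemma strongly_achievable_both_secret_region:
  assumes T: "S1 + T1 \<le> ln (1 + P1) / 2" "S2 + T2 \<le> ln (1 + P2) / 2" and S: "0 \<le> S1" "0 \<le> S2" "0 < S1 + S2"
    and J: "ln ((1 + h1 * P1 + h2 * P2) / (1 + h2 * P2)) / 2 < ln (1 + P1) / 2"
      "ln ((1 + h1 * P1 + h2 * P2) / (1 + h1 * P1)) / 2 < ln (1 + P2) / 2"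
    and sep: "S1 \<le> ln (1 + P1) / 2 - ln ((1 + h1 * P1 + h2 * P2) / (1 + h2 * P2)) / 2"
      "S2 \<le> ln (1 + P2) / 2 - ln ((1 + h1 * P1 + h2 * P2) / (1 + h1 * P1)) / 2"
    and sum: "S1 + S2 \<le> ln (1 + P1) / 2 + ln (1 + P2) / 2 - ln (1 + h1 * P1 + h2 * P2) / 2"
  shows "strongly_achievable Pb1 Pb2 h1 h2 ((S1 / ln 2, T1 / ln 2), (S2 / ln 2, T2 / ln 2))"
proof (rule strongly_achievable_approx_nats)
  fix \<eta> :: real assume e: "\<eta> > 0"
  obtain p1 p2 :: "nat \<Rightarrow> real" where lim: "p1 \<longlonglongrightarrow> P1" "p2 \<longlonglongrightarrow> P2"
    and p: "\<And>n. 0 < p1 n" "\<And>n. p1 n < Pb1" "\<And>n. 0 < p2 n" "\<And>n. p2 n < Pb2"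
    using interior_powers[OF P] by blast
  have hp: "0 \<le> h1 * P1" "0 \<le> h2 * P2" using P h by auto
  let ?c1 = "\<lambda>x::real. ln (1 + x) / 2"
  let ?J1 = "\<lambda>x y. ln ((1 + h1 * x + h2 * y) / (1 + h2 * y)) / 2" and ?J2 = "\<lambda>x y. ln ((1 + h1 * x + h2 * y) / (1 + h1 * x)) / 2"
  let ?J = "\<lambda>x y. ln (1 + h1 * x + h2 * y) / 2"
  \<comment> \<open>The larger secret rate is at least \<open>3 * r\<close>, so it stays positive
    when lowered by \<open>r\<close>; hence \<open>U1 + U2\<close> is positive and strictly below
    \<open>S1 + S2\<close>.\<close>
  define r where "r = min \<eta> (max S1 S2 / 3)"
  define U1 where "U1 = max 0 (S1 - r)"
  define U2 where "U2 = max 0 (S2 - r)"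
  have r: "0 < r" "r \<le> \<eta>" "2 * r < max S1 S2" using S e by (auto simp: r_def min_def max_def)
  have U: "0 \<le> U1" "0 \<le> U2" "0 < U1 + U2" "U1 + U2 < S1 + S2" "S1 - \<eta> \<le> U1" "S2 - \<eta> \<le> U2" "U1 \<le> S1" "U2 \<le> S2"
    "U1 < S1 \<or> U1 = 0" "U2 < S2 \<or> U2 = 0"
    using r S unfolding U1_def U2_def by (simp_all add: max_def split: if_splits)
  \<comment> \<open>Each secret rate was lowered strictly or is 0 now. In the first case the slack
    comes from the lowering, in the second from the strict inequalities \<open>J\<close>.\<close>
  have slack: "0 < ?c1 P1 - U1 - ?J1 P1 P2" "0 < ?c1 P2 - U2 - ?J2 P1 P2" "0 < ?c1 P1 + ?c1 P2 - (U1 + U2) - ?J P1 P2"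
    using U J sep sum by linarith+
  have cl: "(\<lambda>n. ?c1 (p1 n)) \<longlonglongrightarrow> ?c1 P1" "(\<lambda>n. ?c1 (p2 n)) \<longlonglongrightarrow> ?c1 P2"
    by (intro tendsto_intros lim; use P in simp)+
  have ne: "1 + h1 * P1 + h2 * P2 \<noteq> 0" "1 + h1 * P1 \<noteq> 0" "1 + h2 * P2 \<noteq> 0" using hp by linarith+
  have Jl: "(\<lambda>n. ?J1 (p1 n) (p2 n)) \<longlonglongrightarrow> ?J1 P1 P2" "(\<lambda>n. ?J2 (p1 n) (p2 n)) \<longlonglongrightarrow> ?J2 P1 P2"
    "(\<lambda>n. ?J (p1 n) (p2 n)) \<longlonglongrightarrow> ?J P1 P2"
    by (intro tendsto_divide tendsto_ln tendsto_add tendsto_mult tendsto_const lim; use ne in simp)+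
  have 1: "eventually (\<lambda>n. ?c1 P1 - \<eta> / 2 < ?c1 (p1 n)) sequentially"
    "eventually (\<lambda>n. ?c1 P2 - \<eta> / 2 < ?c1 (p2 n)) sequentially"
    by (rule order_tendstoD(1)[OF cl(1)], use e in simp) (rule order_tendstoD(1)[OF cl(2)], use e in simp)
  have 2: "eventually (\<lambda>n. 0 < ?c1 (p1 n) - U1 - ?J1 (p1 n) (p2 n)) sequentially"
    by (rule order_tendstoD(1)[OF _ slack(1)]) (intro tendsto_diff cl Jl tendsto_const)
  have 3: "eventually (\<lambda>n. 0 < ?c1 (p2 n) - U2 - ?J2 (p1 n) (p2 n)) sequentially"
    by (rule order_tendstoD(1)[OF _ slack(2)]) (intro tendsto_diff cl Jl tendsto_const)
  have 4: "eventually (\<lambda>n. 0 < ?c1 (p1 n) + ?c1 (p2 n) - (U1 + U2) - ?J (p1 n) (p2 n)) sequentially"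
    by (rule order_tendstoD(1)[OF _ slack(3)]) (intro tendsto_diff tendsto_add cl Jl tendsto_const)
  from eventually_conj[OF 1(1) eventually_conj[OF 1(2) eventually_conj[OF 2 eventually_conj[OF 3 4]]]]
  obtain n where n: "?c1 P1 - \<eta> / 2 < ?c1 (p1 n)" "?c1 P2 - \<eta> / 2 < ?c1 (p2 n)"
    "0 < ?c1 (p1 n) - U1 - ?J1 (p1 n) (p2 n)" "0 < ?c1 (p2 n) - U2 - ?J2 (p1 n) (p2 n)"
    "0 < ?c1 (p1 n) + ?c1 (p2 n) - (U1 + U2) - ?J (p1 n) (p2 n)"
    using eventually_happens trivial_limit_sequentially by blast
  define m where "m = Min {\<eta> / 2, ?c1 (p1 n) - U1 - ?J1 (p1 n) (p2 n), ?c1 (p2 n) - U2 - ?J2 (p1 n) (p2 n), ?c1 (p1 n) + ?c1 (p2 n) - (U1 + U2) - ?J (p1 n) (p2 n)}"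
  have m: "0 < m" "m \<le> \<eta> / 2" "m \<le> ?c1 (p1 n) - U1 - ?J1 (p1 n) (p2 n)" "m \<le> ?c1 (p2 n) - U2 - ?J2 (p1 n) (p2 n)"
    "m \<le> ?c1 (p1 n) + ?c1 (p2 n) - (U1 + U2) - ?J (p1 n) (p2 n)"
    unfolding m_def by (use n e in \<open>subst Min_gr_iff; simp\<close>) (rule Min_le; simp)+
  \<comment> \<open>Both open rates give up \<open>d\<close>, so the sum condition loses
    \<open>2 * d\<close>; a third of the smallest slack keeps every inequality strict.\<close>
  define d where "d = m / 3"
  have d: "0 < d" "3 * d = m" using m by (auto simp: d_def)
  have hq: "0 \<le> h1 * p1 n" "0 \<le> h2 * p2 n" using p[of n] h by auto
  have J0: "0 \<le> ?J1 (p1 n) (p2 n)" "0 \<le> ?J2 (p1 n) (p2 n)" using hq by (auto simp: le_divide_eq)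
  define T1' where "T1' = ?c1 (p1 n) - U1 - d"
  define T2' where "T2' = ?c1 (p2 n) - U2 - d"
  have "strongly_achievable Pb1 Pb2 h1 h2 ((U1 / ln 2, T1' / ln 2), (U2 / ln 2, T2' / ln 2))"
  proof (rule strongly_achievable_both_secret[OF p(1,2,3,4) less_imp_le[OF h(1)] less_imp_le[OF h(2)] U(1,2,3)])
    show "0 \<le> T1'" "0 \<le> T2'" "?J1 (p1 n) (p2 n) < T1'" "?J2 (p1 n) (p2 n) < T2'"
      unfolding T1'_def T2'_def using m d J0 by linarith+
    show "U1 + T1' < ?c1 (p1 n)" "U2 + T2' < ?c1 (p2 n)" "?J (p1 n) (p2 n) < T1' + T2'"
      unfolding T1'_def T2'_def using m d by linarith+
  qed
  moreover have "T1 - \<eta> \<le> T1'" "T2 - \<eta> \<le> T2'"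
    unfolding T1'_def T2'_def using n m d T U by linarith+
  ultimately show "\<exists>S1' T1' S2' T2'. strongly_achievable Pb1 Pb2 h1 h2 ((S1' / ln 2, T1' / ln 2), (S2' / ln 2, T2' / ln 2))
      \<and> S1 - \<eta> \<le> S1' \<and> T1 - \<eta> \<le> T1' \<and> S2 - \<eta> \<le> S2' \<and> T2 - \<eta> \<le> T2'"
    using U by blast
qed

end

lemma G_TW_strongly_achievable:
  assumes P: "P \<in> power_set (Pb1, Pb2)" and h: "0 < h1" "0 < h2" and Pb: "0 < Pb1" "0 < Pb2"
    and R: "R \<in> G_TW (h1, h2) P"
  shows "strongly_achievable Pb1 Pb2 h1 h2 R"
proof -
  obtain P1 P2 where P_eq: "P = (P1, P2)" by (cases P)
  have box: "0 \<le> P1" "P1 \<le> Pb1" "0 < Pb1" "0 \<le> P2" "P2 \<le> Pb2" "0 < Pb2"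
    using P Pb by (auto simp: P_eq power_set_def)
  have box': "0 \<le> P2" "P2 \<le> Pb2" "0 < Pb2" "0 \<le> P1" "P1 \<le> Pb1" "0 < Pb1" using box by auto
  have hp: "0 \<le> h1 * P1" "0 \<le> h2 * P2" using box h by auto
  let ?c = "\<lambda>x::real. ln (1 + x) / 2"
  let ?J1 = "ln ((1 + h1 * P1 + h2 * P2) / (1 + h2 * P2)) / 2" and ?J2 = "ln ((1 + h1 * P1 + h2 * P2) / (1 + h1 * P1)) / 2"
  let ?J = "ln (1 + h1 * P1 + h2 * P2) / 2"
  \<comment> \<open>Conversion to nats, the unit of the moment estimates and of
    \<open>code_size\<close>.\<close>
  define S1 S2 T1 T2 where "S1 = Rsec R 1 * ln 2" and "S2 = Rsec R 2 * ln 2" and "T1 = Ropen R 1 * ln 2" and "T2 = Ropen R 2 * ln 2"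
  have R_eq: "R = ((S1 / ln 2, T1 / ln 2), (S2 / ln 2, T2 / ln 2))"
    by (simp add: S1_def S2_def T1_def T2_def Rsec_def Ropen_def)
  have log2: "log 2 x = ln x / ln 2" for x :: real by (simp add: log_def)
  have nat_units: "a * ln 2 \<le> b" if "a \<le> b / ln 2" for a b :: real
    using that by (simp add: pos_le_divide_eq)
  have scale: "max 0 (x / ln 2) = max 0 x / ln 2" for x :: real
    by (simp add: max_def divide_le_0_iff zero_le_divide_iff)
  have pos: "0 \<le> S1" "0 \<le> S2" using R by (auto simp: G_TW_def S1_def S2_def)
  have sel: "sel P 1 = P1" "sel P 2 = P2" "sel (h1, h2) 1 = h1" "sel (h1, h2) 2 = h2" by (simp_all add: sel_def P_eq)
  note sel = sel sel[unfolded One_nat_def]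
  have k: "Rsec R k + Ropen R k \<le> 1/2 * log 2 (1 + sel P k)" if "k \<in> {1, 2}" for k
    using R that unfolding G_TW_def by blast
  have tot: "S1 + T1 \<le> ?c P1" "S2 + T2 \<le> ?c P2"
  proof -
    have "Rsec R 1 + Ropen R 1 \<le> ?c P1 / ln 2" using k[of 1] sel by (simp add: log2)
    from nat_units[OF this] show "S1 + T1 \<le> ?c P1" by (simp add: S1_def T1_def algebra_simps)
    have "Rsec R 2 + Ropen R 2 \<le> ?c P2 / ln 2" using k[of 2] by (simp add: sel log2)
    from nat_units[OF this] show "S2 + T2 \<le> ?c P2" by (simp add: S2_def T2_def algebra_simps)
  qed
  have br: "(\<Sum>k\<in>S. Rsec R k) \<le> max 0 ((\<Sum>k\<in>S. 1/2 * log 2 (1 + sel P k)) - CW (h1, h2) P S)" if "S \<subseteq> {1, 2}" "S \<noteq> {}" for S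
    using R that unfolding G_TW_def by blast
  have sets: "{1::nat, 2} - {1} = {2}" "{1::nat, 2} - {2} = {1}" "{1::nat, 2} - {1, 2} = {}" by auto
  have CW1: "CW (h1, h2) P {1} = ?J1 / ln 2"
  proof -
    have "1 + h1 * P1 / (1 + h2 * P2) = (1 + h1 * P1 + h2 * P2) / (1 + h2 * P2)" using hp by (simp add: field_simps)
    then show ?thesis unfolding CW_def sets by (simp add: sel log2)
  qed
  have CW2: "CW (h1, h2) P {2} = ?J2 / ln 2"
  proof -
    have "1 + h2 * P2 / (1 + h1 * P1) = (1 + h1 * P1 + h2 * P2) / (1 + h1 * P1)" using hp by (simp add: field_simps)
    then show ?thesis unfolding CW_def sets by (simp add: sel log2)
  qed
  have CW12: "CW (h1, h2) P {1, 2} = ?J / ln 2"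
    unfolding CW_def sets by (simp add: sel log2 add.assoc)
  have sec1: "S1 \<le> max 0 (?c P1 - ?J1)"
  proof -
    have "Rsec R 1 \<le> max 0 (?c P1 / ln 2 - ?J1 / ln 2)" using br[of "{1}"] by (simp add: CW1[simplified] sel log2)
    also have "\<dots> = max 0 (?c P1 - ?J1) / ln 2" unfolding diff_divide_distrib[symmetric] by (rule scale)
    finally show ?thesis unfolding S1_def by (rule nat_units)
  qed
  have sec2: "S2 \<le> max 0 (?c P2 - ?J2)"
  proof -
    have "Rsec R 2 \<le> max 0 (?c P2 / ln 2 - ?J2 / ln 2)" using br[of "{2}"] by (simp add: CW2 sel log2)
    also have "\<dots> = max 0 (?c P2 - ?J2) / ln 2" unfolding diff_divide_distrib[symmetric] by (rule scale)
    finally show ?thesis unfolding S2_def by (rule nat_units)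
  qed
  have sec12: "S1 + S2 \<le> max 0 (?c P1 + ?c P2 - ?J)"
  proof -
    have "Rsec R 1 + Rsec R 2 \<le> max 0 (?c P1 / ln 2 + ?c P2 / ln 2 - ?J / ln 2)" using br[of "{1, 2}"] by (simp add: CW12[simplified] sel[simplified] log2)
    also have "\<dots> = max 0 (?c P1 + ?c P2 - ?J) / ln 2" unfolding diff_divide_distrib[symmetric] add_divide_distrib[symmetric] by (rule scale)
    finally have "(Rsec R 1 + Rsec R 2) * ln 2 \<le> max 0 (?c P1 + ?c P2 - ?J)" by (rule nat_units)
    then show ?thesis by (simp add: S1_def S2_def distrib_right)
  qed
  consider (none) "S1 = 0" "S2 = 0" | (two) "?c P1 \<le> ?J1" "0 < S1 + S2" | (one) "?c P2 \<le> ?J2" "0 < S1 + S2"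
    | (both) "?J1 < ?c P1" "?J2 < ?c P2" "0 < S1 + S2"
    using pos by linarith
  then show ?thesis
  proof cases
    case none
    then show ?thesis using strongly_achievable_zero_secret_region[OF box h, of T1 T2] tot unfolding R_eq by simp
  next
    case two
    then have S1: "S1 = 0" and S2: "0 < S2" using sec1 pos by auto
    have "strongly_achievable Pb1 Pb2 h1 h2 ((0 / ln 2, T1 / ln 2), (S2 / ln 2, T2 / ln 2))"
      by (rule strongly_achievable_one_secret_region[OF box h]) (use tot S1 S2 two sec12 in auto)
    then show ?thesis unfolding R_eq S1 .
  next
    case one
    then have S2: "S2 = 0" and S1: "0 < S1" using sec2 pos by auto
    have comm: "1 + h2 * P2 + h1 * P1 = 1 + h1 * P1 + h2 * P2" by simp
    have "strongly_achievable Pb2 Pb1 h2 h1 ((0 / ln 2, T2 / ln 2), (S1 / ln 2, T1 / ln 2))"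
    proof (rule strongly_achievable_one_secret_region[OF box' h(2,1)])
      show "T2 \<le> ?c P2" "S1 + T1 \<le> ?c P1" "0 < S1" using tot S1 S2 by auto
      show "?c P2 \<le> ln ((1 + h2 * P2 + h1 * P1) / (1 + h1 * P1)) / 2" using one(1) by (simp only: comm)
      show "S1 \<le> ?c P2 + ?c P1 - ln (1 + h2 * P2 + h1 * P1) / 2" using sec12 S1 S2 unfolding comm by auto
    qed
    from strongly_achievable_swap[OF this] show ?thesis unfolding R_eq S2 by simp
  next
    case both
    show ?thesis unfolding R_eq
      by (rule strongly_achievable_both_secret_region[OF box h]) (use tot pos both sec1 sec2 sec12 in auto)
  qed
qed

theorem theorem2:
  fixes a1 a2 h1 h2 Pb1 Pb2 :: real and R :: rate
  assumes "0 < a1" "0 < a2" "0 < h1" "0 < h2" "0 < Pb1" "0 < Pb2"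
    and "R \<in> closure (convex hull (\<Union>P\<in>power_set (Pb1, Pb2). G_TW (h1, h2) P))"
  shows "gtw_achievable a1 a2 h1 h2 Pb1 Pb2 R"
proof -
  have "(\<Union>P\<in>power_set (Pb1, Pb2). G_TW (h1, h2) P) \<subseteq> {R. strongly_achievable Pb1 Pb2 h1 h2 R}"
    using G_TW_strongly_achievable assms(3-6) by blast
  then have "closure (convex hull (\<Union>P\<in>power_set (Pb1, Pb2). G_TW (h1, h2) P)) \<subseteq> {R. strongly_achievable Pb1 Pb2 h1 h2 R}"
    by (intro closure_minimal hull_minimal strongly_achievable_closed strongly_achievable_convex)
  then have R: "strongly_achievable Pb1 Pb2 h1 h2 R" using assms(7) by blast
  show ?thesis
    unfolding gtw_achievable_def
  proof (intro allI impI)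
    fix \<epsilon> :: real assume e: "\<epsilon> > 0"
    \<comment> \<open>Half the tolerance, because the error bound of
      \<open>wiretap_code_achieves\<close> is twice that of a single direction.\<close>
    then have "\<epsilon> / 2 > 0" by simp
    with R obtain N where N: "\<And>I. finite I \<and> card I \<ge> N \<Longrightarrow> (\<exists>M1 O1 M2 O2. wiretap_code I Pb1 Pb2 h1 h2 (\<epsilon> / 2) M1 O1 M2 O2
      \<and> real (card I) * (Rsec R 1 - \<epsilon> / 2) \<le> log 2 (real M1) \<and> real (card I) * (Ropen R 1 - \<epsilon> / 2) \<le> log 2 (real O1)
      \<and> real (card I) * (Rsec R 2 - \<epsilon> / 2) \<le> log 2 (real M2) \<and> real (card I) * (Ropen R 2 - \<epsilon> / 2) \<le> log 2 (real O2))"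
      unfolding strongly_achievable_def by blast
    \<comment> \<open>The successor keeps the block length positive even if \<open>N\<close> is
      0.\<close>
    define n where "n = Suc N"
    have n: "0 < n" "finite {..<n} \<and> card {..<n} \<ge> N" by (simp_all add: n_def)
    from N[OF n(2)] obtain M1 O1 M2 O2 where g: "wiretap_code {..<n} Pb1 Pb2 h1 h2 (\<epsilon> / 2) M1 O1 M2 O2"
      and r: "real n * (Rsec R 1 - \<epsilon> / 2) \<le> log 2 (real M1)" "real n * (Ropen R 1 - \<epsilon> / 2) \<le> log 2 (real O1)"
        "real n * (Rsec R 2 - \<epsilon> / 2) \<le> log 2 (real M2)" "real n * (Ropen R 2 - \<epsilon> / 2) \<le> log 2 (real O2)" by auto
    have pos: "0 < M1" "0 < O1" "0 < M2" "0 < O2" using g by (auto simp: wiretap_code_def)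
    have rate: "x - \<epsilon> \<le> l / real n" if "real n * (x - \<epsilon> / 2) \<le> l" for x l
    proof -
      have "x - \<epsilon> / 2 \<le> l / real n" using that n(1) by (simp add: pos_le_divide_eq mult.commute)
      then show ?thesis using e by linarith
    qed
    have e2: "0 \<le> \<epsilon> / 2" using e by simp
    from wiretap_code_achieves[OF g n(1) assms(5,6) e2, of a1 a2] obtain enc1 enc2 dec1 dec2 where
      v: "valid_encoder n Pb1 enc1" "valid_encoder n Pb2 enc2" "valid_decoder n dec1" "valid_decoder n dec2"
      and perf: "let M = gtw_joint n M1 O1 M2 O2 enc1 enc2 in
           measure M {\<omega> \<in> space M. decoding_error n a1 a2 dec1 dec2 \<omega>} \<le> 2 * (\<epsilon> / 2) \<and>
           prob_space.conditional_entropy M 2 (count_space UNIV) (Rn n) Wsec_of (Z_of n h1 h2)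
             \<ge> (1 - \<epsilon> / 2) * prob_space.entropy M 2 (count_space UNIV) Wsec_of \<and>
           0 \<le> prob_space.entropy M 2 (count_space UNIV) Wsec_of"
      by blast
    let ?M = "gtw_joint n M1 O1 M2 O2 enc1 enc2"
    have "(1 - \<epsilon>) * prob_space.entropy ?M 2 (count_space UNIV) Wsec_of \<le> (1 - \<epsilon> / 2) * prob_space.entropy ?M 2 (count_space UNIV) Wsec_of"
      using e perf unfolding Let_def by (intro mult_right_mono) auto
    then have "let M = ?M in measure M {\<omega> \<in> space M. decoding_error n a1 a2 dec1 dec2 \<omega>} \<le> \<epsilon> \<and>
           prob_space.conditional_entropy M 2 (count_space UNIV) (Rn n) Wsec_of (Z_of n h1 h2)
             \<ge> (1 - \<epsilon>) * prob_space.entropy M 2 (count_space UNIV) Wsec_of"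
      using perf unfolding Let_def by simp
    then show "\<exists>n Ms1 Mo1 Ms2 Mo2 enc1 enc2 dec1 dec2.
        0 < n \<and> 0 < Ms1 \<and> 0 < Mo1 \<and> 0 < Ms2 \<and> 0 < Mo2 \<and>
        valid_encoder n Pb1 enc1 \<and> valid_encoder n Pb2 enc2 \<and>
        valid_decoder n dec1 \<and> valid_decoder n dec2 \<and>
        log 2 (real Ms1) / real n \<ge> Rsec R 1 - \<epsilon> \<and>
        log 2 (real Mo1) / real n \<ge> Ropen R 1 - \<epsilon> \<and>
        log 2 (real Ms2) / real n \<ge> Rsec R 2 - \<epsilon> \<and>
        log 2 (real Mo2) / real n \<ge> Ropen R 2 - \<epsilon> \<and>
        (let M = gtw_joint n Ms1 Mo1 Ms2 Mo2 enc1 enc2 in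
           measure M {\<omega> \<in> space M. decoding_error n a1 a2 dec1 dec2 \<omega>} \<le> \<epsilon> \<and>
           prob_space.conditional_entropy M 2 (count_space UNIV) (Rn n) Wsec_of (Z_of n h1 h2)
             \<ge> (1 - \<epsilon>) * prob_space.entropy M 2 (count_space UNIV) Wsec_of)"
      using n(1) pos v rate[OF r(1)] rate[OF r(2)] rate[OF r(3)] rate[OF r(4)] by blast
  qed
qed

end
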